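(* Let $f(x_1,x_2,x_3)$ be a non-singular indefinite ternary quadratic form over $\mathbb{Z}$, let $a$ be a non-zero integer with $-a\cdot\det(f)\in(\mathbb{Q}^\times)^2$, and let $\|\cdot\|$ be a norm on $\mathbb{R}^3$. For $T>0$ put $$N(f,a,T)=\#\{(\alpha_1,\alpha_2,\alpha_3)\in\mathbb{Z}^3:\ f(\alpha_1,\alpha_2,\alpha_3)=a,\ \|(\alpha_1,\alpha_2,\alpha_3)\|\le T\},$$ $$B_T=\{(\alpha_1,\alpha_2,\alpha_3)\in\mathbb{R}^3:\ f(\alpha_1,\alpha_2,\alpha_3)=a,\ \|(\alpha_1,\alpha_2,\alpha_3)\|\le T\},$$ and for every prime $p$ put $$\alpha_p(f,a)=\lim_{m\to\infty}\frac{\#\{(\beta_1,\beta_2,\beta_3)\in(\mathbb{Z}/(p^m))^3:\ f(\beta_1,\beta_2,\beta_3)\equiv a \bmod p^m\}}{p^{2m}}.$$ Then $$N(f,a,T)\sim\Big(\prod_{p\ \text{prime}}(1-p^{-1})\,\alpha_p(f,a)\Big)\cdot\Big(\log T\int_{B_T}\omega\Big)\qquad\text{as } T\to\infty,$$ where $\omega$ is the normalized gauge form on the surface $f=a$.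
   Context: $\det(f)$ is the determinant of the symmetric (Gram) matrix $A$ with $f(x)=x^{t}Ax$. The normalized gauge form $\omega$ is the nowhere vanishing algebraic differential 2-form on the affine surface $\{f=a\}$ satisfying $\omega\wedge df=dx_1\wedge dx_2\wedge dx_3$ along the surface; $\int_{B_T}\omega$ denotes the integral of the associated positive measure $|\omega|$ on the real surface $\{f=a\}\subset\mathbb{R}^3$. $F(T)\sim G(T)$ as $T\to\infty$ means $F(T)=(1+o(1))\,G(T)$. *)

theory Defs
  imports "HOL-Analysis.Analysis" "HOL-Number_Theory.Number_Theory" "HOL-Library.Landau_Symbols"
begin

section \<open>Integral ternary quadratic forms\<close>

text \<open>
  An integral ternary quadratic form is presented by an integer matrix \<open>c\<close> that need not be
  symmetric: the coefficient of \<open>x\<^sub>i x\<^sub>j\<close> for \<open>i \<noteq> j\<close> is \<open>c\<^sub>i\<^sub>j + c\<^sub>j\<^sub>i\<close>, so every form with integer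
  coefficients is covered, including those with odd cross terms.  The same form is evaluated at
  integral and at real points.
\<close>

definition qf :: "int^3^3 \<Rightarrow> 'a::comm_ring_1^3 \<Rightarrow> 'a" where
  "qf c x = (\<Sum>i\<in>UNIV. \<Sum>j\<in>UNIV. of_int (c $ i $ j) * x $ i * x $ j)"

definition gram :: "int^3^3 \<Rightarrow> rat^3^3" where
  "gram c = (\<chi> i j. of_int (c $ i $ j + c $ j $ i) / 2)"

definition nonsingular :: "int^3^3 \<Rightarrow> bool" where
  "nonsingular c \<longleftrightarrow> det (gram c) \<noteq> 0"

definition indefinite :: "int^3^3 \<Rightarrow> bool" where
  "indefinite c \<longleftrightarrow> (\<exists>x::real^3. qf c x > 0) \<and> (\<exists>x::real^3. qf c x < 0)"

lemma transpose_gram: "transpose (gram c) = gram c"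
  by (simp add: gram_def transpose_def add.commute)

lemma qf_eq_gram:
  "qf c x = (\<Sum>i\<in>UNIV. \<Sum>j\<in>UNIV. x $ i * of_rat (gram c $ i $ j) * x $ j)"
  for x :: "real^3"
  by (simp add: qf_def gram_def sum_3 of_rat_divide of_rat_add algebra_simps add_divide_distrib)


section \<open>Counting functions\<close>

text \<open>An arbitrary norm, not only the one of the type class.\<close>

definition is_norm :: "('a::real_vector \<Rightarrow> real) \<Rightarrow> bool" where
  "is_norm N \<longleftrightarrow> (\<forall>x. N x \<ge> 0) \<and> (\<forall>x. N x = 0 \<longleftrightarrow> x = 0) \<and>
     (\<forall>r x. N (r *\<^sub>R x) = \<bar>r\<bar> * N x) \<and> (\<forall>x y. N (x + y) \<le> N x + N y)"

definition int_point_count :: "int^3^3 \<Rightarrow> int \<Rightarrow> (real^3 \<Rightarrow> real) \<Rightarrow> real \<Rightarrow> nat" where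
  "int_point_count c a N T =
     card {\<alpha> :: int^3. qf c \<alpha> = a \<and> N (\<chi> i. of_int (\<alpha> $ i)) \<le> T}"

definition quadric :: "int^3^3 \<Rightarrow> int \<Rightarrow> (real^3) set" where
  "quadric c a = {x. qf c x = of_int a}"

definition quadric_ball :: "int^3^3 \<Rightarrow> int \<Rightarrow> (real^3 \<Rightarrow> real) \<Rightarrow> real \<Rightarrow> (real^3) set" where
  "quadric_ball c a N T = {x \<in> quadric c a. N x \<le> T}"

text \<open>Residue classes modulo \<open>p\<^sup>m\<close> are represented by \<open>0, \<dots>, p\<^sup>m - 1\<close>.\<close>

definition local_ratio :: "int^3^3 \<Rightarrow> int \<Rightarrow> nat \<Rightarrow> nat \<Rightarrow> real" where
  "local_ratio c a p m =
     real (card {\<beta> :: int^3. (\<forall>i. 0 \<le> \<beta> $ i \<and> \<beta> $ i < int p ^ m) \<and> [qf c \<beta> = a] (mod int p ^ m)})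
       / real p ^ (2 * m)"

definition local_density :: "int^3^3 \<Rightarrow> int \<Rightarrow> nat \<Rightarrow> real" where
  "local_density c a p = lim (\<lambda>m. local_ratio c a p m)"

text \<open>The Euler factors, extended by 1 to all natural numbers so that \<^const>\<open>prodinf\<close> is the
  product over the primes in increasing order.\<close>

definition euler_factor :: "int^3^3 \<Rightarrow> int \<Rightarrow> nat \<Rightarrow> real" where
  "euler_factor c a p = (if prime p then (1 - 1 / real p) * local_density c a p else 1)"


section \<open>The normalized gauge form\<close>

text \<open>
  A differential 2-form is represented by an ambient one: \<open>\<omega> x\<close> is an alternating bilinear form
  on \<open>\<real>\<^sup>3\<close>, of which only the restriction to the tangent plane of the surface at \<open>x\<close> matters.
\<close>

type_synonym form2 = "real^3 \<Rightarrow> real^3 \<Rightarrow> real^3 \<Rightarrow> real"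

definition algebraic_form2 :: "form2 \<Rightarrow> bool" where
  "algebraic_form2 \<omega> \<longleftrightarrow>
     (\<forall>x. bilinear (\<omega> x) \<and> (\<forall>u. \<omega> x u u = 0)) \<and>
     (\<forall>u v. real_polynomial_function (\<lambda>x. \<omega> x u v))"

text \<open>The wedge product of an alternating 2-form with a linear form, normalized so that
  \<open>(dx\<^sub>1 \<and> dx\<^sub>2) \<and> dx\<^sub>3\<close> is the determinant.\<close>

definition wedge21 ::
    "(real^3 \<Rightarrow> real^3 \<Rightarrow> real) \<Rightarrow> (real^3 \<Rightarrow> real) \<Rightarrow> real^3 \<Rightarrow> real^3 \<Rightarrow> real^3 \<Rightarrow> real" where
  "wedge21 \<alpha> \<eta> u v w = \<alpha> u v * \<eta> w + \<alpha> v w * \<eta> u + \<alpha> w u * \<eta> v"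

definition vol3 :: "real^3 \<Rightarrow> real^3 \<Rightarrow> real^3 \<Rightarrow> real" where
  "vol3 u v w = det (vector [u, v, w] :: real^3^3)"

definition dqf :: "int^3^3 \<Rightarrow> real^3 \<Rightarrow> real^3 \<Rightarrow> real" where
  "dqf c x = frechet_derivative (qf c) (at x)"

definition normalized_gauge_form :: "int^3^3 \<Rightarrow> int \<Rightarrow> form2 \<Rightarrow> bool" where
  "normalized_gauge_form c a \<omega> \<longleftrightarrow>
     algebraic_form2 \<omega> \<and>
     (\<forall>x\<in>quadric c a. \<exists>u v. dqf c x u = 0 \<and> dqf c x v = 0 \<and> \<omega> x u v \<noteq> 0) \<and>
     (\<forall>x\<in>quadric c a. wedge21 (\<omega> x) (dqf c x) = vol3)"


section \<open>The positive measure of a 2-form on a surface\<close>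

text \<open>\<open>\<phi>\<close> is a regular (\<open>C\<^sup>1\<close>) local parametrization of the surface \<open>S\<close> with domain \<open>U\<close>.\<close>

definition parametrization :: "(real^3) set \<Rightarrow> (real^2) set \<Rightarrow> (real^2 \<Rightarrow> real^3) \<Rightarrow> bool" where
  "parametrization S U \<phi> \<longleftrightarrow>
     open U \<and> openin (top_of_set S) (\<phi> ` U) \<and> (\<exists>\<psi>. homeomorphism U (\<phi> ` U) \<phi> \<psi>) \<and>
     (\<forall>u\<in>U. \<phi> differentiable (at u) \<and> inj (frechet_derivative \<phi> (at u))) \<and>
     (\<forall>e. continuous_on U (\<lambda>u. frechet_derivative \<phi> (at u) e))"

text \<open>
  \<open>\<mu>\<close> is the Borel measure \<open>\<bar>\<omega>\<bar>\<close> on \<open>S\<close>: in every local parametrization it is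
  \<open>\<bar>\<omega>(\<partial>\<^sub>1\<phi>, \<partial>\<^sub>2\<phi>)\<bar> du\<^sub>1 du\<^sub>2\<close>.  As a surface is covered by countably many parametrizations, at most
  one \<open>\<mu>\<close> has this property.
\<close>

definition is_abs_form_measure :: "(real^3) set \<Rightarrow> form2 \<Rightarrow> (real^3) measure \<Rightarrow> bool" where
  "is_abs_form_measure S \<omega> \<mu> \<longleftrightarrow>
     sets \<mu> = sets (restrict_space borel S) \<and>
     (\<forall>U \<phi> E. parametrization S U \<phi> \<longrightarrow> E \<in> sets \<mu> \<longrightarrow> E \<subseteq> \<phi> ` U \<longrightarrow>
        emeasure \<mu> E =
          (\<integral>\<^sup>+u\<in>{u\<in>U. \<phi> u \<in> E}. ennreal \<bar>\<omega> (\<phi> u) (frechet_derivative \<phi> (at u) (axis 1 1))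
                                            (frechet_derivative \<phi> (at u) (axis 2 1))\<bar> \<partial>lborel))"


section \<open>Existence of the gauge form and of its measure\<close>

text \<open>
  By Euler's identity \<open>\<omega> x u v = det (x, u, v) / (2 a)\<close> is a normalized gauge form, and it
  agrees with every other one on tangent vectors.  Hence \<open>\<bar>\<omega>\<bar>(E)\<close> is \<open>3 / (2 \<bar>a\<bar>)\<close> times the
  volume of the cone over \<open>E\<close> with apex 0, which is how the measure is constructed here.
\<close>


lemma qf_has_derivative:
  "(qf c has_derivative (\<lambda>u. \<Sum>i\<in>UNIV. \<Sum>j\<in>UNIV. of_int (c $ i $ j) * (x $ i * u $ j + u $ i * x $ j))) (at x)"
  for x :: "real^3"
proof -
  have *: "((\<lambda>x. \<Sum>i\<in>UNIV. \<Sum>j\<in>UNIV. of_int (c $ i $ j) * x $ i * x $ j) has_derivative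
      (\<lambda>u. \<Sum>i\<in>UNIV. \<Sum>j\<in>UNIV. of_int (c $ i $ j) * (x $ i * u $ j + u $ i * x $ j))) (at x)"
    by (auto intro!: derivative_eq_intros bounded_linear_imp_has_derivative[OF bounded_linear_vec_nth]
        simp: algebra_simps)
  then show ?thesis by (simp add: qf_def[abs_def])
qed

lemma dqf_eq:
  "dqf c x u = (\<Sum>i\<in>UNIV. \<Sum>j\<in>UNIV. of_int (c $ i $ j) * (x $ i * u $ j + u $ i * x $ j))"
  unfolding dqf_def by (subst frechet_derivative_at[OF qf_has_derivative, symmetric]) (rule refl)

lemma linear_dqf: "linear (dqf c x)"
  unfolding dqf_def by (rule linear_frechet_derivative) (use qf_has_derivative differentiableI in blast)

lemma dqf_self: "dqf c x x = 2 * qf c x"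
  by (simp add: dqf_eq qf_def sum_3 algebra_simps)


lemma vol3_eq:
  "vol3 u v w = u $ 1 * v $ 2 * w $ 3 + u $ 2 * v $ 3 * w $ 1 + u $ 3 * v $ 1 * w $ 2
     - u $ 1 * v $ 3 * w $ 2 - u $ 2 * v $ 1 * w $ 3 - u $ 3 * v $ 2 * w $ 1"
  by (simp add: vol3_def det_3 vector_3)

lemma vol3_lin:
  "vol3 (u + u') v w = vol3 u v w + vol3 u' v w" "vol3 (r *\<^sub>R u) v w = r * vol3 u v w"
  "vol3 u (v + v') w = vol3 u v w + vol3 u v' w" "vol3 u (r *\<^sub>R v) w = r * vol3 u v w"
  "vol3 u v (w + w') = vol3 u v w + vol3 u v w'" "vol3 u v (r *\<^sub>R w) = r * vol3 u v w"
  by (simp_all add: vol3_eq distrib_left distrib_right right_diff_distrib)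

lemma wedge21_vol3: 
  assumes "linear \<eta>"
  shows "wedge21 (vol3 x) \<eta> u v w = \<eta> x * vol3 u v w"
proof -
  have h: "\<eta> u = adjoint \<eta> 1 \<bullet> u" for u :: "real^3"
    using adjoint_works[OF assms, of u 1] by (simp add: inner_commute)
  show ?thesis
    unfolding wedge21_def vol3_eq h[of u] h[of v] h[of w] h[of x] inner_vec_def sum_3 inner_real_def
    by (simp add: algebra_simps)
qed

lemma gauge_form_tangent:
  assumes "normalized_gauge_form c a \<omega>" "x \<in> quadric c a" "dqf c x u = 0" "dqf c x v = 0"
  shows "\<omega> x u v * (2 * of_int a) = vol3 x u v"
proof -
  have "wedge21 (\<omega> x) (dqf c x) u v x = vol3 u v x"
    using assms by (simp add: normalized_gauge_form_def)
  moreover have "dqf c x x = 2 * of_int a"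
    using assms(2) by (simp add: dqf_self quadric_def)
  moreover have "vol3 u v x = vol3 x u v" by (simp add: vol3_eq algebra_simps)
  ultimately show ?thesis by (simp add: wedge21_def assms)
qed

lemma normalized_gauge_form_exists:
  assumes "a \<noteq> 0"
  shows "normalized_gauge_form c a (\<lambda>x u v. vol3 x u v / (2 * of_int a))"
proof -
  have bl: "bilinear (\<lambda>u v. vol3 x u v / (2 * of_int a))" for x
    unfolding bilinear_def by (intro conjI allI linearI) (simp_all add: vol3_lin add_divide_distrib)
  have pol: "real_polynomial_function (\<lambda>x. vol3 x u v / (2 * of_int a))" for u v
  proof -
    have "bounded_linear (\<lambda>x. vol3 x u v / (2 * of_int a))"
      by (rule linear_conv_bounded_linear[THEN iffD1], rule linearI) (simp_all add: vol3_lin add_divide_distrib)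
    then show ?thesis by (rule real_polynomial_function.intros(1))
  qed
  have wedge: "wedge21 (\<lambda>u v. vol3 x u v / (2 * of_int a)) (dqf c x) = vol3"
    if "x \<in> quadric c a" for x
  proof (intro ext)
    fix u v w
    have "wedge21 (\<lambda>u v. vol3 x u v / (2 * of_int a)) (dqf c x) u v w =
            wedge21 (vol3 x) (dqf c x) u v w / (2 * of_int a)"
      by (simp add: wedge21_def add_divide_distrib)
    also have "\<dots> = vol3 u v w"
      using that assms by (simp add: wedge21_vol3[OF linear_dqf] dqf_self quadric_def)
    finally show "wedge21 (\<lambda>u v. vol3 x u v / (2 * of_int a)) (dqf c x) u v w = vol3 u v w" .
  qed
  have nv: "\<exists>u v. dqf c x u = 0 \<and> dqf c x v = 0 \<and> vol3 x u v / (2 * of_int a) \<noteq> 0"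
    if x: "x \<in> quadric c a" for x
  proof -
    define pr where "pr e = e - (dqf c x e / (2 * of_int a)) *\<^sub>R x" for e
    have xx: "dqf c x x = 2 * of_int a" using x by (simp add: dqf_self quadric_def)
    have pr0: "dqf c x (pr e) = 0" for e
      using assms by (simp add: pr_def linear_diff[OF linear_dqf] linear_cmul[OF linear_dqf] xx)
    have pr_vol: "vol3 x (pr e) (pr e') = vol3 x e e'" for e e'
      by (simp add: vol3_eq pr_def algebra_simps)
    have "x \<noteq> 0" using x assms by (auto simp: quadric_def qf_def)
    then consider "x $ 1 \<noteq> 0" | "x $ 2 \<noteq> 0" | "x $ 3 \<noteq> 0"
      by (auto simp: vec_eq_iff forall_3)
    then obtain e e' where "vol3 x e e' \<noteq> 0"
    proof cases
      case 1 then show ?thesis using that[of "axis 2 1" "axis 3 1"] by (simp add: vol3_eq axis_def)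
    next
      case 2 then show ?thesis using that[of "axis 3 1" "axis 1 1"] by (simp add: vol3_eq axis_def)
    next
      case 3 then show ?thesis using that[of "axis 1 1" "axis 2 1"] by (simp add: vol3_eq axis_def)
    qed
    then show ?thesis using pr0 pr_vol assms
      by (intro exI[of _ "pr e"] exI[of _ "pr e'"]) auto
  qed
  have alt: "vol3 x u u = 0" for x u by (simp add: vol3_eq)
  show ?thesis
    unfolding normalized_gauge_form_def algebraic_form2_def
    using bl pol wedge nv alt by simp
qed

lemma emeasure_image_eq:
  fixes g :: "real^3 \<Rightarrow> real^3"
  assumes W: "W \<in> sets borel" and gW: "g ` W \<in> sets borel"
    and der: "\<And>v. v \<in> W \<Longrightarrow> (g has_derivative g' v) (at v within W)" and inj: "inj_on g W"
    and D: "D \<in> borel_measurable borel" "\<And>v. 0 \<le> D v"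
       "\<And>v. v \<in> W \<Longrightarrow> D v = \<bar>det (matrix (g' v))\<bar>" "\<And>v. v \<notin> W \<Longrightarrow> D v = 0"
  shows "emeasure lborel (g ` W) = (\<integral>\<^sup>+v. ennreal (D v) \<partial>lborel)"
proof -
  have WL: "W \<in> sets lebesgue" using W by simp
  have eql: "emeasure lebesgue (g ` W) = emeasure lborel (g ` W)" using gW by simp
  have hi: "((\<lambda>x. \<bar>det (matrix (g' x))\<bar>) has_integral m) W \<longleftrightarrow> (D has_integral m) UNIV" for m
  proof -
    have "((\<lambda>x. \<bar>det (matrix (g' x))\<bar>) has_integral m) W \<longleftrightarrow> (D has_integral m) W"
      by (rule has_integral_cong) (simp add: D)
    also have "\<dots> \<longleftrightarrow> (D has_integral m) UNIV"
      by (subst has_integral_restrict_UNIV[symmetric], rule has_integral_cong) (simp add: D(4))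
    finally show ?thesis .
  qed
  note cov = has_measure_differentiable_image[OF WL der inj]
  show ?thesis
  proof (cases "(\<integral>\<^sup>+v. ennreal (D v) \<partial>lborel) < \<infinity>")
    case True
    then obtain r where r: "(\<integral>\<^sup>+v. ennreal (D v) \<partial>lborel) = ennreal r" "r \<ge> 0"
      by (metis ennreal_cases infinity_ennreal_def order_less_irrefl)
    have "(D has_integral r) UNIV" by (rule nn_integral_has_integral[OF D(1,2) r])
    then have "g ` W \<in> lmeasurable \<and> measure lebesgue (g ` W) = r" using cov hi by blast
    then show ?thesis using eql r by (metis emeasure_eq_measure2)
  next
    case False
    have "g ` W \<notin> lmeasurable"
    proof
      assume "g ` W \<in> lmeasurable"
      then have "(D has_integral measure lebesgue (g ` W)) UNIV" using cov hi by blast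
      then have "(\<integral>\<^sup>+v. ennreal (D v) \<partial>lborel) = ennreal (measure lebesgue (g ` W))"
        using nn_integral_has_integral_lborel[OF D(1,2)] by fastforce
      then show False using False by simp
    qed
    then have "emeasure lborel (g ` W) = \<infinity>"
      using eql gW by (simp add: fmeasurable_def less_top[symmetric])
    moreover have "(\<integral>\<^sup>+v. ennreal (D v) \<partial>lborel) = \<infinity>"
      using False by (simp add: less_top[symmetric])
    ultimately show ?thesis by simp
  qed
qed

definition join3 :: "real \<times> (real^2) \<Rightarrow> real^3" where
  "join3 p = vector [fst p, snd p $ 1, snd p $ 2]"

lemma prod_Basis_vec:
  fixes f :: "real^'n \<Rightarrow> real"
  shows "(\<Prod>b\<in>Basis. f b) = (\<Prod>i\<in>UNIV. f (axis i 1))"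
  by (simp add: Basis_vec_def prod.UNION_disjoint axis_eq_axis)

lemma join3_measurable: "join3 \<in> borel_measurable borel"
proof (rule borel_measurable_continuous_onI)
  have eq: "join3 = (\<lambda>p. fst p *\<^sub>R axis 1 1 + (snd p $ 1) *\<^sub>R axis 2 1 + (snd p $ 2) *\<^sub>R axis 3 1)"
    by (rule ext) (simp add: join3_def vec_eq_iff forall_3 vector_3 axis_def)
  show "continuous_on UNIV join3" unfolding eq by (intro continuous_intros)
qed

lemma distr_join3: "distr lborel borel join3 = lborel"
proof (rule lborel_eqI[symmetric])
  fix l u :: "real^3"
  assume "\<And>b. b \<in> Basis \<Longrightarrow> l \<bullet> b \<le> u \<bullet> b"
  then have le: "l $ i \<le> u $ i" for i
    by (metis axis_in_Basis_iff Basis_real_def cart_eq_inner_axis insertI1)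
  let ?l = "vector [l $ 2, l $ 3] :: real^2" and ?u = "vector [u $ 2, u $ 3] :: real^2"
  have "join3 -` box l u = box (l $ 1) (u $ 1) \<times> box ?l ?u"
    by (auto simp: join3_def mem_box_cart forall_3 forall_2 vector_3 vector_2)
  then have "emeasure (distr lborel borel join3) (box l u)
     = emeasure (lborel \<Otimes>\<^sub>M lborel) (box (l $ 1) (u $ 1) \<times> box ?l ?u)"
    using join3_measurable by (subst emeasure_distr) (auto simp: lborel_prod)
  also have "\<dots> = emeasure lborel (box (l $ 1) (u $ 1)) * emeasure lborel (box ?l ?u)"
    by (rule lborel.emeasure_pair_measure_Times) auto
  also have "emeasure lborel (box ?l ?u) = ennreal ((u $ 2 - l $ 2) * (u $ 3 - l $ 3))"
  proof -
    have "?l \<bullet> b \<le> ?u \<bullet> b" if b: "b \<in> Basis" for b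
    proof -
      have "\<forall>i. ?l $ i \<le> ?u $ i" by (simp add: forall_2 vector_2 le)
      moreover obtain i where "b = axis i 1" using b by (auto simp: Basis_vec_def)
      ultimately show ?thesis by (simp add: inner_axis)
    qed
    then have "emeasure lborel (box ?l ?u) = ennreal (\<Prod>b\<in>Basis. (?u - ?l) \<bullet> b)"
      by (rule emeasure_lborel_box)
    then show ?thesis by (simp only: prod_Basis_vec inner_axis vector_minus_component UNIV_2) (simp add: vector_2)
  qed
  also have "emeasure lborel (box (l $ 1) (u $ 1)) = ennreal (u $ 1 - l $ 1)"
    by (simp add: le)
  also have "ennreal (u $ 1 - l $ 1) * ennreal ((u $ 2 - l $ 2) * (u $ 3 - l $ 3)) =
      ennreal ((u $ 1 - l $ 1) * ((u $ 2 - l $ 2) * (u $ 3 - l $ 3)))"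
    by (rule ennreal_mult[symmetric]) (simp_all add: le)
  also have "(u $ 1 - l $ 1) * ((u $ 2 - l $ 2) * (u $ 3 - l $ 3)) = (\<Prod>b\<in>Basis. (u - l) \<bullet> b)"
    unfolding prod_Basis_vec UNIV_3 by (simp add: inner_axis)
  finally show "emeasure (distr lborel borel join3) (box l u) = ennreal (\<Prod>b\<in>Basis. (u - l) \<bullet> b)" .
qed simp

lemma nn_integral_join3:
  assumes F: "F \<in> borel_measurable borel"
  shows "(\<integral>\<^sup>+v. F v \<partial>(lborel :: (real^3) measure)) = (\<integral>\<^sup>+t. \<integral>\<^sup>+u. F (join3 (t, u)) \<partial>lborel \<partial>lborel)"
proof -
  have "(\<integral>\<^sup>+v. F v \<partial>lborel) = (\<integral>\<^sup>+p. F (join3 p) \<partial>lborel)"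
    by (subst distr_join3[symmetric], subst nn_integral_distr) (use join3_measurable F in auto)
  also have "\<dots> = (\<integral>\<^sup>+p. F (join3 p) \<partial>(lborel \<Otimes>\<^sub>M lborel))" by (simp add: lborel_prod)
  also have "\<dots> = (\<integral>\<^sup>+t. \<integral>\<^sup>+u. F (join3 (t, u)) \<partial>lborel \<partial>lborel)"
    by (rule lborel.nn_integral_fst[symmetric])
       (use measurable_compose[OF join3_measurable F] in \<open>simp add: lborel_prod\<close>)
  finally show ?thesis .
qed


lemma qf_scaleR: "qf c (t *\<^sub>R x) = t\<^sup>2 * qf c x" for x :: "real^3"
  by (simp add: qf_def sum_3 power2_eq_square algebra_simps)

lemma continuous_qf: "continuous_on A (qf c)" for A :: "(real^3) set"
  by (simp add: qf_def[abs_def]) (intro continuous_intros)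

lemma nn_integral_square:
  "(\<integral>\<^sup>+t. ennreal (indicator {0<..1} t * t\<^sup>2) \<partial>lborel) = ennreal (1 / 3)"
proof -
  have "((\<lambda>t::real. t\<^sup>2) has_integral (1 ^ 3 / 3 - 0 ^ 3 / 3)) {0..1}"
    by (rule fundamental_theorem_of_calculus)
       (auto intro!: derivative_eq_intros simp flip: has_real_derivative_iff_has_vector_derivative)
  then have "((\<lambda>t::real. t\<^sup>2) has_integral (1 / 3)) {0..1}" by simp
  then have "((\<lambda>t::real. t\<^sup>2) has_integral (1 / 3)) {0<..1}"
    by (subst has_integral_spike_set_eq[of _ "{0..1}"]) (auto intro: negligible_subset[of "{0}"])
  then have "((\<lambda>t::real. if t \<in> {0<..1} then t\<^sup>2 else 0) has_integral (1 / 3)) UNIV"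
    by (simp only: has_integral_restrict_UNIV)
  also have "(\<lambda>t::real. if t \<in> {0<..1} then t\<^sup>2 else 0) = (\<lambda>t. indicator {0<..1} t * t\<^sup>2)"
    by (rule ext) (simp add: indicator_def)
  finally show ?thesis
    by (intro nn_integral_has_integral_lborel) auto
qed

theorem is_abs_form_measure_exists:
  assumes a: "a \<noteq> 0" and \<omega>: "normalized_gauge_form c a \<omega>"
  shows "\<exists>\<mu>. is_abs_form_measure (quadric c a) \<omega> \<mu>"
proof -
  let ?S = "quadric c a"
  define h where "h y = qf c y / of_int a" for y :: "real^3"
  define P where "P = {y. 0 < h y \<and> h y \<le> 1}"
  define \<rho> where "\<rho> y = (1 / sqrt (h y)) *\<^sub>R y" for y :: "real^3"
  define k where "k = 3 / (2 * \<bar>real_of_int a\<bar>)"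
  define \<mu> where "\<mu> = scale_measure (ennreal k)
    (distr (restrict_space lborel P) (restrict_space borel ?S) \<rho>)"
  have h_cont: "continuous_on UNIV h"
    unfolding h_def using a by (intro continuous_intros continuous_qf) auto
  have h_meas [measurable]: "h \<in> borel_measurable borel"
    by (rule borel_measurable_continuous_onI[OF h_cont])
  have \<rho>_meas [measurable]: "\<rho> \<in> borel_measurable borel"
    unfolding \<rho>_def by measurable
  have P_meas [measurable]: "P \<in> sets borel" unfolding P_def by measurable
  have S_closed: "closed ?S"
    unfolding quadric_def by (intro closed_Collect_eq continuous_qf continuous_intros)
  then have S_meas [measurable]: "?S \<in> sets borel" by simp
  have h_scale: "h (t *\<^sub>R y) = t\<^sup>2 * h y" for t y by (simp add: h_def qf_scaleR)
  have hS: "y \<in> ?S \<longleftrightarrow> h y = 1" for y using a by (auto simp: h_def quadric_def field_simps)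
  have \<rho>S: "\<rho> y \<in> ?S" if "y \<in> P" for y
    using that by (simp add: hS \<rho>_def h_scale P_def power_divide)
  have \<rho>_restr: "\<rho> \<in> measurable (restrict_space lborel P) (restrict_space borel ?S)"
    by (rule measurable_restrict_space2) (auto simp: \<rho>S intro!: measurable_restrict_space1)
  have sets_\<mu>: "sets \<mu> = sets (restrict_space borel ?S)" by (simp add: \<mu>_def)
  have "emeasure \<mu> E =
          (\<integral>\<^sup>+u\<in>{u\<in>U. \<phi> u \<in> E}. ennreal \<bar>\<omega> (\<phi> u) (frechet_derivative \<phi> (at u) (axis 1 1))
                                            (frechet_derivative \<phi> (at u) (axis 2 1))\<bar> \<partial>lborel)"
    if par: "parametrization ?S U \<phi>" and E: "E \<in> sets \<mu>" and "E \<subseteq> \<phi> ` U" for U \<phi> E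
  proof -
    define \<phi>' where "\<phi>' u = frechet_derivative \<phi> (at u)" for u
    define e1 e2 where "e1 = (axis 1 1 :: real^2)" and "e2 = (axis 2 1 :: real^2)"
    define K where "K = {u\<in>U. \<phi> u \<in> E}"
    define V where "V u = \<bar>vol3 (\<phi> u) (\<phi>' u e1) (\<phi>' u e2)\<bar>" for u
    define H where "H u = indicator K u * V u" for u
    have U: "open U" and cont': "continuous_on U (\<lambda>u. \<phi>' u e)" for e
      using par by (auto simp: parametrization_def \<phi>'_def)
    have der: "(\<phi> has_derivative \<phi>' u) (at u)" if "u \<in> U" for u
      using par that unfolding parametrization_def \<phi>'_def by (metis frechet_derivative_works)
    obtain \<psi> where \<psi>: "homeomorphism U (\<phi> ` U) \<phi> \<psi>"
      using par unfolding parametrization_def by blast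
    have inj: "inj_on \<phi> U"
      using homeomorphism_apply1[OF \<psi>] by (rule inj_on_inverseI)
    have cont: "continuous_on U \<phi>"
      using \<psi> by (simp add: homeomorphism_def)
    have US: "\<phi> ` U \<subseteq> ?S"
      using par openin_imp_subset unfolding parametrization_def by blast
    have ES: "E \<subseteq> ?S" and E_meas [measurable]: "E \<in> sets borel"
      using E by (auto simp: sets_\<mu> sets_restrict_space)
    have U_meas [measurable]: "U \<in> sets borel" using U by simp
    have [measurable]: "(\<lambda>u. indicator U u *\<^sub>R \<phi> u) \<in> borel_measurable borel"
      by (rule borel_measurable_continuous_on_indicator[OF U_meas cont])
    have "K = U \<inter> (\<lambda>u. indicator U u *\<^sub>R \<phi> u) -` E" by (auto simp: K_def)
    then have K_meas [measurable]: "K \<in> sets borel"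
      using measurable_sets_borel[of "\<lambda>u. indicator U u *\<^sub>R \<phi> u" borel E] by (simp add: sets.Int)
    have "continuous_on U V"
      unfolding V_def vol3_eq by (intro continuous_intros cont cont')
    then have [measurable]: "(\<lambda>u. indicator U u *\<^sub>R V u) \<in> borel_measurable borel"
      by (rule borel_measurable_continuous_on_indicator[OF U_meas])
    have H_eq: "H = (\<lambda>u. indicator K u * (indicator U u *\<^sub>R V u))"
      by (auto simp: H_def K_def indicator_def)
    have H_meas [measurable]: "H \<in> borel_measurable borel" unfolding H_eq by measurable
    have H0: "H u \<ge> 0" for u by (simp add: H_def V_def)

    define p where "p v = (vector [v $ 2, v $ 3] :: real^2)" for v :: "real^3"
    have p_eq: "p v = (v $ 2) *\<^sub>R e1 + (v $ 3) *\<^sub>R e2" for v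
      by (simp add: p_def e1_def e2_def vec_eq_iff forall_2 vector_2 axis_def)
    have p_lin: "bounded_linear p"
      unfolding p_eq[abs_def]
      by (intro bounded_linear_add bounded_linear_scaleR_const bounded_linear_vec_nth)
    have p_meas [measurable]: "p \<in> borel_measurable borel"
      by (intro borel_measurable_continuous_onI linear_continuous_on p_lin)
    have nth_meas [measurable]: "(\<lambda>v::real^3. v $ i) \<in> borel_measurable borel" for i
      by (intro borel_measurable_continuous_onI continuous_intros)
    define W where "W = {v. 0 < v $ 1 \<and> v $ 1 \<le> 1 \<and> p v \<in> K}"
    define g where "g v = (v $ 1) *\<^sub>R \<phi> (p v)" for v
    define g' where "g' v = (\<lambda>d. (v $ 1) *\<^sub>R \<phi>' (p v) (p d) + (d $ 1) *\<^sub>R \<phi> (p v))" for v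
    define D where "D v = indicator {0<..1} (v $ 1) * (v $ 1)\<^sup>2 * H (p v)" for v
    have W_meas: "W \<in> sets borel" unfolding W_def by measurable
    have hg: "h (g v) = (v $ 1)\<^sup>2" if "v \<in> W" for v
    proof -
      have "\<phi> (p v) \<in> ?S" using that ES by (auto simp: W_def K_def)
      then show ?thesis by (simp add: g_def h_scale hS)
    qed
    have gW: "g ` W = P \<inter> \<rho> -` E"
    proof (intro equalityI subsetI)
      fix y assume "y \<in> g ` W"
      then obtain v where v: "v \<in> W" "y = g v" by blast
      then have "v $ 1 > 0" "v $ 1 \<le> 1" "\<phi> (p v) \<in> E" by (auto simp: W_def K_def)
      moreover have "\<rho> y = \<phi> (p v)" using hg[OF v(1)] \<open>v $ 1 > 0\<close>
        by (simp add: v \<rho>_def) (simp add: g_def)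
      ultimately show "y \<in> P \<inter> \<rho> -` E"
        using hg[OF v(1)] by (simp add: P_def v power_le_one)
    next
      fix y assume "y \<in> P \<inter> \<rho> -` E"
      then have y: "0 < h y" "h y \<le> 1" "\<rho> y \<in> E" by (auto simp: P_def)
      then obtain u where u: "u \<in> U" "\<rho> y = \<phi> u" using \<open>E \<subseteq> \<phi> ` U\<close> by blast
      define v where "v = (vector [sqrt (h y), u $ 1, u $ 2] :: real^3)"
      have pv: "p v = u" by (simp add: p_def v_def vec_eq_iff forall_2 vector_2 vector_3)
      have v1: "v $ 1 = sqrt (h y)" by (simp add: v_def vector_3)
      have "v \<in> W" using y u by (simp add: W_def pv v1 K_def)
      moreover have "g v = y" using y by (simp add: g_def pv v1 u(2)[symmetric] \<rho>_def)
      ultimately show "y \<in> g ` W" by blast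
    qed
    have gW_meas: "g ` W \<in> sets borel" unfolding gW
      using measurable_sets_borel[OF \<rho>_meas E_meas] P_meas by (simp add: sets.Int)
    have g_inj: "inj_on g W"
    proof (rule inj_onI)
      fix v w assume vw: "v \<in> W" "w \<in> W" "g v = g w"
      then have pos: "v $ 1 > 0" "w $ 1 > 0" and pU: "p v \<in> U" "p w \<in> U" by (auto simp: W_def K_def)
      have "(v $ 1)\<^sup>2 = (w $ 1)\<^sup>2" using hg vw by metis
      then have 1: "v $ 1 = w $ 1" using pos by (simp add: power2_eq_iff)
      then have "\<phi> (p v) = \<phi> (p w)" using vw(3) pos by (simp add: g_def)
      then have "p v = p w" using inj pU by (simp add: inj_on_eq_iff)
      then show "v = w" using 1
        by (simp add: p_def vec_eq_iff forall_2 forall_3 vector_2)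
    qed
    have g_der: "(g has_derivative g' v) (at v within W)" if "v \<in> W" for v
    proof -
      have "p v \<in> U" using that by (auto simp: W_def K_def)
      have "(p has_derivative p) (at v)" by (rule bounded_linear_imp_has_derivative[OF p_lin])
      from has_derivative_compose[OF this der[OF \<open>p v \<in> U\<close>]]
      have "((\<lambda>v. \<phi> (p v)) has_derivative (\<lambda>d. \<phi>' (p v) (p d))) (at v)" .
      moreover have "((\<lambda>v::real^3. v $ 1) has_derivative (\<lambda>d. d $ 1)) (at v)"
        by (rule bounded_linear_imp_has_derivative[OF bounded_linear_vec_nth])
      ultimately have "(g has_derivative g' v) (at v)"
        unfolding g_def g'_def by (intro has_derivative_scaleR)
      then show ?thesis by (rule has_derivative_at_withinI)
    qed
    have g_det: "D v = \<bar>det (matrix (g' v))\<bar>" if "v \<in> W" for v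
    proof -
      have v: "0 < v $ 1" "v $ 1 \<le> 1" "p v \<in> K" "p v \<in> U" using that by (auto simp: W_def K_def)
      have lin: "linear (\<phi>' (p v))" using der[OF v(4)] has_derivative_linear by blast
      have p_ax: "p (axis 1 1) = 0" "p (axis 2 1) = e1" "p (axis 3 1) = e2"
        by (simp_all add: p_eq axis_def)
      have ax_nth: "axis 1 1 $ (1::3) = (1::real)" "axis 2 1 $ (1::3) = (0::real)" "axis 3 1 $ (1::3) = (0::real)"
        by (simp_all add: axis_def)
      have "g' v (axis 1 1) = \<phi> (p v)" "g' v (axis 2 1) = (v $ 1) *\<^sub>R \<phi>' (p v) e1"
           "g' v (axis 3 1) = (v $ 1) *\<^sub>R \<phi>' (p v) e2"
        by (simp_all add: g'_def p_ax linear_0[OF lin] ax_nth)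
      then have "det (matrix (g' v)) = (v $ 1)\<^sup>2 * vol3 (\<phi> (p v)) (\<phi>' (p v) e1) (\<phi>' (p v) e2)"
        by (simp add: det_3 matrix_def vol3_eq power2_eq_square algebra_simps)
      then show ?thesis using v by (simp add: D_def H_def V_def abs_mult)
    qed
    have D_meas: "D \<in> borel_measurable borel" unfolding D_def by measurable
    have D0: "D v \<ge> 0" for v by (simp add: D_def H0)
    have D_out: "D v = 0" if "v \<notin> W" for v using that by (auto simp: D_def W_def H_def indicator_def)
    have "emeasure lborel (g ` W) = (\<integral>\<^sup>+v. ennreal (D v) \<partial>lborel)"
      by (rule emeasure_image_eq[OF W_meas gW_meas g_der g_inj D_meas D0 g_det D_out])
    also have "\<dots> = (\<integral>\<^sup>+t. \<integral>\<^sup>+u. ennreal (D (join3 (t, u))) \<partial>lborel \<partial>lborel)"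
      by (rule nn_integral_join3) (use D_meas in measurable)
    also have "\<dots> = (\<integral>\<^sup>+t. \<integral>\<^sup>+u. ennreal (indicator {0<..1} t * t\<^sup>2) * ennreal (H u) \<partial>lborel \<partial>lborel)"
    proof -
      have "p (join3 (t, u)) = u" for t u
        by (simp add: join3_def p_def vec_eq_iff forall_2 vector_2 vector_3)
      then show ?thesis by (simp add: D_def join3_def vector_3 ennreal_mult H0)
    qed
    also have "\<dots> = (\<integral>\<^sup>+t. ennreal (indicator {0<..1} t * t\<^sup>2) * (\<integral>\<^sup>+u. ennreal (H u) \<partial>lborel) \<partial>lborel)"
      by (intro nn_integral_cong nn_integral_cmult) simp
    also have "\<dots> = (\<integral>\<^sup>+t. ennreal (indicator {0<..1} t * t\<^sup>2) \<partial>lborel) * (\<integral>\<^sup>+u. ennreal (H u) \<partial>lborel)"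
      by (rule nn_integral_multc) simp
    also have "\<dots> = ennreal (1 / 3) * (\<integral>\<^sup>+u. ennreal (H u) \<partial>lborel)"
      by (simp only: nn_integral_square)
    finally have vol: "emeasure lborel (P \<inter> \<rho> -` E) = ennreal (1 / 3) * (\<integral>\<^sup>+u. ennreal (H u) \<partial>lborel)"
      unfolding gW .

    have "emeasure \<mu> E = ennreal k * emeasure (restrict_space lborel P) (\<rho> -` E \<inter> P)"
      unfolding \<mu>_def emeasure_scale_measure
      by (subst emeasure_distr[OF \<rho>_restr]) (use E in \<open>auto simp: sets_\<mu> space_restrict_space\<close>)
    also have "emeasure (restrict_space lborel P) (\<rho> -` E \<inter> P) = emeasure lborel (P \<inter> \<rho> -` E)"
      by (subst emeasure_restrict_space) (auto simp: Int_commute)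
    also have "ennreal k * (emeasure lborel (P \<inter> \<rho> -` E)) = 
        ennreal (k / 3) * (\<integral>\<^sup>+u. ennreal (H u) \<partial>lborel)"
      unfolding vol by (simp add: mult.assoc[symmetric] k_def flip: ennreal_mult)
    also have "\<dots> = (\<integral>\<^sup>+u. ennreal (k / 3) * ennreal (H u) \<partial>lborel)"
      by (rule nn_integral_cmult[symmetric]) simp
    also have "\<dots> = (\<integral>\<^sup>+u\<in>K. ennreal \<bar>\<omega> (\<phi> u) (\<phi>' u e1) (\<phi>' u e2)\<bar> \<partial>lborel)"
    proof (rule nn_integral_cong)
      fix u
      show "ennreal (k / 3) * ennreal (H u) =
              ennreal \<bar>\<omega> (\<phi> u) (\<phi>' u e1) (\<phi>' u e2)\<bar> * indicator K u"
      proof (cases "u \<in> K")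
        case True
        then have u: "u \<in> U" "\<phi> u \<in> ?S" using ES by (auto simp: K_def)
        have tan: "dqf c (\<phi> u) (\<phi>' u e) = 0" for e
        proof -
          have "(qf c has_derivative dqf c (\<phi> u)) (at (\<phi> u))"
            using qf_has_derivative[of c "\<phi> u"] by (simp add: dqf_eq[abs_def])
          from has_derivative_compose[OF der[OF u(1)] this]
          have "((\<lambda>u. qf c (\<phi> u)) has_derivative (\<lambda>d. dqf c (\<phi> u) (\<phi>' u d))) (at u)" .
          moreover have "((\<lambda>u. qf c (\<phi> u)) has_derivative (\<lambda>d. 0)) (at u)"
          proof (rule has_derivative_transform_within_open[OF _ U u(1)])
            show "((\<lambda>u. real_of_int a) has_derivative (\<lambda>d. 0)) (at u)" by simp
            show "\<And>w. w \<in> U \<Longrightarrow> real_of_int a = qf c (\<phi> w)"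
              using US by (auto simp: quadric_def)
          qed
          ultimately show ?thesis using has_derivative_unique by metis
        qed
        have "\<bar>\<omega> (\<phi> u) (\<phi>' u e1) (\<phi>' u e2)\<bar> * (2 * \<bar>of_int a\<bar>) = V u"
          using arg_cong[OF gauge_form_tangent[OF \<omega> u(2) tan tan, of e1 e2], of abs]
          by (simp add: V_def abs_mult)
        then have "k / 3 * V u = \<bar>\<omega> (\<phi> u) (\<phi>' u e1) (\<phi>' u e2)\<bar>"
          using a by (simp add: k_def field_simps)
        moreover have "ennreal (k / 3) * ennreal (V u) = ennreal (k / 3 * V u)"
          by (rule ennreal_mult[symmetric]) (simp_all add: k_def V_def)
        ultimately show ?thesis using True by (simp add: H_def)
      qed (simp add: H_def)
    qed
    finally show ?thesis by (simp add: K_def \<phi>'_def e1_def e2_def)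
  qed
  then show ?thesis unfolding is_abs_form_measure_def using sets_\<mu> by blast
qed

end

theory Submission
  imports Defs "HOL-Computational_Algebra.Squarefree" "HOL-Real_Asymp.Real_Asymp"
begin

text \<open>
  If some local density vanishes, both sides are 0. Otherwise \<open>f = a\<close> is solvable modulo every
  integer, and the square condition turns this, by Legendre's theorem, into an integral change of
  variables \<open>R\<close> with \<open>a q(R x) = n\<^sup>2 f(x)\<close>, where \<open>q(A, B, C) = A\<^sup>2 + B C\<close>. Solutions of \<open>q = n\<^sup>2\<close> are
  trace-free 2 by 2 matrices with eigenvalues \<open>n\<close> and \<open>- n\<close>. They are fibred over the primitive
  eigenvectors \<open>u\<close> for \<open>n\<close>: those with a given \<open>u\<close> lie on a line in the direction of the nilpotent
  matrix \<open>evec u\<close>, which contributes \<open>2 T / N(evec u)\<close> points of norm at most \<open>T\<close> up to congruence conditions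
  and a bounded error. As \<open>N(evec u)\<close> is homogeneous of degree 2, summing over the primitive vectors
  \<open>u\<close> produces the logarithm, the area of \<open>{u. N(evec u) \<le> 1}\<close> and the Euler product
  \<open>\<Prod>(1 - 1/p\<^sup>2)\<close> over the good primes. To keep the error under control a point is counted this way only
  if its eigenvector for \<open>n\<close> is the shorter of the two; the others are the negatives of such points.
  The same fibration computes the volume: in the chart (eigenvector, position on the line) the
  density of the gauge form is constant. At the bad primes the congruence weights are
  evaluated modulo one large integer \<open>Q\<close>, where Hensel's lemma identifies them with local densities.
\<close>

section \<open>Counting residue classes in three variables\<close>

text \<open>Why only the shorter eigenvector is used: if U and V are the sizes of the primitive
  eigenvectors of a point for n and -n, the point itself has size about U V. Counting along all
  lines would involve U up to about T, hence about T^2 lines, and a bounded error per line would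
  exceed the main term T log T. If U is at most V, then U^2 is at most of order T, only O(T) lines
  occur, and the errors add up to O(T).

  The area and the factor n^2 / (|a| |det R|) occur in the count as well as in the volume and
  cancel. What remains is to match the congruence weights with the Euler factors at the primes of
  \<open>Q\<close>. At a good prime the density is 1 + 1/p, so that 1 - 1/p is the convergence
  factor and the product 1 - 1/p^2 is also the proportion of vectors primitive at p.

  The square condition says that f and a q have the same determinant up to squares. Isotropic
  rational ternary forms with this property are equivalent, so a single rational zero of f yields
  \<open>R\<close>. Indefiniteness is the real condition in Legendre's theorem, and the nonvanishing
  densities supply the conditions at the primes.\<close>

definition box3 :: "int \<Rightarrow> (int^3) set" where
  "box3 M = {x. \<forall>i. 0 \<le> x $ i \<and> x $ i < M}"

definition vcong :: "int \<Rightarrow> int^3 \<Rightarrow> int^3 \<Rightarrow> bool" where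
  "vcong M x y \<longleftrightarrow> (\<forall>i. M dvd x $ i - y $ i)"

definition periodic :: "int \<Rightarrow> (int^3 \<Rightarrow> bool) \<Rightarrow> bool" where
  "periodic M P \<longleftrightarrow> (\<forall>x y. vcong M x y \<longrightarrow> P x = P y)"

definition vmod :: "int \<Rightarrow> int^3 \<Rightarrow> int^3" where
  "vmod M x = (\<chi> i. x $ i mod M)"

lemma periodicD: "periodic M P \<Longrightarrow> vcong M x y \<Longrightarrow> P x = P y"
  by (auto simp: periodic_def)

lemma vcong_sym: "vcong M x y \<Longrightarrow> vcong M y x"
  unfolding vcong_def by (metis dvd_minus_iff minus_diff_eq)

lemma vcong_refl: "vcong M x x" by (simp add: vcong_def)

lemma vcong_trans: "vcong M x y \<Longrightarrow> vcong M y z \<Longrightarrow> vcong M x z"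
  unfolding vcong_def by (metis dvd_add diff_add_cancel add_diff_eq)

lemma vcong_add_scaled: "vcong M (x + M *s z) x"
  by (simp add: vcong_def)

lemma vcongE: assumes "vcong M x y" obtains z where "x = y + M *s z"
proof -
  from assms obtain f where f: "\<And>i. x $ i - y $ i = M * f i" unfolding vcong_def dvd_def by metis
  have "x = y + M *s (\<chi> i. f i)" by (simp add: vec_eq_iff f[symmetric])
  then show ?thesis by (rule that)
qed

lemma vcong_matrix: "vcong M x y \<Longrightarrow> vcong M (V *v x) (V *v y)"
proof (elim vcongE)
  fix z assume "x = y + M *s z"
  then have "V *v x = V *v y + M *s (V *v z)"
    by (simp add: vec_eq_iff matrix_vector_mult_def sum_3 algebra_simps)
  then show ?thesis by (simp add: vcong_add_scaled)
qed

lemma vmod_cong: "vcong M (vmod M x) x"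
  unfolding vcong_def vmod_def by (simp add: mod_eq_dvd_iff[symmetric])

lemma vmod_eq_iff: "vmod M x = vmod M y \<longleftrightarrow> vcong M x y"
  by (simp add: vmod_def vcong_def vec_eq_iff mod_eq_dvd_iff)

lemma vmod_in_box3: "M > 0 \<Longrightarrow> vmod M x \<in> box3 M"
  by (simp add: vmod_def box3_def)

lemma vmod_box3: "x \<in> box3 M \<Longrightarrow> vmod M x = x"
  by (simp add: vmod_def box3_def vec_eq_iff)

lemma box3_vcong_eq: "x \<in> box3 M \<Longrightarrow> y \<in> box3 M \<Longrightarrow> vcong M x y \<Longrightarrow> x = y"
  using vmod_box3 vmod_eq_iff by metis

lemma box3_bij:
  "bij_betw (\<lambda>(a, b, c). vector [a, b, c] :: int^3) ({0..<M} \<times> {0..<M} \<times> {0..<M}) (box3 M)"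
  by (rule bij_betw_byWitness[where f' = "\<lambda>x. (x $ 1, x $ 2, x $ 3)"])
     (auto simp: box3_def forall_3 vector_3 vec_eq_iff)

lemma finite_box3 [simp]: "finite (box3 M)"
  using bij_betw_finite[OF box3_bij] by blast

lemma card_box3: "card (box3 M) = nat M ^ 3"
  using bij_betw_same_card[OF box3_bij, of M] by (simp add: card_cartesian_product power3_eq_cube)

lemma card_box3_sum:
  "card {x \<in> box3 M. P x} = (\<Sum>a\<in>{0..<M}. \<Sum>b\<in>{0..<M}. card {c \<in> {0..<M}. P (vector [a, b, c])})"
proof -
  let ?f = "\<lambda>(a, b, c). vector [a, b, c] :: int^3"
  have "card {x \<in> box3 M. P x} = (\<Sum>x\<in>box3 M. if P x then 1 else 0)"
    by (simp add: sum.If_cases Int_def)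
  also have "\<dots> = (\<Sum>t\<in>{0..<M} \<times> {0..<M} \<times> {0..<M}. if P (?f t) then 1 else 0)"
    by (rule sum.reindex_bij_betw[symmetric, OF box3_bij])
  also have "\<dots> = (\<Sum>a\<in>{0..<M}. \<Sum>b\<in>{0..<M}. \<Sum>c\<in>{0..<M}. if P (vector [a, b, c]) then 1 else 0)"
    by (simp add: sum.cartesian_product split_def)
  also have "\<dots> = (\<Sum>a\<in>{0..<M}. \<Sum>b\<in>{0..<M}. card {c \<in> {0..<M}. P (vector [a, b, c])})"
    by (intro sum.cong refl) (simp add: sum.If_cases Int_def)
  finally show ?thesis .
qed

text \<open>\<open>F\<close> and \<open>G\<close> are inverse to each other only up to congruence,
  as for an integral matrix whose determinant is a unit modulo \<open>M\<close>; reduction with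
  \<open>vmod\<close> turns them into genuine bijections of \<open>box3 M\<close>.\<close>

lemma card_box3_bij:
  assumes M: "M > 0" and P: "periodic M P"
    and F: "\<And>x y. vcong M x y \<Longrightarrow> vcong M (F x) (F y)" and G: "\<And>x y. vcong M x y \<Longrightarrow> vcong M (G x) (G y)"
    and FG: "\<And>x. vcong M (F (G x)) x" and GF: "\<And>x. vcong M (G (F x)) x"
  shows "card {x \<in> box3 M. P (F x)} = card {x \<in> box3 M. P x}"
proof (rule bij_betw_same_card)
  have 1: "vmod M (G (vmod M (F x))) = vmod M x" for x
    unfolding vmod_eq_iff using G[OF vmod_cong] GF vcong_trans by blast
  have 2: "vmod M (F (vmod M (G x))) = vmod M x" for x
    unfolding vmod_eq_iff using F[OF vmod_cong] FG vcong_trans by blast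
  have 3: "P (vmod M x) = P x" for x using P vmod_cong periodicD by blast
  have 4: "P (F (vmod M (G x))) = P x" for x
    using P F[OF vmod_cong] FG vcong_trans periodicD by meson
  show "bij_betw (\<lambda>x. vmod M (F x)) {x \<in> box3 M. P (F x)} {x \<in> box3 M. P x}"
    by (rule bij_betw_byWitness[where f' = "\<lambda>x. vmod M (G x)"])
       (use M in \<open>auto simp: 1 2 3 4 vmod_in_box3 vmod_box3\<close>)
qed

lemma int_div_less: "(x::int) div M < k" if "0 < M" "x < M * k"
proof (rule ccontr)
  assume "\<not> x div M < k"
  then have "M * k \<le> M * (x div M)" using that by (intro mult_left_mono) auto
  also have "\<dots> \<le> x" using that mult_div_mod_eq[of M x] pos_mod_sign[of M x] by linarith
  finally show False using that by simp
qed

text \<open>Expansion in base \<open>M\<close>: a class modulo \<open>M * k\<close> is a class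
  \<open>b\<close> modulo \<open>M\<close> together with a digit vector \<open>z\<close> modulo
  \<open>k\<close>. The Hensel type lifting arguments below start from this.\<close>

lemma card_box3_mult:
  assumes M: "M > 0" and k: "k > 0"
  shows "card {x \<in> box3 (M * k). P x} = (\<Sum>b\<in>box3 M. card {z \<in> box3 k. P (b + M *s z)})"
proof -
  let ?S = "SIGMA b:box3 M. {z \<in> box3 k. P (b + M *s z)}"
  have *: "(b + M * z) mod M = b" "(b + M * z) div M = z" "0 \<le> b + M * z" "b + M * z < M * k"
    if "0 \<le> b" "b < M" "0 \<le> z" "z < k" for b z
  proof -
    have "M * z \<le> M * (k - 1)" using that M by (intro mult_left_mono) auto
    then show "b + M * z < M * k" using that by (simp add: algebra_simps)
  qed (use that M k in auto)
  have div: "x div M < k" if "0 \<le> x" "x < M * k" for x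
    using that M by (simp add: int_div_less)
  have "bij_betw (\<lambda>(b, z). b + M *s z) ?S {x \<in> box3 (M * k). P x}"
  proof (rule bij_betw_byWitness[where f' = "\<lambda>x. (vmod M x, \<chi> i. x $ i div M)"])
    have v: "0 \<le> vmod M x $ i" "vmod M x $ i < M" for x i using M by (simp_all add: vmod_def)
    have "vmod M x + M *s (\<chi> i. x $ i div M) = x" for x by (simp add: vmod_def vec_eq_iff)
    then show "\<forall>x\<in>{x \<in> box3 (M * k). P x}. (\<lambda>(b, z). b + M *s z) (vmod M x, \<chi> i. x $ i div M) = x"
      and "(\<lambda>x. (vmod M x, \<chi> i. x $ i div M)) ` {x \<in> box3 (M * k). P x} \<subseteq> ?S"
      using M k div v by (auto simp: box3_def pos_imp_zdiv_nonneg_iff)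
  qed (use * M in \<open>auto simp: box3_def vmod_def vec_eq_iff\<close>)
  from bij_betw_same_card[OF this] show ?thesis by (simp add: card_SigmaI)
qed

lemma card_box3_periodic:
  assumes M: "M > 0" and k: "k > 0" and P: "periodic M P"
  shows "card {x \<in> box3 (M * k). P x} = nat k ^ 3 * card {x \<in> box3 M. P x}"
proof -
  have "P (b + M *s z) = P b" for b z using P vcong_add_scaled periodicD by blast
  then have "card {x \<in> box3 (M * k). P x} = (\<Sum>b\<in>box3 M. if P b then nat k ^ 3 else 0)"
    unfolding card_box3_mult[OF M k] by (intro sum.cong refl) (simp add: card_box3)
  also have "\<dots> = nat k ^ 3 * card {x \<in> box3 M. P x}" by (simp add: sum.If_cases Int_def)
  finally show ?thesis .
qed

text \<open>The Chinese remainder theorem for zeros of a function that respects every modulus, as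
  polynomials do.\<close>

lemma card_box3_coprime:
  assumes M: "M > 0" and k: "k > 0" and co: "coprime M k"
    and F: "\<And>m x y. vcong m x y \<Longrightarrow> m dvd F x - F y"
  shows "card {x \<in> box3 (M * k). M * k dvd F x} =
    card {x \<in> box3 M. M dvd F x} * card {x \<in> box3 k. k dvd F x}"
proof -
  have per: "m dvd F x \<longleftrightarrow> m dvd F y" if "vcong m x y" for m x y
    using F[OF that] by (metis dvd_add_right_iff diff_add_cancel)
  have cm: "M * k dvd t \<longleftrightarrow> M dvd t \<and> k dvd t" for t :: int
    using co by (meson divides_mult dvd_mult_left dvd_mult_right)
  have cv: "vcong (M * k) x y \<longleftrightarrow> vcong M x y \<and> vcong k x y" for x y
    by (auto simp: vcong_def cm)
  let ?f = "\<lambda>x. (vmod M x, vmod k x)"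
  have "bij_betw ?f {x \<in> box3 (M * k). M * k dvd F x}
     ({x \<in> box3 M. M dvd F x} \<times> {x \<in> box3 k. k dvd F x})"
  proof (rule bij_betwI')
    fix x y assume "x \<in> {x \<in> box3 (M * k). M * k dvd F x}" "y \<in> {x \<in> box3 (M * k). M * k dvd F x}"
    then show "(?f x = ?f y) = (x = y)"
      by (auto simp: vmod_eq_iff cv[symmetric] vcong_refl intro: box3_vcong_eq)
  next
    fix x assume "x \<in> {x \<in> box3 (M * k). M * k dvd F x}"
    then show "?f x \<in> {x \<in> box3 M. M dvd F x} \<times> {x \<in> box3 k. k dvd F x}"
      using per[OF vmod_cong] M k by (auto simp: vmod_in_box3 cm)
  next
    fix y assume y: "y \<in> {x \<in> box3 M. M dvd F x} \<times> {x \<in> box3 k. k dvd F x}"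
    have "\<forall>i. \<exists>t. [t = fst y $ i] (mod M) \<and> [t = snd y $ i] (mod k)"
      using binary_chinese_remainder_int[OF co] by blast
    then obtain t where t: "\<And>i. M dvd t i - fst y $ i" "\<And>i. k dvd t i - snd y $ i"
      by (metis cong_iff_dvd_diff)
    define x where "x = vmod (M * k) (\<chi> i. t i)"
    have "vcong (M * k) x (\<chi> i. t i)" by (simp add: x_def vmod_cong)
    then have x: "vcong M x (fst y)" "vcong k x (snd y)"
      using t unfolding cv by (auto intro: vcong_trans simp: vcong_def[of _ "\<chi> i. t i"])
    have "M * k dvd F x" using per[OF x(1)] per[OF x(2)] y by (auto simp: cm)
    moreover have "x \<in> box3 (M * k)" using M k by (simp add: x_def vmod_in_box3)
    moreover have "y = ?f x" using x y by (metis (no_types, lifting) vmod_eq_iff vmod_box3 mem_Sigma_iff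
        mem_Collect_eq prod.collapse)
    ultimately show "\<exists>x\<in>{x \<in> box3 (M * k). M * k dvd F x}. y = ?f x" by blast
  qed
  from bij_betw_same_card[OF this] show ?thesis by (simp add: card_cartesian_product)
qed

section \<open>Linear congruences\<close>

lemma card_linear_cong_1:
  fixes M g b :: int
  assumes M: "M > 0"
  shows "card {z \<in> {0..<M}. M dvd g * z - b} = (if gcd g M dvd b then nat (gcd g M) else 0)"
proof (cases "gcd g M dvd b")
  case True
  define d where "d = gcd g M"
  have d: "d > 0" using M by (simp add: d_def)
  obtain h where h: "g = d * h" unfolding d_def by (metis dvdE gcd_dvd1)
  obtain m where m: "M = d * m" unfolding d_def by (metis dvdE gcd_dvd2)
  obtain b' where b': "b = d * b'" using True unfolding d_def[symmetric] by (metis dvdE)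
  have m0: "m > 0" using M d m by (simp add: zero_less_mult_iff)
  have co: "coprime h m"
  proof (rule coprimeI)
    fix e assume e: "e dvd h" "e dvd m"
    then have "d * e dvd g" "d * e dvd M" unfolding h m by (auto intro: mult_dvd_mono)
    then have "d * e dvd d * 1" by (simp add: d_def)
    then show "is_unit e" using d by (subst (asm) dvd_mult_cancel_left) auto
  qed
  obtain k where k: "[h * k = 1] (mod m)" using cong_solve_coprime_int[OF co] by auto
  \<comment> \<open>Dividing by \<open>d\<close> leaves a unit \<open>h\<close> modulo
    \<open>m\<close>, so the solutions form one class modulo \<open>m\<close>, and \<open>d\<close>
    of its members lie below \<open>M\<close>.\<close>
  define z0 where "z0 = (k * b') mod m"
  have iff: "M dvd g * z - b \<longleftrightarrow> m dvd z - z0" for z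
  proof -
    have "M dvd g * z - b \<longleftrightarrow> m dvd h * z - b'"
      unfolding h m b' using d by (simp add: mult.assoc flip: right_diff_distrib)
    also have "\<dots> \<longleftrightarrow> m dvd h * (z - k * b')"
    proof -
      have "m dvd h * k - 1" using k by (simp add: cong_iff_dvd_diff)
      then have "m dvd (h * k - 1) * b'" by simp
      moreover have "h * z - b' = h * (z - k * b') + (h * k - 1) * b'" by (simp add: algebra_simps)
      ultimately show ?thesis by (simp add: dvd_add_left_iff)
    qed
    also have "\<dots> \<longleftrightarrow> m dvd z - k * b'"
      using co by (simp add: coprime_dvd_mult_right_iff coprime_commute)
    also have "\<dots> \<longleftrightarrow> m dvd z - z0" unfolding z0_def
      by (simp flip: mod_eq_dvd_iff)
    finally show ?thesis .
  qed
  have "bij_betw (\<lambda>j. z0 + m * j) {0..<d} {z \<in> {0..<M}. M dvd g * z - b}"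
  proof (rule bij_betw_byWitness[where f' = "\<lambda>z. z div m"])
    have z0: "0 \<le> z0" "z0 < m" using m0 by (auto simp: z0_def)
    show "\<forall>j\<in>{0..<d}. (z0 + m * j) div m = j" using z0 m0 by simp
    have zz: "z mod m = z0" if "m dvd z - z0" for z
      using that z0 by (simp flip: mod_eq_dvd_iff)
    show "\<forall>z\<in>{z \<in> {0..<M}. M dvd g * z - b}. z0 + m * (z div m) = z"
      proof
      fix z assume "z \<in> {z \<in> {0..<M}. M dvd g * z - b}"
      then have "z mod m = z0" unfolding iff using zz by blast
      then show "z0 + m * (z div m) = z" using mult_div_mod_eq[of m z] by linarith
    qed
    show "(\<lambda>j. z0 + m * j) ` {0..<d} \<subseteq> {z \<in> {0..<M}. M dvd g * z - b}"
    proof clarsimp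
      fix j assume j: "0 \<le> j" "j < d"
      have "m * j \<le> m * (d - 1)" using j m0 by (intro mult_left_mono) auto
      then show "0 \<le> z0 + m * j \<and> z0 + m * j < M \<and> M dvd g * (z0 + m * j) - b"
        using z0 m0 j unfolding iff by (auto simp: m algebra_simps)
    qed
    show "(\<lambda>z. z div m) ` {z \<in> {0..<M}. M dvd g * z - b} \<subseteq> {0..<d}"
    proof clarsimp
      fix z assume "0 \<le> z" "z < M"
      then show "0 \<le> z div m \<and> z div m < d" using m0
        by (simp add: pos_imp_zdiv_nonneg_iff m int_div_less mult.commute)
    qed
  qed
  from bij_betw_same_card[OF this] show ?thesis using True by (simp add: d_def)
next
  case False
  have "{z \<in> {0..<M}. M dvd g * z - b} = {}"
  proof -
    have "\<not> M dvd g * z - b" for z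
    proof
      assume "M dvd g * z - b"
      then have "gcd g M dvd g * z - b" by (meson dvd_trans gcd_dvd2)
      moreover have "gcd g M dvd g * z" by simp
      ultimately have "gcd g M dvd g * z - (g * z - b)" by (rule dvd_diff[rotated])
      then have "gcd g M dvd b" by (simp only: diff_diff_eq2 add_diff_cancel_left')
      with False show False by contradiction
    qed
    then show ?thesis by auto
  qed
  then show ?thesis using False by (simp only: card.empty if_False)
qed

definition unimodular :: "int^3^3 \<Rightarrow> bool" where
  "unimodular V \<longleftrightarrow> (\<exists>W. V ** W = mat 1 \<and> W ** V = mat 1)"

lemma unimodular_mult: "unimodular U \<Longrightarrow> unimodular V \<Longrightarrow> unimodular (U ** V)"
  unfolding unimodular_def by (metis matrix_mul_assoc matrix_mul_lid)

lemma card_box3_unimodular: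
  assumes "M > 0" "periodic M P" "unimodular V"
  shows "card {x \<in> box3 M. P (V *v x)} = card {x \<in> box3 M. P x}"
proof -
  obtain W where W: "V ** W = mat 1" "W ** V = mat 1" using assms(3) unfolding unimodular_def by blast
  show ?thesis
    by (rule card_box3_bij[where G = "\<lambda>x. W *v x", OF assms(1,2) vcong_matrix vcong_matrix])
       (simp_all add: W vcong_refl matrix_vector_mul_assoc)
qed

text \<open>One step of column reduction: the matrix with rows (s, u) and (t, v) has determinant 1
  and sends the row (a, b) to (gcd a b, 0).\<close>

lemma elimination_pair:
  fixes a b :: int
  obtains s t u v where "s * v - t * u = 1" "a * s + b * t = gcd a b" "a * u + b * v = 0"
proof (cases "gcd a b = 0")
  case True then show ?thesis using that[of 1 1 0 0] by simp
next
  case False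
  obtain s t where st: "s * a + t * b = gcd a b" using bezout_int by blast
  obtain p q where p: "a = gcd a b * p" and q: "b = gcd a b * q" by (metis dvdE gcd_dvd1 gcd_dvd2)
  have "gcd a b * (s * p + t * q) = s * (gcd a b * p) + t * (gcd a b * q)" by (simp add: algebra_simps)
  also have "\<dots> = gcd a b * 1" using st p q by simp
  finally have 1: "s * p + t * q = 1" using False by (simp only: mult_cancel_left) simp
  have "a * (- q) + b * p = - (gcd a b * p) * q + (gcd a b * q) * p" using p q by simp
  then have "a * (- q) + b * p = 0" by simp
  then show ?thesis using that[of s p t "- q"] 1 st by (simp add: algebra_simps)
qed

abbreviation mat33 :: "'a::zero \<Rightarrow> 'a \<Rightarrow> 'a \<Rightarrow> 'a \<Rightarrow> 'a \<Rightarrow> 'a \<Rightarrow> 'a \<Rightarrow> 'a \<Rightarrow> 'a \<Rightarrow> 'a^3^3" where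
  "mat33 a b c d e f g h i \<equiv> vector [vector [a, b, c], vector [d, e, f], vector [g, h, i]]"

lemma unimodular_ops:
  assumes "s * v - t * u = 1"
  shows "unimodular (mat33 s u 0 t v 0 0 0 1)" "unimodular (mat33 s 0 u 0 1 0 t 0 v)"
    "unimodular (mat33 1 0 0 0 s u 0 t v)"
  unfolding unimodular_def
proof -
  show "\<exists>W. mat33 s u 0 t v 0 0 0 1 ** W = mat 1 \<and> W ** mat33 s u 0 t v 0 0 0 1 = mat 1"
    by (rule exI[of _ "mat33 v (-u) 0 (-t) s 0 0 0 1"])
       (use assms in \<open>unfold vec_eq_iff forall_3 matrix_matrix_mult_def mat_def, simp add: sum_3 vector_3 algebra_simps\<close>)
  show "\<exists>W. mat33 s 0 u 0 1 0 t 0 v ** W = mat 1 \<and> W ** mat33 s 0 u 0 1 0 t 0 v = mat 1"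
    by (rule exI[of _ "mat33 v 0 (-u) 0 1 0 (-t) 0 s"])
       (use assms in \<open>unfold vec_eq_iff forall_3 matrix_matrix_mult_def mat_def, simp add: sum_3 vector_3 algebra_simps\<close>)
  show "\<exists>W. mat33 1 0 0 0 s u 0 t v ** W = mat 1 \<and> W ** mat33 1 0 0 0 s u 0 t v = mat 1"
    by (rule exI[of _ "mat33 1 0 0 0 v (-u) 0 (-t) s"])
       (use assms in \<open>unfold vec_eq_iff forall_3 matrix_matrix_mult_def mat_def, simp add: sum_3 vector_3 algebra_simps\<close>)
qed

lemma row_reduction:
  fixes R :: "int^3^3"
  obtains V where "unimodular V" "det V = 1" "(R ** V) $ i $ 1 = gcd (gcd (R $ i $ 1) (R $ i $ 2)) (R $ i $ 3)"
    "(R ** V) $ i $ 2 = 0" "(R ** V) $ i $ 3 = 0"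
proof -
  obtain s t u v where 1: "s * v - t * u = 1" "R $ i $ 1 * s + R $ i $ 2 * t = gcd (R $ i $ 1) (R $ i $ 2)"
    "R $ i $ 1 * u + R $ i $ 2 * v = 0" by (rule elimination_pair)
  define g where "g = gcd (R $ i $ 1) (R $ i $ 2)"
  obtain s' t' u' v' where 2: "s' * v' - t' * u' = 1" "g * s' + R $ i $ 3 * t' = gcd g (R $ i $ 3)"
    "g * u' + R $ i $ 3 * v' = 0" by (rule elimination_pair)
  define V1 :: "int^3^3" where "V1 = mat33 s u 0 t v 0 0 0 1"
  define V2 :: "int^3^3" where "V2 = mat33 s' 0 u' 0 1 0 t' 0 v'"
  have R1: "(R ** V1) $ i $ 1 = g" "(R ** V1) $ i $ 2 = 0" "(R ** V1) $ i $ 3 = R $ i $ 3"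
    using 1 by (simp_all add: V1_def matrix_matrix_mult_def sum_3 vector_3 g_def)
  have "(R ** V1 ** V2) $ i $ 1 = gcd g (R $ i $ 3)" "(R ** V1 ** V2) $ i $ 2 = 0" "(R ** V1 ** V2) $ i $ 3 = 0"
    using 2 by (simp_all add: V2_def matrix_matrix_mult_def[of "R ** V1"] sum_3 vector_3 R1)
  moreover have "unimodular (V1 ** V2)" using unimodular_ops[OF 1(1)] unimodular_ops[OF 2(1)]
    by (auto simp: V1_def V2_def intro: unimodular_mult)
  moreover have "det (V1 ** V2) = 1" using 1(1) 2(1)
    by (simp add: det_mul) (simp add: V1_def V2_def det_3 vector_3 algebra_simps)
  ultimately show ?thesis using that[of "V1 ** V2"] by (simp add: g_def matrix_mul_assoc)
qed

lemma card_linear_cong_3: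
  fixes l :: "int^3"
  assumes M: "M > 0"
  defines "g \<equiv> gcd (gcd (gcd (l $ 1) (l $ 2)) (l $ 3)) M"
  shows "card {z \<in> box3 M. M dvd l $ 1 * z $ 1 + l $ 2 * z $ 2 + l $ 3 * z $ 3 - b} =
    (if g dvd b then nat g * nat M ^ 2 else 0)"
proof -
  \<comment> \<open>Only the first row matters; the matrix is formed in order to apply
    \<open>row_reduction\<close>. After the substitution the linear form is \<open>g0\<close> times
    one variable and the other two are free, whence the factor M^2.\<close>
  define R where "R = (\<chi> i::3. l)"
  obtain V where V: "unimodular V" "(R ** V) $ 1 $ 1 = gcd (gcd (l $ 1) (l $ 2)) (l $ 3)"
    "(R ** V) $ 1 $ 2 = 0" "(R ** V) $ 1 $ 3 = 0"
    using row_reduction[of R 1] by (auto simp: R_def)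
  define g0 where "g0 = gcd (gcd (l $ 1) (l $ 2)) (l $ 3)"
  let ?P = "\<lambda>z :: int^3. M dvd l $ 1 * z $ 1 + l $ 2 * z $ 2 + l $ 3 * z $ 3 - b"
  have eq: "l $ 1 * z $ 1 + l $ 2 * z $ 2 + l $ 3 * z $ 3 = (R *v z) $ 1" for z
    by (simp add: R_def matrix_vector_mult_def sum_3)
  have RV: "(R *v (V *v z)) $ 1 = g0 * z $ 1" for z
    by (simp only: matrix_vector_mul_assoc) (simp add: matrix_vector_mult_def[of "R ** V"] sum_3 V g0_def)
  have per: "periodic M ?P" unfolding periodic_def eq
  proof (intro allI impI)
    fix x y assume "vcong M x y"
    then have "M dvd (R *v x) $ 1 - (R *v y) $ 1" using vcong_matrix by (auto simp: vcong_def)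
    then show "(M dvd (R *v x) $ 1 - b) = (M dvd (R *v y) $ 1 - b)"
      by (metis (no_types, lifting) mod_eq_dvd_iff mod_diff_left_eq dvd_eq_mod_eq_0)
  qed
  have "card {z \<in> box3 M. ?P z} = card {z \<in> box3 M. ?P (V *v z)}"
    by (rule card_box3_unimodular[OF M per V(1), symmetric])
  also have "\<dots> = card {z \<in> box3 M. M dvd g0 * z $ 1 - b}" unfolding eq RV ..
  also have "\<dots> = (\<Sum>a\<in>{0..<M}. if M dvd g0 * a - b then nat M ^ 2 else 0)"
  proof -
    have "card {c. 0 \<le> c \<and> c < M} = nat M" using card_atLeastLessThan_int[of 0 M]
      by (simp add: atLeastLessThan_def lessThan_def atLeast_def Int_def)
    then show ?thesis
      unfolding card_box3_sum by (intro sum.cong refl) (simp add: vector_3 power2_eq_square)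
  qed
  also have "\<dots> = nat M ^ 2 * card {z \<in> {0..<M}. M dvd g0 * z - b}" by (simp add: sum.If_cases Int_def)
  also have "\<dots> = (if g dvd b then nat g * nat M ^ 2 else 0)"
    unfolding card_linear_cong_1[OF M] by (simp add: g_def g0_def)
  finally show ?thesis .
qed

lemma lower_triangular:
  fixes R :: "int^3^3"
  obtains V where "unimodular V" "det V = 1" "(R ** V) $ 1 $ 2 = 0" "(R ** V) $ 1 $ 3 = 0" "(R ** V) $ 2 $ 3 = 0"
proof -
  obtain V1 where V1: "unimodular V1" "det V1 = 1" "(R ** V1) $ 1 $ 2 = 0" "(R ** V1) $ 1 $ 3 = 0"
    using row_reduction[of R 1] by metis
  define S where "S = R ** V1"
  obtain s t u v where 1: "s * v - t * u = 1" "S $ 2 $ 2 * u + S $ 2 $ 3 * v = 0" by (rule elimination_pair)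
  define V2 :: "int^3^3" where "V2 = mat33 1 0 0 0 s u 0 t v"
  have "(S ** V2) $ 1 $ 2 = 0" "(S ** V2) $ 1 $ 3 = 0" "(S ** V2) $ 2 $ 3 = 0"
    using 1 V1 by (simp_all add: V2_def matrix_matrix_mult_def[of S] sum_3 vector_3 S_def[symmetric])
  moreover have "unimodular (V1 ** V2)" using V1 unimodular_ops[OF 1(1)]
    by (auto simp: V2_def intro: unimodular_mult)
  moreover have "det (V1 ** V2) = 1" using 1(1) V1
    by (simp add: det_mul) (simp add: V2_def det_3 vector_3 algebra_simps)
  ultimately show ?thesis using that[of "V1 ** V2"] by (simp add: S_def matrix_mul_assoc)
qed

text \<open>
  For lower triangular \<open>R\<close> the three congruences can be solved one after the other, and divisibility
  of \<open>M\<close> by the determinant makes each of them solvable.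
\<close>

lemma card_kernel_mod:
  fixes R :: "int^3^3"
  assumes M: "M > 0" and dM: "det R dvd M"
  shows "card {x \<in> box3 M. vcong M (R *v x) 0} = nat \<bar>det R\<bar>"
proof -
  obtain V where V: "unimodular V" "det V = 1" "(R ** V) $ 1 $ 2 = 0" "(R ** V) $ 1 $ 3 = 0" "(R ** V) $ 2 $ 3 = 0"
    by (rule lower_triangular)
  define S where "S = R ** V"
  define t1 where "t1 = S $ 1 $ 1"
  define t2 where "t2 = S $ 2 $ 2"
  define t3 where "t3 = S $ 3 $ 3"
  have det: "det R = t1 * t2 * t3"
  proof -
    have "det R = det S" by (simp add: S_def det_mul V)
    also have "\<dots> = t1 * t2 * t3" using V by (simp add: det_3 t1_def t2_def t3_def S_def[symmetric])
    finally show ?thesis .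
  qed
  obtain m where m: "M = t1 * t2 * t3 * m" using dM det by (metis dvdE)
  have t0: "t1 \<noteq> 0" "t2 \<noteq> 0" "t3 \<noteq> 0" using M m by auto
  have per: "periodic M (\<lambda>x. vcong M (R *v x) 0)" unfolding periodic_def
    using vcong_matrix vcong_trans vcong_sym by blast
  have one: "card {z \<in> {0..<M}. M dvd t * z + c} = nat \<bar>t\<bar>" if "t dvd M" "t dvd c" for t c :: int
  proof -
    have "gcd t M = \<bar>t\<bar>" using that(1) by (metis gcd_proj1_iff normalize_int_def gcd_abs1_int abs_dvd_iff abs_abs)
    then show ?thesis using card_linear_cong_1[OF M, of t "- c"] that by simp
  qed
  have "card {x \<in> box3 M. vcong M (R *v x) 0} = card {x \<in> box3 M. vcong M (R *v (V *v x)) 0}"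
    by (rule card_box3_unimodular[OF M per V(1), symmetric])
  also have "\<dots> = card {x \<in> box3 M. vcong M (S *v x) 0}" by (simp add: matrix_vector_mul_assoc S_def)
  also have "\<dots> = (\<Sum>a\<in>{0..<M}. \<Sum>b\<in>{0..<M}. card {c \<in> {0..<M}. M dvd t1 * a \<and> M dvd S $ 2 $ 1 * a + t2 * b
      \<and> M dvd t3 * c + (S $ 3 $ 1 * a + S $ 3 $ 2 * b)})"
    unfolding card_box3_sum using V(3-5)
    by (intro sum.cong refl arg_cong[where f = card])
       (auto simp: vcong_def forall_3 matrix_vector_mult_def sum_3 vector_3 t1_def t2_def t3_def S_def[symmetric] algebra_simps)
  also have "\<dots> = (\<Sum>a\<in>{0..<M}. if M dvd t1 * a then nat \<bar>t2\<bar> * nat \<bar>t3\<bar> else 0)"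
  proof (intro sum.cong refl)
    fix a
    have "(\<Sum>b\<in>{0..<M}. card {c \<in> {0..<M}. M dvd S $ 2 $ 1 * a + t2 * b
      \<and> M dvd t3 * c + (S $ 3 $ 1 * a + S $ 3 $ 2 * b)}) = nat \<bar>t2\<bar> * nat \<bar>t3\<bar>" if a: "M dvd t1 * a"
    proof -
      have "t1 * (t2 * t3 * m) dvd t1 * a" using a m by (simp add: mult.assoc)
      then have "t2 * t3 * m dvd a" using t0(1) by (subst (asm) dvd_mult_cancel_left) auto
      then obtain a' where a': "a = t2 * t3 * m * a'" by (rule dvdE)
      have "(\<Sum>b\<in>{0..<M}. card {c \<in> {0..<M}. M dvd S $ 2 $ 1 * a + t2 * b
        \<and> M dvd t3 * c + (S $ 3 $ 1 * a + S $ 3 $ 2 * b)}) =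
        (\<Sum>b\<in>{0..<M}. if M dvd t2 * b + S $ 2 $ 1 * a then nat \<bar>t3\<bar> else 0)"
      proof (intro sum.cong refl)
        fix b
        have "card {c \<in> {0..<M}. M dvd t3 * c + (S $ 3 $ 1 * a + S $ 3 $ 2 * b)} = nat \<bar>t3\<bar>"
          if b: "M dvd t2 * b + S $ 2 $ 1 * a"
        proof (rule one)
          have "t2 * (t3 * m) dvd t2 * b + S $ 2 $ 1 * a" using b m
            by (metis dvd_mult_right mult.assoc mult.commute)
          moreover have "t2 * (t3 * m) dvd S $ 2 $ 1 * a" unfolding a' by (simp add: mult.assoc)
          ultimately have "t2 * (t3 * m) dvd t2 * b" by (metis dvd_add_left_iff)
          then have "t3 * m dvd b" using t0 by simp
          then have "t3 dvd b" by (rule dvd_mult_left)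
          then show "t3 dvd S $ 3 $ 1 * a + S $ 3 $ 2 * b" unfolding a' by (simp add: mult.assoc)
        qed (simp add: m)
        then show "card {c \<in> {0..<M}. M dvd S $ 2 $ 1 * a + t2 * b
          \<and> M dvd t3 * c + (S $ 3 $ 1 * a + S $ 3 $ 2 * b)} = (if M dvd t2 * b + S $ 2 $ 1 * a then nat \<bar>t3\<bar> else 0)"
          by (auto simp: add.commute)
      qed
      also have "\<dots> = nat \<bar>t3\<bar> * card {b \<in> {0..<M}. M dvd t2 * b + S $ 2 $ 1 * a}" by (simp add: sum.If_cases Int_def)
      also have "card {b \<in> {0..<M}. M dvd t2 * b + S $ 2 $ 1 * a} = nat \<bar>t2\<bar>"
        by (rule one) (simp_all add: m a' mult.assoc)
      finally show ?thesis by simp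
    qed
    then show "(\<Sum>b\<in>{0..<M}. card {c \<in> {0..<M}. M dvd t1 * a \<and> M dvd S $ 2 $ 1 * a + t2 * b
      \<and> M dvd t3 * c + (S $ 3 $ 1 * a + S $ 3 $ 2 * b)}) = (if M dvd t1 * a then nat \<bar>t2\<bar> * nat \<bar>t3\<bar> else 0)"
      by auto
  qed
  also have "\<dots> = nat \<bar>t2\<bar> * nat \<bar>t3\<bar> * card {a \<in> {0..<M}. M dvd t1 * a + 0}" by (simp add: sum.If_cases Int_def)
  also have "card {a \<in> {0..<M}. M dvd t1 * a + 0} = nat \<bar>t1\<bar>" by (rule one) (simp_all add: m)
  also have "nat \<bar>t2\<bar> * nat \<bar>t3\<bar> * nat \<bar>t1\<bar> = nat \<bar>det R\<bar>" by (simp add: det abs_mult nat_mult_distrib)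
  finally show ?thesis .
qed

section \<open>Legendre's theorem\<close>

text \<open>The polynomial is the norm form z^2 - A x^2 - B y^2 + A B k^2 of the quaternion algebra
  (A, B). A zero with k \<noteq> 0 at every prime means that the algebra splits there, which is the
  local hypothesis of Legendre's theorem. Fixing one \<open>k\<close> for all moduli takes the place
  of primitivity of the solutions and avoids p-adic numbers.\<close>

definition locally_represented :: "int \<Rightarrow> int \<Rightarrow> bool" where
  "locally_represented A B \<longleftrightarrow>
     (\<exists>k. k \<noteq> 0 \<and> (\<forall>m>0. \<exists>x y z. m dvd z^2 - A * x^2 - B * (y^2 - A * k^2)))"

definition isotropic :: "int \<Rightarrow> int \<Rightarrow> bool" where
  "isotropic A B \<longleftrightarrow> (\<exists>x y z. (x \<noteq> 0 \<or> y \<noteq> 0 \<or> z \<noteq> 0) \<and> z^2 = A * x^2 + B * y^2)"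

lemma locally_represented_swap: "locally_represented A B \<Longrightarrow> locally_represented B A"
proof -
  have "z^2 - A * x^2 - B * (y^2 - A * k^2) = z^2 - B * y^2 - A * (x^2 - B * k^2)" for x y z k :: int
    by (simp add: algebra_simps)
  then show "locally_represented A B \<Longrightarrow> locally_represented B A"
    unfolding locally_represented_def by metis
qed

lemma isotropic_swap: "isotropic A B \<Longrightarrow> isotropic B A"
  unfolding isotropic_def by (metis add.commute)

text \<open>z^2 - A x^2 and t^2 - A = B B' are norms from Q(sqrt A), hence so is their product. This
  trades \<open>B\<close> for \<open>B'\<close> at the price of scaling \<open>k\<close> by
  \<open>B\<close>, which is why \<open>k\<close> is only required to be nonzero.\<close>

lemma locally_represented_step:
  assumes AB: "locally_represented A B" and t: "t^2 - A = B * B'" and B: "B \<noteq> 0"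
  shows "locally_represented A B'"
proof -
  obtain k where k: "k \<noteq> 0" and sol: "\<And>m. m > 0 \<Longrightarrow> \<exists>x y z. m dvd z^2 - A * x^2 - B * (y^2 - A * k^2)"
    using AB unfolding locally_represented_def by blast
  have "\<exists>x y z. m dvd z^2 - A * x^2 - B' * (y^2 - A * (B * k)^2)" if m: "m > 0" for m
  proof -
    obtain x y z where xyz: "m dvd z^2 - A * x^2 - B * (y^2 - A * k^2)" using sol[OF m] by blast
    have "(z * t + A * x)^2 - A * (z + t * x)^2 - B' * ((B * y)^2 - A * (B * k)^2)
        = (t^2 - A) * (z^2 - A * x^2) - B * B' * (B * (y^2 - A * k^2))"
      by (simp add: power2_eq_square algebra_simps)
    also have "\<dots> = B * B' * (z^2 - A * x^2 - B * (y^2 - A * k^2))"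
      unfolding t by (simp add: algebra_simps)
    finally show ?thesis using xyz by (metis dvd_mult)
  qed
  moreover have "B * k \<noteq> 0" using B k by simp
  ultimately show ?thesis unfolding locally_represented_def by blast
qed

text \<open>The same multiplication of norms carries an exact zero back from \<open>B'\<close> to
  \<open>B\<close>; it stays nontrivial because t^2 - A \<noteq> 0.\<close>

lemma isotropic_step:
  assumes "isotropic A B'" and t: "t^2 - A = B * B'" and B: "B \<noteq> 0" "B' \<noteq> 0"
  shows "isotropic A B"
proof -
  obtain x y z where xyz: "x \<noteq> 0 \<or> y \<noteq> 0 \<or> z \<noteq> 0" "z^2 = A * x^2 + B' * y^2"
    using assms unfolding isotropic_def by blast
  have "(z * t + A * x)^2 - A * (z + t * x)^2 = (t^2 - A) * (z^2 - A * x^2)"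
    by (simp add: power2_eq_square algebra_simps)
  also have "\<dots> = B * (B' * y)^2" unfolding t xyz(2) by (simp add: power2_eq_square)
  finally have "(z * t + A * x)^2 = A * (z + t * x)^2 + B * (B' * y)^2" by simp
  moreover have "z + t * x \<noteq> 0 \<or> B' * y \<noteq> 0 \<or> z * t + A * x \<noteq> 0"
  proof (rule ccontr)
    assume "\<not> ?thesis"
    then have h: "z = - t * x" "y = 0" "z * t + A * x = 0" using B by auto
    have "(t^2 - A) * x = - ((- t * x) * t + A * x)" by (simp add: power2_eq_square algebra_simps)
    then have "(t^2 - A) * x = 0" by (simp only: h(3)[unfolded h(1)] minus_zero)
    then have "x = 0" using t B by simp
    then show False using h xyz by simp
  qed
  ultimately show ?thesis unfolding isotropic_def by blast
qed

lemma locally_represented_square: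
  assumes "locally_represented A (B * u^2)" "u \<noteq> 0"
  shows "locally_represented A B"
proof -
  obtain k where k: "k \<noteq> 0" and sol: "\<And>m. m > 0 \<Longrightarrow> \<exists>x y z. m dvd z^2 - A * x^2 - B * u^2 * (y^2 - A * k^2)"
    using assms unfolding locally_represented_def by blast
  have "B * u^2 * (y^2 - A * k^2) = B * ((u * y)^2 - A * (u * k)^2)" for y
    by (simp add: power2_eq_square algebra_simps)
  then have "\<exists>x y z. m dvd z^2 - A * x^2 - B * (y^2 - A * (u * k)^2)" if "m > 0" for m
    using sol[OF that] by metis
  moreover have "u * k \<noteq> 0" using assms k by simp
  ultimately show ?thesis unfolding locally_represented_def by blast
qed

lemma isotropic_square:
  assumes "isotropic A B" "u \<noteq> 0"
  shows "isotropic A (B * u^2)"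
proof -
  obtain x y z where xyz: "x \<noteq> 0 \<or> y \<noteq> 0 \<or> z \<noteq> 0" "z^2 = A * x^2 + B * y^2"
    using assms unfolding isotropic_def by blast
  have "(u * z)^2 = A * (u * x)^2 + B * u^2 * y^2"
    by (simp add: power_mult_distrib xyz algebra_simps)
  moreover have "u * x \<noteq> 0 \<or> y \<noteq> 0 \<or> u * z \<noteq> 0" using xyz assms by auto
  ultimately show ?thesis unfolding isotropic_def by blast
qed

text \<open>If \<open>A\<close> were not a square modulo \<open>p\<close>, then \<open>p\<close> would divide both variables of every value
  of \<open>z\<^sup>2 - A x\<^sup>2\<close> divisible by \<open>p\<close>, and infinite descent would make \<open>k\<close> divisible by every power of \<open>p\<close>.\<close>

lemma square_mod_prime_divisor:
  fixes p :: int
  assumes AB: "locally_represented A B" and p: "prime p" "p dvd B" "\<not> p^2 dvd B"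
  shows "\<exists>t. p dvd t^2 - A"
proof (rule ccontr)
  assume no: "\<not> ?thesis"
  have an: "p dvd x \<and> p dvd z" if "p dvd z^2 - A * x^2" for x z
  proof -
    have "p dvd x"
    proof (rule ccontr)
      assume "\<not> p dvd x"
      then have "coprime x p" using p(1) by (simp add: prime_imp_coprime coprime_commute)
      then obtain w where w: "[x * w = 1] (mod p)" using cong_solve_coprime_int by blast
      then have "[(x * w)^2 = 1^2] (mod p)" by (rule cong_pow)
      then have "p dvd (x * w)^2 - 1" by (simp add: cong_iff_dvd_diff)
      then have "p dvd w^2 * (z^2 - A * x^2) + A * ((x * w)^2 - 1)" using that by (intro dvd_add dvd_mult) auto
      also have "\<dots> = (z * w)^2 - A" by (simp add: power2_eq_square algebra_simps)
      finally show False using no by blast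
    qed
    then have "p dvd (z^2 - A * x^2) + A * x^2" using that by (intro dvd_add dvd_mult) (auto simp: power2_eq_square)
    then have "p dvd z^2" by simp
    then show ?thesis using \<open>p dvd x\<close> p(1) prime_dvd_power by blast
  qed
  have desc: "p^e dvd k" if "p^(2*e) dvd z^2 - A * x^2 - B * (y^2 - A * k^2)" for e x y z k
    using that
  proof (induction e arbitrary: x y z k)
    case (Suc e)
    obtain B1 where B1: "B = p * B1" using p(2) by (rule dvdE)
    have "\<not> p dvd B1" using p(3) unfolding B1 by (simp add: power2_eq_square mult_dvd_mono)
    let ?E = "z^2 - A * x^2 - B * (y^2 - A * k^2)"
    have p2: "p^2 dvd ?E" using Suc.prems by (rule power_le_dvd) simp
    have "p dvd p^2" by (simp add: power2_eq_square)
    then have "p dvd ?E" using p2 by (rule dvd_trans)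
    then have "p dvd ?E + B * (y^2 - A * k^2)" using p(2) by (intro dvd_add) auto
    then have xz: "p dvd x \<and> p dvd z" by (intro an) simp
    obtain x' z' where x': "x = p * x'" "z = p * z'" using xz by (auto elim!: dvdE)
    have "z^2 - A * x^2 = p^2 * (z'^2 - A * x'^2)" unfolding x' by (simp add: power_mult_distrib algebra_simps)
    then have "p^2 dvd z^2 - A * x^2" by (metis dvd_triv_left)
    then have "p^2 dvd (z^2 - A * x^2) - ?E" using p2 by (rule dvd_diff)
    moreover have "(z^2 - A * x^2) - ?E = p * (B1 * (y^2 - A * k^2))" by (simp add: B1)
    ultimately have "p * p dvd p * (B1 * (y^2 - A * k^2))" by (simp only: power2_eq_square)
    then have "p dvd B1 * (y^2 - A * k^2)" using p(1) by (subst (asm) dvd_mult_cancel_left) auto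
    then have "p dvd y^2 - A * k^2" using \<open>\<not> p dvd B1\<close> p(1) prime_dvd_multD by blast
    then have "p dvd k \<and> p dvd y" by (rule an)
    then obtain y' k' where y': "y = p * y'" "k = p * k'" by (auto elim!: dvdE)
    have "?E = p^2 * (z'^2 - A * x'^2 - B * (y'^2 - A * k'^2))"
      unfolding x' y' by (simp add: power2_eq_square algebra_simps)
    moreover have "p^(2 * Suc e) = p^2 * p^(2*e)" by (simp flip: power_add)
    ultimately have "p^2 * p^(2*e) dvd p^2 * (z'^2 - A * x'^2 - B * (y'^2 - A * k'^2))"
      using Suc.prems by metis
    then have "p^(2*e) dvd z'^2 - A * x'^2 - B * (y'^2 - A * k'^2)"
      using p(1) by (subst (asm) dvd_mult_cancel_left) auto
    then have "p^e dvd k'" by (rule Suc.IH)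
    then show ?case by (simp add: y')
  qed simp
  obtain k where k: "k \<noteq> 0" and sol: "\<And>m. m > 0 \<Longrightarrow> \<exists>x y z. m dvd z^2 - A * x^2 - B * (y^2 - A * k^2)"
    using AB unfolding locally_represented_def by blast
  have "p > 1" using p(1) by (simp add: prime_gt_1_int)
  \<comment> \<open>With this exponent 2^e > |k|, so that \<open>p^e\<close> cannot divide the
    nonzero \<open>k\<close>.\<close>
  define e where "e = nat \<bar>k\<bar>"
  have "int e < 2 ^ e" using less_exp[of e] by (metis of_nat_less_iff of_nat_numeral of_nat_power)
  also have "(2::int) ^ e \<le> p ^ e" using \<open>p > 1\<close> by (intro power_mono) auto
  finally have e: "\<bar>k\<bar> < p ^ e" by (simp add: e_def)
  have "p ^ (2 * e) > 0" using \<open>p > 1\<close> by simp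
  then have "p ^ e dvd k" using sol desc by blast
  then show False using k e zdvd_imp_le[of "p^e" "\<bar>k\<bar>"] by auto
qed

lemma square_mod_squarefree:
  fixes n :: nat and A :: int
  assumes "squarefree n" "\<And>p. prime p \<Longrightarrow> p dvd n \<Longrightarrow> \<exists>t. int p dvd t^2 - A"
  shows "\<exists>t. int n dvd t^2 - A"
  using assms
proof (induction n rule: less_induct)
  case (less n)
  show ?case
  proof (cases "n = 1")
    case False
    have "n \<noteq> 0" using less.prems(1) by (metis not_squarefree_0)
    obtain p where p: "prime p" "p dvd n" using False prime_factor_nat by blast
    then obtain n' where n': "n = p * n'" by (auto elim: dvdE)
    have "\<not> p dvd n'"
    proof
      assume "p dvd n'"
      then have "p^2 dvd n" unfolding n' by (simp add: power2_eq_square)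
      then show False using less.prems(1) p by (auto simp: squarefree_def)
    qed
    then have co: "coprime (int p) (int n')" using p by (simp add: prime_imp_coprime)
    have "n' < n" using p \<open>n \<noteq> 0\<close> unfolding n' by (simp add: prime_gt_Suc_0_nat)
    moreover have "squarefree n'" using less.prems(1) unfolding n' by (rule squarefree_multD)
    ultimately obtain t2 where t2: "int n' dvd t2^2 - A" using less.IH less.prems(2) n' by (metis dvd_mult)
    obtain t1 where t1: "int p dvd t1^2 - A" using less.prems p by blast
    obtain t where t: "[t = t1] (mod int p)" "[t = t2] (mod int n')"
      using binary_chinese_remainder_int[OF co] by blast
    have "[t^2 = t1^2] (mod int p)" "[t^2 = t2^2] (mod int n')" using t by (auto intro: cong_pow)
    then have "int p dvd t^2 - t1^2" "int n' dvd t^2 - t2^2" by (auto simp: cong_iff_dvd_diff)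
    then have "int p dvd (t^2 - t1^2) + (t1^2 - A)" "int n' dvd (t^2 - t2^2) + (t2^2 - A)"
      using dvd_add t1 t2 by blast+
    then have "int p * int n' dvd t^2 - A" using co by (intro divides_mult) simp_all
    then show ?thesis by (auto simp: n')
  qed simp
qed

lemma squarefree_reduction:
  fixes B :: int assumes "B \<noteq> 0"
  obtains B' u where "B = B' * u^2" "u \<noteq> 0" "squarefree B'" "B' \<noteq> 0"
proof -
  have "B = squarefree_part B * square_part B ^ 2" by (rule squarefree_decompose)
  with assms show ?thesis using that[of "squarefree_part B" "square_part B"] squarefree_squarefree_part[of B]
    by (metis mult_eq_0_iff zero_power2)
qed

text \<open>Descent in the manner of Lagrange: with |A| \<le> |B| and \<open>B\<close> squarefree,
  \<open>A\<close> is congruent to a square t^2 modulo \<open>B\<close>, and B' = (t^2 - A) / B is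
  smaller than \<open>B\<close> once |t| \<le> |B| / 2. The excluded sign pattern stays excluded:
  for A < 0 the number t^2 - A is positive, so \<open>B'\<close> has the sign of
  \<open>B\<close>.\<close>

theorem legendre:
  fixes A B :: int
  assumes "locally_represented A B" "A \<noteq> 0" "B \<noteq> 0" "\<not> (A < 0 \<and> B < 0)"
  shows "isotropic A B"
  using assms
proof (induction "nat (\<bar>A\<bar> + \<bar>B\<bar>)" arbitrary: A B rule: less_induct)
  case less
  \<comment> \<open>The case |A| \<le> |B|, with the induction hypothesis as a premise so that it
    can also be used with \<open>A\<close> and \<open>B\<close> exchanged.\<close>
  have key: "isotropic A B" if *: "locally_represented A B" "A \<noteq> 0" "B \<noteq> 0" "\<not> (A < 0 \<and> B < 0)"
      "\<bar>A\<bar> \<le> \<bar>B\<bar>" "\<And>B'. \<bar>B'\<bar> < \<bar>B\<bar> \<Longrightarrow> locally_represented A B' \<Longrightarrow> B' \<noteq> 0 \<Longrightarrow> \<not> (A < 0 \<and> B' < 0) \<Longrightarrow> isotropic A B'"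
      for A B
  proof -
    obtain B1 u where B1: "B = B1 * u^2" "u \<noteq> 0" "squarefree B1" "B1 \<noteq> 0"
      using squarefree_reduction[OF *(3)] by blast
    have lr: "locally_represented A B1" using *(1) B1 locally_represented_square by blast
    have "0 < u^2" using B1 by simp
    then have sgn: "B1 < 0 \<longleftrightarrow> B < 0" unfolding B1(1) by (auto simp: mult_less_0_iff)
    have "isotropic A B1"
    proof (cases "\<bar>B1\<bar> < \<bar>B\<bar>")
      case True then show ?thesis using *(6) lr B1 *(4) sgn by blast
    next
      case False
      have "\<bar>B\<bar> = \<bar>B1\<bar> * u^2" by (simp add: B1(1) abs_mult)
      moreover have "u^2 \<ge> 1" using \<open>0 < u^2\<close> by linarith
      ultimately have "\<bar>B1\<bar> * u^2 \<le> \<bar>B1\<bar> * 1" using False by simp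
      then have "u^2 = 1" using B1 \<open>u^2 \<ge> 1\<close> by simp
      then have BB: "B1 = B" by (simp add: B1(1))
      show ?thesis
      proof (cases "\<bar>B\<bar> = 1")
        case True
        then have "\<bar>A\<bar> = 1" using *(2,5) by linarith
        then have "A = 1 \<or> B = 1" using True *(4) by linarith
        then show ?thesis
        proof
          assume "A = 1" then show ?thesis unfolding isotropic_def by (intro exI[of _ 1] exI[of _ 0]) auto
        next
          assume "B = 1" then show ?thesis unfolding isotropic_def BB by (intro exI[of _ 0] exI[of _ 1]) auto
        qed
      next
        case False
        then have B2: "\<bar>B\<bar> \<ge> 2" using *(3) by linarith
        have "squarefree (nat \<bar>B\<bar>)" unfolding squarefree_def
        proof (intro allI impI)
          fix x :: nat assume "x^2 dvd nat \<bar>B\<bar>"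
          then have "int (x^2) dvd \<bar>B\<bar>" by (metis abs_ge_zero int_dvd_int_iff int_nat_eq)
          then have "(int x)^2 dvd B" by simp
          then have "int x dvd 1" using B1(3) BB unfolding squarefree_def by blast
          then show "x dvd 1" by simp
        qed
        moreover have "\<exists>t. int p dvd t^2 - A" if "prime p" "p dvd nat \<bar>B\<bar>" for p
        proof (rule square_mod_prime_divisor[OF *(1)])
          show "prime (int p)" using that by simp
          then show "\<not> (int p)^2 dvd B" using B1(3) BB by (auto simp: squarefree_def)
          show "int p dvd B" using that by (simp add: int_dvd_int_iff[symmetric])
        qed
        ultimately obtain t0 where t0: "B dvd t0^2 - A"
          using square_mod_squarefree[of "nat \<bar>B\<bar>" A] by auto
        \<comment> \<open>\<open>t\<close> will be the residue of \<open>t0\<close> of least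
          absolute value.\<close>
        define h where "h = \<bar>B\<bar> div 2"
        define t where "t = (t0 + h) mod \<bar>B\<bar> - h"
        have "\<bar>B\<bar> dvd t - t0" 
        proof -
          have "\<bar>B\<bar> dvd (t0 + h) - (t0 + h) mod \<bar>B\<bar>" by (rule dvd_minus_mod)
          moreover have "(t0 + h) - (t0 + h) mod \<bar>B\<bar> = - (t - t0)" by (simp add: t_def)
          ultimately show ?thesis by (simp only: dvd_minus_iff)
        qed
        then have "B dvd (t - t0) * (t + t0)" by simp
        then have "B dvd (t - t0) * (t + t0) + (t0^2 - A)" using t0 by (intro dvd_add)
        then have "B dvd t^2 - A" by (simp add: power2_eq_square algebra_simps)
        then obtain B' where B': "t^2 - A = B * B'" by (rule dvdE)
        have "0 \<le> (t0 + h) mod \<bar>B\<bar>" "(t0 + h) mod \<bar>B\<bar> < \<bar>B\<bar>" using B2 by auto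
        moreover have "2 * h \<le> \<bar>B\<bar>" "\<bar>B\<bar> \<le> 2 * h + 1" unfolding h_def by linarith+
        moreover have "2 * \<bar>r - h\<bar> \<le> b" if "0 \<le> r" "r < b" "2 * h \<le> b" "b \<le> 2 * h + 1" for r b h :: int
          using that by (auto simp: abs_if)
        ultimately have "2 * \<bar>t\<bar> \<le> \<bar>B\<bar>" unfolding t_def by blast
        then have "(2 * \<bar>t\<bar>)^2 \<le> \<bar>B\<bar>^2" by (intro power_mono) auto
        then have t4: "4 * t^2 \<le> B^2" by (simp add: power_mult_distrib)
        show ?thesis
        proof (cases "B' = 0")
          case True
          then have "t^2 = A * 1^2 + B1 * 0^2" using B' by simp
          then show ?thesis unfolding isotropic_def by (intro exI[of _ 1] exI[of _ 0] exI[of _ t]) auto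
        next
          case False
          have "\<bar>B\<bar> * \<bar>B'\<bar> = \<bar>t^2 - A\<bar>" by (simp add: B' abs_mult)
          then have "\<bar>B\<bar> * \<bar>B'\<bar> \<le> t^2 + \<bar>A\<bar>" using zero_le_power2[of t] by linarith
          moreover have "B^2 = \<bar>B\<bar> * \<bar>B\<bar>" by (simp add: power2_eq_square)
          ultimately have "\<bar>B\<bar> * (4 * \<bar>B'\<bar>) \<le> \<bar>B\<bar> * (\<bar>B\<bar> + 4)" using t4 *(5)
            unfolding distrib_left by linarith
          \<comment> \<open>So |B'| \<le> |B| / 4 + 1, which is below |B| as soon as |B| \<ge>
            2.\<close>
          then have "4 * \<bar>B'\<bar> \<le> \<bar>B\<bar> + 4" using B2 by (subst (asm) mult_le_cancel_left_pos) auto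
          then have small: "\<bar>B'\<bar> < \<bar>B\<bar>" using B2 by linarith
          have lr': "locally_represented A B'" using locally_represented_step[OF *(1) B' *(3)] .
          have "\<not> (A < 0 \<and> B' < 0)"
          proof
            assume n: "A < 0 \<and> B' < 0"
            then have "t^2 - A > 0" using zero_le_power2[of t] by linarith
            then show False using B' n *(4) by (simp add: zero_less_mult_iff)
          qed
          then have "isotropic A B'" using *(6)[OF small lr' False] by blast
          then show ?thesis unfolding BB using isotropic_step B' *(3) False by blast
        qed
      qed
    qed
    then show ?thesis unfolding B1(1) using isotropic_square B1(2) by blast
  qed
  show ?case
  proof (cases "\<bar>A\<bar> \<le> \<bar>B\<bar>")
    case True
    show ?thesis by (rule key) (use less.prems True less.hyps in auto)
  next
    case False
    have "isotropic B A"
    proof (rule key)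
      show "locally_represented B A" using less.prems locally_represented_swap by blast
      fix A' assume A': "\<bar>A'\<bar> < \<bar>A\<bar>" "locally_represented B A'" "A' \<noteq> 0" "\<not> (B < 0 \<and> A' < 0)"
      then show "isotropic B A'" using less.hyps[of B A'] less.prems by auto
    qed (use less.prems False in auto)
    then show ?thesis by (rule isotropic_swap)
  qed
qed

text \<open>A zero with y = 0 makes \<open>A\<close> a rational square, and (B + 1)^2 = (B - 1)^2 +
  4 B then provides another zero. The condition y \<noteq> 0 makes the later matrix
  \<open>K x y z\<close> invertible.\<close>

lemma isotropic_nondegenerate:
  assumes "isotropic A B" "A \<noteq> 0"
  obtains x y z where "z^2 = A * x^2 + B * y^2" "y \<noteq> 0"
proof -
  obtain x y z where xyz: "x \<noteq> 0 \<or> y \<noteq> 0 \<or> z \<noteq> 0" "z^2 = A * x^2 + B * y^2"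
    using assms unfolding isotropic_def by blast
  show ?thesis
  proof (cases "y = 0")
    case True
    then have z: "z^2 = A * x^2" using xyz by simp
    then have "z \<noteq> 0" using True xyz assms(2) by auto
    moreover have "(z * (B + 1))^2 = A * ((B - 1) * x)^2 + B * (2 * z)^2"
    proof -
      have "(z * (B + 1))^2 = z^2 * (B - 1)^2 + B * (2 * z)^2" by (simp add: power2_eq_square algebra_simps)
      then show ?thesis unfolding z power_mult_distrib by (simp add: mult.commute mult.left_commute)
    qed
    ultimately show ?thesis using that[of "z * (B + 1)" "(B - 1) * x" "2 * z"] by simp
  qed (use that xyz in blast)
qed

section \<open>Lattice points in the region of a homogeneous gauge\<close>

text \<open>In the encoding of trace-free matrices used with \<open>qform\<close>, this is the
  nilpotent matrix whose kernel and image are the line of (i, j). Adding multiples of it to a matrix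
  does not change the value at (i, j).\<close>

definition evec :: "real \<Rightarrow> real \<Rightarrow> real^3" where
  "evec i j = vector [- (i * j), i^2, - (j^2)]"

locale vec_norm =
  fixes N :: "real^3 \<Rightarrow> real"
  assumes is_norm: "is_norm N"
begin

lemma norm_scale: "N (r *\<^sub>R x) = \<bar>r\<bar> * N x"
  and norm_triangle: "N (x + y) \<le> N x + N y"
  and norm_nonneg: "0 \<le> N x"
  and norm_eq_0: "N x = 0 \<longleftrightarrow> x = 0"
  using is_norm by (auto simp: is_norm_def)

lemma norm_uminus: "N (- x) = N x" using norm_scale[of "-1" x] by simp

lemma norm_diff_le: "\<bar>N x - N y\<bar> \<le> N (x - y)"
  using norm_triangle[of "x - y" y] norm_triangle[of "y - x" x] norm_uminus[of "x - y"] by auto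

lemma norm_upper: obtains C where "C > 0" "\<And>x. N x \<le> C * norm x"
proof -
  define C where "C = N (axis 1 1) + N (axis 2 1) + N (axis 3 1)"
  have "N (axis 1 1) \<noteq> 0" by (simp add: norm_eq_0 axis_eq_0_iff)
  then have "C > 0" using norm_nonneg[of "axis 1 1"] norm_nonneg[of "axis 2 1"] norm_nonneg[of "axis 3 1"]
    unfolding C_def by linarith
  moreover have "N x \<le> C * norm x" for x
  proof -
    have "x = (x $ 1) *\<^sub>R axis 1 1 + (x $ 2) *\<^sub>R axis 2 1 + (x $ 3) *\<^sub>R axis 3 1"
      by (simp add: vec_eq_iff forall_3 axis_def)
    moreover have "N (u + v + w) \<le> N u + N v + N w" for u v w
      using norm_triangle[of "u + v" w] norm_triangle[of u v] by linarith
    ultimately have "N x \<le> N ((x $ 1) *\<^sub>R axis 1 1) + N ((x $ 2) *\<^sub>R axis 2 1) + N ((x $ 3) *\<^sub>R axis 3 1)"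
      by metis
    also have "\<dots> = \<bar>x $ 1\<bar> * N (axis 1 1) + \<bar>x $ 2\<bar> * N (axis 2 1) + \<bar>x $ 3\<bar> * N (axis 3 1)"
      by (simp add: norm_scale)
    also have "\<dots> \<le> norm x * N (axis 1 1) + norm x * N (axis 2 1) + norm x * N (axis 3 1)"
      by (intro add_mono mult_right_mono component_le_norm_cart norm_nonneg)
    finally show ?thesis by (simp add: C_def algebra_simps)
  qed
  ultimately show ?thesis by (rule that)
qed

lemma continuous_N: "continuous_on A N"
proof -
  obtain C where C: "C > 0" "\<And>x. N x \<le> C * norm x" using norm_upper by blast
  have "C-lipschitz_on A N"
  proof (rule lipschitz_onI)
    show "dist (N x) (N y) \<le> C * dist x y" for x y
      using norm_diff_le[of x y] C(2)[of "x - y"] by (simp add: dist_real_def dist_norm)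
  qed (use C in simp)
  then show ?thesis by (rule lipschitz_on_continuous_on)
qed

lemma norm_lower: obtains c where "c > 0" "\<And>x. c * norm x \<le> N x"
proof -
  have "sphere (0::real^3) 1 \<noteq> {}" by (simp add: sphere_eq_empty)
  then obtain x0 where x0: "x0 \<in> sphere (0::real^3) 1" "\<And>x. x \<in> sphere 0 1 \<Longrightarrow> N x0 \<le> N x"
    using continuous_attains_inf[OF compact_sphere _ continuous_N] by blast
  have "x0 \<noteq> 0" using x0(1) by auto
  then have "N x0 > 0" using norm_eq_0[of x0] norm_nonneg[of x0] by linarith
  moreover have "N x0 * norm x \<le> N x" for x
  proof (cases "x = 0")
    case False
    have "N x0 \<le> N ((1 / norm x) *\<^sub>R x)" using False by (intro x0(2)) simp
    also have "\<dots> = N x / norm x" by (simp add: norm_scale)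
    finally show ?thesis using False by (simp add: field_simps)
  qed (simp add: norm_nonneg)
  ultimately show ?thesis by (rule that)
qed

lemma norm_components:
  obtains c C where "c > 0" "C > 0" "\<And>x i. c * \<bar>x $ i\<bar> \<le> N x"
    "\<And>x m. (\<And>i. \<bar>x $ i\<bar> \<le> m) \<Longrightarrow> N x \<le> C * m"
proof -
  obtain c where c: "c > 0" "\<And>x. c * norm x \<le> N x" using norm_lower by blast
  obtain C where C: "C > 0" "\<And>x. N x \<le> C * norm x" using norm_upper by blast
  have "c * \<bar>x $ i\<bar> \<le> N x" for x i
    using c(2)[of x] mult_left_mono[OF component_le_norm_cart[of x i], of c] c(1) by linarith
  moreover have "N x \<le> (C * 3) * m" if "\<And>i. \<bar>x $ i\<bar> \<le> m" for x m
  proof -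
    have "norm x \<le> (\<Sum>i\<in>UNIV. \<bar>x $ i\<bar>)" by (rule norm_le_l1_cart)
    also have "\<dots> \<le> 3 * m" using that by (simp add: sum_3) (smt (verit, ccfv_SIG))
    finally have "C * norm x \<le> C * (3 * m)" using C(1) by simp
    then show ?thesis using C(2)[of x] by linarith
  qed
  ultimately show ?thesis using that[of c "C * 3"] c(1) C(1) by simp
qed

definition gau :: "real \<times> real \<Rightarrow> real" where
  "gau u = N (evec (fst u) (snd u))"

lemma gau_scale: "gau (r * i, r * j) = r^2 * gau (i, j)"
proof -
  have "evec (r * i) (r * j) = r^2 *\<^sub>R evec i j"
    by (simp add: evec_def vec_eq_iff forall_3 vector_3 power2_eq_square algebra_simps)
  then show ?thesis by (simp add: gau_def norm_scale)
qed

lemma evec_continuous: "continuous_on UNIV (\<lambda>u. evec (fst u) (snd u))"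
proof -
  have "(\<lambda>u. evec (fst u) (snd u)) = (\<lambda>u. (- (fst u * snd u)) *\<^sub>R axis 1 1 + ((fst u)^2) *\<^sub>R axis 2 1 + (- ((snd u)^2)) *\<^sub>R axis 3 1)"
    by (rule ext) (simp add: evec_def vec_eq_iff forall_3 vector_3 axis_def)
  then show ?thesis by (simp only:) (intro continuous_intros)
qed

lemma gau_continuous: "continuous_on UNIV gau"
  unfolding gau_def
  by (rule continuous_on_compose2[OF continuous_N[of UNIV] evec_continuous]) auto

lemma gau_measurable [measurable]: "gau \<in> borel_measurable borel"
  by (rule borel_measurable_continuous_onI[OF gau_continuous])

lemma gau_lower: obtains c where "c > 0" "\<And>i j. c * i^2 \<le> gau (i, j)" "\<And>i j. c * j^2 \<le> gau (i, j)"
proof -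
  obtain c C where c: "c > 0" "C > 0" "\<And>x i. c * \<bar>x $ i\<bar> \<le> N x"
    "\<And>x m. (\<And>i. \<bar>x $ i\<bar> \<le> m) \<Longrightarrow> N x \<le> C * m" using norm_components by metis
  have "c * i^2 \<le> gau (i, j)" "c * j^2 \<le> gau (i, j)" for i j
    using c(3)[of "evec i j" 2] c(3)[of "evec i j" 3] by (simp_all add: gau_def evec_def vector_3)
  then show ?thesis using c(1) that by blast
qed

lemma gau_nonneg: "0 \<le> gau u" by (simp add: gau_def norm_nonneg)

lemma gau_pos: "u \<noteq> 0 \<Longrightarrow> 0 < gau u"
proof -
  assume u: "u \<noteq> 0"
  obtain c where c: "c > 0" "\<And>i j. c * i^2 \<le> gau (i, j)" "\<And>i j. c * j^2 \<le> gau (i, j)" using gau_lower by metis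
  from u have "fst u \<noteq> 0 \<or> snd u \<noteq> 0" by (auto simp: prod_eq_iff)
  then have "0 < c * (fst u)^2 \<or> 0 < c * (snd u)^2" using c(1) by (auto simp: zero_less_mult_iff)
  moreover have "c * (fst u)^2 \<le> gau u" "c * (snd u)^2 \<le> gau u"
    using c(2)[of "fst u" "snd u"] c(3)[of "snd u" "fst u"] by simp_all
  ultimately show ?thesis by linarith
qed

definition area :: real where "area = measure lborel {u. gau u \<le> 1}"

text \<open>Coordinates (r, r t), with Jacobian |r|, separate size from slope, since gau (r, r t) =
  r^2 gau (1, t). A general set \<open>Z\<close> covers both the region \<open>gau u \<le> 1\<close>
  and its boundary.\<close>

lemma emeasure_gauge:
  assumes Z [measurable]: "Z \<in> sets borel"
  shows "emeasure lborel {u. gau u \<in> Z} =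
    (\<integral>\<^sup>+t. \<integral>\<^sup>+r. ennreal \<bar>r\<bar> * indicator Z (r^2 * gau (1, t)) \<partial>lborel \<partial>lborel)"
proof -
  have [measurable]: "(\<lambda>t. gau (1, t)) \<in> borel_measurable borel"
    by (intro borel_measurable_continuous_onI continuous_on_compose2[OF gau_continuous] continuous_intros) auto
  have "emeasure lborel {u. gau u \<in> Z} = (\<integral>\<^sup>+u. indicator {u. gau u \<in> Z} u \<partial>lborel)"
    by (rule nn_integral_indicator[symmetric]) simp
  also have "\<dots> = (\<integral>\<^sup>+u. indicator Z (gau u) \<partial>(lborel \<Otimes>\<^sub>M lborel))"
    unfolding lborel_prod by (intro nn_integral_cong) (simp add: indicator_def)
  also have "\<dots> = (\<integral>\<^sup>+r. \<integral>\<^sup>+y. indicator Z (gau (r, y)) \<partial>lborel \<partial>lborel)"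
  proof (rule lborel.nn_integral_fst[symmetric])
    have "(\<lambda>u. indicator Z (gau u) :: ennreal) \<in> borel_measurable borel" by measurable
    then show "(\<lambda>u. indicator Z (gau u) :: ennreal) \<in> borel_measurable (lborel \<Otimes>\<^sub>M lborel)"
      by (simp add: lborel_prod)
  qed
  also have "\<dots> = (\<integral>\<^sup>+r. \<integral>\<^sup>+t. ennreal \<bar>r\<bar> * indicator Z (r^2 * gau (1, t)) \<partial>lborel \<partial>lborel)"
  proof (rule nn_integral_cong_AE)
    have "AE r in lborel. r \<noteq> (0::real)" by (rule AE_lborel_singleton)
    then show "AE r in lborel. (\<integral>\<^sup>+y. indicator Z (gau (r, y)) \<partial>lborel) =
        (\<integral>\<^sup>+t. ennreal \<bar>r\<bar> * indicator Z (r^2 * gau (1, t)) \<partial>lborel)"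
    proof eventually_elim
      case (elim r)
      have [measurable]: "(\<lambda>y. gau (r, y)) \<in> borel_measurable borel"
        by (intro borel_measurable_continuous_onI continuous_on_compose2[OF gau_continuous] continuous_intros) auto
      have eq: "gau (r, 0 + r * t) = r^2 * gau (1, t)" for t using gau_scale[of r 1 t] by simp
      have "(\<integral>\<^sup>+y. indicator Z (gau (r, y)) \<partial>lborel) =
          ennreal \<bar>r\<bar> * (\<integral>\<^sup>+t. indicator Z (gau (r, 0 + r * t)) \<partial>lborel)"
        by (rule nn_integral_real_affine) (measurable, rule elim)
      also have "\<dots> = (\<integral>\<^sup>+t. ennreal \<bar>r\<bar> * indicator Z (r^2 * gau (1, t)) \<partial>lborel)"
        unfolding eq by (rule nn_integral_cmult[symmetric]) measurable
      finally show ?case .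
    qed
  qed
  also have "\<dots> = (\<integral>\<^sup>+t. \<integral>\<^sup>+r. ennreal \<bar>r\<bar> * indicator Z (r^2 * gau (1, t)) \<partial>lborel \<partial>lborel)"
    by (rule lborel_pair.Fubini'[symmetric]) measurable
  finally show ?thesis .
qed

lemma nn_integral_abs_interval:
  assumes "a \<ge> 0"
  shows "(\<integral>\<^sup>+r. ennreal \<bar>r\<bar> * indicator {-a..a} r \<partial>lborel) = ennreal (a^2)"
proof -
  have "((\<lambda>r. \<bar>r\<bar>) has_integral (a * \<bar>a\<bar> / 2 - (-a) * \<bar>-a\<bar> / 2)) {-a..a}"
  proof (rule fundamental_theorem_of_calculus_interior_strong[where S = "{0}"])
    fix x assume x: "x \<in> {-a<..<a} - {0}"
    have "((\<lambda>x. x * x / 2) has_real_derivative x) (at x)" "((\<lambda>x. - x * x / 2) has_real_derivative - x) (at x)"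
      by (auto intro!: derivative_eq_intros)
    moreover have "x < 0 \<or> x > 0" using x by auto
    ultimately show "((\<lambda>x. x * \<bar>x\<bar> / 2) has_vector_derivative \<bar>x\<bar>) (at x)"
      unfolding has_real_derivative_iff_has_vector_derivative[symmetric]
    proof (elim disjE)
      assume "x < 0" and d: "((\<lambda>x. - x * x / 2) has_real_derivative - x) (at x)"
      show "((\<lambda>x. x * \<bar>x\<bar> / 2) has_real_derivative \<bar>x\<bar>) (at x)"
        using \<open>x < 0\<close> has_field_derivative_transform_within_open[OF d, of "{..<0}" "\<lambda>x. x * \<bar>x\<bar> / 2"] by auto
    next
      assume "x > 0" and d: "((\<lambda>x. x * x / 2) has_real_derivative x) (at x)"
      show "((\<lambda>x. x * \<bar>x\<bar> / 2) has_real_derivative \<bar>x\<bar>) (at x)"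
        using \<open>x > 0\<close> has_field_derivative_transform_within_open[OF d, of "{0<..}" "\<lambda>x. x * \<bar>x\<bar> / 2"] by auto
    qed
  qed (use assms in \<open>auto intro!: continuous_intros\<close>)
  moreover have "a * \<bar>a\<bar> / 2 - (-a) * \<bar>-a\<bar> / 2 = a^2" using assms by (simp add: power2_eq_square)
  ultimately have "((\<lambda>r. if r \<in> {-a..a} then \<bar>r\<bar> else 0) has_integral a^2) UNIV"
    by (simp only: has_integral_restrict_UNIV)
  then have "(\<integral>\<^sup>+r. ennreal (if r \<in> {-a..a} then \<bar>r\<bar> else 0) \<partial>lborel) = ennreal (a^2)"
    by (intro nn_integral_has_integral_lborel) auto
  moreover have "ennreal (if r \<in> {-a..a} then \<bar>r\<bar> else 0) = ennreal \<bar>r\<bar> * indicator {-a..a} r" for r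
    by (simp add: indicator_def)
  ultimately show ?thesis by simp
qed

text \<open>The integral of 1 / gau (1, t) over the slopes reappears when the volume of the quadric
  is computed; this is how the same constant \<open>area\<close> enters both asymptotics.\<close>

lemma emeasure_gau_le_1: "emeasure lborel {u. gau u \<le> 1} = (\<integral>\<^sup>+t. ennreal (1 / gau (1, t)) \<partial>lborel)"
proof -
  have "(\<integral>\<^sup>+r. ennreal \<bar>r\<bar> * indicator {..1} (r^2 * gau (1, t)) \<partial>lborel) = ennreal (1 / gau (1, t))" for t
  proof -
    have g: "gau (1, t) > 0" by (rule gau_pos) (simp add: prod_eq_iff)
    have "r^2 * gau (1, t) \<le> 1 \<longleftrightarrow> r \<in> {-sqrt (1 / gau (1, t))..sqrt (1 / gau (1, t))}" for r
    proof -
      have "r^2 * gau (1, t) \<le> 1 \<longleftrightarrow> r^2 \<le> 1 / gau (1, t)" using g by (simp add: field_simps)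
      also have "\<dots> \<longleftrightarrow> \<bar>r\<bar> \<le> sqrt (1 / gau (1, t))" by (metis real_sqrt_abs real_sqrt_le_iff)
      finally show ?thesis by auto
    qed
    then have "(\<integral>\<^sup>+r. ennreal \<bar>r\<bar> * indicator {..1} (r^2 * gau (1, t)) \<partial>lborel)
      = (\<integral>\<^sup>+r. ennreal \<bar>r\<bar> * indicator {-sqrt (1 / gau (1, t))..sqrt (1 / gau (1, t))} r \<partial>lborel)"
      by (intro nn_integral_cong) (simp add: indicator_def)
    also have "\<dots> = ennreal ((sqrt (1 / gau (1, t)))^2)"
      by (rule nn_integral_abs_interval) (use g in simp)
    finally show ?thesis using g by simp
  qed
  then show ?thesis using emeasure_gauge[of "{..1}"] by simp
qed

text \<open>The boundary has to be a null set for the indicators of the scaled cells to converge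
  almost everywhere.\<close>

lemma gau_level_null: "{u. gau u = 1} \<in> null_sets lborel"
proof
  have "(\<integral>\<^sup>+r. ennreal \<bar>r\<bar> * indicator {1} (r^2 * gau (1, t)) \<partial>lborel) = 0" for t
  proof -
    have g: "gau (1, t) > 0" by (rule gau_pos) (simp add: prod_eq_iff)
    have lev: "r \<in> {sqrt (1 / gau (1, t)), - sqrt (1 / gau (1, t))}" if "r^2 * gau (1, t) = 1" for r
    proof -
      have "r^2 = 1 / gau (1, t)" using g that by (simp add: field_simps)
      then have "\<bar>r\<bar> = sqrt (1 / gau (1, t))" by (metis real_sqrt_abs)
      then show ?thesis by (auto simp: abs_if split: if_splits)
    qed
    have "AE r in lborel. r \<notin> {sqrt (1 / gau (1, t)), - sqrt (1 / gau (1, t))}"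
      using AE_lborel_singleton[of "sqrt (1 / gau (1, t))"] AE_lborel_singleton[of "- sqrt (1 / gau (1, t))"]
      by eventually_elim auto
    then have "AE r in lborel. r^2 * gau (1, t) \<noteq> 1" by (rule eventually_mono) (use lev in blast)
    then have "AE r in lborel. ennreal \<bar>r\<bar> * indicator {1} (r^2 * gau (1, t)) = 0"
      by eventually_elim (simp add: indicator_def)
    then show ?thesis by (subst nn_integral_cong_AE[where v = "\<lambda>_. 0"]) auto
  qed
  then show "emeasure lborel {u. gau u = 1} = 0" using emeasure_gauge[of "{1}"] by simp
qed simp

lemma gau_le_bounded:
  obtains B where "B > 0" "\<And>i j X. gau (i, j) \<le> X \<Longrightarrow> \<bar>i\<bar> \<le> B * sqrt X \<and> \<bar>j\<bar> \<le> B * sqrt X"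
proof -
  obtain c where c: "c > 0" "\<And>i j. c * i^2 \<le> gau (i, j)" "\<And>i j. c * j^2 \<le> gau (i, j)" using gau_lower by metis
  have *: "\<bar>i\<bar> \<le> (1 / sqrt c) * sqrt X" if "c * i^2 \<le> X" for i X
  proof -
    have "i^2 \<le> X / c" using c(1) that by (simp add: field_simps)
    then have "sqrt (i^2) \<le> sqrt (X / c)" by (rule real_sqrt_le_mono)
    then show ?thesis by (simp add: real_sqrt_divide)
  qed
  have "\<bar>i\<bar> \<le> (1 / sqrt c) * sqrt X \<and> \<bar>j\<bar> \<le> (1 / sqrt c) * sqrt X" if "gau (i, j) \<le> X" for i j X
    using *[OF order_trans[OF c(2) that]] *[OF order_trans[OF c(3) that]] by blast
  then show ?thesis using c(1) by (intro that[of "1 / sqrt c"]) auto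
qed

lemma area_finite: "emeasure lborel {u. gau u \<le> 1} < \<infinity>"
proof -
  obtain B where B: "B > 0" "\<And>i j X. gau (i, j) \<le> X \<Longrightarrow> \<bar>i\<bar> \<le> B * sqrt X \<and> \<bar>j\<bar> \<le> B * sqrt X"
    using gau_le_bounded by blast
  have "{u. gau u \<le> 1} \<subseteq> cbox (-B, -B) (B, B)"
  proof
    fix u assume "u \<in> {u. gau u \<le> 1}"
    then have "gau (fst u, snd u) \<le> 1" by simp
    from B(2)[OF this] have "(fst u, snd u) \<in> cbox (-B, -B) (B, B)" by (auto simp: cbox_Pair_eq abs_le_iff mem_Times_iff)
    then show "u \<in> cbox (-B, -B) (B, B)" by simp
  qed
  then have "emeasure lborel {u. gau u \<le> 1} \<le> emeasure lborel (cbox (-B, -B) (B, B))"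
    by (rule emeasure_mono) simp
  also have "\<dots> < \<infinity>" by (rule emeasure_lborel_cbox_finite)
  finally show ?thesis .
qed

lemma area_pos: "area > 0"
proof -
  have "open {u. gau u < 1}" by (intro open_Collect_less gau_continuous continuous_intros)
  moreover have "gau 0 = 0" by (simp add: gau_def evec_def norm_eq_0 vec_eq_iff forall_3 vector_3)
  then have "0 \<in> {u. gau u < 1}" by simp
  ultimately obtain e where e: "e > 0" "ball 0 e \<subseteq> {u. gau u < 1}"
    using openE by blast
  have "0 < emeasure lborel (ball (0::real\<times>real) e)"
  proof -
    have "\<not> negligible (ball (0::real\<times>real) e)" using e(1) by (intro open_not_negligible) auto
    moreover have "emeasure lebesgue (ball (0::real\<times>real) e) = emeasure lborel (ball (0::real\<times>real) e)" by simp
    ultimately show ?thesis by (simp add: negligible_iff_emeasure0 zero_less_iff_neq_zero)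
  qed
  also have "\<dots> \<le> emeasure lborel {u. gau u \<le> 1}" using e(2) by (intro emeasure_mono) auto
  finally show ?thesis using area_finite
    unfolding area_def measure_def enn2real_positive_iff infinity_ennreal_def by blast
qed

lemma finite_gau_le: "finite {(a::int, b::int). gau (of_int a, of_int b) \<le> X}"
proof -
  obtain B where B: "B > 0" "\<And>i j X. gau (i, j) \<le> X \<Longrightarrow> \<bar>i\<bar> \<le> B * sqrt X \<and> \<bar>j\<bar> \<le> B * sqrt X"
    using gau_le_bounded by blast
  define m where "m = \<lceil>B * sqrt X\<rceil>"
  have "\<bar>a\<bar> \<le> m" if "\<bar>real_of_int a\<bar> \<le> B * sqrt X" for a
  proof -
    have "real_of_int \<bar>a\<bar> \<le> real_of_int m" using that le_of_int_ceiling[of "B * sqrt X"] unfolding m_def by linarith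
    then show ?thesis by linarith
  qed
  then have "{(a::int, b::int). gau (of_int a, of_int b) \<le> X} \<subseteq> {-m..m} \<times> {-m..m}"
    using B(2) by (fastforce simp: abs_le_iff)
  then show ?thesis by (rule finite_subset) simp
qed

text \<open>Without the origin the bound has no additive constant and holds down to X = 0. The sieve
  depends on this, as it applies the bound at X / d^2 for large d.\<close>

lemma nonzero_count:
  obtains K where "K > 0"
    "\<And>X. X \<ge> 0 \<Longrightarrow> real (card {(a::int, b::int). (a, b) \<noteq> (0, 0) \<and> gau (of_int a, of_int b) \<le> X}) \<le> K * X"
proof -
  obtain B where B: "B > 0" "\<And>i j X. gau (i, j) \<le> X \<Longrightarrow> \<bar>i\<bar> \<le> B * sqrt X \<and> \<bar>j\<bar> \<le> B * sqrt X"
    using gau_le_bounded by blast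
  have "real (card {(a::int, b::int). (a, b) \<noteq> (0, 0) \<and> gau (of_int a, of_int b) \<le> X}) \<le> (9 * B^2) * X"
    if X: "X \<ge> 0" for X
  proof -
    let ?S = "{(a::int, b::int). (a, b) \<noteq> (0, 0) \<and> gau (of_int a, of_int b) \<le> X}"
    define m where "m = \<lfloor>B * sqrt X\<rfloor>"
    have m0: "m \<ge> 0" using B(1) X by (simp add: m_def)
    have bnd: "\<bar>a\<bar> \<le> m" if "\<bar>real_of_int a\<bar> \<le> B * sqrt X" for a
      using that unfolding m_def by (simp add: le_floor_iff)
    have sub: "?S \<subseteq> {-m..m} \<times> {-m..m} - {(0, 0)}"
    proof
      fix u assume "u \<in> ?S"
      then obtain a b where u: "u = (a, b)" "(a, b) \<noteq> (0, 0)" "gau (of_int a, of_int b) \<le> X" by auto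
      from B(2)[OF u(3)] have "\<bar>a\<bar> \<le> m" "\<bar>b\<bar> \<le> m" using bnd by auto
      then show "u \<in> {-m..m} \<times> {-m..m} - {(0, 0)}" using u(1,2) by (auto simp: abs_le_iff)
    qed
    show ?thesis
    proof (cases "m = 0")
      case True
      then have "?S = {}" using sub by auto
      then have "card ?S = 0" by (simp only: card.empty)
      then show ?thesis using X by simp
    next
      case False
      then have m1: "m \<ge> 1" using m0 by simp
      have "card ?S \<le> card ({-m..m} \<times> {-m..m})" by (rule card_mono) (use sub in auto)
      also have "\<dots> = nat (2 * m + 1) ^ 2" by (simp add: card_cartesian_product power2_eq_square)
      finally have "real (card ?S) \<le> real (nat (2 * m + 1) ^ 2)" by (rule of_nat_mono)
      also have "\<dots> = (2 * of_int m + 1)^2" using m0 by simp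
      also have "\<dots> \<le> (3 * (B * sqrt X))^2"
      proof (rule power_mono)
        have "real_of_int m \<le> B * sqrt X" "1 \<le> real_of_int m" using m1 by (simp_all add: m_def)
        then show "2 * real_of_int m + 1 \<le> 3 * (B * sqrt X)" by linarith
      qed (use m0 in simp)
      also have "\<dots> = (9 * B^2) * X" using X by (simp add: power_mult_distrib)
      finally show ?thesis .
    qed
  qed
  then show ?thesis using that[of "9 * B^2"] B(1) by simp
qed

text \<open>
  The points of the class are in bijection with half-open squares of side \<open>Q / sqrt X\<close>; after
  scaling, the indicator function of the union of the squares converges to that of \<open>{gau \<le> 1}\<close>.
\<close>

lemma lattice_count:
  fixes Q r1 r2 :: int
  assumes Q: "Q > 0"
  shows "((\<lambda>X. real (card {(a, b). Q dvd a - r1 \<and> Q dvd b - r2 \<and> gau (of_int a, of_int b) \<le> X}) / X)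
    \<longlongrightarrow> area / of_int Q ^ 2) at_top"
proof -
  define K where "K X = {(k, l). gau (of_int (r1 + Q * k), of_int (r2 + Q * l)) \<le> X}" for X
  define s where "s X = of_int Q / sqrt X" for X
  define I where "I X k = {of_int k * s X ..< of_int (k + 1) * s X}" for X and k :: int
  define S where "S X = (\<Union>u\<in>K X. I X (fst u) \<times> I X (snd u))" for X
  have bij: "bij_betw (\<lambda>(k, l). (r1 + Q * k, r2 + Q * l)) (K X)
     {(a, b). Q dvd a - r1 \<and> Q dvd b - r2 \<and> gau (of_int a, of_int b) \<le> X}" for X
  proof (rule bij_betw_byWitness[where f' = "\<lambda>(a, b). ((a - r1) div Q, (b - r2) div Q)"])
    have *: "real_of_int r1 + real_of_int Q * real_of_int ((a - r1) div Q) = real_of_int a" if "Q dvd a - r1" for a r1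
    proof -
      have "r1 + Q * ((a - r1) div Q) = a" using that by simp
      then show ?thesis by (metis of_int_add of_int_mult)
    qed
    show "(\<lambda>(a, b). ((a - r1) div Q, (b - r2) div Q)) `
      {(a, b). Q dvd a - r1 \<and> Q dvd b - r2 \<and> gau (of_int a, of_int b) \<le> X} \<subseteq> K X"
      unfolding K_def by (auto simp: *)
  qed (use Q in \<open>auto simp: K_def\<close>)
  have fin: "finite (K X)" for X
  proof -
    have "finite {(a, b). Q dvd a - r1 \<and> Q dvd b - r2 \<and> gau (of_int a, of_int b) \<le> X}"
      by (rule finite_subset[OF _ finite_gau_le[of X]]) auto
    then show ?thesis using bij_betw_finite[OF bij[of X]] by blast
  qed
  have card_eq: "card {(a, b). Q dvd a - r1 \<and> Q dvd b - r2 \<and> gau (of_int a, of_int b) \<le> X} = card (K X)" for X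
    using bij_betw_same_card[OF bij] by simp
  have S_meas: "S X \<in> sets lborel" for X
  proof -
    have "I X k \<times> I X l \<in> sets borel" for k l
      unfolding borel_prod[symmetric] by (intro pair_measureI) (simp_all add: I_def)
    then show ?thesis unfolding S_def using fin by (simp add: sets.finite_UN)
  qed
  have s_pos: "s X > 0" if "X > 0" for X using Q that by (simp add: s_def)
  have I_iff: "y \<in> I X k \<longleftrightarrow> \<lfloor>y / s X\<rfloor> = k" if "X > 0" for X y k
    using s_pos[OF that] by (simp add: I_def floor_eq_iff field_simps)
  have S_iff: "y \<in> S X \<longleftrightarrow> gau (of_int (r1 + Q * \<lfloor>fst y / s X\<rfloor>), of_int (r2 + Q * \<lfloor>snd y / s X\<rfloor>)) \<le> X"
    if "X > 0" for X y
    unfolding S_def K_def by (auto simp: I_iff[OF that] mem_Times_iff)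
  have measS: "measure lborel (S X) = real (card (K X)) / X * of_int Q ^ 2" if X: "X > 0" for X
  proof -
    have em: "emeasure lborel (I X (fst u) \<times> I X (snd u)) = ennreal ((s X)^2)" for u
    proof -
      have 1: "emeasure lborel (I X k) = ennreal (s X)" for k
        using s_pos[OF X] by (simp add: I_def algebra_simps)
      have "emeasure lborel (I X (fst u) \<times> I X (snd u)) = emeasure lborel (I X (fst u)) * emeasure lborel (I X (snd u))"
        unfolding lborel_prod[symmetric] by (rule lborel.emeasure_pair_measure_Times) (simp_all add: I_def)
      also have "\<dots> = ennreal ((s X)^2)" unfolding 1 using s_pos[OF X]
        by (simp add: power2_eq_square ennreal_mult)
      finally show ?thesis .
    qed
    have "measure lborel (S X) = (\<Sum>u\<in>K X. measure lborel (I X (fst u) \<times> I X (snd u)))"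
      unfolding S_def
    proof (rule measure_finite_Union[OF fin])
      have "I X k \<times> I X l \<in> sets borel" for k l
        unfolding borel_prod[symmetric] by (intro pair_measureI) (simp_all add: I_def)
      then show "(\<lambda>u. I X (fst u) \<times> I X (snd u)) ` K X \<subseteq> sets lborel" by auto
      show "disjoint_family_on (\<lambda>u. I X (fst u) \<times> I X (snd u)) (K X)"
        unfolding disjoint_family_on_def by (auto simp: I_iff[OF X])
    qed (simp add: em)
    also have "\<dots> = real (card (K X)) * (s X)^2" by (simp add: measure_def em)
    also have "\<dots> = real (card (K X)) / X * of_int Q ^ 2" using X by (simp add: s_def power_divide)
    finally show ?thesis .
  qed
  obtain B where B: "B > 0" "\<And>i j X. gau (i, j) \<le> X \<Longrightarrow> \<bar>i\<bar> \<le> B * sqrt X \<and> \<bar>j\<bar> \<le> B * sqrt X"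
    using gau_le_bounded by blast
  \<comment> \<open>The box of this size contains the union of the cells for every X \<ge> 1 and
    provides the dominating function.\<close>
  define D where "D = B + \<bar>of_int r1\<bar> + \<bar>of_int r2\<bar> + of_int Q"
  have cell: "\<bar>y\<bar> \<le> D" if h: "\<bar>of_int (r + Q * \<lfloor>y / s X\<rfloor>)\<bar> \<le> B * sqrt X" "\<bar>of_int r\<bar> \<le> \<bar>of_int r1\<bar> + \<bar>real_of_int r2\<bar>" "X \<ge> 1"
    for y X r
  proof -
    have q: "sqrt X \<ge> 1" using h(3) by simp
    define k where "k = \<lfloor>y / s X\<rfloor>"
    have "of_int k \<le> y / s X" "y / s X < of_int k + 1" unfolding k_def by linarith+
    then have "\<bar>y / s X - of_int k\<bar> \<le> 1" by linarith
    then have "\<bar>of_int Q * (y / s X - of_int k)\<bar> \<le> of_int Q" using Q by (simp add: abs_mult)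
    moreover have "of_int Q * (y / s X) = sqrt X * y" using Q by (simp add: s_def)
    ultimately have "\<bar>sqrt X * y - of_int Q * of_int k\<bar> \<le> of_int Q" by (simp add: right_diff_distrib)
    moreover have "\<bar>of_int r + of_int Q * of_int k\<bar> \<le> B * sqrt X" using h(1) by (simp add: k_def)
    ultimately have "\<bar>sqrt X * y\<bar> \<le> B * sqrt X + \<bar>of_int r\<bar> + of_int Q" by linarith
    also have "\<dots> \<le> B * sqrt X + (\<bar>of_int r1\<bar> + \<bar>of_int r2\<bar> + of_int Q) * 1" using h(2) by simp
    also have "\<dots> \<le> B * sqrt X + (\<bar>of_int r1\<bar> + \<bar>of_int r2\<bar> + of_int Q) * sqrt X"
      using q Q by (intro add_left_mono mult_left_mono) auto
    finally have "sqrt X * \<bar>y\<bar> \<le> sqrt X * D" using q by (simp add: abs_mult D_def algebra_simps)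
    then show ?thesis using q by simp
  qed
  \<comment> \<open>The lattice point attached to the cell around y, scaled by 1 / sqrt X, tends to
    y.\<close>
  have lim: "((\<lambda>X. of_int (r + Q * \<lfloor>y / s X\<rfloor>) / sqrt X) \<longlongrightarrow> y) at_top" for y r
  proof (rule Lim_transform_eventually)
    have "((\<lambda>X. (\<bar>of_int r\<bar> + of_int Q) / sqrt X) \<longlongrightarrow> 0) at_top"
      by (intro tendsto_divide_0[OF tendsto_const] filterlim_at_top_imp_at_infinity sqrt_at_top)
    then show "((\<lambda>X. y + (of_int (r + Q * \<lfloor>y / s X\<rfloor>) / sqrt X - y)) \<longlongrightarrow> y) at_top"
    proof -
      assume a: "((\<lambda>X. (\<bar>of_int r\<bar> + of_int Q) / sqrt X) \<longlongrightarrow> 0) at_top"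
      have "((\<lambda>X. of_int (r + Q * \<lfloor>y / s X\<rfloor>) / sqrt X - y) \<longlongrightarrow> 0) at_top"
      proof (rule Lim_null_comparison[OF _ a])
        show "\<forall>\<^sub>F X in at_top. norm (of_int (r + Q * \<lfloor>y / s X\<rfloor>) / sqrt X - y) \<le> (\<bar>of_int r\<bar> + of_int Q) / sqrt X"
          using eventually_gt_at_top[of 0]
        proof eventually_elim
          case (elim X)
          define k where "k = \<lfloor>y / s X\<rfloor>"
          have "of_int k \<le> y / s X" "y / s X < of_int k + 1" unfolding k_def by linarith+
          then have "\<bar>y / s X - of_int k\<bar> \<le> 1" by linarith
          then have "\<bar>of_int Q * (y / s X - of_int k)\<bar> \<le> of_int Q" using Q by (simp add: abs_mult)
          moreover have "of_int Q * (y / s X) = sqrt X * y" using Q by (simp add: s_def)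
          ultimately have "\<bar>sqrt X * y - of_int Q * of_int k\<bar> \<le> of_int Q" by (simp add: right_diff_distrib)
          then have "\<bar>of_int r + of_int Q * of_int k - sqrt X * y\<bar> \<le> \<bar>of_int r\<bar> + of_int Q" by linarith
          then have "\<bar>of_int r + of_int Q * of_int k - sqrt X * y\<bar> / sqrt X \<le> (\<bar>of_int r\<bar> + of_int Q) / sqrt X"
            using elim by (intro divide_right_mono) auto
          moreover have "of_int (r + Q * k) / sqrt X - y = (of_int r + of_int Q * of_int k - sqrt X * y) / sqrt X"
            using elim by (simp add: field_simps)
          ultimately show ?case using elim by (simp add: k_def)
        qed
      qed
      from tendsto_add[OF tendsto_const[of y] this] show ?thesis by simp
    qed
  qed simp
  have gauX: "gau (i, j) \<le> X \<longleftrightarrow> gau (i / sqrt X, j / sqrt X) \<le> 1" if "X > 0" for i j X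
  proof -
    have "gau (i / sqrt X, j / sqrt X) = gau (i, j) / X"
      using gau_scale[of "1 / sqrt X" i j] that by (simp add: power_divide)
    then show ?thesis using that by simp
  qed
  have "((\<lambda>X. integral\<^sup>L lborel (indicator (S X) :: _ \<Rightarrow> real)) \<longlongrightarrow> integral\<^sup>L lborel (indicator {u. gau u \<le> 1})) at_top"
  proof (rule integral_dominated_convergence_at_top[where w = "indicator (cbox (-D, -D) (D, D))"])
    show "integrable lborel (indicator (cbox (- D, - D) (D, D)) :: real \<times> real \<Rightarrow> real)"
      by (rule integrable_real_indicator[OF _ emeasure_lborel_cbox_finite]) simp
    show "AE u in lborel. ((\<lambda>X. indicator (S X) u :: real) \<longlongrightarrow> indicator {u. gau u \<le> 1} u) at_top"
    proof (rule AE_I'[OF gau_level_null], rule subsetI, rule CollectI)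
      fix y assume "y \<in> {x \<in> space lborel. \<not> ((\<lambda>X. indicator (S X) x :: real) \<longlongrightarrow> indicator {u. gau u \<le> 1} x) at_top}"
      then have no: "\<not> ((\<lambda>X. indicator (S X) y :: real) \<longlongrightarrow> indicator {u. gau u \<le> 1} y) at_top" by simp
      define h where "h X = gau (of_int (r1 + Q * \<lfloor>fst y / s X\<rfloor>) / sqrt X, of_int (r2 + Q * \<lfloor>snd y / s X\<rfloor>) / sqrt X)" for X
      have "((\<lambda>X. (of_int (r1 + Q * \<lfloor>fst y / s X\<rfloor>) / sqrt X, of_int (r2 + Q * \<lfloor>snd y / s X\<rfloor>) / sqrt X)) \<longlongrightarrow> (fst y, snd y)) at_top"
        by (intro tendsto_Pair lim)
      then have "(h \<longlongrightarrow> gau (fst y, snd y)) at_top"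
        unfolding h_def by (rule continuous_on_tendsto_compose[OF gau_continuous]) auto
      then have hl: "(h \<longlongrightarrow> gau y) at_top" by simp
      have ind: "\<forall>\<^sub>F X in at_top. indicator (S X) y = (if h X \<le> 1 then 1 else (0::real))"
        using eventually_gt_at_top[of 0]
        by eventually_elim (simp add: indicator_def S_iff h_def gauX[symmetric])
      show "gau y = 1"
      proof (rule ccontr)
        assume "gau y \<noteq> 1"
        then consider "gau y < 1" | "gau y > 1" by linarith
        then have "\<forall>\<^sub>F X in at_top. (if h X \<le> 1 then 1 else (0::real)) = indicator {u. gau u \<le> 1} y"
        proof cases
          case 1
          have "\<forall>\<^sub>F X in at_top. h X < 1" using hl 1 by (rule order_tendstoD(2))
          then show ?thesis using 1 by (auto elim!: eventually_mono)
        next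
          case 2
          have "\<forall>\<^sub>F X in at_top. h X > 1" using hl 2 by (rule order_tendstoD(1))
          then show ?thesis using 2 by (auto elim!: eventually_mono)
        qed
        with ind have "\<forall>\<^sub>F X in at_top. indicator {u. gau u \<le> 1} y = (indicator (S X) y :: real)"
          by eventually_elim simp
        then have "((\<lambda>X. indicator (S X) y :: real) \<longlongrightarrow> indicator {u. gau u \<le> 1} y) at_top"
          by (rule Lim_transform_eventually[OF tendsto_const])
        with no show False by contradiction
      qed
    qed
    show "\<forall>\<^sub>F X in at_top. AE u in lborel. norm (indicator (S X) u :: real) \<le> indicator (cbox (-D, -D) (D, D)) u"
      using eventually_ge_at_top[of 1]
    proof eventually_elim
      case (elim X)
      have "u \<in> cbox (-D, -D) (D, D)" if "u \<in> S X" for u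
      proof -
        have "gau (of_int (r1 + Q * \<lfloor>fst u / s X\<rfloor>), of_int (r2 + Q * \<lfloor>snd u / s X\<rfloor>)) \<le> X"
          using that S_iff[of X u] elim by simp
        from B(2)[OF this] have "\<bar>fst u\<bar> \<le> D" "\<bar>snd u\<bar> \<le> D"
          using cell[of r1 "fst u" X] cell[of r2 "snd u" X] elim by auto
        then show ?thesis by (auto simp: cbox_Pair_eq mem_Times_iff abs_le_iff)
      qed
      then show ?case by (intro AE_I2) (simp add: indicator_def)
    qed
  qed (use S_meas in simp_all)
  then have "((\<lambda>X. measure lborel (S X)) \<longlongrightarrow> area) at_top" by (simp add: area_def)
  then have "((\<lambda>X. measure lborel (S X) / of_int Q ^ 2) \<longlongrightarrow> area / of_int Q ^ 2) at_top"
    by (rule tendsto_divide) (use Q in auto)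
  moreover have "\<forall>\<^sub>F X in at_top. measure lborel (S X) / of_int Q ^ 2 = real (card (K X)) / X"
    using eventually_gt_at_top[of 0] by eventually_elim (use Q in \<open>simp add: measS\<close>)
  ultimately show ?thesis unfolding card_eq by (rule Lim_transform_eventually)
qed

end

section \<open>Logarithmic sums\<close>

text \<open>The shift by one fits the telescoping of increments 1/j over j < K in
  \<open>log_growth\<close>.\<close>

lemma harm_quotient_ln: "(\<lambda>K. harm (K - 1) / ln (real K)) \<longlonglongrightarrow> 1"
proof -
  obtain c where c: "(\<lambda>n. harm n - ln (real n) :: real) \<longlonglongrightarrow> c"
    using euler_mascheroni_convergent by (auto simp: convergent_def)
  have "(\<lambda>n. (harm n - ln (real n)) * (1 / ln (real n))) \<longlonglongrightarrow> c * 0"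
    by (rule tendsto_mult[OF c]) real_asymp
  moreover have "(\<lambda>n. 1 / (real n * ln (real n))) \<longlonglongrightarrow> 0" by real_asymp
  ultimately have "(\<lambda>n. (harm n - ln (real n)) * (1 / ln (real n)) - 1 / (real n * ln (real n)) + 1) \<longlonglongrightarrow> c * 0 - 0 + 1"
    by (rule tendsto_add[OF tendsto_diff tendsto_const])
  then have "(\<lambda>n. (harm n - ln (real n)) * (1 / ln (real n)) - 1 / (real n * ln (real n)) + 1) \<longlonglongrightarrow> 1" by simp
  moreover have "\<forall>\<^sub>F n in sequentially. (harm n - ln (real n)) * (1 / ln (real n)) - 1 / (real n * ln (real n)) + 1 = harm (n - 1) / ln (real n)"
    using eventually_ge_at_top[of 2]
  proof eventually_elim
    case (elim n)
    then obtain m where m: "n = Suc m" by (cases n) auto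
    have "harm n = harm (n - 1) + 1 / real n" by (simp add: m harm_Suc inverse_eq_divide)
    moreover have "(h + 1 / t - l) * (1 / l) - 1 / (t * l) + 1 = h / l" if "l \<noteq> 0" "t \<noteq> 0" for h t l :: real
      using that by (simp add: field_simps)
    moreover have "ln (real n) \<noteq> 0" using elim by simp
    ultimately show ?case using elim by simp
  qed
  ultimately show ?thesis by (rule Lim_transform_eventually)
qed

text \<open>A Stolz-Cesaro argument against the harmonic numbers: after subtraction of \<kappa>
  times these, the increments are o(1/K), so the remainder is o(log K).\<close>

lemma log_growth:
  fixes x :: "nat \<Rightarrow> real"
  assumes "(\<lambda>K. (x (Suc K) - x K) * real K) \<longlonglongrightarrow> \<kappa>"
  shows "(\<lambda>K. x K / ln (real K)) \<longlonglongrightarrow> \<kappa>"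
proof -
  define y where "y K = x K - \<kappa> * harm (K - 1)" for K
  have y0: "(\<lambda>K. y K / ln (real K)) \<longlonglongrightarrow> 0"
  proof (rule tendstoI)
    fix e :: real assume e: "e > 0"
    have "\<forall>\<^sub>F K in sequentially. dist ((x (Suc K) - x K) * real K) \<kappa> < e / 4"
      using assms e by (intro tendstoD) auto
    then obtain K1 where K1: "\<And>K. K \<ge> K1 \<Longrightarrow> \<bar>(x (Suc K) - x K) * real K - \<kappa>\<bar> < e / 4"
      by (auto simp: eventually_sequentially dist_real_def)
    define K0 where "K0 = Suc K1"
    have ystep: "\<bar>y (Suc K) - y K\<bar> \<le> e / 4 * (1 / real K)" if K: "K \<ge> K0" for K
    proof -
      obtain m where m: "K = Suc m" using K by (cases K) (auto simp: K0_def)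
      have "harm K = harm (K - 1) + 1 / real K" by (simp add: m harm_Suc inverse_eq_divide)
      then have "y (Suc K) - y K = ((x (Suc K) - x K) * real K - \<kappa>) / real K"
        by (simp add: y_def m field_simps)
      then have "\<bar>y (Suc K) - y K\<bar> = \<bar>(x (Suc K) - x K) * real K - \<kappa>\<bar> / real K" by simp
      also have "\<dots> \<le> (e / 4) / real K"
        using K1[of K] K by (intro divide_right_mono) (auto simp: K0_def)
      finally show ?thesis by simp
    qed
    have bnd: "\<bar>y K\<bar> \<le> \<bar>y K0\<bar> + e / 4 * harm (K - 1)" if K: "K \<ge> K0" for K
      using K
    proof (induction K rule: dec_induct)
      case base then show ?case using e harm_nonneg[of "K0 - 1", where 'a = real] by simp
    next
      case (step K)
      obtain m where m: "K = Suc m" using step.hyps by (cases K) (auto simp: K0_def)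
      have "\<bar>y (Suc K)\<bar> \<le> \<bar>y K\<bar> + e / 4 * (1 / real K)" using ystep[of K] step.hyps by linarith
      also have "\<dots> \<le> \<bar>y K0\<bar> + e / 4 * harm (K - 1) + e / 4 * (1 / real K)" using step.IH by simp
      also have "\<dots> = \<bar>y K0\<bar> + e / 4 * harm (Suc K - 1)"
        by (simp add: m harm_Suc inverse_eq_divide algebra_simps add_divide_distrib)
      finally show ?case .
    qed
    have "\<forall>\<^sub>F K in sequentially. harm (K - 1) / ln (real K) < (2::real)"
      using harm_quotient_ln by (rule order_tendstoD) simp
    moreover have "(\<lambda>K. \<bar>y K0\<bar> / ln (real K)) \<longlonglongrightarrow> 0" by real_asymp
    then have "\<forall>\<^sub>F K in sequentially. \<bar>y K0\<bar> / ln (real K) < e / 2"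
      by (rule order_tendstoD) (use e in simp)
    ultimately show "\<forall>\<^sub>F K in sequentially. dist (y K / ln (real K)) 0 < e"
      using eventually_ge_at_top[of K0] eventually_ge_at_top[of 2]
    proof eventually_elim
      case (elim K)
      have l: "ln (real K) > 0" using elim by simp
      have "\<bar>y K\<bar> / ln (real K) \<le> (\<bar>y K0\<bar> + e / 4 * harm (K - 1)) / ln (real K)"
        using bnd[of K] elim l by (intro divide_right_mono) auto
      also have "\<dots> = \<bar>y K0\<bar> / ln (real K) + e / 4 * (harm (K - 1) / ln (real K))" by (simp add: add_divide_distrib)
      also have "\<dots> < e / 2 + e / 4 * 2"
        using elim e by (intro add_less_le_mono mult_left_mono) auto
      finally show ?case using l by (simp add: dist_real_def)
    qed
  qed
  have "(\<lambda>K. y K / ln (real K) + \<kappa> * (harm (K - 1) / ln (real K))) \<longlonglongrightarrow> 0 + \<kappa> * 1"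
    by (intro tendsto_intros y0 harm_quotient_ln)
  moreover have "y K / ln (real K) + \<kappa> * (harm (K - 1) / ln (real K)) = x K / ln (real K)" for K
    by (simp add: y_def diff_divide_distrib)
  ultimately show ?thesis by simp
qed

text \<open>Partial summation, applied along the integers.\<close>

lemma logarithmic_sum:
  fixes g w :: "'u \<Rightarrow> real" and U :: "'u set"
  assumes fin: "\<And>X. finite {u\<in>U. g u \<le> X}" and pos: "\<And>u. u \<in> U \<Longrightarrow> g u > 0" and w: "\<And>u. u \<in> U \<Longrightarrow> w u \<ge> 0"
    and lim: "((\<lambda>X. (\<Sum>u | u \<in> U \<and> g u \<le> X. w u) / X) \<longlongrightarrow> \<kappa>) at_top"
  shows "((\<lambda>X. (\<Sum>u | u \<in> U \<and> g u \<le> X. w u / g u) / ln X) \<longlongrightarrow> \<kappa>) at_top"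
proof -
  define n where "n X = (\<Sum>u | u \<in> U \<and> g u \<le> X. w u)" for X
  define S where "S X = (\<Sum>u | u \<in> U \<and> g u \<le> X. w u / g u)" for X
  \<comment> \<open>In partial summation the sum of w / g equals n(X) / X plus the integral of n(t)
    / t^2. \<open>L\<close> stands for the integral, the part that grows.\<close>
  define L where "L K = S (real K) - n (real K) / real K" for K
  have nlim: "(\<lambda>K. n (real K) / real K) \<longlonglongrightarrow> \<kappa>"
    unfolding n_def by (rule filterlim_compose[OF lim filterlim_real_sequentially])
  have split: "(\<Sum>u | u \<in> U \<and> g u \<le> real (Suc K). f u) =
      (\<Sum>u | u \<in> U \<and> g u \<le> real K. f u) + (\<Sum>u | u \<in> U \<and> real K < g u \<and> g u \<le> real (Suc K). f u)" for f K
  proof -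
    have "{u. u \<in> U \<and> g u \<le> real (Suc K)} =
      {u. u \<in> U \<and> g u \<le> real K} \<union> {u. u \<in> U \<and> real K < g u \<and> g u \<le> real (Suc K)}" by auto
    moreover have "finite {u. u \<in> U \<and> real K < g u \<and> g u \<le> real (Suc K)}"
      by (rule finite_subset[OF _ fin[of "real (Suc K)"]]) auto
    ultimately show ?thesis using fin[of "real K"] by (simp add: sum.union_disjoint disjoint_iff)
  qed
  \<comment> \<open>For values of \<open>g\<close> in (K, K + 1] the weight 1 / g lies between 1 /
    (K + 1) and 1 / K. This encloses K times the increment of \<open>L\<close> between two
    quantities that tend to \<kappa>.\<close>
  have bounds: "n (real K) / real (Suc K) \<le> (L (Suc K) - L K) * real K \<and>
      (L (Suc K) - L K) * real K \<le> n (real (Suc K)) / real (Suc K)" if K: "K \<ge> 1" for K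
  proof -
    let ?D = "{u. u \<in> U \<and> real K < g u \<and> g u \<le> real (Suc K)}"
    have dn: "n (real (Suc K)) - n (real K) = (\<Sum>u\<in>?D. w u)" unfolding n_def split by simp
    have dS: "S (real (Suc K)) - S (real K) = (\<Sum>u\<in>?D. w u / g u)" unfolding S_def split by simp
    have "(\<Sum>u\<in>?D. w u / real (Suc K)) \<le> (\<Sum>u\<in>?D. w u / g u)"
      using w pos K by (intro sum_mono divide_left_mono) (auto intro!: mult_pos_pos)
    then have lo: "(n (real (Suc K)) - n (real K)) / real (Suc K) \<le> S (real (Suc K)) - S (real K)"
      unfolding dn dS by (simp add: sum_divide_distrib)
    have "(\<Sum>u\<in>?D. w u / g u) \<le> (\<Sum>u\<in>?D. w u / real K)"
      using w pos K by (intro sum_mono divide_left_mono) (auto intro!: mult_pos_pos)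
    then have hi: "S (real (Suc K)) - S (real K) \<le> (n (real (Suc K)) - n (real K)) / real K"
      unfolding dn dS by (simp add: sum_divide_distrib)
    define a b k where "a = n (real K)" and "b = n (real (Suc K))" and "k = real K"
    have k: "k > 0" "real (Suc K) = k + 1" using K by (auto simp: k_def)
    have "(L (Suc K) - L K) * k = (S (real (Suc K)) - S (real K)) * k - b * k / (k + 1) + a"
    proof -
      have "L (Suc K) - L K = (S (real (Suc K)) - S (real K)) - b / (k + 1) + a / k"
        unfolding L_def a_def b_def k(2)[symmetric] by (simp add: k_def)
      then show ?thesis using k(1) by (simp add: distrib_right left_diff_distrib)
    qed
    moreover have "(b - a) / (k + 1) * k \<le> (S (real (Suc K)) - S (real K)) * k"
      using lo k(1) unfolding a_def b_def k(2)[symmetric] by (intro mult_right_mono) auto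
    moreover have "(S (real (Suc K)) - S (real K)) * k \<le> (b - a) / k * k"
      using hi k(1) unfolding a_def b_def k_def[symmetric] by (intro mult_right_mono) auto
    moreover have "(b - a) / j * (j - 1) - b * (j - 1) / j + a = a / j"
      "b - b * (j - 1) / j = b / j" if "j \<noteq> 0" for j
      using that by (simp_all add: field_simps)
    from this[of "k + 1"] have "(b - a) / (k + 1) * k - b * k / (k + 1) + a = a / (k + 1)"
      "(b - a) / k * k - b * k / (k + 1) + a = b / (k + 1)" using k(1) by simp_all
    ultimately have "a / (k + 1) \<le> (L (Suc K) - L K) * k \<and> (L (Suc K) - L K) * k \<le> b / (k + 1)" by linarith
    then show ?thesis unfolding a_def b_def k(2)[symmetric] unfolding k_def .
  qed
  have "(\<lambda>K. (L (Suc K) - L K) * real K) \<longlonglongrightarrow> \<kappa>"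
  proof (rule tendsto_sandwich)
    have "(\<lambda>K. n (real K) / real K * (real K / real (Suc K))) \<longlonglongrightarrow> \<kappa> * 1"
      by (rule tendsto_mult[OF nlim]) real_asymp
    moreover have "\<forall>\<^sub>F K in sequentially. n (real K) / real K * (real K / real (Suc K)) = n (real K) / real (Suc K)"
      using eventually_ge_at_top[of 1] by eventually_elim simp
    ultimately have "(\<lambda>K. n (real K) / real (Suc K)) \<longlonglongrightarrow> \<kappa> * 1" by (rule Lim_transform_eventually)
    then show "(\<lambda>K. n (real K) / real (Suc K)) \<longlonglongrightarrow> \<kappa>" by simp
    show "(\<lambda>K. n (real (Suc K)) / real (Suc K)) \<longlonglongrightarrow> \<kappa>" using nlim by (rule LIMSEQ_Suc)
    have "\<forall>\<^sub>F K in sequentially. n (real K) / real (Suc K) \<le> (L (Suc K) - L K) * real K \<and>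
        (L (Suc K) - L K) * real K \<le> n (real (Suc K)) / real (Suc K)"
      using eventually_ge_at_top[of 1] by eventually_elim (rule bounds)
    then show "\<forall>\<^sub>F K in sequentially. n (real K) / real (Suc K) \<le> (L (Suc K) - L K) * real K"
      "\<forall>\<^sub>F K in sequentially. (L (Suc K) - L K) * real K \<le> n (real (Suc K)) / real (Suc K)"
      unfolding eventually_conj_iff by blast+
  qed
  then have "(\<lambda>K. L K / ln (real K)) \<longlonglongrightarrow> \<kappa>" by (rule log_growth)
  moreover have "(\<lambda>K. n (real K) / real K * (1 / ln (real K))) \<longlonglongrightarrow> \<kappa> * 0"
    by (rule tendsto_mult[OF nlim]) real_asymp
  ultimately have "(\<lambda>K. L K / ln (real K) + n (real K) / real K * (1 / ln (real K))) \<longlonglongrightarrow> \<kappa> + \<kappa> * 0"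
    by (rule tendsto_add)
  then have Slim: "(\<lambda>K. S (real K) / ln (real K)) \<longlonglongrightarrow> \<kappa>"
    by (simp add: L_def diff_divide_distrib)
  \<comment> \<open>Monotonicity carries the limit from the integers over to real X, since log X and
    the logarithm of a neighbouring integer have quotient tending to 1.\<close>
  have Smono: "S x \<le> S y" if "x \<le> y" for x y
    unfolding S_def using fin[of y] that w pos by (intro sum_mono2) (auto intro!: divide_nonneg_pos)
  have fl: "filterlim (\<lambda>X::real. nat \<lfloor>X\<rfloor>) sequentially at_top" by real_asymp
  have "((\<lambda>X. S X / ln X) \<longlongrightarrow> \<kappa>) at_top"
  proof (rule tendsto_sandwich)
    have "((\<lambda>X. S (real (nat \<lfloor>X\<rfloor>)) / ln (real (nat \<lfloor>X\<rfloor>)) * (ln (real (nat \<lfloor>X\<rfloor>)) / ln X)) \<longlongrightarrow> \<kappa> * 1) at_top"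
      by (intro tendsto_mult filterlim_compose[OF Slim fl]) real_asymp
    moreover have "\<forall>\<^sub>F X in at_top. S (real (nat \<lfloor>X\<rfloor>)) / ln (real (nat \<lfloor>X\<rfloor>)) * (ln (real (nat \<lfloor>X\<rfloor>)) / ln X) = S (real (nat \<lfloor>X\<rfloor>)) / ln X"
      using eventually_ge_at_top[of 2]
    proof eventually_elim
      case (elim X)
      then have "nat \<lfloor>X\<rfloor> \<ge> 2" by linarith
      then have "1 < real (nat \<lfloor>X\<rfloor>)" by linarith
      then have "ln (real (nat \<lfloor>X\<rfloor>)) > 0" by (rule ln_gt_zero)
      then show ?case by simp
    qed
    ultimately have "((\<lambda>X. S (real (nat \<lfloor>X\<rfloor>)) / ln X) \<longlongrightarrow> \<kappa> * 1) at_top" by (rule Lim_transform_eventually)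
    then show "((\<lambda>X. S (real (nat \<lfloor>X\<rfloor>)) / ln X) \<longlongrightarrow> \<kappa>) at_top" by simp
    have "((\<lambda>X. S (real (Suc (nat \<lfloor>X\<rfloor>))) / ln (real (Suc (nat \<lfloor>X\<rfloor>))) * (ln (real (Suc (nat \<lfloor>X\<rfloor>))) / ln X)) \<longlongrightarrow> \<kappa> * 1) at_top"
      by (intro tendsto_mult filterlim_compose[OF LIMSEQ_Suc[OF Slim] fl]) real_asymp
    moreover have "\<forall>\<^sub>F X in at_top. S (real (Suc (nat \<lfloor>X\<rfloor>))) / ln (real (Suc (nat \<lfloor>X\<rfloor>))) * (ln (real (Suc (nat \<lfloor>X\<rfloor>))) / ln X) = S (real (Suc (nat \<lfloor>X\<rfloor>))) / ln X"
      using eventually_ge_at_top[of 2]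
    proof eventually_elim
      case (elim X)
      then have "Suc (nat \<lfloor>X\<rfloor>) \<ge> 2" by linarith
      then have "1 < real (Suc (nat \<lfloor>X\<rfloor>))" by linarith
      then have "ln (real (Suc (nat \<lfloor>X\<rfloor>))) > 0" by (rule ln_gt_zero)
      then show ?case by (simp del: of_nat_Suc)
    qed
    ultimately have "((\<lambda>X. S (real (Suc (nat \<lfloor>X\<rfloor>))) / ln X) \<longlongrightarrow> \<kappa> * 1) at_top" by (rule Lim_transform_eventually)
    then show "((\<lambda>X. S (real (Suc (nat \<lfloor>X\<rfloor>))) / ln X) \<longlongrightarrow> \<kappa>) at_top" by simp
    show "\<forall>\<^sub>F X in at_top. S (real (nat \<lfloor>X\<rfloor>)) / ln X \<le> S X / ln X"
      using eventually_ge_at_top[of 2]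
      by eventually_elim (intro divide_right_mono Smono, auto)
    show "\<forall>\<^sub>F X in at_top. S X / ln X \<le> S (real (Suc (nat \<lfloor>X\<rfloor>))) / ln X"
      using eventually_ge_at_top[of 2]
    proof eventually_elim
      case (elim X)
      have "X \<le> real (Suc (nat \<lfloor>X\<rfloor>))" by linarith
      then show ?case using elim by (intro divide_right_mono Smono) auto
    qed
  qed
  then show ?thesis by (simp add: S_def)
qed

text \<open>Interchange of two limits: X tends to infinity first, for fixed \<open>z\<close>, and
  the threshold for X may depend on \<open>z\<close>. In the sieve, \<open>z\<close> bounds the
  sieving primes.\<close>

lemma tendsto_approx:
  fixes g :: "real \<Rightarrow> real" and f :: "nat \<Rightarrow> real \<Rightarrow> real"
  assumes f: "\<And>z. z \<ge> z0 \<Longrightarrow> (f z \<longlongrightarrow> l z) at_top" and l: "l \<longlonglongrightarrow> L" and e: "e \<longlonglongrightarrow> 0"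
    and close: "\<And>z. z \<ge> z0 \<Longrightarrow> \<forall>\<^sub>F X in at_top. \<bar>g X - f z X\<bar> \<le> e z"
  shows "(g \<longlongrightarrow> L) at_top"
proof (rule tendstoI)
  fix d :: real assume d: "d > 0"
  have "\<forall>\<^sub>F z in sequentially. dist (l z) L < d / 3" using l d by (intro tendstoD) auto
  moreover have "\<forall>\<^sub>F z in sequentially. dist (e z) 0 < d / 3" using e d by (intro tendstoD) auto
  ultimately have "\<forall>\<^sub>F z in sequentially. dist (l z) L < d / 3 \<and> dist (e z) 0 < d / 3 \<and> z \<ge> z0"
    using eventually_ge_at_top[of z0] by eventually_elim simp
  then obtain z where z: "dist (l z) L < d / 3" "dist (e z) 0 < d / 3" "z \<ge> z0"
    using eventually_happens'[OF sequentially_bot] by blast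
  have "\<forall>\<^sub>F X in at_top. dist (f z X) (l z) < d / 3" using f[OF z(3)] d by (intro tendstoD) auto
  with close[OF z(3)] show "\<forall>\<^sub>F X in at_top. dist (g X) L < d"
    by eventually_elim (use z in \<open>simp add: dist_real_def abs_if split: if_splits\<close>)
qed

section \<open>Primitive vectors in residue classes: the sieve\<close>

context vec_norm begin

definition sieved :: "int \<Rightarrow> int \<Rightarrow> int \<Rightarrow> nat set \<Rightarrow> real \<Rightarrow> (int \<times> int) set" where
  "sieved Q r1 r2 P X = {(a, b). Q dvd a - r1 \<and> Q dvd b - r2 \<and>
     (\<forall>p\<in>P. \<not> (int p dvd a \<and> int p dvd b)) \<and> gau (of_int a, of_int b) \<le> X}"

lemma finite_sieved: "finite (sieved Q r1 r2 P X)"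
  by (rule finite_subset[OF _ finite_gau_le[of X]]) (auto simp: sieved_def)

text \<open>Removing the multiples of a new prime p is a self-similar step: they are p times the
  vectors at level X / p^2, in the class multiplied by the inverse \<open>w\<close> of p modulo
  \<open>Q\<close>. Hence the residues are arbitrary in the induction, and each prime contributes
  the factor 1 - 1/p^2.\<close>

lemma sieve_count:
  fixes Q r1 r2 :: int
  assumes Q: "Q > 0" and P: "finite P" "\<And>p. p \<in> P \<Longrightarrow> prime p \<and> \<not> int p dvd Q"
  shows "((\<lambda>X. real (card (sieved Q r1 r2 P X)) / X) \<longlongrightarrow>
    area / of_int Q ^ 2 * (\<Prod>p\<in>P. 1 - 1 / real p ^ 2)) at_top"
  using P
proof (induction P arbitrary: r1 r2 rule: finite_induct)
  case empty
  show ?case using lattice_count[OF Q, of r1 r2] by (simp add: sieved_def)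
next
  case (insert p P)
  have p: "prime p" "\<not> int p dvd Q" using insert.prems by auto
  have p0: "int p > 0" using p(1) by (simp add: prime_gt_0_nat)
  have co: "coprime (int p) Q" using p by (simp add: prime_imp_coprime)
  then obtain w where "[int p * w = 1] (mod Q)" using cong_solve_coprime_int by blast
  then have w: "Q dvd int p * w - 1" by (simp add: cong_iff_dvd_diff)
  have class_iff: "Q dvd int p * a - r \<longleftrightarrow> Q dvd a - w * r" for a r
  proof -
    have "Q dvd int p * (a - w * r) \<longleftrightarrow> Q dvd a - w * r"
      using co by (simp add: coprime_dvd_mult_right_iff coprime_commute)
    moreover have "int p * a - r = int p * (a - w * r) + (int p * w - 1) * r" by (simp add: algebra_simps)
    ultimately show ?thesis using w by (metis dvd_add_left_iff dvd_mult2)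
  qed
  have avoid: "int q dvd int p * a \<longleftrightarrow> int q dvd a" if "q \<in> P" for q a
  proof -
    have "prime q" "q \<noteq> p" using that insert by auto
    then have "coprime (int q) (int p)" using p(1) primes_coprime[of q p] by simp
    then show ?thesis by (simp add: coprime_dvd_mult_right_iff)
  qed
  have gp: "gau (of_int (int p * a), of_int (int p * b)) \<le> X \<longleftrightarrow> gau (of_int a, of_int b) \<le> X / real p ^ 2" for a b X
    using gau_scale[of "real p" "of_int a" "of_int b"] p0 by (simp add: field_simps)
  let ?m = "\<lambda>(a, b). (int p * a, int p * b)"
  have union: "sieved Q r1 r2 P X = sieved Q r1 r2 (insert p P) X \<union> ?m ` sieved Q (w * r1) (w * r2) P (X / real p ^ 2)" for X
  proof (intro equalityI subsetI)
    fix u assume u: "u \<in> sieved Q r1 r2 P X"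
    show "u \<in> sieved Q r1 r2 (insert p P) X \<union> ?m ` sieved Q (w * r1) (w * r2) P (X / real p ^ 2)"
    proof (cases "int p dvd fst u \<and> int p dvd snd u")
      case True
      then obtain a b where "fst u = int p * a" "snd u = int p * b" by (auto elim!: dvdE)
      then have ab: "u = ?m (a, b)" by (simp add: prod_eq_iff)
      have "(a, b) \<in> sieved Q (w * r1) (w * r2) P (X / real p ^ 2)"
        using u unfolding ab sieved_def by (auto simp: class_iff avoid gp simp del: of_int_mult)
      then show ?thesis unfolding ab by blast
    next
      case False then show ?thesis using u by (auto simp: sieved_def)
    qed
  next
    fix u assume "u \<in> sieved Q r1 r2 (insert p P) X \<union> ?m ` sieved Q (w * r1) (w * r2) P (X / real p ^ 2)"
    then show "u \<in> sieved Q r1 r2 P X"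
      by (auto simp: sieved_def class_iff avoid gp simp del: of_int_mult)
  qed
  have card: "real (card (sieved Q r1 r2 (insert p P) X)) / X =
     real (card (sieved Q r1 r2 P X)) / X -
     real (card (sieved Q (w * r1) (w * r2) P (X / real p ^ 2))) / (X / real p ^ 2) * (1 / real p ^ 2)" for X
  proof -
    have "card (sieved Q r1 r2 P X) = card (sieved Q r1 r2 (insert p P) X) +
       card (?m ` sieved Q (w * r1) (w * r2) P (X / real p ^ 2))"
      unfolding union by (rule card_Un_disjoint[OF finite_sieved finite_imageI[OF finite_sieved]]) (auto simp: sieved_def)
    also have "card (?m ` sieved Q (w * r1) (w * r2) P (X / real p ^ 2)) = card (sieved Q (w * r1) (w * r2) P (X / real p ^ 2))"
      by (rule card_image) (use p0 in \<open>auto simp: inj_on_def\<close>)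
    finally show ?thesis using p0 by (simp add: field_simps add_divide_distrib)
  qed
  have "((\<lambda>X. real (card (sieved Q (w * r1) (w * r2) P (X / real p ^ 2))) / (X / real p ^ 2)) \<longlongrightarrow>
    area / of_int Q ^ 2 * (\<Prod>p\<in>P. 1 - 1 / real p ^ 2)) at_top"
  proof (rule filterlim_compose[OF insert.IH])
    show "filterlim (\<lambda>X. X / real p ^ 2) at_top at_top"
      using filterlim_tendsto_pos_mult_at_top[OF tendsto_const[of "1 / real p ^ 2"] _ filterlim_ident] p0 by simp
  qed (use insert.prems in auto)
  from tendsto_diff[OF insert.IH[of r1 r2] tendsto_mult[OF this tendsto_const[of "1 / real p ^ 2"]]]
  have "((\<lambda>X. real (card (sieved Q r1 r2 (insert p P) X)) / X) \<longlongrightarrow>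
    area / of_int Q ^ 2 * (\<Prod>p\<in>P. 1 - 1 / real p ^ 2) - area / of_int Q ^ 2 * (\<Prod>p\<in>P. 1 - 1 / real p ^ 2) * (1 / real p ^ 2)) at_top"
    unfolding card using insert.prems by auto
  then show ?case using insert.hyps by (simp add: algebra_simps)
qed

lemma sum_inverse_squares_le: "z \<ge> 1 \<Longrightarrow> (\<Sum>d\<in>{z<..z + n}. 1 / real d ^ 2) \<le> 1 / real z - 1 / real (z + n)"
proof (induction n)
  case (Suc n)
  have "{z<..z + Suc n} = insert (z + Suc n) {z<..z + n}" by auto
  then have "(\<Sum>d\<in>{z<..z + Suc n}. 1 / real d ^ 2) = 1 / real (z + Suc n) ^ 2 + (\<Sum>d\<in>{z<..z + n}. 1 / real d ^ 2)" by simp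
  also have "\<dots> \<le> 1 / real (z + Suc n) ^ 2 + (1 / real z - 1 / real (z + n))" using Suc by simp
  also have "\<dots> \<le> 1 / real z - 1 / real (z + Suc n)"
  proof -
    define x where "x = real (z + n)"
    have x: "x > 0" "real (z + Suc n) = x + 1" using Suc.prems by (auto simp: x_def)
    have "1 / (x + 1)^2 \<le> 1 / (x * (x + 1))" using x by (intro divide_left_mono) (auto simp: power2_eq_square)
    also have "\<dots> = 1 / x - 1 / (x + 1)" using x by (simp add: field_simps)
    finally show ?thesis unfolding x(2) x_def[symmetric] by linarith
  qed
  finally show ?case .
qed simp

definition primitive_class :: "int \<Rightarrow> int \<Rightarrow> int \<Rightarrow> real \<Rightarrow> (int \<times> int) set" where
  "primitive_class Q r1 r2 X = {(a, b). Q dvd a - r1 \<and> Q dvd b - r2 \<and> coprime a b \<and> gau (of_int a, of_int b) \<le> X}"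

lemma finite_primitive_class: "finite (primitive_class Q r1 r2 X)"
  by (rule finite_subset[OF _ finite_gau_le[of X]]) (auto simp: primitive_class_def)

text \<open>Sieving by the primes up to \<open>z\<close> overcounts by vectors with a common prime
  factor above \<open>z\<close>, at most K X times the sum of 1/d^2 over d > z, hence at most K X /
  z. Common primes of \<open>Q\<close> are ruled out by the condition on the class.\<close>

lemma primitive_count:
  fixes Q r1 r2 :: int
  assumes Q: "Q > 0" and r: "gcd (gcd r1 r2) Q = 1"
    and Z: "(\<lambda>z. \<Prod>p | prime p \<and> p \<le> z \<and> \<not> int p dvd Q. 1 - 1 / real p ^ 2) \<longlonglongrightarrow> Z"
  shows "((\<lambda>X. real (card (primitive_class Q r1 r2 X)) / X) \<longlongrightarrow> area / of_int Q ^ 2 * Z) at_top"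
proof -
  obtain K where K: "K > 0"
    "\<And>X. X \<ge> 0 \<Longrightarrow> real (card {(a::int, b::int). (a, b) \<noteq> (0, 0) \<and> gau (of_int a, of_int b) \<le> X}) \<le> K * X"
    using nonzero_count by blast
  obtain B where B: "B > 0" "\<And>i j X. gau (i, j) \<le> X \<Longrightarrow> \<bar>i\<bar> \<le> B * sqrt X \<and> \<bar>j\<bar> \<le> B * sqrt X"
    using gau_le_bounded by blast
  define P where "P z = {p::nat. prime p \<and> p \<le> z \<and> \<not> int p dvd Q}" for z
  have finP: "finite (P z)" for z by (rule finite_subset[of _ "{..z}"]) (auto simp: P_def)
  define M where "M d X = {(a::int, b::int). (a, b) \<noteq> (0, 0) \<and> int d dvd a \<and> int d dvd b \<and> gau (of_int a, of_int b) \<le> X}" for d X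
  have finM: "finite (M d X)" for d X by (rule finite_subset[OF _ finite_gau_le[of X]]) (auto simp: M_def)
  have cardM: "real (card (M d X)) \<le> K * X * (1 / real d ^ 2)" if d: "d > 0" and X: "X \<ge> 0" for d X
  proof -
    let ?S = "{(a::int, b::int). (a, b) \<noteq> (0, 0) \<and> gau (of_int a, of_int b) \<le> X / real d ^ 2}"
    have gd: "gau (of_int (int d * a), of_int (int d * b)) \<le> X \<longleftrightarrow> gau (of_int a, of_int b) \<le> X / real d ^ 2" for a b
      using gau_scale[of "real d" "of_int a" "of_int b"] d by (simp add: field_simps)
    have "M d X \<subseteq> (\<lambda>(a, b). (int d * a, int d * b)) ` ?S"
    proof
      fix u assume u: "u \<in> M d X"
      then obtain a b where "fst u = int d * a" "snd u = int d * b" by (auto simp: M_def elim!: dvdE)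
      then have ab: "u = (\<lambda>(a, b). (int d * a, int d * b)) (a, b)" by (simp add: prod_eq_iff)
      have "(a, b) \<in> ?S" using u d unfolding ab M_def by (auto simp: gd simp del: of_int_mult)
      then show "u \<in> (\<lambda>(a, b). (int d * a, int d * b)) ` ?S" unfolding ab by blast
    qed
    moreover have "finite ?S" by (rule finite_subset[OF _ finite_gau_le[of "X / real d ^ 2"]]) auto
    ultimately have "card (M d X) \<le> card ?S" by (meson card_image_le card_mono finite_imageI order_trans)
    also have "real (card ?S) \<le> K * (X / real d ^ 2)" using X by (intro K(2)) simp
    finally show ?thesis by simp
  qed
  have no_common: "\<not> (int p dvd a \<and> int p dvd b)" if "prime p" "int p dvd Q" "Q dvd a - r1" "Q dvd b - r2" for p a b
  proof
    assume "int p dvd a \<and> int p dvd b"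
    moreover have "int p dvd a - r1" "int p dvd b - r2" using that dvd_trans by blast+
    ultimately have "int p dvd a - (a - r1)" "int p dvd b - (b - r2)" using dvd_diff by blast+
    then have "int p dvd r1" "int p dvd r2" by simp_all
    then have "int p dvd gcd (gcd r1 r2) Q" using that(2) by simp
    then show False using r that(1) by simp
  qed
  have sub: "primitive_class Q r1 r2 X \<subseteq> sieved Q r1 r2 (P z) X" for z X
  proof
    fix u assume u: "u \<in> primitive_class Q r1 r2 X"
    have "\<not> (int p dvd fst u \<and> int p dvd snd u)" if "p \<in> P z" for p
    proof
      assume "int p dvd fst u \<and> int p dvd snd u"
      moreover have "coprime (fst u) (snd u)" using u by (auto simp: primitive_class_def)
      ultimately have "is_unit (int p)" using coprime_common_divisor by blast
      then show False using that by (auto simp: P_def)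
    qed
    then show "u \<in> sieved Q r1 r2 (P z) X" using u by (auto simp: primitive_class_def sieved_def)
  qed
  have sup: "sieved Q r1 r2 (P z) X - primitive_class Q r1 r2 X \<subseteq> (\<Union>d\<in>{z<..z + nat \<lfloor>B * sqrt X\<rfloor>}. M d X)"
    if z: "z \<ge> 2" for z X
  proof
    fix u assume u: "u \<in> sieved Q r1 r2 (P z) X - primitive_class Q r1 r2 X"
    obtain a b where ab: "u = (a, b)" by (cases u)
    have s: "Q dvd a - r1" "Q dvd b - r2" "gau (of_int a, of_int b) \<le> X" "\<not> coprime a b"
      "\<And>p. p \<in> P z \<Longrightarrow> \<not> (int p dvd a \<and> int p dvd b)"
      using u by (auto simp: ab sieved_def primitive_class_def)
    \<comment> \<open>The origin is divisible by every d and must be excluded: either 2 divides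
      \<open>Q\<close>, which the class forbids, or 2 is among the sieving primes because z \<ge>
      2.\<close>
    have nz: "(a, b) \<noteq> (0, 0)"
    proof
      assume "(a, b) = (0, 0)"
      then have "\<not> int p dvd Q" if "prime p" for p using no_common[OF that _ s(1,2)] by auto
      from this[OF two_is_prime_nat] have "2 \<in> P z" using z by (simp add: P_def)
      then show False using s(5)[of 2] \<open>(a, b) = (0, 0)\<close> by simp
    qed
    have "gcd a b \<noteq> 1" using s(4) by (simp add: coprime_iff_gcd_eq_1)
    moreover have "gcd a b \<ge> 0" by simp
    ultimately have "nat (gcd a b) \<noteq> 1" by linarith
    then obtain p where p: "prime p" "p dvd nat (gcd a b)" using prime_factor_nat by blast
    then have pd: "int p dvd a" "int p dvd b" by (auto simp: nat_dvd_iff int_dvd_int_iff[symmetric] dest: gcd_dvdI1 gcd_dvdI2)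
    have "\<not> int p dvd Q" using no_common[OF p(1) _ s(1,2)] pd by blast
    then have "z < p" using s(5)[of p] pd p(1) by (force simp: P_def)
    moreover have "p \<le> nat \<lfloor>B * sqrt X\<rfloor>"
    proof -
      have "a \<noteq> 0 \<or> b \<noteq> 0" using nz by auto
      then have "int p \<le> \<bar>a\<bar> \<or> int p \<le> \<bar>b\<bar>"
        using pd zdvd_imp_le[of "int p" "\<bar>a\<bar>"] zdvd_imp_le[of "int p" "\<bar>b\<bar>"] by auto
      then have "real p \<le> B * sqrt X" using B(2)[OF s(3)] by linarith
      then show ?thesis by (simp add: le_nat_floor)
    qed
    ultimately have "p \<in> {z<..z + nat \<lfloor>B * sqrt X\<rfloor>}" by simp
    moreover have "u \<in> M p X" using nz pd s(3) by (simp add: ab M_def)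
    ultimately show "u \<in> (\<Union>d\<in>{z<..z + nat \<lfloor>B * sqrt X\<rfloor>}. M d X)" by blast
  qed
  show ?thesis
  proof (rule tendsto_approx[where ?z0.0 = 2])
    show "((\<lambda>X. real (card (sieved Q r1 r2 (P z) X)) / X) \<longlongrightarrow> area / of_int Q ^ 2 * (\<Prod>p\<in>P z. 1 - 1 / real p ^ 2)) at_top" for z
      by (rule sieve_count[OF Q finP]) (auto simp: P_def)
    show "(\<lambda>z. area / of_int Q ^ 2 * (\<Prod>p\<in>P z. 1 - 1 / real p ^ 2)) \<longlonglongrightarrow> area / of_int Q ^ 2 * Z"
      unfolding P_def by (intro tendsto_mult tendsto_const Z)
    show "(\<lambda>z. K / real z) \<longlonglongrightarrow> 0" by real_asymp
    show "\<forall>\<^sub>F X in at_top. \<bar>real (card (primitive_class Q r1 r2 X)) / X - real (card (sieved Q r1 r2 (P z) X)) / X\<bar> \<le> K / real z"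
      if z: "z \<ge> 2" for z
      using eventually_gt_at_top[of 0]
    proof eventually_elim
      case (elim X)
      let ?I = "{z<..z + nat \<lfloor>B * sqrt X\<rfloor>}"
      have "card (sieved Q r1 r2 (P z) X) - card (primitive_class Q r1 r2 X) = card (sieved Q r1 r2 (P z) X - primitive_class Q r1 r2 X)"
        using card_Diff_subset[OF finite_primitive_class sub] by simp
      also have "\<dots> \<le> card (\<Union>d\<in>?I. M d X)" by (rule card_mono[OF _ sup[OF z]]) (use finM in auto)
      also have "\<dots> \<le> (\<Sum>d\<in>?I. card (M d X))" by (rule card_UN_le) simp
      finally have "real (card (sieved Q r1 r2 (P z) X) - card (primitive_class Q r1 r2 X)) \<le> (\<Sum>d\<in>?I. real (card (M d X)))"
        by (metis of_nat_mono of_nat_sum)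
      also have "\<dots> \<le> (\<Sum>d\<in>?I. K * X * (1 / real d ^ 2))" using elim by (intro sum_mono cardM) auto
      also have "\<dots> = K * X * (\<Sum>d\<in>?I. 1 / real d ^ 2)" by (simp only: sum_distrib_left)
      also have "\<dots> \<le> K * X * (1 / real z - 1 / real (z + nat \<lfloor>B * sqrt X\<rfloor>))"
        using z elim K(1) by (intro mult_left_mono sum_inverse_squares_le) auto
      also have "\<dots> \<le> K * X * (1 / real z)" using elim K(1) by (intro mult_left_mono) auto
      finally have 1: "real (card (sieved Q r1 r2 (P z) X) - card (primitive_class Q r1 r2 X)) \<le> K * X * (1 / real z)" .
      have 2: "card (primitive_class Q r1 r2 X) \<le> card (sieved Q r1 r2 (P z) X)" by (rule card_mono[OF finite_sieved sub])
      have "\<bar>real (card (primitive_class Q r1 r2 X)) / X - real (card (sieved Q r1 r2 (P z) X)) / X\<bar>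
        = real (card (sieved Q r1 r2 (P z) X) - card (primitive_class Q r1 r2 X)) / X"
        using elim 2 by (simp add: of_nat_diff diff_divide_distrib[symmetric] abs_if divide_less_0_iff minus_divide_left)
      also have "\<dots> \<le> K * X * (1 / real z) / X" using 1 elim by (intro divide_right_mono) auto
      finally show ?case using elim by simp
    qed
  qed
qed

definition primitive_pairs :: "real \<Rightarrow> (int \<times> int) set" where
  "primitive_pairs X = {(a, b). coprime a b \<and> gau (of_int a, of_int b) \<le> X}"

lemma weighted_primitive_count:
  fixes Q :: int and w :: "int \<times> int \<Rightarrow> real"
  assumes Q: "Q > 0" and w: "\<And>a b. w (a, b) = w (a mod Q, b mod Q)"
    and Z: "(\<lambda>z. \<Prod>p | prime p \<and> p \<le> z \<and> \<not> int p dvd Q. 1 - 1 / real p ^ 2) \<longlonglongrightarrow> Z"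
  shows "((\<lambda>X. (\<Sum>u\<in>primitive_pairs X. w u) / X) \<longlongrightarrow>
    area / of_int Q ^ 2 * Z * (\<Sum>r | r \<in> {0..<Q} \<times> {0..<Q} \<and> gcd (gcd (fst r) (snd r)) Q = 1. w r)) at_top"
proof -
  let ?R = "{r \<in> {0..<Q} \<times> {0..<Q}. gcd (gcd (fst r) (snd r)) Q = 1}"
  let ?red = "\<lambda>(a, b). (a mod Q, b mod Q)"
  have finX: "finite (primitive_pairs X)" for X
    by (rule finite_subset[OF _ finite_gau_le[of X]]) (auto simp: primitive_pairs_def)
  have dvd_mod: "Q dvd a - r \<longleftrightarrow> a mod Q = r" if "r \<in> {0..<Q}" for a r
    using that by (simp flip: mod_eq_dvd_iff)
  have "(\<Sum>u\<in>primitive_pairs X. w u) = (\<Sum>r\<in>?R. w r * real (card (primitive_class Q (fst r) (snd r) X)))" for X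
  proof -
    have "?red ` primitive_pairs X \<subseteq> ?R"
    proof
      fix r assume "r \<in> ?red ` primitive_pairs X"
      then obtain a b where ab: "coprime a b" "r = (a mod Q, b mod Q)" by (auto simp: primitive_pairs_def)
      define d where "d = gcd (gcd (a mod Q) (b mod Q)) Q"
      have dQ: "d dvd Q" and "d dvd a mod Q" "d dvd b mod Q" unfolding d_def by (meson dvd_trans gcd_dvd1 gcd_dvd2)+
      then have "d dvd a" "d dvd b" by (simp_all add: dvd_mod_iff)
      then have "is_unit d" using ab(1) coprime_common_divisor by blast
      moreover have "d \<ge> 0" by (simp add: d_def)
      ultimately have "d = 1" by simp
      then show "r \<in> ?R" using ab Q by (simp add: d_def)
    qed
    then have "(\<Sum>u\<in>primitive_pairs X. w u) = (\<Sum>r\<in>?R. \<Sum>u | u \<in> primitive_pairs X \<and> ?red u = r. w u)"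
      by (intro sum.group[symmetric] finX) (auto intro: finite_subset[of _ "{0..<Q} \<times> {0..<Q}"])
    also have "\<dots> = (\<Sum>r\<in>?R. w r * real (card (primitive_class Q (fst r) (snd r) X)))"
    proof (intro sum.cong refl)
      fix r assume r: "r \<in> ?R"
      have "(\<Sum>u | u \<in> primitive_pairs X \<and> ?red u = r. w u) = (\<Sum>u | u \<in> primitive_pairs X \<and> ?red u = r. w r)"
        by (intro sum.cong refl) (use w in auto)
      moreover have "{u. u \<in> primitive_pairs X \<and> ?red u = r} = primitive_class Q (fst r) (snd r) X"
        using r by (auto simp: primitive_class_def primitive_pairs_def dvd_mod)
      ultimately show "(\<Sum>u | u \<in> primitive_pairs X \<and> ?red u = r. w u) = w r * real (card (primitive_class Q (fst r) (snd r) X))"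
        by simp
    qed
    finally show ?thesis .
  qed
  then have eq: "(\<Sum>u\<in>primitive_pairs X. w u) / X = (\<Sum>r\<in>?R. w r * (real (card (primitive_class Q (fst r) (snd r) X)) / X))" for X
    by (simp add: sum_divide_distrib)
  have "((\<lambda>X. \<Sum>r\<in>?R. w r * (real (card (primitive_class Q (fst r) (snd r) X)) / X)) \<longlongrightarrow>
    (\<Sum>r\<in>?R. w r * (area / of_int Q ^ 2 * Z))) at_top"
    by (intro tendsto_sum tendsto_mult tendsto_const primitive_count Q Z) auto
  then show ?thesis unfolding eq by (simp add: sum_distrib_left mult.commute)
qed

lemma primitive_log_sum:
  fixes Q :: int and w :: "int \<times> int \<Rightarrow> real"
  assumes Q: "Q > 0" and w: "\<And>a b. w (a, b) = w (a mod Q, b mod Q)" and w0: "\<And>u. w u \<ge> 0"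
    and Z: "(\<lambda>z. \<Prod>p | prime p \<and> p \<le> z \<and> \<not> int p dvd Q. 1 - 1 / real p ^ 2) \<longlonglongrightarrow> Z"
  shows "((\<lambda>X. (\<Sum>u\<in>primitive_pairs X. w u / gau (of_int (fst u), of_int (snd u))) / ln X) \<longlongrightarrow>
    area / of_int Q ^ 2 * Z * (\<Sum>r | r \<in> {0..<Q} \<times> {0..<Q} \<and> gcd (gcd (fst r) (snd r)) Q = 1. w r)) at_top"
proof -
  define U where "U = {u :: int \<times> int. coprime (fst u) (snd u)}"
  have eq: "primitive_pairs X = {u. u \<in> U \<and> gau (of_int (fst u), of_int (snd u)) \<le> X}" for X
    by (auto simp: primitive_pairs_def U_def)
  show ?thesis
    unfolding eq
  proof (rule logarithmic_sum)
    show "finite {u \<in> U. gau (of_int (fst u), of_int (snd u)) \<le> X}" for X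
      by (rule finite_subset[OF _ finite_gau_le[of X]]) auto
    show "0 < gau (of_int (fst u), of_int (snd u))" if "u \<in> U" for u
      by (rule gau_pos) (use that in \<open>auto simp: U_def prod_eq_iff\<close>)
  qed (use w0 weighted_primitive_count[OF Q w Z] in \<open>simp_all add: eq\<close>)
qed

end

section \<open>Points on a quadric and their eigenlines\<close>

text \<open>
  The vector \<open>(A, B, C)\<close> encodes the matrix with rows \<open>(A, B)\<close> and \<open>(C, -A)\<close>, whose square is
  \<open>A\<^sup>2 + B C\<close> times the identity; \<open>eig y n u\<close> says that \<open>u\<close> is an eigenvector for \<open>n\<close>.
\<close>

definition qform :: "'a::comm_ring_1^3 \<Rightarrow> 'a" where "qform y = (y $ 1)^2 + y $ 2 * y $ 3"

definition eig :: "int^3 \<Rightarrow> int \<Rightarrow> int \<times> int \<Rightarrow> bool" where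
  "eig y n u \<longleftrightarrow> y $ 1 * fst u + y $ 2 * snd u = n * fst u \<and> y $ 3 * fst u - y $ 1 * snd u = n * snd u"

definition ivec :: "int \<times> int \<Rightarrow> int^3" where
  "ivec u = vector [- (fst u * snd u), (fst u)^2, - ((snd u)^2)]"

definition rvec :: "int^3 \<Rightarrow> real^3" where "rvec y = (\<chi> i. of_int (y $ i))"

lemma rvec_nth [simp]: "rvec y $ i = of_int (y $ i)" by (simp add: rvec_def)

text \<open>\<open>k\<close> is the value of the linear functional that sends the nilpotent matrix
  of (a, b) to (s a + t b)^2 = 1. The ring is general because the lemma serves twice: over the
  integers with Bezout coefficients, and over the reals with s = a / (a^2 + b^2) and t = b / (a^2 +
  b^2).\<close>

lemma kernel_multiple:
  fixes a b s t y1 y2 y3 :: "'a::comm_ring_1"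
  assumes st: "s * a + t * b = 1" and e: "y1 * a + y2 * b = 0" "y3 * a - y1 * b = 0"
  defines "k \<equiv> s^2 * y2 - 2 * s * t * y1 - t^2 * y3"
  shows "y1 = - (a * b) * k" "y2 = a^2 * k" "y3 = - (b^2) * k"
proof -
  have e': "y2 * b = - (y1 * a)" "y3 * a = y1 * b" using e by (simp_all add: eq_neg_iff_add_eq_0 add.commute)
  have one: "s^2 * a^2 + 2 * s * t * a * b + t^2 * b^2 = 1"
  proof -
    have "(s * a + t * b)^2 = 1" by (simp add: st)
    then show ?thesis by (simp add: power2_eq_square algebra_simps)
  qed
  have "- (a * b) * k = - (a * s^2) * (y2 * b) + 2 * s * t * a * b * y1 + b * t^2 * (y3 * a)"
    by (simp add: k_def power2_eq_square algebra_simps)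
  also have "\<dots> = (s^2 * a^2 + 2 * s * t * a * b + t^2 * b^2) * y1"
    unfolding e' by (simp add: power2_eq_square algebra_simps)
  finally show "y1 = - (a * b) * k" by (simp add: one)
  have "a^2 * k = a^2 * s^2 * y2 - 2 * s * t * a * (y1 * a) - t^2 * a * (y3 * a)"
    by (simp add: k_def power2_eq_square algebra_simps)
  also have "\<dots> = a^2 * s^2 * y2 + 2 * s * t * a * (y2 * b) - t^2 * b * (y1 * a)"
    unfolding e' by (simp add: power2_eq_square algebra_simps)
  also have "\<dots> = a^2 * s^2 * y2 + 2 * s * t * a * (y2 * b) + t^2 * b * (y2 * b)"
    unfolding e'(1) by (simp add: power2_eq_square algebra_simps)
  also have "\<dots> = (s^2 * a^2 + 2 * s * t * a * b + t^2 * b^2) * y2"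
    by (simp add: power2_eq_square algebra_simps)
  finally show "y2 = a^2 * k" by (simp add: one)
  have "- (b^2) * k = - (b * s^2) * (y2 * b) + 2 * s * t * b * (y1 * b) + b^2 * t^2 * y3"
    by (simp add: k_def power2_eq_square algebra_simps)
  also have "\<dots> = s^2 * a * (y1 * b) + 2 * s * t * b * (y1 * b) + b^2 * t^2 * y3"
    unfolding e'(1) by (simp add: power2_eq_square algebra_simps)
  also have "\<dots> = (s^2 * a^2 + 2 * s * t * a * b + t^2 * b^2) * y3"
    unfolding e'(2)[symmetric] by (simp add: power2_eq_square algebra_simps)
  finally show "y3 = - (b^2) * k" by (simp add: one)
qed

text \<open>The lower bound covers negative \<open>\<rho>\<close>, where it is trivial, because it
  is applied with (T - c) / g for small T as well.\<close>

lemma card_int_interval: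
  fixes \<tau> \<rho> Q :: real
  assumes Q: "Q > 0"
  defines "S \<equiv> {k::int. \<bar>\<tau> + of_int k * Q\<bar> \<le> \<rho>}"
  shows "finite S" "real (card S) \<ge> 2 * \<rho> / Q - 1" "\<rho> \<ge> 0 \<Longrightarrow> real (card S) \<le> 2 * \<rho> / Q + 1"
proof -
  define l h where "l = (- \<rho> - \<tau>) / Q" and "h = (\<rho> - \<tau>) / Q"
  have "S = {\<lceil>l\<rceil>..\<lfloor>h\<rfloor>}"
  proof (rule Set.set_eqI)
    fix k :: int
    have "k \<in> S \<longleftrightarrow> l \<le> of_int k \<and> of_int k \<le> h" using Q
      by (auto simp: S_def l_def h_def abs_le_iff field_simps)
    also have "\<dots> \<longleftrightarrow> k \<in> {\<lceil>l\<rceil>..\<lfloor>h\<rfloor>}" by (simp add: ceiling_le_iff le_floor_iff)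
    finally show "k \<in> S \<longleftrightarrow> k \<in> {\<lceil>l\<rceil>..\<lfloor>h\<rfloor>}" .
  qed
  then have c: "card S = nat (\<lfloor>h\<rfloor> - \<lceil>l\<rceil> + 1)" and "finite S" by simp_all
  then show "finite S" by simp
  have hl: "h - l = 2 * \<rho> / Q" using Q by (simp add: h_def l_def diff_divide_distrib[symmetric])
  have b: "of_int \<lfloor>h\<rfloor> - of_int \<lceil>l\<rceil> + 1 \<ge> h - l - 1" "of_int \<lfloor>h\<rfloor> - of_int \<lceil>l\<rceil> + 1 \<le> h - l + 1" by linarith+
  show "real (card S) \<ge> 2 * \<rho> / Q - 1" unfolding c hl[symmetric] using b(1) by linarith
  assume "\<rho> \<ge> 0"
  then have "h - l \<ge> 0" unfolding hl using Q by simp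
  then show "real (card S) \<le> 2 * \<rho> / Q + 1" unfolding c hl[symmetric] using b(2) by linarith
qed

text \<open>Every class modulo \<open>Q\<close> that satisfies the eigenvector equations modulo
  \<open>Q\<close> contains an integral point of the line, so each class counted by
  \<open>eig_weight\<close> contributes a full arithmetic progression.\<close>

lemma eig_solution:
  assumes co: "coprime a b" and c: "Q dvd y $ 1 * a + y $ 2 * b - n * a" "Q dvd y $ 3 * a - y $ 1 * b - n * b"
  obtains z where "eig (y + Q *s z) n (a, b)"
proof -
  obtain s t where st: "s * a + t * b = 1" using bezout_int[of a b] co by (auto simp: coprime_iff_gcd_eq_1)
  obtain e f where e: "y $ 1 * a + y $ 2 * b - n * a = Q * e" and f: "y $ 3 * a - y $ 1 * b - n * b = Q * f"
    using c by (elim dvdE)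
  have one: "s^2 * a^2 + 2 * s * t * a * b + t^2 * b^2 = 1"
  proof -
    have "(s * a + t * b)^2 = 1" by (simp add: st)
    then show ?thesis by (simp add: power2_eq_square algebra_simps)
  qed
  \<comment> \<open>The corrections distribute the terms of 1 = (s a + t b)^2 over the two
    equations.\<close>
  define z1 where "z1 = e * s^2 * a - f * t^2 * b"
  define z2 where "z2 = 2 * e * s * t * a + e * t^2 * b + f * t^2 * a"
  define z3 where "z3 = f * s^2 * a + 2 * f * s * t * b + e * s^2 * b"
  have 1: "z1 * a + z2 * b = e"
  proof -
    have "z1 * a + z2 * b = e * (s^2 * a^2 + 2 * s * t * a * b + t^2 * b^2)"
      by (simp add: z1_def z2_def power2_eq_square algebra_simps)
    then show ?thesis by (simp add: one)
  qed
  have 2: "z3 * a - z1 * b = f"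
  proof -
    have "z3 * a - z1 * b = f * (s^2 * a^2 + 2 * s * t * a * b + t^2 * b^2)"
      by (simp add: z1_def z3_def power2_eq_square algebra_simps)
    then show ?thesis by (simp add: one)
  qed
  have "(y $ 1 + Q * (- z1)) * a + (y $ 2 + Q * (- z2)) * b = y $ 1 * a + y $ 2 * b - Q * (z1 * a + z2 * b)"
    "(y $ 3 + Q * (- z3)) * a - (y $ 1 + Q * (- z1)) * b = y $ 3 * a - y $ 1 * b - Q * (z3 * a - z1 * b)"
    by (simp_all add: algebra_simps)
  then have "eig (y + Q *s vector [- z1, - z2, - z3]) n (a, b)"
    using e f by (simp add: eig_def 1 2 vector_3 del: mult_minus_right)
  then show ?thesis by (rule that)
qed

lemma eig_scaled_ivec: "eig y n u \<Longrightarrow> eig (y + k *s ivec u) n u"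
  by (simp add: eig_def ivec_def vector_3 power2_eq_square algebra_simps)

text \<open>Because u is primitive, the multiple of \<open>ivec u\<close> is an integral combination
  of the coordinates of the difference and inherits their divisibility by \<open>Q\<close>.\<close>

lemma eig_difference:
  assumes "coprime (fst u) (snd u)" "eig y n u" "eig y' n u" "vcong Q y y'"
  shows "\<exists>k. y = y' + (k * Q) *s ivec u"
proof -
  obtain s t where st: "s * fst u + t * snd u = 1"
    using bezout_int[of "fst u" "snd u"] assms(1) by (auto simp: coprime_iff_gcd_eq_1)
  define d where "d = y - y'"
  have d: "d $ 1 * fst u + d $ 2 * snd u = 0" "d $ 3 * fst u - d $ 1 * snd u = 0"
    using assms(2,3) by (simp_all add: eig_def d_def algebra_simps)
  define k where "k = s^2 * d $ 2 - 2 * s * t * d $ 1 - t^2 * d $ 3"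
  have "Q dvd d $ i" for i using assms(4) by (simp add: d_def vcong_def)
  then have "Q dvd k" unfolding k_def by (intro dvd_diff dvd_mult) auto
  then obtain k' where k': "k = k' * Q" by (metis dvdE mult.commute)
  have "d = k *s ivec u" using kernel_multiple[OF st d] unfolding k_def[symmetric]
    by (simp add: vec_eq_iff forall_3 ivec_def vector_3 mult.commute)
  then have "y = y' + (k' * Q) *s ivec u" by (simp add: d_def k' algebra_simps)
  then show ?thesis by blast
qed

text \<open>For primitive u this is the number of classes modulo \<open>Q\<close> inside
  \<open>L\<close> that the line of u meets. It depends only on u modulo \<open>Q\<close>.\<close>

definition eig_weight :: "(int^3) set \<Rightarrow> int \<Rightarrow> int \<Rightarrow> int \<times> int \<Rightarrow> nat" where
  "eig_weight L n Q u = card {\<beta> \<in> box3 Q. \<beta> \<in> L \<and>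
     Q dvd \<beta> $ 1 * fst u + \<beta> $ 2 * snd u - n * fst u \<and> Q dvd \<beta> $ 3 * fst u - \<beta> $ 1 * snd u - n * snd u}"

context vec_norm begin

lemma finite_norm_le: "finite {y. N (rvec y) \<le> T}"
proof -
  obtain c C where c: "c > 0" "\<And>x i. c * \<bar>x $ i\<bar> \<le> N x" using norm_components by metis
  define M where "M = \<lfloor>T / c\<rfloor> + 1"
  have "{y. N (rvec y) \<le> T} \<subseteq> (\<lambda>x. x - (\<chi> i. M)) ` box3 (2 * M)"
  proof
    fix y assume y: "y \<in> {y. N (rvec y) \<le> T}"
    have "- M \<le> y $ i \<and> y $ i < M" for i
    proof -
      have "c * \<bar>of_int (y $ i)\<bar> \<le> T" using c(2)[of "rvec y" i] y by simp
      then have "\<bar>of_int (y $ i)\<bar> \<le> T / c" using c(1) by (simp add: field_simps)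
      then show ?thesis unfolding M_def by linarith
    qed
    then have "0 \<le> y $ i + M \<and> y $ i + M < 2 * M" for i by (smt (verit))
    then have "y + (\<chi> i. M) \<in> box3 (2 * M)" by (simp add: box3_def)
    then show "y \<in> (\<lambda>x. x - (\<chi> i. M)) ` box3 (2 * M)" by (rule image_eqI[rotated]) simp
  qed
  then show ?thesis by (rule finite_subset) simp
qed

lemma gau_lower_primitive: obtains g0 where "g0 > 0" "\<And>u::int \<times> int. u \<noteq> (0, 0) \<Longrightarrow> g0 \<le> gau (of_int (fst u), of_int (snd u))"
proof -
  obtain c where c: "c > 0" "\<And>i j. c * i^2 \<le> gau (i, j)" "\<And>i j. c * j^2 \<le> gau (i, j)" using gau_lower by metis
  have "c \<le> gau (of_int (fst u), of_int (snd u))" if "u \<noteq> (0, 0)" for u :: "int \<times> int"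
  proof -
    have sq: "1 \<le> (real_of_int x)^2" if "x \<noteq> 0" for x
    proof -
      have "0 < x^2" using that by simp
      then have "1 \<le> x^2" by linarith
      then show ?thesis by (metis of_int_1_le_iff of_int_power)
    qed
    have "fst u \<noteq> 0 \<or> snd u \<noteq> 0" using that by (auto simp: prod_eq_iff)
    then have "c * 1 \<le> c * (of_int (fst u))^2 \<or> c * 1 \<le> c * (of_int (snd u))^2"
      using sq c(1) by (auto intro: mult_left_mono)
    then show ?thesis using c(2)[of "of_int (fst u)" "of_int (snd u)"] c(3)[of "of_int (snd u)" "of_int (fst u)"] by linarith
  qed
  then show ?thesis using c(1) that by blast
qed

text \<open>
  The real points of the line \<open>{y. eig y n u}\<close> are \<open>p + \<tau> evec u\<close>, where \<open>p\<close>, the symmetric matrix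
  with eigenvector \<open>u\<close>, is bounded independently of \<open>u\<close>.
\<close>

lemma eig_line_count:
  fixes n :: int
  assumes n: "n > 0"
  obtains C where "C > 0"
    "\<And>Q u y0 T. Q > 0 \<Longrightarrow> coprime (fst u) (snd u) \<Longrightarrow> eig y0 n u \<Longrightarrow> T \<ge> 0 \<Longrightarrow>
       \<bar>real (card {y. vcong Q y y0 \<and> eig y n u \<and> N (rvec y) \<le> T}) -
         2 * T / (of_int Q * gau (of_int (fst u), of_int (snd u)))\<bar> \<le> C"
proof -
  obtain c1 C1 where C1: "C1 > 0" "\<And>x m. (\<And>i. \<bar>x $ i\<bar> \<le> m) \<Longrightarrow> N x \<le> C1 * m" using norm_components by metis
  obtain g0 where g0: "g0 > 0" "\<And>u::int \<times> int. u \<noteq> (0, 0) \<Longrightarrow> g0 \<le> gau (of_int (fst u), of_int (snd u))"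
    using gau_lower_primitive by metis
  define c where "c = C1 * of_int n"
  have c0: "c > 0" using C1 n by (simp add: c_def)
  have "\<bar>real (card {y. vcong Q y y0 \<and> eig y n u \<and> N (rvec y) \<le> T}) -
         2 * T / (of_int Q * gau (of_int (fst u), of_int (snd u)))\<bar> \<le> 1 + 2 * c / g0"
    if Q: "Q > 0" and co: "coprime (fst u) (snd u)" and y0: "eig y0 n u" and T: "T \<ge> 0" for Q u y0 T
  proof -
    define a b where "a = real_of_int (fst u)" and "b = real_of_int (snd u)"
    define g where "g = gau (a, b)"
    have u0: "u \<noteq> (0, 0)" using co by auto
    have g: "g \<ge> g0" unfolding g_def a_def b_def by (rule g0(2)[OF u0])
    define r where "r = a^2 + b^2"
    have "a \<noteq> 0 \<or> b \<noteq> 0" using u0 by (auto simp: a_def b_def prod_eq_iff)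
    then have r: "r > 0" unfolding r_def by (simp add: sum_power2_gt_zero_iff)
    \<comment> \<open>n times the reflection in the line of u; its entries are at most n in absolute
      value, whatever u is.\<close>
    define p :: "real^3" where "p = vector [of_int n * (a^2 - b^2) / r, of_int n * (2 * a * b) / r, of_int n * (2 * a * b) / r]"
    have Np: "N p \<le> c" unfolding c_def
    proof (rule C1(2))
      fix i :: 3
      have "\<bar>a^2 - b^2\<bar> \<le> r" unfolding r_def by (simp add: abs_le_iff)
      moreover have "\<bar>2 * a * b\<bar> \<le> r" using sum_squares_bound[of a b] sum_squares_bound[of a "-b"]
        unfolding r_def by (simp add: abs_le_iff)
      ultimately have "\<bar>of_int n * (a^2 - b^2) / r\<bar> \<le> of_int n" "\<bar>of_int n * (2 * a * b) / r\<bar> \<le> of_int n"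
        using r n by (simp_all add: abs_mult divide_le_eq)
      then show "\<bar>p $ i\<bar> \<le> of_int n" using exhaust_3[of i] by (auto simp: p_def vector_3)
    qed
    define d where "d = rvec y0 - p"
    have p1: "p $ 1 * a + p $ 2 * b = of_int n * a"
    proof -
      have "p $ 1 * a + p $ 2 * b = (of_int n * (a^2 - b^2) * a + of_int n * (2 * a * b) * b) / r"
        by (simp add: p_def vector_3 add_divide_distrib)
      also have "of_int n * (a^2 - b^2) * a + of_int n * (2 * a * b) * b = of_int n * a * r"
        by (simp add: r_def power2_eq_square algebra_simps)
      finally show ?thesis using r by simp
    qed
    have p2: "p $ 3 * a - p $ 1 * b = of_int n * b"
    proof -
      have "p $ 3 * a - p $ 1 * b = (of_int n * (2 * a * b) * a - of_int n * (a^2 - b^2) * b) / r"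
        by (simp add: p_def vector_3 diff_divide_distrib)
      also have "of_int n * (2 * a * b) * a - of_int n * (a^2 - b^2) * b = of_int n * b * r"
        by (simp add: r_def power2_eq_square algebra_simps)
      finally show ?thesis using r by simp
    qed
    have e0: "of_int (y0 $ 1) * a + of_int (y0 $ 2) * b = of_int n * a" "of_int (y0 $ 3) * a - of_int (y0 $ 1) * b = of_int n * b"
      using y0 unfolding eig_def a_def b_def by (metis of_int_add of_int_mult, metis of_int_diff of_int_mult)
    have d: "d $ 1 * a + d $ 2 * b = 0" "d $ 3 * a - d $ 1 * b = 0"
      using p1 p2 e0 by (simp_all add: d_def left_diff_distrib)
    have "(a / r) * a + (b / r) * b = 1"
    proof -
      have "(a / r) * a + (b / r) * b = (a^2 + b^2) / r" by (simp add: add_divide_distrib power2_eq_square)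
      then show ?thesis using r by (simp flip: r_def)
    qed
    from kernel_multiple[OF this d] obtain \<tau> where "d $ 1 = - (a * b) * \<tau>" "d $ 2 = a^2 * \<tau>" "d $ 3 = - (b^2) * \<tau>" by metis
    then have "d = \<tau> *\<^sub>R evec a b" by (simp add: vec_eq_iff forall_3 evec_def vector_3 mult.commute)
    then have y0eq: "rvec y0 = p + \<tau> *\<^sub>R evec a b" by (simp add: d_def algebra_simps)
    have rv: "rvec (y0 + (k * Q) *s ivec u) = p + (\<tau> + of_int k * of_int Q) *\<^sub>R evec a b" for k
    proof -
      have "rvec (y0 + (k * Q) *s ivec u) = rvec y0 + (of_int k * of_int Q) *\<^sub>R evec a b"
        by (simp add: vec_eq_iff forall_3 evec_def ivec_def vector_3 a_def b_def)
      then show ?thesis unfolding y0eq by (simp add: scaleR_add_left)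
    qed
    let ?K = "{k. N (p + (\<tau> + of_int k * of_int Q) *\<^sub>R evec a b) \<le> T}"
    have Ng: "N (x *\<^sub>R evec a b) = \<bar>x\<bar> * g" for x by (simp add: norm_scale g_def gau_def)
    have set_eq: "{y. vcong Q y y0 \<and> eig y n u \<and> N (rvec y) \<le> T} = (\<lambda>k. y0 + (k * Q) *s ivec u) ` ?K"
    proof (intro equalityI subsetI)
      fix y assume y: "y \<in> {y. vcong Q y y0 \<and> eig y n u \<and> N (rvec y) \<le> T}"
      then obtain k where k: "y = y0 + (k * Q) *s ivec u" using eig_difference[OF co _ y0] by blast
      then show "y \<in> (\<lambda>k. y0 + (k * Q) *s ivec u) ` ?K" using y by (auto simp: rv)
    next
      fix y assume "y \<in> (\<lambda>k. y0 + (k * Q) *s ivec u) ` ?K"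
      then obtain k where k: "y = y0 + (k * Q) *s ivec u" "N (p + (\<tau> + of_int k * of_int Q) *\<^sub>R evec a b) \<le> T" by blast
      have "vcong Q y y0" unfolding k(1) by (simp add: vcong_def)
      then show "y \<in> {y. vcong Q y y0 \<and> eig y n u \<and> N (rvec y) \<le> T}"
        using k rv eig_scaled_ivec[OF y0] by simp
    qed
    have "inj (\<lambda>k. y0 + (k * Q) *s ivec u)"
    proof (rule injI)
      fix k k' assume eq: "y0 + (k * Q) *s ivec u = y0 + (k' * Q) *s ivec u"
      have "k * Q * (fst u)^2 = k' * Q * (fst u)^2" "k * Q * (snd u)^2 = k' * Q * (snd u)^2"
        using arg_cong[OF eq, of "\<lambda>v. v $ 2"] arg_cong[OF eq, of "\<lambda>v. v $ 3"]
        by (simp_all add: ivec_def vector_3)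
      moreover have "fst u \<noteq> 0 \<or> snd u \<noteq> 0" using u0 by (auto simp: prod_eq_iff)
      ultimately show "k = k'" using Q by (metis less_irrefl mult_right_cancel power_not_zero)
    qed
    then have card_eq: "card {y. vcong Q y y0 \<and> eig y n u \<and> N (rvec y) \<le> T} = card ?K"
      unfolding set_eq by (rule card_image[OF inj_on_subset]) simp
    have g1: "g > 0" using g g0 by linarith
    have Qr: "real_of_int Q > 0" "real_of_int Q \<ge> 1" using Q by simp_all
    have up: "?K \<subseteq> {k::int. \<bar>\<tau> + of_int k * of_int Q\<bar> \<le> (T + c) / g}"
    proof
      fix k assume k: "k \<in> ?K"
      have "\<bar>\<tau> + of_int k * of_int Q\<bar> * g = N ((\<tau> + of_int k * of_int Q) *\<^sub>R evec a b)" by (simp add: Ng)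
      also have "\<dots> \<le> N (p + (\<tau> + of_int k * of_int Q) *\<^sub>R evec a b) + N (- p)"
        using norm_triangle[of "p + (\<tau> + of_int k * of_int Q) *\<^sub>R evec a b" "- p"] by simp
      also have "\<dots> \<le> T + c" using k Np by (simp add: norm_uminus)
      finally show "k \<in> {k::int. \<bar>\<tau> + of_int k * of_int Q\<bar> \<le> (T + c) / g}" using g1 by (simp add: field_simps)
    qed
    have lo: "{k::int. \<bar>\<tau> + of_int k * of_int Q\<bar> \<le> (T - c) / g} \<subseteq> ?K"
    proof
      fix k assume "k \<in> {k::int. \<bar>\<tau> + of_int k * of_int Q\<bar> \<le> (T - c) / g}"
      then have "\<bar>\<tau> + of_int k * of_int Q\<bar> * g \<le> T - c" using g1 by (simp add: field_simps)
      then have "N p + N ((\<tau> + of_int k * of_int Q) *\<^sub>R evec a b) \<le> T" using Np by (simp add: Ng)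
      then show "k \<in> ?K" using norm_triangle[of p "(\<tau> + of_int k * of_int Q) *\<^sub>R evec a b"] by simp
    qed
    note I1 = card_int_interval[OF Qr(1), where \<tau> = \<tau> and \<rho> = "(T + c) / g"]
    note I2 = card_int_interval[OF Qr(1), where \<tau> = \<tau> and \<rho> = "(T - c) / g"]
    have finK: "finite ?K" using up I1(1) by (rule finite_subset)
    have cg: "2 * c / (of_int Q * g) \<le> 2 * c / g0"
    proof -
      have "1 * g0 \<le> of_int Q * g" using Qr g g0(1) by (intro mult_mono) auto
      then show ?thesis using c0 g0(1) by (intro divide_left_mono) (auto intro!: mult_pos_pos simp: Q g1)
    qed
    have "real (card ?K) \<le> 2 * ((T + c) / g) / of_int Q + 1"
      using card_mono[OF I1(1) up] I1(3) T c0 g1 by (simp add: order_trans[OF of_nat_mono])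
    also have "\<dots> = 2 * T / (of_int Q * g) + 2 * c / (of_int Q * g) + 1"
      by (simp add: add_divide_distrib distrib_left mult.commute)
    finally have 1: "real (card ?K) \<le> 2 * T / (of_int Q * g) + 2 * c / g0 + 1" using cg by linarith
    have "2 * T / (of_int Q * g) - 2 * c / (of_int Q * g) - 1 = 2 * ((T - c) / g) / of_int Q - 1"
      by (simp add: diff_divide_distrib right_diff_distrib mult.commute)
    also have "\<dots> \<le> real (card {k::int. \<bar>\<tau> + of_int k * of_int Q\<bar> \<le> (T - c) / g})" by (rule I2(2))
    also have "\<dots> \<le> real (card ?K)" using card_mono[OF finK lo] by simp
    finally have 2: "2 * T / (of_int Q * g) - 2 * c / g0 - 1 \<le> real (card ?K)" using cg by linarith
    show ?thesis unfolding card_eq a_def[symmetric] b_def[symmetric] g_def[symmetric] using 1 2 by linarith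
  qed
  moreover have "1 + 2 * c / g0 > 0" using c0 g0(1) by (simp add: add_pos_pos)
  ultimately show ?thesis using that by blast
qed

end

section \<open>The two eigenlines of an integral point\<close>

lemma eig_neg: "eig (- y) n u \<longleftrightarrow> eig y (- n) u"
  by (auto simp: eig_def algebra_simps)

lemma eig_uminus: "eig y n (- u) \<longleftrightarrow> eig y n u"
  by (auto simp: eig_def algebra_simps)

lemma eig_qform:
  assumes "eig y n u" "u \<noteq> (0, 0)"
  shows "qform y = n^2"
proof -
  obtain a b where u: "u = (a, b)" by (cases u)
  have e: "y $ 1 * a + y $ 2 * b = n * a" "y $ 3 * a - y $ 1 * b = n * b" using assms by (auto simp: eig_def u)
  have "((y $ 1)^2 + y $ 2 * y $ 3) * a = y $ 1 * (y $ 1 * a + y $ 2 * b) + y $ 2 * (y $ 3 * a - y $ 1 * b)"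
    by (simp add: power2_eq_square algebra_simps)
  also have "\<dots> = y $ 1 * (n * a) + y $ 2 * (n * b)" by (simp only: e)
  also have "\<dots> = n * (y $ 1 * a + y $ 2 * b)" by (simp add: algebra_simps)
  also have "\<dots> = n^2 * a" by (simp only: e power2_eq_square mult.assoc)
  finally have 1: "((y $ 1)^2 + y $ 2 * y $ 3) * a = n^2 * a" .
  have "((y $ 1)^2 + y $ 2 * y $ 3) * b = y $ 3 * (y $ 1 * a + y $ 2 * b) - y $ 1 * (y $ 3 * a - y $ 1 * b)"
    by (simp add: power2_eq_square algebra_simps)
  also have "\<dots> = y $ 3 * (n * a) - y $ 1 * (n * b)" by (simp only: e)
  also have "\<dots> = n * (y $ 3 * a - y $ 1 * b)" by (simp add: algebra_simps)
  also have "\<dots> = n^2 * b" by (simp only: e power2_eq_square mult.assoc)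
  finally have 2: "((y $ 1)^2 + y $ 2 * y $ 3) * b = n^2 * b" .
  show ?thesis using 1 2 assms(2) by (auto simp: qform_def u)
qed

text \<open>Since (y - n)(y + n) = 0, the columns of y + n are eigenvectors for n. If the second
  column vanishes, the first has the entry 2 n.\<close>

lemma eig_exists:
  fixes y :: "int^3"
  assumes q: "qform y = n^2" and n: "n \<noteq> 0"
  obtains u where "coprime (fst u) (snd u)" "eig y n u"
proof -
  obtain a b where ab: "(a, b) \<noteq> (0, 0)" "eig y n (a, b)"
  proof (cases "y $ 2 = 0 \<and> n - y $ 1 = 0")
    case True
    then have "(y $ 1 + n, y $ 3) \<noteq> (0, 0)" "eig y n (y $ 1 + n, y $ 3)" using n
      by (auto simp: eig_def algebra_simps)
    then show ?thesis using that by blast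
  next
    case False
    have "y $ 3 * y $ 2 = n^2 - (y $ 1)^2" using q by (simp add: qform_def algebra_simps)
    then have "eig y n (y $ 2, n - y $ 1)" by (simp add: eig_def power2_eq_square algebra_simps)
    moreover have "(y $ 2, n - y $ 1) \<noteq> (0, 0)" using False by auto
    ultimately show ?thesis using that by blast
  qed
  define d where "d = gcd a b"
  have d: "d \<noteq> 0" using ab(1) by (simp add: d_def)
  obtain a' b' where a': "a = a' * d" "b = b' * d" "coprime a' b'" using gcd_coprime_exists[OF d[unfolded d_def]] unfolding d_def by blast
  have "d * (y $ 1 * a' + y $ 2 * b') = d * (n * a')" "d * (y $ 3 * a' - y $ 1 * b') = d * (n * b')"
    using ab(2) unfolding eig_def a'(1,2) by (simp_all add: algebra_simps)
  then have "eig y n (a', b')" using d by (simp add: eig_def)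
  then show ?thesis using that[of "(a', b')"] a'(3) by simp
qed

text \<open>Cramer's rule for the matrix with eigenvectors u, v and eigenvalues n, -n: the point is
  recovered from its two eigenlines.\<close>

lemma pair_identity:
  assumes u: "eig y n u" and v: "eig y (- n) v"
  defines "D \<equiv> fst u * snd v - snd u * fst v"
  shows "D * y $ 1 = n * (fst u * snd v + snd u * fst v)" "D * y $ 2 = - (2 * n * (fst u * fst v))"
    "D * y $ 3 = 2 * n * (snd u * snd v)"
proof -
  obtain a b c d where uv: "u = (a, b)" "v = (c, d)" by (cases u, cases v)
  have e: "y $ 1 * a + y $ 2 * b = n * a" "y $ 3 * a - y $ 1 * b = n * b"
    "y $ 1 * c + y $ 2 * d = - n * c" "y $ 3 * c - y $ 1 * d = - n * d"
    using u v by (auto simp: eig_def uv)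
  have "D * y $ 1 = d * (y $ 1 * a + y $ 2 * b) - b * (y $ 1 * c + y $ 2 * d)" by (simp add: D_def uv algebra_simps)
  then show "D * y $ 1 = n * (fst u * snd v + snd u * fst v)" unfolding e by (simp add: uv algebra_simps)
  have "D * y $ 2 = a * (y $ 1 * c + y $ 2 * d) - c * (y $ 1 * a + y $ 2 * b)" by (simp add: D_def uv algebra_simps)
  then show "D * y $ 2 = - (2 * n * (fst u * fst v))" unfolding e by (simp add: uv algebra_simps)
  have "D * y $ 3 = d * (y $ 3 * a - y $ 1 * b) - b * (y $ 3 * c - y $ 1 * d)" by (simp add: D_def uv algebra_simps)
  then show "D * y $ 3 = 2 * n * (snd u * snd v)" unfolding e by (simp add: uv algebra_simps)
qed

text \<open>By the preceding identities \<open>D\<close> divides 2 n times each product of a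
  coordinate of u with one of v, and these four products have no common factor because u and v are
  primitive. The bound |D| \<le> 2 n makes the size of y comparable with the product of the sizes of
  u and v.\<close>

lemma pair_determinant:
  assumes n: "n > 0" and u: "eig y n u" "coprime (fst u) (snd u)" and v: "eig y (- n) v" "coprime (fst v) (snd v)"
  defines "D \<equiv> fst u * snd v - snd u * fst v"
  shows "D \<noteq> 0" "D dvd 2 * n"
proof -
  obtain a b c d where uv: "u = (a, b)" "v = (c, d)" by (cases u, cases v)
  note id = pair_identity[OF u(1) v(1), folded D_def, unfolded uv fst_conv snd_conv]
  have D: "D = a * d - b * c" by (simp add: D_def uv)
  show "D \<noteq> 0"
  proof
    assume "D = 0"
    then have "a * d = b * c" "a * d + b * c = 0" "a * c = 0" "b * d = 0" using id n D by auto
    then have z: "a * d = 0" "b * c = 0" "a * c = 0" "b * d = 0" by auto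
    then show False using u(2) v(2) by (auto simp: uv)
  qed
  have "D dvd D * y $ 1 + n * D" "D dvd D * y $ 1 - n * D" "D dvd - (D * y $ 2)" "D dvd D * y $ 3" by simp_all
  moreover have "D * y $ 1 + n * D = 2 * n * (a * d)" "D * y $ 1 - n * D = 2 * n * (b * c)"
    unfolding id by (simp_all add: D algebra_simps)
  ultimately have dv: "D dvd 2 * n * (a * d)" "D dvd 2 * n * (b * c)" "D dvd 2 * n * (a * c)" "D dvd 2 * n * (b * d)"
    unfolding id by simp_all
  obtain s t where st: "s * a + t * b = 1" using bezout_int[of a b] u(2) by (auto simp: coprime_iff_gcd_eq_1 uv)
  obtain s' t' where st': "s' * c + t' * d = 1" using bezout_int[of c d] v(2) by (auto simp: coprime_iff_gcd_eq_1 uv)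
  have "2 * n = 2 * n * ((s * a + t * b) * (s' * c + t' * d))" by (simp add: st st')
  also have "\<dots> = (s * t') * (2 * n * (a * d)) + (t * s') * (2 * n * (b * c)) + (s * s') * (2 * n * (a * c)) + (t * t') * (2 * n * (b * d))"
    by (simp add: algebra_simps)
  finally have eq: "2 * n = (s * t') * (2 * n * (a * d)) + (t * s') * (2 * n * (b * c)) + (s * s') * (2 * n * (a * c)) + (t * t') * (2 * n * (b * d))" .
  have "D dvd (s * t') * (2 * n * (a * d)) + (t * s') * (2 * n * (b * c)) + (s * s') * (2 * n * (a * c)) + (t * t') * (2 * n * (b * d))"
    by (intro dvd_add; rule dvd_mult; rule dv)
  then show "D dvd 2 * n" unfolding eq[symmetric] .
qed

lemma eig_unique:
  assumes n: "n \<noteq> 0" and u: "eig y n u" "coprime (fst u) (snd u)" and v: "eig y n v" "coprime (fst v) (snd v)"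
  shows "v = u \<or> v = - u"
proof -
  obtain a b c d where uv: "u = (a, b)" "v = (c, d)" by (cases u, cases v)
  have e: "y $ 1 * a + y $ 2 * b = n * a" "y $ 3 * a - y $ 1 * b = n * b"
    "y $ 1 * c + y $ 2 * d = n * c" "y $ 3 * c - y $ 1 * d = n * d"
    using u v by (auto simp: eig_def uv)
  have det: "a * d = b * c"
  proof (rule ccontr)
    assume ne: "a * d \<noteq> b * c"
    have "y $ 1 * (a * d - b * c) = d * (y $ 1 * a + y $ 2 * b) - b * (y $ 1 * c + y $ 2 * d)" by (simp add: algebra_simps)
    also have "\<dots> = n * (a * d - b * c)" unfolding e by (simp add: algebra_simps)
    finally have 1: "y $ 1 = n" using ne by simp
    have "y $ 1 * (b * c - a * d) = c * (y $ 3 * a - y $ 1 * b) - a * (y $ 3 * c - y $ 1 * d) + 2 * (y $ 1 * (b * c - a * d))"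
      by (simp add: algebra_simps)
    then have "y $ 1 * (b * c - a * d) = - (n * (b * c - a * d))" unfolding e by (simp add: algebra_simps)
    then have "y $ 1 * (b * c - a * d) = (- n) * (b * c - a * d)" by simp
    then have "y $ 1 = - n" using ne by (subst (asm) mult_cancel_right) auto
    with 1 n show False by simp
  qed
  have "a dvd b * c" using det by (metis dvd_triv_left)
  then have ac: "a dvd c" using u(2) by (simp add: uv coprime_dvd_mult_right_iff)
  have "c dvd a * d" using det by (metis dvd_triv_right)
  then have ca: "c dvd a" using v(2) by (simp add: uv coprime_dvd_mult_left_iff)
  have "b dvd a * d" using det by (metis dvd_triv_left)
  then have bd: "b dvd d" using u(2) by (simp add: uv coprime_commute coprime_dvd_mult_right_iff)
  have "d dvd b * c" using det by (metis dvd_triv_right)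
  then have db: "d dvd b" using v(2) by (simp add: uv coprime_commute coprime_dvd_mult_left_iff)
  have abs: "\<bar>a\<bar> = \<bar>c\<bar>" "\<bar>b\<bar> = \<bar>d\<bar>" by (rule zdvd_antisym_abs[OF ac ca], rule zdvd_antisym_abs[OF bd db])
  consider "c = a" "d = b" | "c = - a" "d = - b" | "c = a" "d = - b" | "c = - a" "d = b"
    using abs by (auto simp: abs_if split: if_splits)
  then show ?thesis
  proof cases
    case 3
    then have "a * b = 0" using det by simp
    then show ?thesis using 3 by (auto simp: uv)
  next
    case 4
    then have "a * b = 0" using det by simp
    then show ?thesis using 4 by (auto simp: uv)
  qed (auto simp: uv)
qed

context vec_norm begin

text \<open>The choice is immaterial, as the primitive eigenvector is unique up to sign and
  \<open>gau\<close> is even.\<close>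

definition line_gauge :: "int \<Rightarrow> int^3 \<Rightarrow> real" where
  "line_gauge n y = (let u = (SOME u. coprime (fst u) (snd u) \<and> eig y n u) in gau (of_int (fst u), of_int (snd u)))"

lemma gau_uminus: "gau (- i, - j) = gau (i, j)" using gau_scale[of "-1" i j] by simp

lemma line_gauge_eq:
  assumes n: "n \<noteq> 0" and u: "eig y n u" "coprime (fst u) (snd u)"
  shows "line_gauge n y = gau (of_int (fst u), of_int (snd u))"
proof -
  define v where "v = (SOME u. coprime (fst u) (snd u) \<and> eig y n u)"
  have "\<exists>u. coprime (fst u) (snd u) \<and> eig y n u" using u by blast
  then have "coprime (fst v) (snd v) \<and> eig y n v" unfolding v_def by (rule someI_ex)
  then have "v = u \<or> v = - u" using eig_unique[OF n u] by blast
  then have "gau (of_int (fst v), of_int (snd v)) = gau (of_int (fst u), of_int (snd u))"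
    by (elim disjE) (simp_all add: gau_uminus)
  then show ?thesis unfolding line_gauge_def Let_def v_def .
qed

text \<open>Let U and V be the maximum norms of the primitive eigenvectors for n and -n. Then
  \<open>pair_identity\<close> and 1 \<le> |D| \<le> 2 n give U V - n \<le> max |y_i| \<le> 2 n U V.
  If the line for n has the smaller gauge, then U^2 is at most U V, hence at most T, up to
  constants; if it has the larger one, the norm of y is at most U^2 up to a constant.\<close>

lemma line_gauge_bounds:
  fixes n :: int
  assumes n: "n > 0"
  obtains C where "C > 0"
    "\<And>y T. qform y = n^2 \<Longrightarrow> N (rvec y) \<le> T \<Longrightarrow> T \<ge> 1 \<Longrightarrow> line_gauge n y \<le> line_gauge (- n) y \<Longrightarrow> line_gauge n y \<le> C * T"
    "\<And>y. qform y = n^2 \<Longrightarrow> line_gauge (- n) y \<le> line_gauge n y \<Longrightarrow> N (rvec y) \<le> C * line_gauge n y"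
proof -
  obtain c C where cC: "c > 0" "C > 0" "\<And>x i. c * \<bar>x $ i\<bar> \<le> N x"
    "\<And>x m. (\<And>i. \<bar>x $ i\<bar> \<le> m) \<Longrightarrow> N x \<le> C * m" using norm_components by metis
  define nr where "nr = real_of_int n"
  have nr: "nr > 0" using n by (simp add: nr_def)
  have main: "\<exists>U V. U \<ge> 0 \<and> V \<ge> 0 \<and> c * U^2 \<le> line_gauge n y \<and> line_gauge n y \<le> C * U^2 \<and>
      c * V^2 \<le> line_gauge (- n) y \<and> line_gauge (- n) y \<le> C * V^2 \<and>
      (\<forall>i. \<bar>real_of_int (y $ i)\<bar> \<le> 2 * nr * (U * V)) \<and>
      (\<forall>m. (\<forall>i. \<bar>real_of_int (y $ i)\<bar> \<le> m) \<longrightarrow> U * V \<le> m + nr)"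
    if q: "qform y = n^2" for y
  proof -
    obtain u where u: "coprime (fst u) (snd u)" "eig y n u" using eig_exists[OF q] n by auto
    have "qform y = (- n)^2" using q by simp
    then obtain v where v: "coprime (fst v) (snd v)" "eig y (- n) v" using eig_exists[of y "- n"] n by auto
    define D where "D = fst u * snd v - snd u * fst v"
    have D: "D \<noteq> 0" "D dvd 2 * n" using pair_determinant[OF n u(2,1) v(2,1)] by (auto simp: D_def)
    define a b c' d where "a = real_of_int (fst u)" and "b = real_of_int (snd u)"
      and "c' = real_of_int (fst v)" and "d = real_of_int (snd v)"
    define Dr where "Dr = real_of_int D"
    define U V where "U = max \<bar>a\<bar> \<bar>b\<bar>" and "V = max \<bar>c'\<bar> \<bar>d\<bar>"
    have id: "Dr * of_int (y $ 1) = nr * (a * d + b * c')" "Dr * of_int (y $ 2) = - (2 * nr * (a * c'))"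
      "Dr * of_int (y $ 3) = 2 * nr * (b * d)"
      using arg_cong[OF pair_identity(1)[OF u(2) v(2)], of real_of_int]
        arg_cong[OF pair_identity(2)[OF u(2) v(2)], of real_of_int]
        arg_cong[OF pair_identity(3)[OF u(2) v(2)], of real_of_int]
      by (simp_all add: Dr_def D_def nr_def a_def b_def c'_def d_def)
    have Dd: "Dr = a * d - b * c'" by (simp add: Dr_def D_def a_def b_def c'_def d_def)
    have D1: "\<bar>Dr\<bar> \<ge> 1" using D(1) unfolding Dr_def by linarith
    have "\<bar>D\<bar> \<le> 2 * n" using zdvd_imp_le[of "\<bar>D\<bar>" "2 * n"] D(2) n by simp
    then have D2: "\<bar>Dr\<bar> \<le> 2 * nr" unfolding Dr_def nr_def by linarith
    have ab: "\<bar>a\<bar> \<le> U" "\<bar>b\<bar> \<le> U" "\<bar>c'\<bar> \<le> V" "\<bar>d\<bar> \<le> V" by (simp_all add: U_def V_def)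
    have U0: "U \<ge> 0" "V \<ge> 0" using ab by linarith+
    have UV: "\<bar>a * c'\<bar> \<le> U * V" "\<bar>a * d\<bar> \<le> U * V" "\<bar>b * c'\<bar> \<le> U * V" "\<bar>b * d\<bar> \<le> U * V"
      unfolding abs_mult by (rule mult_mono; (rule ab U0 abs_ge_zero))+
    have gb: "c * (max \<bar>i\<bar> \<bar>j\<bar>)^2 \<le> gau (i, j) \<and> gau (i, j) \<le> C * (max \<bar>i\<bar> \<bar>j\<bar>)^2" for i j
    proof
      have "c * i^2 \<le> gau (i, j)" "c * j^2 \<le> gau (i, j)"
        using cC(3)[of "evec i j" 2] cC(3)[of "evec i j" 3] by (simp_all add: gau_def evec_def vector_3)
      moreover have "max \<bar>i\<bar> \<bar>j\<bar> = \<bar>i\<bar> \<or> max \<bar>i\<bar> \<bar>j\<bar> = \<bar>j\<bar>" by (simp add: max_def)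
      ultimately show "c * (max \<bar>i\<bar> \<bar>j\<bar>)^2 \<le> gau (i, j)" by (elim disjE) (simp_all only: power2_abs)
      have m: "\<bar>i\<bar> \<le> max \<bar>i\<bar> \<bar>j\<bar>" "\<bar>j\<bar> \<le> max \<bar>i\<bar> \<bar>j\<bar>" by simp_all
      then have m0: "0 \<le> max \<bar>i\<bar> \<bar>j\<bar>" by linarith
      have "\<bar>i\<bar> * \<bar>j\<bar> \<le> (max \<bar>i\<bar> \<bar>j\<bar>)^2" "\<bar>i\<bar> * \<bar>i\<bar> \<le> (max \<bar>i\<bar> \<bar>j\<bar>)^2" "\<bar>j\<bar> * \<bar>j\<bar> \<le> (max \<bar>i\<bar> \<bar>j\<bar>)^2"
        unfolding power2_eq_square by (rule mult_mono; (rule m m0 abs_ge_zero))+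
      moreover have "\<bar>evec i j $ 1\<bar> = \<bar>i\<bar> * \<bar>j\<bar>" "\<bar>evec i j $ 2\<bar> = \<bar>i\<bar> * \<bar>i\<bar>" "\<bar>evec i j $ 3\<bar> = \<bar>j\<bar> * \<bar>j\<bar>"
        by (simp_all add: evec_def vector_3 abs_mult power2_eq_square)
      ultimately have "\<bar>evec i j $ k\<bar> \<le> (max \<bar>i\<bar> \<bar>j\<bar>)^2" for k
        using exhaust_3[of k] by (elim disjE) (simp_all only:)
      then show "gau (i, j) \<le> C * (max \<bar>i\<bar> \<bar>j\<bar>)^2" unfolding gau_def fst_conv snd_conv by (rule cC(4))
    qed
    have lg: "line_gauge n y = gau (a, b)" "line_gauge (- n) y = gau (c', d)"
      using line_gauge_eq[OF _ u(2,1)] line_gauge_eq[OF _ v(2,1)] n by (simp_all add: a_def b_def c'_def d_def)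
    have up: "\<bar>real_of_int (y $ i)\<bar> \<le> 2 * nr * (U * V)" for i
    proof -
      have "\<bar>Dr * of_int (y $ i)\<bar> \<le> 2 * nr * (U * V)"
      proof -
        have "\<bar>a * d + b * c'\<bar> \<le> 2 * (U * V)" using UV by linarith
        then have "nr * \<bar>a * d + b * c'\<bar> \<le> nr * (2 * (U * V))" using nr by (intro mult_left_mono) auto
        then have "\<bar>nr * (a * d + b * c')\<bar> \<le> 2 * nr * (U * V)" using nr by (simp only: abs_mult abs_of_pos mult_ac)
        moreover have "\<bar>- (2 * nr * (a * c'))\<bar> \<le> 2 * nr * (U * V)" "\<bar>2 * nr * (b * d)\<bar> \<le> 2 * nr * (U * V)"
          using UV nr by (simp_all add: abs_mult)
        ultimately show ?thesis using exhaust_3[of i] by (elim disjE) (simp_all only: id)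
      qed
      moreover have "1 * \<bar>of_int (y $ i)\<bar> \<le> \<bar>Dr\<bar> * \<bar>real_of_int (y $ i)\<bar>" using D1 by (intro mult_right_mono) auto
      ultimately show ?thesis by (simp add: abs_mult)
    qed
    have lo: "U * V \<le> m + nr" if m: "\<forall>i. \<bar>real_of_int (y $ i)\<bar> \<le> m" for m
    proof -
      have *: "\<bar>x\<bar> \<le> m + nr" if "2 * nr * x = Dr * z" "\<bar>z\<bar> \<le> m + nr" for x z
      proof -
        have "2 * nr * \<bar>x\<bar> = \<bar>Dr\<bar> * \<bar>z\<bar>" 
        proof -
          have "\<bar>2 * nr * x\<bar> = \<bar>Dr * z\<bar>" by (simp only: that(1))
          then show ?thesis using nr by (simp add: abs_mult)
        qed
        also have "\<dots> \<le> 2 * nr * (m + nr)" using D2 that(2) by (intro mult_mono) auto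
        finally show ?thesis using nr by simp
      qed
      have mi: "\<bar>real_of_int (y $ i)\<bar> \<le> m" for i using m by blast
      have m0: "\<bar>real_of_int (y $ 1) + nr\<bar> \<le> m + nr" "\<bar>real_of_int (y $ 1) - nr\<bar> \<le> m + nr"
        "\<bar>- real_of_int (y $ 2)\<bar> \<le> m + nr" "\<bar>real_of_int (y $ 3)\<bar> \<le> m + nr"
        using mi[of 1] mi[of 2] mi[of 3] nr by linarith+
      have "2 * nr * (a * d) = Dr * (of_int (y $ 1) + nr)" "2 * nr * (b * c') = Dr * (of_int (y $ 1) - nr)"
        "2 * nr * (a * c') = Dr * (- of_int (y $ 2))" "2 * nr * (b * d) = Dr * of_int (y $ 3)"
      proof -
        have "2 * nr * (a * d) = nr * (a * d + b * c') + (a * d - b * c') * nr" by (simp add: algebra_simps)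
        also have "\<dots> = Dr * of_int (y $ 1) + Dr * nr" by (simp only: id(1)[symmetric] Dd[symmetric])
        finally show "2 * nr * (a * d) = Dr * (of_int (y $ 1) + nr)" by (simp only: distrib_left)
        have "2 * nr * (b * c') = nr * (a * d + b * c') - (a * d - b * c') * nr" by (simp add: algebra_simps)
        also have "\<dots> = Dr * of_int (y $ 1) - Dr * nr" by (simp only: id(1)[symmetric] Dd[symmetric])
        finally show "2 * nr * (b * c') = Dr * (of_int (y $ 1) - nr)" by (simp only: right_diff_distrib)
        show "2 * nr * (a * c') = Dr * (- of_int (y $ 2))" "2 * nr * (b * d) = Dr * of_int (y $ 3)"
          by (simp_all only: mult_minus_right id minus_minus)
      qed
      then have "\<bar>a * d\<bar> \<le> m + nr" "\<bar>b * c'\<bar> \<le> m + nr" "\<bar>a * c'\<bar> \<le> m + nr" "\<bar>b * d\<bar> \<le> m + nr"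
        using * m0 by blast+
      moreover have "U = \<bar>a\<bar> \<or> U = \<bar>b\<bar>" "V = \<bar>c'\<bar> \<or> V = \<bar>d\<bar>" by (simp_all add: U_def V_def max_def)
      ultimately show ?thesis by (elim disjE) (simp_all only: abs_mult)
    qed
    have "c * U^2 \<le> line_gauge n y \<and> line_gauge n y \<le> C * U^2" unfolding lg U_def by (rule gb)
    moreover have "c * V^2 \<le> line_gauge (- n) y \<and> line_gauge (- n) y \<le> C * V^2" unfolding lg V_def by (rule gb)
    ultimately show ?thesis using U0 up lo by blast
  qed
  define C' where "C' = C * (1 / c + nr) + 2 * nr * C / c"
  have pos1: "C * (1 / c + nr) > 0" "2 * nr * C / c > 0" using cC(1,2) nr by (simp_all add: add_pos_pos)
  have A: "line_gauge n y \<le> C' * T"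
    if h: "qform y = n^2" "N (rvec y) \<le> T" "T \<ge> 1" "line_gauge n y \<le> line_gauge (- n) y" for y T
  proof -
    obtain U V where UV: "U \<ge> 0" "V \<ge> 0" "line_gauge n y \<le> C * U^2" "line_gauge (- n) y \<le> C * V^2" "c * U^2 \<le> line_gauge n y"
      "\<And>m. (\<forall>i. \<bar>real_of_int (y $ i)\<bar> \<le> m) \<Longrightarrow> U * V \<le> m + nr" using main[OF h(1)] by blast
    have "0 \<le> c * U^2" using cC(1) by simp
    then have g0: "line_gauge n y \<ge> 0" using UV(5) by linarith
    have "\<bar>real_of_int (y $ i)\<bar> \<le> T / c" for i
      using cC(3)[of "rvec y" i] h(2) cC(1) by (simp add: field_simps)
    then have "U * V \<le> T / c + nr" using UV(6) by blast
    also have "\<dots> \<le> (1 / c + nr) * T" using h(3) nr by (simp add: distrib_right)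
    finally have 1: "U * V \<le> (1 / c + nr) * T" .
    have "(line_gauge n y)^2 \<le> line_gauge n y * line_gauge (- n) y"
      unfolding power2_eq_square using h(4) g0 by (intro mult_left_mono)
    also have "\<dots> \<le> (C * U^2) * (C * V^2)"
    proof (rule mult_mono[OF UV(3,4)])
      show "0 \<le> C * U^2" using cC(2) by simp
      show "0 \<le> line_gauge (- n) y" using g0 h(4) by linarith
    qed
    also have "\<dots> = (C * (U * V))^2" by (simp add: power_mult_distrib power2_eq_square algebra_simps)
    finally have "line_gauge n y \<le> C * (U * V)" by (rule power2_le_imp_le) (use UV cC in auto)
    also have "\<dots> \<le> C * ((1 / c + nr) * T)" using 1 cC(2) by simp
    also have "\<dots> = (C * (1 / c + nr)) * T" by simp
    also have "\<dots> \<le> C' * T" using pos1 h(3) by (intro mult_right_mono) (auto simp: C'_def)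
    finally show ?thesis .
  qed
  have B: "N (rvec y) \<le> C' * line_gauge n y"
    if h: "qform y = n^2" "line_gauge (- n) y \<le> line_gauge n y" for y
  proof -
    obtain U V where UV: "U \<ge> 0" "V \<ge> 0" "c * U^2 \<le> line_gauge n y" "c * V^2 \<le> line_gauge (- n) y"
      "\<And>i. \<bar>real_of_int (y $ i)\<bar> \<le> 2 * nr * (U * V)" using main[OF h(1)] by blast
    have "0 \<le> c * U^2" using cC(1) by simp
    then have g0: "line_gauge n y \<ge> 0" using UV(3) by linarith
    have "(c * (U * V))^2 = (c * U^2) * (c * V^2)" by (simp add: power_mult_distrib power2_eq_square algebra_simps)
    also have "\<dots> \<le> line_gauge n y * line_gauge n y"
    proof (rule mult_mono[OF UV(3) order_trans[OF UV(4) h(2)] g0])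
      show "0 \<le> c * V^2" using cC(1) by simp
    qed
    finally have "(c * (U * V))^2 \<le> (line_gauge n y)^2" by (simp add: power2_eq_square)
    then have "c * (U * V) \<le> line_gauge n y" using g0 by (rule power2_le_imp_le)
    then have 1: "U * V \<le> line_gauge n y / c" using cC(1) by (simp add: field_simps)
    have "N (rvec y) \<le> C * (2 * nr * (U * V))" by (rule cC(4)) (use UV(5) in simp)
    also have "\<dots> \<le> C * (2 * nr * (line_gauge n y / c))" using 1 cC(2) nr by (intro mult_left_mono) auto
    also have "\<dots> = (2 * nr * C / c) * line_gauge n y" by simp
    also have "\<dots> \<le> C' * line_gauge n y" using pos1 g0 by (intro mult_right_mono) (auto simp: C'_def)
    finally show ?thesis .
  qed
  have "C' > 0" using add_pos_pos[OF pos1] unfolding C'_def .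
  show ?thesis
  proof (rule that[of C'])
    show "C' > 0" by fact
  next
    fix y T assume "qform y = n^2" "N (rvec y) \<le> T" "T \<ge> 1" "line_gauge n y \<le> line_gauge (- n) y"
    then show "line_gauge n y \<le> C' * T" by (rule A)
  next
    fix y assume "qform y = n^2" "line_gauge (- n) y \<le> line_gauge n y"
    then show "N (rvec y) \<le> C' * line_gauge n y" by (rule B)
  qed
qed

text \<open>
  Each point is counted through its eigenline for \<open>n\<close>; the points whose eigenline for \<open>- n\<close> is the
  shorter one are obtained from the others by \<open>y \<mapsto> - y\<close>, which gives the factor 2.
\<close>

lemma point_count_asymp:
  fixes n Q :: int and L :: "(int^3) set"
  assumes n: "n > 0" and Q: "Q > 0" and per: "periodic Q (\<lambda>y. y \<in> L)" and sym: "\<And>y. - y \<in> L \<longleftrightarrow> y \<in> L"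
    and Z: "(\<lambda>z. \<Prod>p | prime p \<and> p \<le> z \<and> \<not> int p dvd Q. 1 - 1 / real p ^ 2) \<longlonglongrightarrow> Z"
  shows "((\<lambda>T. real (card {y \<in> L. qform y = n^2 \<and> N (rvec y) \<le> T}) / (T * ln T)) \<longlongrightarrow>
    2 * area * Z * (\<Sum>r | r \<in> {0..<Q} \<times> {0..<Q} \<and> gcd (gcd (fst r) (snd r)) Q = 1. real (eig_weight L n Q r)) / of_int Q ^ 3) at_top"
proof -
  define w where "w = eig_weight L n Q"
  define W where "W = (\<Sum>r | r \<in> {0..<Q} \<times> {0..<Q} \<and> gcd (gcd (fst r) (snd r)) Q = 1. real (w r))"
  define Y where "Y T = {y \<in> L. qform y = n^2 \<and> N (rvec y) \<le> T}" for T
  define lp where "lp y = line_gauge n y" for y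
  define lm where "lm y = line_gauge (- n) y" for y
  define G where "G u = gau (of_int (fst u), of_int (snd u))" for u :: "int \<times> int"
  have n0: "n \<noteq> 0" using n by simp
  obtain C where C: "C > 0" "\<And>Q u y0 T. Q > 0 \<Longrightarrow> coprime (fst u) (snd u) \<Longrightarrow> eig y0 n u \<Longrightarrow> T \<ge> 0 \<Longrightarrow>
       \<bar>real (card {y. vcong Q y y0 \<and> eig y n u \<and> N (rvec y) \<le> T}) - 2 * T / (of_int Q * G u)\<bar> \<le> C"
    unfolding G_def using eig_line_count[OF n] by blast
  obtain K where K: "K > 0"
    "\<And>X. X \<ge> 0 \<Longrightarrow> real (card {(a::int, b::int). (a, b) \<noteq> (0, 0) \<and> gau (of_int a, of_int b) \<le> X}) \<le> K * X"
    using nonzero_count by blast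
  obtain B where B: "B > 0"
    "\<And>y T. qform y = n^2 \<Longrightarrow> N (rvec y) \<le> T \<Longrightarrow> T \<ge> 1 \<Longrightarrow> lp y \<le> lm y \<Longrightarrow> lp y \<le> B * T"
    "\<And>y. qform y = n^2 \<Longrightarrow> lm y \<le> lp y \<Longrightarrow> N (rvec y) \<le> B * lp y"
    unfolding lp_def lm_def using line_gauge_bounds[OF n] by blast
  have finY: "finite (Y T)" for T by (rule finite_subset[OF _ finite_norm_le[of T]]) (auto simp: Y_def)
  have PPeq: "primitive_pairs X = {u. coprime (fst u) (snd u) \<and> G u \<le> X}" for X
    by (auto simp: primitive_pairs_def G_def)
  have finP: "finite (primitive_pairs X)" for X
    by (rule finite_subset[OF _ finite_gau_le[of X]]) (auto simp: primitive_pairs_def)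
  have cardP: "real (card (primitive_pairs X)) \<le> K * X" if "X \<ge> 0" for X
  proof -
    have "primitive_pairs X \<subseteq> {(a::int, b::int). (a, b) \<noteq> (0, 0) \<and> gau (of_int a, of_int b) \<le> X}"
      by (auto simp: primitive_pairs_def)
    moreover have "finite {(a::int, b::int). (a, b) \<noteq> (0, 0) \<and> gau (of_int a, of_int b) \<le> X}"
      by (rule finite_subset[OF _ finite_gau_le[of X]]) auto
    ultimately have "card (primitive_pairs X) \<le> card {(a::int, b::int). (a, b) \<noteq> (0, 0) \<and> gau (of_int a, of_int b) \<le> X}"
      by (rule card_mono[rotated])
    then show ?thesis using K(2)[OF that] by linarith
  qed
  have Gpos: "G u > 0" if "coprime (fst u) (snd u)" for u
    unfolding G_def by (rule gau_pos) (use that in \<open>auto simp: prod_eq_iff\<close>)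
  have line_bound: "finite {y. eig y n u \<and> N (rvec y) \<le> T}" "real (card {y. eig y n u \<and> N (rvec y) \<le> T}) \<le> 2 * T / G u + C"
    if u: "coprime (fst u) (snd u)" and T: "T \<ge> 0" for u T
  proof -
    show "finite {y. eig y n u \<and> N (rvec y) \<le> T}" by (rule finite_subset[OF _ finite_norm_le[of T]]) auto
    show "real (card {y. eig y n u \<and> N (rvec y) \<le> T}) \<le> 2 * T / G u + C"
    proof (cases "\<exists>y0. eig y0 n u")
      case True
      then obtain y0 where "eig y0 n u" by blast
      from C(2)[of 1, OF _ u this T] have "real (card {y. vcong 1 y y0 \<and> eig y n u \<and> N (rvec y) \<le> T}) \<le> 2 * T / G u + C"
        by simp
      then show ?thesis by (simp add: vcong_def)
    next
      case False
      then have "{y. eig y n u \<and> N (rvec y) \<le> T} = {}" by blast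
      then have "card {y. eig y n u \<and> N (rvec y) \<le> T} = 0" by (simp only: card.empty)
      then show ?thesis using T Gpos[OF u] C(1) by simp
    qed
  qed
  \<comment> \<open>Each point lies on the line of exactly two primitive vectors, u and -u.\<close>
  have two: "(\<Sum>u\<in>primitive_pairs X. card {y \<in> A. eig y n u}) = 2 * card {y \<in> A. lp y \<le> X}"
    if A: "finite A" "\<And>y. y \<in> A \<Longrightarrow> qform y = n^2" for A X
  proof -
    have "(\<Sum>u\<in>primitive_pairs X. card {y \<in> A. eig y n u}) = (\<Sum>u\<in>primitive_pairs X. \<Sum>y\<in>A. if eig y n u then 1 else 0)"
      using A(1) by (intro sum.cong refl) (simp add: sum.If_cases Int_def)
    also have "\<dots> = (\<Sum>y\<in>A. \<Sum>u\<in>primitive_pairs X. if eig y n u then 1 else 0)" by (rule sum.swap)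
    also have "\<dots> = (\<Sum>y\<in>A. if lp y \<le> X then 2 else 0)"
    proof (intro sum.cong refl)
      fix y assume "y \<in> A"
      then obtain u where u: "coprime (fst u) (snd u)" "eig y n u" using eig_exists[OF A(2) n0] by blast
      have lpu: "lp y = G v" if "coprime (fst v) (snd v)" "eig y n v" for v
        unfolding lp_def G_def by (rule line_gauge_eq[OF n0 that(2,1)])
      have "{v \<in> primitive_pairs X. eig y n v} = (if lp y \<le> X then {u, - u} else {})"
      proof (cases "lp y \<le> X")
        case True
        have "v \<in> {u, - u}" if "v \<in> primitive_pairs X" "eig y n v" for v
          using eig_unique[OF n0 u(2,1) that(2)] that(1) by (auto simp: PPeq)
        moreover have "coprime (fst (- u)) (snd (- u))" "eig y n (- u)" using u by (simp_all add: eig_uminus)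
        ultimately show ?thesis using True u lpu[OF u] lpu[of "- u"] by (auto simp: PPeq)
      next
        case False
        have "\<not> (v \<in> primitive_pairs X \<and> eig y n v)" for v using lpu[of v] False by (auto simp: PPeq)
        then show ?thesis using False by auto
      qed
      moreover have "u \<noteq> - u"
      proof
        assume "u = - u"
        then have "fst u = - fst u" "snd u = - snd u" by (metis fst_uminus, metis snd_uminus)
        then have "fst u = 0" "snd u = 0" by simp_all
        then show False using u(1) by simp
      qed
      ultimately show "(\<Sum>u\<in>primitive_pairs X. if eig y n u then 1 else 0) = (if lp y \<le> X then 2 else 0)"
        using finP by (simp add: sum.If_cases Int_def)
    qed
    also have "\<dots> = 2 * card {y \<in> A. lp y \<le> X}" using A(1) by (simp add: sum.If_cases Int_def)
    finally show ?thesis .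
  qed
  \<comment> \<open>The line for n is the shorter one but has gauge above T. The gauge is still at
    most B T, so O(T) lines are involved, and each of them carries at most 2 + C points.\<close>
  have far: "real (card {y \<in> Y T. lp y > T \<and> lp y \<le> lm y}) \<le> (2 + C) * (K * (B * T))" if T: "T \<ge> 1" for T
  proof -
    let ?A = "{y \<in> Y T. lp y > T \<and> lp y \<le> lm y}"
    have finA: "finite ?A" using finY by simp
    have "2 * card ?A = 2 * card {y \<in> ?A. lp y \<le> B * T}"
      using B(2) T by (intro arg_cong[where f = "\<lambda>S. 2 * card S"]) (auto simp: Y_def)
    also have "\<dots> = (\<Sum>u\<in>primitive_pairs (B * T). card {y \<in> ?A. eig y n u})"
      by (rule two[symmetric]) (use finA in \<open>auto simp: Y_def\<close>)
    finally have "real (2 * card ?A) = (\<Sum>u\<in>primitive_pairs (B * T). real (card {y \<in> ?A. eig y n u}))" by simp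
    also have "\<dots> \<le> (\<Sum>u\<in>primitive_pairs (B * T). 2 + C)"
    proof (rule sum_mono)
      fix u assume "u \<in> primitive_pairs (B * T)"
      then have u: "coprime (fst u) (snd u)" by (simp add: PPeq)
      show "real (card {y \<in> ?A. eig y n u}) \<le> 2 + C"
      proof (cases "G u > T")
        case True
        have "card {y \<in> ?A. eig y n u} \<le> card {y. eig y n u \<and> N (rvec y) \<le> T}"
          using T by (intro card_mono line_bound(1)[OF u]) (auto simp: Y_def)
        then have "real (card {y \<in> ?A. eig y n u}) \<le> 2 * T / G u + C" using line_bound(2)[OF u, of T] T by linarith
        moreover have "2 * T / G u \<le> 2" using True T by (simp add: divide_le_eq)
        ultimately show ?thesis by linarith
      next
        case False
        have "{y \<in> ?A. eig y n u} = {}"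
          using line_gauge_eq[OF n0 _ u] False by (auto simp: lp_def G_def)
        then have "card {y \<in> ?A. eig y n u} = 0" by (simp only: card.empty)
        then show ?thesis using C(1) by simp
      qed
    qed
    also have "\<dots> = (2 + C) * real (card (primitive_pairs (B * T)))" by simp
    also have "\<dots> \<le> (2 + C) * (K * (B * T))" using T B(1) C(1) by (intro mult_left_mono cardP) auto
    finally show ?thesis by simp
  qed
  \<comment> \<open>The gauge is at most T but the other line is shorter. Such points on the line of
    u have norm at most B G(u), which leaves boundedly many per line. Together with
    \<open>far\<close> this replaces the comparison of the two lines by the cut-off
    \<open>lp y \<le> T\<close>, at the cost of O(T).\<close>
  have near: "real (card {y \<in> Y T. lp y \<le> T \<and> lm y \<le> lp y}) \<le> (2 * B + C) * (K * T)" if T: "T \<ge> 1" for T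
  proof -
    let ?A = "{y \<in> Y T. lp y \<le> T \<and> lm y \<le> lp y}"
    have finA: "finite ?A" using finY by simp
    have "2 * card ?A = 2 * card {y \<in> ?A. lp y \<le> T}"
      by (intro arg_cong[where f = "\<lambda>S. 2 * card S"]) auto
    also have "\<dots> = (\<Sum>u\<in>primitive_pairs T. card {y \<in> ?A. eig y n u})"
      by (rule two[symmetric]) (use finA in \<open>auto simp: Y_def\<close>)
    finally have "real (2 * card ?A) = (\<Sum>u\<in>primitive_pairs T. real (card {y \<in> ?A. eig y n u}))" by simp
    also have "\<dots> \<le> (\<Sum>u\<in>primitive_pairs T. 2 * B + C)"
    proof (rule sum_mono)
      fix u assume "u \<in> primitive_pairs T"
      then have u: "coprime (fst u) (snd u)" by (simp add: PPeq)
      have BG: "B * G u \<ge> 0" using B(1) Gpos[OF u] by simp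
      have "{y \<in> ?A. eig y n u} \<subseteq> {y. eig y n u \<and> N (rvec y) \<le> B * G u}"
      proof
        fix y assume y: "y \<in> {y \<in> ?A. eig y n u}"
        then have "lp y = G u" using line_gauge_eq[OF n0 _ u, of y] by (simp add: lp_def G_def)
        then show "y \<in> {y. eig y n u \<and> N (rvec y) \<le> B * G u}" using B(3)[of y] y by (simp add: Y_def)
      qed
      then have "card {y \<in> ?A. eig y n u} \<le> card {y. eig y n u \<and> N (rvec y) \<le> B * G u}"
        by (rule card_mono[OF line_bound(1)[OF u BG]])
      then have "real (card {y \<in> ?A. eig y n u}) \<le> 2 * (B * G u) / G u + C" using line_bound(2)[OF u BG] by linarith
      then show "real (card {y \<in> ?A. eig y n u}) \<le> 2 * B + C" using Gpos[OF u] by simp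
    qed
    also have "\<dots> = (2 * B + C) * real (card (primitive_pairs T))" by simp
    also have "\<dots> \<le> (2 * B + C) * (K * T)" using T B(1) C(1) by (intro mult_left_mono cardP) auto
    finally show ?thesis by simp
  qed
  define E where "E = (2 + C) * (K * B) + (2 * B + C) * K"
  define M where "M T = card {y \<in> Y T. lp y \<le> T}" for T
  have half: "\<bar>real (card {y \<in> Y T. P y}) - real (M T)\<bar> \<le> E * T"
    if T: "T \<ge> 1" and P: "\<And>y. P y \<Longrightarrow> lp y \<le> lm y" "\<And>y. \<not> P y \<Longrightarrow> lm y \<le> lp y" for T P
  proof -
    let ?F = "{y \<in> Y T. lp y > T \<and> lp y \<le> lm y}" and ?N = "{y \<in> Y T. lp y \<le> T \<and> lm y \<le> lp y}"
    have "card {y \<in> Y T. P y} \<le> card ({y \<in> Y T. lp y \<le> T} \<union> ?F)"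
      by (rule card_mono) (use finY P(1) in auto)
    also have "\<dots> \<le> M T + card ?F" unfolding M_def by (rule card_Un_le)
    finally have 1: "real (card {y \<in> Y T. P y}) \<le> real (M T) + real (card ?F)" by linarith
    have "M T \<le> card ({y \<in> Y T. P y} \<union> ?N)" unfolding M_def
      by (rule card_mono) (use finY P(2) in auto)
    also have "\<dots> \<le> card {y \<in> Y T. P y} + card ?N" by (rule card_Un_le)
    finally have 2: "real (M T) \<le> real (card {y \<in> Y T. P y}) + real (card ?N)" by linarith
    have E: "E * T = (2 + C) * (K * (B * T)) + (2 * B + C) * (K * T)" by (simp add: E_def algebra_simps)
    have "(2 + C) * (K * (B * T)) \<ge> 0" "(2 * B + C) * (K * T) \<ge> 0" using T B(1) C(1) K(1) by simp_all
    then show ?thesis using 1 2 far[OF T] near[OF T] unfolding E by linarith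
  qed
  have Ymain: "\<bar>real (card (Y T)) - 2 * real (M T)\<bar> \<le> 2 * E * T" if T: "T \<ge> 1" for T
  proof -
    have "Y T = {y \<in> Y T. lp y \<le> lm y} \<union> {y \<in> Y T. lm y < lp y}" by auto
    moreover have "{y \<in> Y T. lp y \<le> lm y} \<inter> {y \<in> Y T. lm y < lp y} = {}" by auto
    ultimately have "card (Y T) = card {y \<in> Y T. lp y \<le> lm y} + card {y \<in> Y T. lm y < lp y}"
      using card_Un_disjoint[of "{y \<in> Y T. lp y \<le> lm y}" "{y \<in> Y T. lm y < lp y}"] finY by simp
    also have "card {y \<in> Y T. lm y < lp y} = card {y \<in> Y T. lp y < lm y}"
    proof (rule bij_betw_same_card)
      have neg: "lp (- y) = lm y" "lm (- y) = lp y" for y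
        by (simp_all add: lp_def lm_def line_gauge_def eig_neg)
      have rn: "rvec (- y) = - rvec y" for y by (simp add: vec_eq_iff)
      have Yneg: "- y \<in> Y T \<longleftrightarrow> y \<in> Y T" for y by (simp add: Y_def sym qform_def rn norm_uminus)
      show "bij_betw uminus {y \<in> Y T. lm y < lp y} {y \<in> Y T. lp y < lm y}"
        by (rule bij_betw_byWitness[where f' = uminus]) (auto simp: neg Yneg)
    qed
    finally have c: "card (Y T) = card {y \<in> Y T. lp y \<le> lm y} + card {y \<in> Y T. lp y < lm y}" .
    have "\<bar>real (card {y \<in> Y T. lp y \<le> lm y}) - real (M T)\<bar> \<le> E * T" "\<bar>real (card {y \<in> Y T. lp y < lm y}) - real (M T)\<bar> \<le> E * T"
      by (rule half[OF T]; linarith)+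
    then show ?thesis unfolding c by linarith
  qed
  \<comment> \<open>The line of u is cut into its residue classes modulo \<open>Q\<close> inside
    \<open>L\<close>; each is a progression to which \<open>eig_line_count\<close> applies.\<close>
  have line_L: "\<bar>real (card {y \<in> Y T. eig y n u}) - real (w u) * (2 * T / (of_int Q * G u))\<bar> \<le> real (nat Q ^ 3) * C"
    if u: "coprime (fst u) (snd u)" and T: "T \<ge> 0" for u T
  proof -
    let ?B = "{\<beta> \<in> box3 Q. \<beta> \<in> L \<and>
     Q dvd \<beta> $ 1 * fst u + \<beta> $ 2 * snd u - n * fst u \<and> Q dvd \<beta> $ 3 * fst u - \<beta> $ 1 * snd u - n * snd u}"
    let ?S = "\<lambda>\<beta>. {y. vcong Q y \<beta> \<and> eig y n u \<and> N (rvec y) \<le> T}"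
    have u0: "u \<noteq> (0, 0)" using u by auto
    have finS: "finite (?S \<beta>)" for \<beta> by (rule finite_subset[OF _ finite_norm_le[of T]]) auto
    have union: "{y \<in> Y T. eig y n u} = (\<Union>\<beta>\<in>?B. ?S \<beta>)"
    proof (intro equalityI subsetI)
      fix y assume y: "y \<in> {y \<in> Y T. eig y n u}"
      have v: "vcong Q (vmod Q y) y" by (rule vmod_cong)
      have "vmod Q y \<in> L" using periodicD[OF per v] y by (simp add: Y_def)
      moreover have "Q dvd vmod Q y $ 1 * fst u + vmod Q y $ 2 * snd u - n * fst u"
        "Q dvd vmod Q y $ 3 * fst u - vmod Q y $ 1 * snd u - n * snd u"
      proof -
        define z where "z = (\<lambda>i. vmod Q y $ i - y $ i)"
        have zz: "Q dvd z i" for i using v by (simp add: z_def vcong_def)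
        have e: "y $ 1 * fst u + y $ 2 * snd u = n * fst u" "y $ 3 * fst u - y $ 1 * snd u = n * snd u"
          using y by (auto simp: eig_def)
        have "vmod Q y $ 1 * fst u + vmod Q y $ 2 * snd u - n * fst u = z 1 * fst u + z 2 * snd u"
          "vmod Q y $ 3 * fst u - vmod Q y $ 1 * snd u - n * snd u = z 3 * fst u - z 1 * snd u"
          unfolding e[symmetric] z_def by (simp_all add: algebra_simps)
        then show "Q dvd vmod Q y $ 1 * fst u + vmod Q y $ 2 * snd u - n * fst u"
          "Q dvd vmod Q y $ 3 * fst u - vmod Q y $ 1 * snd u - n * snd u"
          using zz by (simp_all add: dvd_add dvd_diff)
      qed
      ultimately have "vmod Q y \<in> ?B" using vmod_in_box3[OF Q] by simp
      moreover have "y \<in> ?S (vmod Q y)" using y vcong_sym[OF v] by (simp add: Y_def)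
      ultimately show "y \<in> (\<Union>\<beta>\<in>?B. ?S \<beta>)" by blast
    next
      fix y assume "y \<in> (\<Union>\<beta>\<in>?B. ?S \<beta>)"
      then obtain \<beta> where \<beta>: "\<beta> \<in> L" "vcong Q y \<beta>" "eig y n u" "N (rvec y) \<le> T" by blast
      then show "y \<in> {y \<in> Y T. eig y n u}" using periodicD[OF per \<beta>(2)] eig_qform[OF \<beta>(3) u0] by (simp add: Y_def)
    qed
    have "card (\<Union>\<beta>\<in>?B. ?S \<beta>) = (\<Sum>\<beta>\<in>?B. card (?S \<beta>))"
    proof (rule card_UN_disjoint)
      show "\<forall>\<beta>\<in>?B. \<forall>\<beta>'\<in>?B. \<beta> \<noteq> \<beta>' \<longrightarrow> ?S \<beta> \<inter> ?S \<beta>' = {}"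
      proof (intro ballI impI)
        fix \<beta> \<beta>' assume b: "\<beta> \<in> ?B" "\<beta>' \<in> ?B" "\<beta> \<noteq> \<beta>'"
        have "\<not> (vcong Q y \<beta> \<and> vcong Q y \<beta>')" for y
        proof
          assume h: "vcong Q y \<beta> \<and> vcong Q y \<beta>'"
          then have "vcong Q \<beta> \<beta>'" using vcong_trans[OF vcong_sym[OF conjunct1[OF h]] conjunct2[OF h]] by simp
          then have "\<beta> = \<beta>'" using box3_vcong_eq[of \<beta> Q \<beta>'] b(1,2) by simp
          then show False using b(3) by simp
        qed
        then show "?S \<beta> \<inter> ?S \<beta>' = {}" by blast
      qed
    qed (use finS in auto)
    then have card: "real (card {y \<in> Y T. eig y n u}) = (\<Sum>\<beta>\<in>?B. real (card (?S \<beta>)))"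
      unfolding union by (simp only: of_nat_sum)
    have wB: "w u = card ?B" by (simp add: w_def eig_weight_def)
    have each: "\<bar>real (card (?S \<beta>)) - 2 * T / (of_int Q * G u)\<bar> \<le> C" if "\<beta> \<in> ?B" for \<beta>
    proof -
      obtain a b where ab: "u = (a, b)" by (cases u)
      have "coprime a b" "Q dvd \<beta> $ 1 * a + \<beta> $ 2 * b - n * a" "Q dvd \<beta> $ 3 * a - \<beta> $ 1 * b - n * b"
        using that u by (auto simp: ab)
      then obtain z where z: "eig (\<beta> + Q *s z) n (a, b)" by (rule eig_solution)
      define y0 where "y0 = \<beta> + Q *s z"
      have y0: "eig y0 n u" "vcong Q y0 \<beta>" using z by (simp_all add: y0_def ab vcong_add_scaled)
      have "vcong Q y \<beta> \<longleftrightarrow> vcong Q y y0" for y using y0(2) vcong_sym vcong_trans by blast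
      then have "?S \<beta> = {y. vcong Q y y0 \<and> eig y n u \<and> N (rvec y) \<le> T}" by simp
      then show ?thesis using C(2)[OF Q u y0(1) T] by simp
    qed
    have "\<bar>(\<Sum>\<beta>\<in>?B. real (card (?S \<beta>))) - real (card ?B) * (2 * T / (of_int Q * G u))\<bar>
      = \<bar>\<Sum>\<beta>\<in>?B. real (card (?S \<beta>)) - 2 * T / (of_int Q * G u)\<bar>" by (simp add: sum_subtractf)
    also have "\<dots> \<le> (\<Sum>\<beta>\<in>?B. C)" by (rule order_trans[OF sum_abs sum_mono]) (rule each)
    also have "\<dots> = real (card ?B) * C" by simp
    also have "\<dots> \<le> real (nat Q ^ 3) * C"
    proof -
      have "card ?B \<le> card (box3 Q)" by (rule card_mono) auto
      then show ?thesis using C(1) by (intro mult_right_mono of_nat_mono) (auto simp: card_box3)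
    qed
    finally show ?thesis unfolding card wB .
  qed
  define S where "S T = (\<Sum>u\<in>primitive_pairs T. real (w u) / G u)" for T
  \<comment> \<open>The factor 2 from u and -u equals the factor 2 from the symmetry of y and -y, so
    the sum over primitive vectors directly approximates the full count.\<close>
  have M2: "\<bar>2 * real (M T) - 2 * T / of_int Q * S T\<bar> \<le> real (nat Q ^ 3) * C * (K * T)" if T: "T \<ge> 1" for T
  proof -
    have "2 * M T = (\<Sum>u\<in>primitive_pairs T. card {y \<in> Y T. eig y n u})"
      unfolding M_def by (rule two[symmetric]) (use finY in \<open>auto simp: Y_def\<close>)
    then have "2 * real (M T) = (\<Sum>u\<in>primitive_pairs T. real (card {y \<in> Y T. eig y n u}))" 
      by (simp only: of_nat_sum[symmetric] of_nat_mult[symmetric] of_nat_numeral[symmetric, where 'a = real])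
    moreover have "2 * T / of_int Q * S T = (\<Sum>u\<in>primitive_pairs T. real (w u) * (2 * T / (of_int Q * G u)))"
      unfolding S_def sum_distrib_left by (intro sum.cong refl) simp
    ultimately have "\<bar>2 * real (M T) - 2 * T / of_int Q * S T\<bar> =
      \<bar>\<Sum>u\<in>primitive_pairs T. real (card {y \<in> Y T. eig y n u}) - real (w u) * (2 * T / (of_int Q * G u))\<bar>"
      by (simp add: sum_subtractf)
    also have "\<dots> \<le> (\<Sum>u\<in>primitive_pairs T. real (nat Q ^ 3) * C)"
      by (rule order_trans[OF sum_abs sum_mono], rule line_L) (use T in \<open>auto simp: PPeq\<close>)
    also have "\<dots> = real (nat Q ^ 3) * C * real (card (primitive_pairs T))" by simp
    also have "\<dots> \<le> real (nat Q ^ 3) * C * (K * T)" using T C(1) by (intro mult_left_mono cardP) auto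
    finally show ?thesis .
  qed
  define E' where "E' = 2 * E + real (nat Q ^ 3) * C * K"
  have total: "\<bar>real (card (Y T)) - 2 * T / of_int Q * S T\<bar> \<le> E' * T" if T: "T \<ge> 1" for T
  proof -
    have "E' * T = 2 * E * T + real (nat Q ^ 3) * C * (K * T)" by (simp add: E'_def algebra_simps)
    then show ?thesis using Ymain[OF T] M2[OF T] by linarith
  qed
  have Slim: "((\<lambda>T. S T / ln T) \<longlongrightarrow> area / of_int Q ^ 2 * Z * W) at_top"
    unfolding S_def W_def G_def
  proof (rule primitive_log_sum[OF Q _ _ Z])
    fix a b
    have "Q dvd x * a + y * b - n * a \<longleftrightarrow> Q dvd x * (a mod Q) + y * (b mod Q) - n * (a mod Q)" for x y n a b :: int
    proof -
      have eq: "x * a + y * b - n * a = x * (a mod Q) + y * (b mod Q) - n * (a mod Q) + (x * (a div Q) + y * (b div Q) - n * (a div Q)) * Q"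
        by (simp add: minus_mult_div_eq_mod[symmetric] algebra_simps)
      show ?thesis by (subst eq) (rule dvd_add_times_triv_right_iff)
    qed
    moreover have "Q dvd x * a - y * b - n * b \<longleftrightarrow> Q dvd x * (a mod Q) - y * (b mod Q) - n * (b mod Q)" for x y n a b :: int
    proof -
      have eq: "x * a - y * b - n * b = x * (a mod Q) - y * (b mod Q) - n * (b mod Q) + (x * (a div Q) - y * (b div Q) - n * (b div Q)) * Q"
        by (simp add: minus_mult_div_eq_mod[symmetric] algebra_simps)
      show ?thesis by (subst eq) (rule dvd_add_times_triv_right_iff)
    qed
    ultimately show "real (w (a, b)) = real (w (a mod Q, b mod Q))" by (simp add: w_def eig_weight_def)
  qed simp
  have "((\<lambda>T. 2 / of_int Q * (S T / ln T)) \<longlongrightarrow> 2 / of_int Q * (area / of_int Q ^ 2 * Z * W)) at_top"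
    by (intro tendsto_mult tendsto_const Slim)
  moreover have "((\<lambda>T. real (card (Y T)) / (T * ln T) - 2 / of_int Q * (S T / ln T)) \<longlongrightarrow> 0) at_top"
  proof (rule Lim_null_comparison)
    show "((\<lambda>T. E' / ln T) \<longlongrightarrow> 0) at_top" by real_asymp
    show "\<forall>\<^sub>F T in at_top. norm (real (card (Y T)) / (T * ln T) - 2 / of_int Q * (S T / ln T)) \<le> E' / ln T"
      using eventually_ge_at_top[of 2]
    proof eventually_elim
      case (elim T)
      have l: "ln T > 0" using elim by simp
      have "real (card (Y T)) / (T * ln T) - 2 / of_int Q * (S T / ln T) = (real (card (Y T)) - 2 * T / of_int Q * S T) / (T * ln T)"
        using elim l by (simp add: diff_divide_distrib)
      then have "norm (real (card (Y T)) / (T * ln T) - 2 / of_int Q * (S T / ln T)) = \<bar>real (card (Y T)) - 2 * T / of_int Q * S T\<bar> / (T * ln T)"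
        using elim l by (simp add: abs_mult)
      also have "\<dots> \<le> E' * T / (T * ln T)" using total[of T] elim l by (intro divide_right_mono) auto
      also have "\<dots> = E' / ln T" using elim by simp
      finally show ?case .
    qed
  qed
  ultimately have "((\<lambda>T. 2 / of_int Q * (S T / ln T) + (real (card (Y T)) / (T * ln T) - 2 / of_int Q * (S T / ln T))) \<longlongrightarrow>
    2 / of_int Q * (area / of_int Q ^ 2 * Z * W) + 0) at_top" by (rule tendsto_add)
  moreover have "2 / of_int Q * (area / of_int Q ^ 2 * Z * W) + 0 = 2 * area * Z * W / of_int Q ^ 3"
    using Q by (simp add: power3_eq_cube power2_eq_square)
  ultimately show ?thesis unfolding Y_def W_def w_def by (simp add: mult.commute)
qed

end

section \<open>Volumes on the real quadric\<close>

definition join2 :: "real \<times> real \<Rightarrow> real^2" where "join2 p = vector [fst p, snd p]"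

lemma join2_nth [simp]: "join2 p $ 1 = fst p" "join2 p $ 2 = snd p"
  by (simp_all add: join2_def vector_2)

lemma join2_measurable: "join2 \<in> borel_measurable borel"
proof (rule borel_measurable_continuous_onI)
  have eq: "join2 = (\<lambda>p. fst p *\<^sub>R axis 1 1 + snd p *\<^sub>R axis 2 1)"
    by (rule ext) (simp add: vec_eq_iff forall_2 axis_def)
  show "continuous_on UNIV join2" unfolding eq by (intro continuous_intros)
qed

lemma distr_join2: "distr lborel borel join2 = lborel"
proof (rule lborel_eqI[symmetric])
  fix l u :: "real^2"
  assume "\<And>b. b \<in> Basis \<Longrightarrow> l \<bullet> b \<le> u \<bullet> b"
  then have le: "l $ i \<le> u $ i" for i
    by (metis axis_in_Basis_iff Basis_real_def cart_eq_inner_axis insertI1)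
  have "join2 -` box l u = box (l $ 1) (u $ 1) \<times> box (l $ 2) (u $ 2)"
    by (auto simp: mem_box_cart forall_2)
  then have "emeasure (distr lborel borel join2) (box l u)
     = emeasure (lborel \<Otimes>\<^sub>M lborel) (box (l $ 1) (u $ 1) \<times> box (l $ 2) (u $ 2))"
    using join2_measurable by (subst emeasure_distr) (auto simp: lborel_prod)
  also have "\<dots> = emeasure lborel (box (l $ 1) (u $ 1)) * emeasure lborel (box (l $ 2) (u $ 2))"
    by (rule lborel.emeasure_pair_measure_Times) auto
  also have "\<dots> = ennreal (u $ 1 - l $ 1) * ennreal (u $ 2 - l $ 2)" by (simp add: le)
  also have "\<dots> = ennreal ((u $ 1 - l $ 1) * (u $ 2 - l $ 2))"
    by (rule ennreal_mult[symmetric]) (simp_all add: le)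
  also have "(u $ 1 - l $ 1) * (u $ 2 - l $ 2) = (\<Prod>b\<in>Basis. (u - l) \<bullet> b)"
    unfolding prod_Basis_vec UNIV_2 by (simp add: inner_axis)
  finally show "emeasure (distr lborel borel join2) (box l u) = ennreal (\<Prod>b\<in>Basis. (u - l) \<bullet> b)" .
qed simp

lemma nn_integral_join2:
  assumes F: "F \<in> borel_measurable borel"
  shows "(\<integral>\<^sup>+v. F v \<partial>(lborel :: (real^2) measure)) = (\<integral>\<^sup>+t. \<integral>\<^sup>+s. F (join2 (t, s)) \<partial>lborel \<partial>lborel)"
proof -
  have "(\<integral>\<^sup>+v. F v \<partial>lborel) = (\<integral>\<^sup>+p. F (join2 p) \<partial>lborel)"
    by (subst distr_join2[symmetric], subst nn_integral_distr) (use join2_measurable F in auto)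
  also have "\<dots> = (\<integral>\<^sup>+p. F (join2 p) \<partial>(lborel \<Otimes>\<^sub>M lborel))" by (simp add: lborel_prod)
  also have "\<dots> = (\<integral>\<^sup>+t. \<integral>\<^sup>+s. F (join2 (t, s)) \<partial>lborel \<partial>lborel)"
    by (rule lborel.nn_integral_fst[symmetric])
       (use measurable_compose[OF join2_measurable F] in \<open>simp add: lborel_prod\<close>)
  finally show ?thesis .
qed

text \<open>The matrix with eigenvector \<open>(1, t)\<close> for the eigenvalue \<open>n\<close> and upper right entry \<open>s\<close>.\<close>

definition chart :: "real \<Rightarrow> real^2 \<Rightarrow> real^3" where
  "chart n v = vector [n - v $ 1 * v $ 2, v $ 2, 2 * n * v $ 1 - (v $ 1)^2 * v $ 2]"

definition chart_deriv :: "real \<Rightarrow> real^2 \<Rightarrow> real^2 \<Rightarrow> real^3" where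
  "chart_deriv n v h = vector [- (v $ 1 * h $ 2 + h $ 1 * v $ 2), h $ 2,
     2 * n * h $ 1 - (2 * v $ 1 * h $ 1 * v $ 2 + (v $ 1)^2 * h $ 2)]"

lemma vector3_axis: "(vector [a, b, c] :: real^3) = a *\<^sub>R axis 1 1 + b *\<^sub>R axis 2 1 + c *\<^sub>R axis 3 1"
  by (simp add: vec_eq_iff forall_3 vector_3 axis_def)

lemma chart_has_derivative: "(chart n has_derivative chart_deriv n v) (at v)"
proof -
  have "((\<lambda>v. (n - v $ 1 * v $ 2) *\<^sub>R axis 1 1 + (v $ 2) *\<^sub>R axis 2 1 +
      (2 * n * v $ 1 - (v $ 1)^2 * v $ 2) *\<^sub>R (axis 3 1 :: real^3)) has_derivative
    (\<lambda>h. (- (v $ 1 * h $ 2 + h $ 1 * v $ 2)) *\<^sub>R axis 1 1 + (h $ 2) *\<^sub>R axis 2 1 +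
      (2 * n * h $ 1 - (2 * v $ 1 * h $ 1 * v $ 2 + (v $ 1)^2 * h $ 2)) *\<^sub>R (axis 3 1 :: real^3))) (at v)"
    by (auto intro!: derivative_eq_intros bounded_linear_imp_has_derivative[OF bounded_linear_vec_nth]
        simp: fun_eq_iff algebra_simps)
  then show ?thesis unfolding chart_def[abs_def] chart_deriv_def[abs_def] vector3_axis .
qed

lemma chart_qform: "qform (chart n v) = n^2"
  by (simp add: qform_def chart_def vector_3 power2_eq_square algebra_simps)

text \<open>The slope t solves both t y_2 = n - y_1 and t (n + y_1) = y_3; the least squares
  quotient is one formula that is valid whenever one of the two coefficients is nonzero. Only the
  matrices with eigenvector (0, 1) for n are missed, and they form a line.\<close>

lemma chart_range:
  assumes n: "n \<noteq> 0"
  shows "range (chart n) = {y. qform y = n^2 \<and> (y $ 2 \<noteq> 0 \<or> y $ 1 \<noteq> - n)}"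
    and "homeomorphism UNIV (range (chart n)) (chart n)
      (\<lambda>y. vector [(y $ 2 * (n - y $ 1) + y $ 3 * (n + y $ 1)) / ((y $ 2)^2 + (n + y $ 1)^2), y $ 2])"
proof -
  let ?R = "{y :: real^3. qform y = n^2 \<and> (y $ 2 \<noteq> 0 \<or> y $ 1 \<noteq> - n)}"
  let ?t = "\<lambda>y :: real^3. (y $ 2 * (n - y $ 1) + y $ 3 * (n + y $ 1)) / ((y $ 2)^2 + (n + y $ 1)^2)"
  let ?inv = "\<lambda>y :: real^3. vector [?t y, y $ 2] :: real^2"
  have nz: "(y $ 2)^2 + (n + y $ 1)^2 \<noteq> 0" if "y $ 2 \<noteq> 0 \<or> y $ 1 \<noteq> - n" for y :: "real^3"
    using that by (simp add: sum_power2_eq_zero_iff) (metis add_eq_0_iff)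
  have inR: "chart n v \<in> ?R" for v
    using n chart_qform[of n v] by (auto simp: chart_def vector_3)
  have left: "?inv (chart n v) = v" for v
  proof -
    define y where "y = chart n v"
    have y: "y $ 1 = n - v $ 1 * v $ 2" "y $ 2 = v $ 2" "y $ 3 = v $ 1 * (2 * n - v $ 1 * v $ 2)"
      by (simp_all add: y_def chart_def vector_3 power2_eq_square algebra_simps)
    have "y $ 2 * (n - y $ 1) + y $ 3 * (n + y $ 1) = v $ 1 * ((y $ 2)^2 + (n + y $ 1)^2)"
      unfolding y by (simp add: power2_eq_square algebra_simps)
    moreover have "(y $ 2)^2 + (n + y $ 1)^2 \<noteq> 0" using inR[of v] by (intro nz) (simp add: y_def)
    ultimately have "?t y = v $ 1" by simp
    then show ?thesis by (simp add: y_def[symmetric] y(2) vec_eq_iff forall_2 vector_2)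
  qed
  have right: "chart n (?inv y) = y" if y: "y \<in> ?R" for y
  proof -
    define r where "r = (y $ 2)^2 + (n + y $ 1)^2"
    have r: "r \<noteq> 0" unfolding r_def by (rule nz) (use y in simp)
    have q: "y $ 2 * y $ 3 = n^2 - (y $ 1)^2" using y by (simp add: qform_def algebra_simps)
    define t where "t = ?t y"
    have tr: "t * r = y $ 2 * (n - y $ 1) + y $ 3 * (n + y $ 1)" using r by (simp add: t_def r_def)
    have "(t * y $ 2) * r = y $ 2 * (t * r)" by simp
    also have "\<dots> = (y $ 2)^2 * (n - y $ 1) + (y $ 2 * y $ 3) * (n + y $ 1)"
      unfolding tr by (simp add: power2_eq_square algebra_simps)
    also have "\<dots> = (n - y $ 1) * r" unfolding q by (simp add: r_def power2_eq_square algebra_simps)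
    finally have 1: "t * y $ 2 = n - y $ 1" using r by simp
    have "(t * (n + y $ 1)) * r = (n + y $ 1) * (t * r)" by simp
    also have "\<dots> = y $ 2 * (n^2 - (y $ 1)^2) + y $ 3 * (n + y $ 1)^2"
      unfolding tr by (simp add: power2_eq_square algebra_simps)
    also have "\<dots> = y $ 3 * r" unfolding q[symmetric] by (simp add: r_def power2_eq_square algebra_simps)
    finally have 2: "t * (n + y $ 1) = y $ 3" using r by simp
    have "chart n (vector [t, y $ 2]) = y"
    proof -
      have "2 * n * t - t^2 * y $ 2 = t * (2 * n - t * y $ 2)" by (simp add: power2_eq_square algebra_simps)
      also have "\<dots> = t * (n + y $ 1)" unfolding 1 by (simp add: algebra_simps)
      finally have "2 * n * t - t^2 * y $ 2 = y $ 3" using 2 by simp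
      then show ?thesis by (simp add: chart_def vec_eq_iff forall_3 vector_2 vector_3 1)
    qed
    then show ?thesis by (simp only: t_def)
  qed
  show ran: "range (chart n) = ?R"
  proof (intro equalityI subsetI)
    fix y assume "y \<in> range (chart n)"
    then show "y \<in> ?R" using inR by blast
  next
    fix y assume "y \<in> ?R"
    from right[OF this, symmetric] show "y \<in> range (chart n)" by (rule range_eqI)
  qed
  have c1: "continuous_on UNIV (chart n)"
    by (intro continuous_at_imp_continuous_on ballI has_derivative_continuous[OF chart_has_derivative])
  have inv_eq: "?inv = (\<lambda>y. ?t y *\<^sub>R axis 1 1 + (y $ 2) *\<^sub>R axis 2 1)"
    by (rule ext) (simp add: vec_eq_iff forall_2 vector_2 axis_def)
  have c2: "continuous_on ?R ?inv" unfolding inv_eq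
    by (intro continuous_intros) (use nz in auto)
  show "homeomorphism UNIV (range (chart n)) (chart n) ?inv"
    by (rule homeomorphismI) (use c1 c2 left right ran in auto)
qed

section \<open>The measure of the quadric in the chart\<close>

lemma is_norm_matrix:
  fixes \<Phi> \<Psi> :: "real^3^3"
  assumes N: "is_norm N" and inv: "\<And>y. \<Phi> *v (\<Psi> *v y) = y"
  shows "is_norm (\<lambda>y. N (\<Psi> *v y))"
proof -
  have "\<Psi> *v y = 0 \<longleftrightarrow> y = 0" for y
    by (metis inv matrix_vector_mult_0_right)
  then show ?thesis using N
    by (simp add: is_norm_def matrix_vector_right_distrib scaleR_matrix_vector_assoc[symmetric] matrix_vector_mult_scaleR)
qed

text \<open>By \<open>form\<close>, \<Psi> carries the level set \<open>qform y = n^2\<close> onto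
  the quadric. \<Psi> is kept general because the locale is interpreted once more, with an exchange
  of coordinates, to cover the line that the chart misses.\<close>

locale quadric_chart =
  fixes c :: "int^3^3" and a :: int and n :: real and \<Psi> :: "real^3^3"
    and \<omega> :: form2 and \<mu> :: "(real^3) measure"
  assumes a: "a \<noteq> 0" and n: "n > 0" and det: "det \<Psi> \<noteq> 0"
    and form: "\<And>y. qf c (\<Psi> *v y) * n^2 = of_int a * qform y"
    and gauge_form: "normalized_gauge_form c a \<omega>" and measure: "is_abs_form_measure (quadric c a) \<omega> \<mu>"
begin

definition param :: "real^2 \<Rightarrow> real^3" where "param v = \<Psi> *v chart n v"

lemma quadric_iff: "\<Psi> *v y \<in> quadric c a \<longleftrightarrow> qform y = n^2"
proof -
  have "qf c (\<Psi> *v y) = of_int a \<longleftrightarrow> qf c (\<Psi> *v y) * n^2 = of_int a * n^2" using n by simp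
  then show ?thesis using form[of y] a by (simp add: quadric_def)
qed

definition inv\<Psi> :: "real^3^3" where "inv\<Psi> = matrix_inv \<Psi>"

lemma inv\<Psi>: "inv\<Psi> *v (\<Psi> *v y) = y" "\<Psi> *v (inv\<Psi> *v y) = y"
proof -
  have "invertible \<Psi>" using det by (simp add: invertible_det_nz)
  then have "\<exists>B. \<Psi> ** B = mat 1 \<and> B ** \<Psi> = mat 1" unfolding invertible_def .
  then have "\<Psi> ** inv\<Psi> = mat 1 \<and> inv\<Psi> ** \<Psi> = mat 1" unfolding inv\<Psi>_def matrix_inv_def by (rule someI_ex)
  then show "inv\<Psi> *v (\<Psi> *v y) = y" "\<Psi> *v (inv\<Psi> *v y) = y" by (simp_all add: matrix_vector_mul_assoc)
qed

lemma param_has_derivative: "(param has_derivative (\<lambda>h. \<Psi> *v chart_deriv n v h)) (at v)"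
  unfolding param_def[abs_def]
  by (rule bounded_linear.has_derivative[OF matrix_vector_mul_bounded_linear chart_has_derivative])

lemma param_deriv: "frechet_derivative param (at v) = (\<lambda>h. \<Psi> *v chart_deriv n v h)"
  using frechet_derivative_at[OF param_has_derivative] by simp

lemma param_range: "range param = quadric c a - {\<Psi> *v y |y. y $ 2 = 0 \<and> y $ 1 = - n}"
proof (intro equalityI subsetI)
  fix x assume "x \<in> range param"
  then obtain v where x: "x = \<Psi> *v chart n v" by (auto simp: param_def)
  have "chart n v \<in> range (chart n)" by simp
  then have "qform (chart n v) = n^2" "\<not> (chart n v $ 2 = 0 \<and> chart n v $ 1 = - n)"
    using chart_range(1)[of n] n by auto
  then have q: "qform (chart n v) = n^2" and ne: "\<not> (chart n v $ 2 = 0 \<and> chart n v $ 1 = - n)" by blast+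
  show "x \<in> quadric c a - {\<Psi> *v y |y. y $ 2 = 0 \<and> y $ 1 = - n}"
  proof (rule DiffI)
    show "x \<in> quadric c a" unfolding x quadric_iff by (rule q)
    show "x \<notin> {\<Psi> *v y |y. y $ 2 = 0 \<and> y $ 1 = - n}"
    proof
      assume "x \<in> {\<Psi> *v y |y. y $ 2 = 0 \<and> y $ 1 = - n}"
      then obtain y where y: "x = \<Psi> *v y" "y $ 2 = 0 \<and> y $ 1 = - n" by blast
      have "inv\<Psi> *v (\<Psi> *v y) = inv\<Psi> *v (\<Psi> *v chart n v)" using x y(1) by (simp only:)
      then have "y = chart n v" unfolding inv\<Psi> .
      then show False using y(2) ne by blast
    qed
  qed
next
  fix x assume x: "x \<in> quadric c a - {\<Psi> *v y |y. y $ 2 = 0 \<and> y $ 1 = - n}"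
  define y where "y = inv\<Psi> *v x"
  have xy: "x = \<Psi> *v y" by (simp add: y_def inv\<Psi>)
  have "qform y = n^2" "y $ 2 \<noteq> 0 \<or> y $ 1 \<noteq> - n" using x quadric_iff[of y] unfolding xy by auto
  then have "y \<in> range (chart n)" using chart_range(1)[of n] n by auto
  then show "x \<in> range param" unfolding xy param_def by auto
qed

lemma parametrization_param: "parametrization (quadric c a) UNIV param"
  unfolding parametrization_def
proof (intro conjI ballI allI)
  have closed: "closed {\<Psi> *v y |y. y $ 2 = 0 \<and> y $ 1 = - n}"
  proof -
    have "{\<Psi> *v y |y. y $ 2 = 0 \<and> y $ 1 = - n} = {x. (inv\<Psi> *v x) $ 2 = 0 \<and> (inv\<Psi> *v x) $ 1 = - n}"
      proof (intro equalityI subsetI)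
      fix x assume "x \<in> {x. (inv\<Psi> *v x) $ 2 = 0 \<and> (inv\<Psi> *v x) $ 1 = - n}"
      then show "x \<in> {\<Psi> *v y |y. y $ 2 = 0 \<and> y $ 1 = - n}" using inv\<Psi>(2)[of x, symmetric] by blast
    qed (auto simp: inv\<Psi>)
    moreover have "closed {x. (inv\<Psi> *v x) $ 2 = 0 \<and> (inv\<Psi> *v x) $ 1 = - n}"
      by (intro closed_Collect_conj closed_Collect_eq continuous_intros matrix_vector_mult_linear_continuous_on)
    ultimately show ?thesis by simp
  qed
  show "openin (top_of_set (quadric c a)) (range param)"
    unfolding param_range openin_open Diff_eq using closed open_Compl by blast
  define \<psi> where "\<psi> y = (vector [(y $ 2 * (n - y $ 1) + y $ 3 * (n + y $ 1)) / ((y $ 2)^2 + (n + y $ 1)^2), y $ 2] :: real^2)" for y :: "real^3"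
  have h: "homeomorphism UNIV (range (chart n)) (chart n) \<psi>"
    using chart_range(2)[of n] n unfolding \<psi>_def by simp
  have "homeomorphism UNIV (range param) param (\<lambda>x. \<psi> (inv\<Psi> *v x))"
  proof (rule homeomorphismI)
    show "continuous_on UNIV param"
      by (intro continuous_at_imp_continuous_on ballI has_derivative_continuous[OF param_has_derivative])
    show "continuous_on (range param) (\<lambda>x. \<psi> (inv\<Psi> *v x))"
    proof (rule continuous_on_compose2[of "range (chart n)" \<psi>])
      show "continuous_on (range (chart n)) \<psi>" using h by (simp add: homeomorphism_def)
      show "continuous_on (range param) ((*v) inv\<Psi>)" by (rule matrix_vector_mult_linear_continuous_on)
      show "(*v) inv\<Psi> ` range param \<subseteq> range (chart n)" by (auto simp: param_def inv\<Psi>)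
    qed
    show "\<psi> (inv\<Psi> *v param v) = v" for v
      using homeomorphism_apply1[OF h] by (simp add: param_def inv\<Psi>)
    show "param (\<psi> (inv\<Psi> *v x)) = x" if "x \<in> range param" for x
      using that homeomorphism_apply1[OF h] by (auto simp: param_def inv\<Psi>)
  qed auto
  then show "\<exists>\<psi>. homeomorphism UNIV (range param) param \<psi>" by blast
  show "param differentiable at v" for v using param_has_derivative differentiableI by blast
  show "inj (frechet_derivative param (at v))" for v
  proof (rule injI)
    fix h k assume "frechet_derivative param (at v) h = frechet_derivative param (at v) k"
    then have "inv\<Psi> *v (\<Psi> *v chart_deriv n v h) = inv\<Psi> *v (\<Psi> *v chart_deriv n v k)" unfolding param_deriv by simp
    then have "chart_deriv n v h = chart_deriv n v k" unfolding inv\<Psi> .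
    from arg_cong[OF this, of "\<lambda>y. y $ 1"] arg_cong[OF this, of "\<lambda>y. y $ 2"] arg_cong[OF this, of "\<lambda>y. y $ 3"]
    have e: "v $ 1 * h $ 2 + h $ 1 * v $ 2 = v $ 1 * k $ 2 + k $ 1 * v $ 2" "h $ 2 = k $ 2"
      "2 * n * h $ 1 - (2 * v $ 1 * h $ 1 * v $ 2 + (v $ 1)^2 * h $ 2) =
       2 * n * k $ 1 - (2 * v $ 1 * k $ 1 * v $ 2 + (v $ 1)^2 * k $ 2)"
      by (simp_all add: chart_deriv_def vector_3)
    have 1: "h $ 1 * v $ 2 = k $ 1 * v $ 2" using e(1,2) by simp
    have x: "2 * v $ 1 * h $ 1 * v $ 2 = 2 * v $ 1 * k $ 1 * v $ 2" using 1 by (simp only: mult.assoc)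
    have "2 * n * h $ 1 = 2 * n * k $ 1" using e(3) unfolding x e(2) by linarith
    then have "h $ 1 = k $ 1" using n by simp
    then show "h = k" using e(2) by (simp add: vec_eq_iff forall_2)
  qed
  show "continuous_on UNIV (\<lambda>u. frechet_derivative param (at u) e)" for e
  proof -
    have "continuous_on UNIV (\<lambda>u. chart_deriv n u e)"
      unfolding chart_deriv_def vector3_axis by (intro continuous_intros)
    then show ?thesis unfolding param_deriv
      by (intro continuous_on_compose2[OF matrix_vector_mult_linear_continuous_on[of UNIV \<Psi>]]) auto
  qed
qed simp

lemma vol3_matrix: "vol3 (A *v x) (A *v y) (A *v z) = det A * vol3 x y z"
proof -
  have "vol3 (A *v x) (A *v y) (A *v z) = det (transpose (A ** transpose (vector [x, y, z])))"
    unfolding vol3_def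
    by (rule arg_cong[where f = det]) (simp add: vec_eq_iff forall_3 vector_3 transpose_def matrix_matrix_mult_def matrix_vector_mult_def)
  also have "\<dots> = det A * vol3 x y z" by (simp add: det_transpose det_mul vol3_def)
  finally show ?thesis .
qed

text \<open>Invariance under the group makes the density constant in this chart.\<close>

lemma density:
  "\<bar>\<omega> (param v) (frechet_derivative param (at v) (axis 1 1)) (frechet_derivative param (at v) (axis 2 1))\<bar> = n^2 * \<bar>det \<Psi>\<bar> / \<bar>of_int a\<bar>"
proof -
  have pq: "param v \<in> quadric c a" unfolding param_def quadric_iff by (rule chart_qform)
  have tan: "dqf c (param v) (frechet_derivative param (at v) e) = 0" for e
  proof -
    have "(qf c has_derivative dqf c (param v)) (at (param v))"
      using qf_has_derivative[of c "param v"] by (simp add: dqf_eq[abs_def])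
    from has_derivative_compose[OF param_has_derivative this]
    have "((\<lambda>u. qf c (param u)) has_derivative (\<lambda>d. dqf c (param v) (\<Psi> *v chart_deriv n v d))) (at v)" .
    moreover have "(\<lambda>u. qf c (param u)) = (\<lambda>u. of_int a)"
      using quadric_iff[of "chart n u" for u] chart_qform by (auto simp: param_def quadric_def fun_eq_iff)
    ultimately have "((\<lambda>u. of_int a :: real) has_derivative (\<lambda>d. dqf c (param v) (\<Psi> *v chart_deriv n v d))) (at v)" by simp
    then have "(\<lambda>d. dqf c (param v) (\<Psi> *v chart_deriv n v d)) = (\<lambda>d. 0)"
      using has_derivative_unique has_derivative_const by blast
    then show ?thesis unfolding param_deriv by (simp add: fun_eq_iff)
  qed
  have "vol3 (chart n v) (chart_deriv n v (axis 1 1)) (chart_deriv n v (axis 2 1)) = - 2 * n^2"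
    by (simp add: vol3_eq chart_def chart_deriv_def vector_3 axis_def power2_eq_square algebra_simps)
  then have "vol3 (param v) (frechet_derivative param (at v) (axis 1 1)) (frechet_derivative param (at v) (axis 2 1)) = det \<Psi> * (- 2 * n^2)"
    unfolding param_deriv param_def vol3_matrix by simp
  then have "\<omega> (param v) (frechet_derivative param (at v) (axis 1 1)) (frechet_derivative param (at v) (axis 2 1)) * (2 * of_int a) = det \<Psi> * (- 2 * n^2)"
    using gauge_form_tangent[OF gauge_form pq tan tan] by simp
  then have "\<bar>\<omega> (param v) (frechet_derivative param (at v) (axis 1 1)) (frechet_derivative param (at v) (axis 2 1))\<bar> * (2 * \<bar>of_int a\<bar>) = \<bar>det \<Psi>\<bar> * (2 * n^2)"
    (is "\<bar>?w\<bar> * _ = _")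
  proof -
    assume "?w * (2 * of_int a) = det \<Psi> * (- 2 * n^2)"
    then have "\<bar>?w * (2 * of_int a)\<bar> = \<bar>det \<Psi> * (- 2 * n^2)\<bar>" by (simp only:)
    then show ?thesis by (simp add: abs_mult)
  qed
  then show ?thesis using a by (simp add: field_simps)
qed

lemma emeasure_param:
  assumes E: "E \<in> sets \<mu>" "E \<subseteq> range param"
  shows "emeasure \<mu> E = ennreal (n^2 * \<bar>det \<Psi>\<bar> / \<bar>of_int a\<bar>) * emeasure lborel {v. param v \<in> E}"
proof -
  have "E \<in> sets borel"
  proof -
    have "closed (quadric c a)" unfolding quadric_def by (intro closed_Collect_eq continuous_qf continuous_intros)
    moreover have "E \<in> sets (restrict_space borel (quadric c a))" using E(1) measure by (simp add: is_abs_form_measure_def)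
    ultimately show ?thesis by (simp add: sets_restrict_space_iff)
  qed
  moreover have "param \<in> borel_measurable borel"
    by (intro borel_measurable_continuous_onI continuous_at_imp_continuous_on ballI
        has_derivative_continuous[OF param_has_derivative])
  ultimately have m: "{v. param v \<in> E} \<in> sets lborel" using measurable_sets_borel[of param borel E] by (simp add: vimage_def)
  have "emeasure \<mu> E = (\<integral>\<^sup>+u\<in>{u\<in>UNIV. param u \<in> E}. ennreal \<bar>\<omega> (param u) (frechet_derivative param (at u) (axis 1 1))
                                            (frechet_derivative param (at u) (axis 2 1))\<bar> \<partial>lborel)"
    using measure parametrization_param E unfolding is_abs_form_measure_def by blast
  also have "\<dots> = (\<integral>\<^sup>+u. ennreal (n^2 * \<bar>det \<Psi>\<bar> / \<bar>of_int a\<bar>) * indicator {v. param v \<in> E} u \<partial>lborel)"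
    unfolding density by simp
  also have "\<dots> = ennreal (n^2 * \<bar>det \<Psi>\<bar> / \<bar>of_int a\<bar>) * emeasure lborel {v. param v \<in> E}"
    by (rule nn_integral_cmult_indicator[OF m])
  finally show ?thesis .
qed

text \<open>The measure is known only through parametrizations, so a second chart has to show that
  the missed line is a null set: there it is the line of slope 0 in the parameter plane.\<close>

lemma exceptional_line:
  defines "\<L> \<equiv> {\<Psi> *v y |y. y $ 2 = 0 \<and> y $ 1 = - n}"
  shows "\<L> \<in> sets borel" "\<L> \<subseteq> quadric c a" "\<And>E. E \<in> sets \<mu> \<Longrightarrow> E \<subseteq> \<L> \<Longrightarrow> emeasure \<mu> E = 0"
proof -
  have "\<L> = {x. (inv\<Psi> *v x) $ 2 = 0 \<and> (inv\<Psi> *v x) $ 1 = - n}"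
  proof (intro equalityI subsetI)
    fix x assume "x \<in> {x. (inv\<Psi> *v x) $ 2 = 0 \<and> (inv\<Psi> *v x) $ 1 = - n}"
    then show "x \<in> \<L>" using inv\<Psi>(2)[of x, symmetric] unfolding \<L>_def by blast
  qed (auto simp: inv\<Psi> \<L>_def)
  moreover have "closed {x. (inv\<Psi> *v x) $ 2 = 0 \<and> (inv\<Psi> *v x) $ 1 = - n}"
    by (intro closed_Collect_conj closed_Collect_eq continuous_intros matrix_vector_mult_linear_continuous_on)
  ultimately show "\<L> \<in> sets borel" by simp
  show "\<L> \<subseteq> quadric c a" unfolding \<L>_def by (auto simp: quadric_iff qform_def)
  fix E assume E: "E \<in> sets \<mu>" "E \<subseteq> \<L>"
  \<comment> \<open>Conjugation with the permutation of the two coordinates; the missed eigenvector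
    (0, 1) becomes (1, 0), which has slope 0.\<close>
  define \<sigma> :: "real^3^3" where "\<sigma> = mat33 (-1) 0 0 0 0 1 0 1 0"
  have \<sigma>: "\<sigma> *v y = vector [- (y $ 1), y $ 3, y $ 2]" for y
    by (simp add: \<sigma>_def matrix_vector_mult_def sum_3 vector_3 vec_eq_iff forall_3)
  interpret swapped: quadric_chart c a n "\<Psi> ** \<sigma>" \<omega> \<mu>
  proof
    show "det (\<Psi> ** \<sigma>) \<noteq> 0" using det by (simp add: det_mul) (simp add: \<sigma>_def det_3 vector_3)
    have "qform (\<sigma> *v y) = qform y" for y by (simp add: \<sigma> qform_def vector_3 mult.commute)
    then show "qf c ((\<Psi> ** \<sigma>) *v y) * n^2 = of_int a * qform y" for y
      using form[of "\<sigma> *v y"] by (simp add: matrix_vector_mul_assoc[symmetric])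
  qed (fact a n gauge_form measure)+
  have sw: "swapped.param v = \<Psi> *v (\<sigma> *v chart n v)" for v
    by (simp add: swapped.param_def matrix_vector_mul_assoc[symmetric])
  have sub: "{v. swapped.param v \<in> E} \<subseteq> {v. v $ 1 = 0}"
  proof
    fix v assume "v \<in> {v. swapped.param v \<in> E}"
    then obtain y where y: "\<Psi> *v (\<sigma> *v chart n v) = \<Psi> *v y" "y $ 2 = 0" "y $ 1 = - n"
      using E(2) unfolding \<L>_def sw by blast
    have "inv\<Psi> *v (\<Psi> *v (\<sigma> *v chart n v)) = inv\<Psi> *v (\<Psi> *v y)" using y(1) by (simp only:)
    then have "\<sigma> *v chart n v = y" unfolding inv\<Psi> .
    then have h: "2 * n * v $ 1 - (v $ 1)^2 * v $ 2 = 0" "v $ 1 * v $ 2 = 0"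
      using y(2,3) unfolding \<sigma> by (auto simp: chart_def vector_3)
    then show "v \<in> {v. v $ 1 = 0}" using n by auto
  qed
  have "E \<subseteq> range swapped.param"
  proof
    fix x assume "x \<in> E"
    then obtain y where y: "x = \<Psi> *v y" "y $ 2 = 0" "y $ 1 = - n" using E(2) unfolding \<L>_def by blast
    have "\<sigma> *v chart n (vector [0, y $ 3]) = y"
      by (simp add: \<sigma> chart_def vector_2 vector_3 vec_eq_iff forall_3 y)
    then have "x = swapped.param (vector [0, y $ 3])" by (simp add: sw y(1))
    then show "x \<in> range swapped.param" by (rule range_eqI)
  qed
  note em = swapped.emeasure_param[OF E(1) this]
  have "negligible {v :: real^2. v $ 1 = 0}" by (rule negligible_standard_hyperplane_cart)
  then have "{v :: real^2. v $ 1 = 0} \<in> null_sets lebesgue" by (simp add: negligible_iff_null_sets)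
  then have "emeasure lebesgue {v :: real^2. v $ 1 = 0} = 0" by auto
  moreover have "{v :: real^2. v $ 1 = 0} \<in> sets borel"
    by (intro borel_closed closed_Collect_eq continuous_intros)
  ultimately have "emeasure lborel {v :: real^2. v $ 1 = 0} = 0" by simp
  moreover have "emeasure lborel {v. swapped.param v \<in> E} \<le> emeasure lborel {v :: real^2. v $ 1 = 0}"
    using \<open>{v :: real^2. v $ 1 = 0} \<in> sets borel\<close> by (intro emeasure_mono sub) simp
  ultimately show "emeasure \<mu> E = 0" using em by simp
qed

lemma emeasure_quadric:
  assumes E: "E \<in> sets \<mu>"
  shows "emeasure \<mu> E = ennreal (n^2 * \<bar>det \<Psi>\<bar> / \<bar>of_int a\<bar>) * emeasure lborel {v. param v \<in> E}"
proof -
  define \<L> where "\<L> = {\<Psi> *v y |y. y $ 2 = 0 \<and> y $ 1 = - n}"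
  have S: "sets \<mu> = sets (restrict_space borel (quadric c a))" using measure by (simp add: is_abs_form_measure_def)
  have \<L>: "\<L> \<in> sets \<mu>" unfolding S using exceptional_line(1,2) unfolding \<L>_def[symmetric]
    by (auto simp: sets_restrict_space)
  have parts: "E \<inter> \<L> \<in> sets \<mu>" "E - \<L> \<in> sets \<mu>" using E \<L> by auto
  have "E \<subseteq> quadric c a" using E unfolding S by (auto simp: sets_restrict_space)
  then have sub: "E - \<L> \<subseteq> range param" unfolding param_range \<L>_def by blast
  have "emeasure \<mu> E = emeasure \<mu> (E \<inter> \<L>) + emeasure \<mu> (E - \<L>)"
    using plus_emeasure[OF parts] by (simp add: Int_Diff_Un Int_Diff_disjoint)
  also have "emeasure \<mu> (E \<inter> \<L>) = 0" by (rule exceptional_line(3)[OF parts(1)]) (auto simp: \<L>_def)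
  also have "emeasure \<mu> (E - \<L>) = ennreal (n^2 * \<bar>det \<Psi>\<bar> / \<bar>of_int a\<bar>) * emeasure lborel {v. param v \<in> E - \<L>}"
    by (rule emeasure_param[OF parts(2) sub])
  also have "{v. param v \<in> E - \<L>} = {v. param v \<in> E}"
    using param_range unfolding \<L>_def by blast
  finally show ?thesis by simp
qed

end

section \<open>Volume of the part of the quadric in a large ball\<close>

context vec_norm begin

lemma norm_triangle_minus: "N (x - y) \<le> N x + N y"
  using norm_triangle[of x "- y"] norm_uminus[of y] by simp

text \<open>The two estimates have different uses. The first is independent of \<open>p\<close>,
  since two points of the segment differ by at most 2 T in norm, and yields the dominating function;
  the second yields the limit for fixed \<open>p\<close>, but its error grows with
  \<open>p\<close>.\<close>

lemma segment_length:
  fixes p e :: "real^3" and T :: real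
  assumes g: "N e > 0" and T: "T \<ge> 0"
  defines "S \<equiv> {s. N (p + s *\<^sub>R e) \<le> T}"
  shows "S \<in> sets borel" "emeasure lborel S \<le> ennreal (4 * T / N e)" "\<bar>measure lborel S - 2 * T / N e\<bar> \<le> 2 * N p / N e"
proof -
  have "closed S" unfolding S_def
    by (intro closed_Collect_le continuous_on_compose2[OF continuous_N[of UNIV]] continuous_intros) auto
  then show meas: "S \<in> sets borel" by simp
  have Ne: "N (s *\<^sub>R e) = \<bar>s\<bar> * N e" for s by (rule norm_scale)
  show em: "emeasure lborel S \<le> ennreal (4 * T / N e)"
  proof (cases "S = {}")
    case False
    then obtain s0 where s0: "s0 \<in> S" by blast
    have "S \<subseteq> {s0 - 2 * T / N e .. s0 + 2 * T / N e}"
    proof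
      fix s assume s: "s \<in> S"
      have "\<bar>s - s0\<bar> * N e = N ((p + s *\<^sub>R e) - (p + s0 *\<^sub>R e))" by (simp add: Ne[symmetric] scaleR_diff_left)
      also have "\<dots> \<le> N (p + s *\<^sub>R e) + N (p + s0 *\<^sub>R e)"
        by (rule norm_triangle_minus)
      also have "\<dots> \<le> 2 * T" using s s0 by (simp add: S_def)
      finally have "\<bar>s - s0\<bar> \<le> 2 * T / N e" using g by (simp add: field_simps)
      then show "s \<in> {s0 - 2 * T / N e .. s0 + 2 * T / N e}" by (auto simp: abs_le_iff)
    qed
    then have "emeasure lborel S \<le> emeasure lborel {s0 - 2 * T / N e .. s0 + 2 * T / N e}" by (rule emeasure_mono) simp
    also have "\<dots> = ennreal (4 * T / N e)" using T g by (simp add: add_divide_distrib[symmetric])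
    finally show ?thesis .
  qed simp
  have fin: "emeasure lborel S < \<infinity>" using em by (rule order_le_less_trans) simp
  have up: "S \<subseteq> {- ((T + N p) / N e) .. (T + N p) / N e}"
  proof
    fix s assume s: "s \<in> S"
    have "\<bar>s\<bar> * N e \<le> N (p + s *\<^sub>R e) + N (- p)"
      using norm_triangle[of "p + s *\<^sub>R e" "- p"] by (simp add: Ne)
    then have "\<bar>s\<bar> * N e \<le> T + N p" using s by (simp add: S_def norm_uminus)
    then have "\<bar>s\<bar> \<le> (T + N p) / N e" using g by (simp add: field_simps)
    then show "s \<in> {- ((T + N p) / N e) .. (T + N p) / N e}" by (auto simp: abs_le_iff)
  qed
  have lo: "{- ((T - N p) / N e) .. (T - N p) / N e} \<subseteq> S"
  proof
    fix s assume "s \<in> {- ((T - N p) / N e) .. (T - N p) / N e}"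
    then have "\<bar>s\<bar> \<le> (T - N p) / N e" by (auto simp: abs_le_iff)
    then have "\<bar>s\<bar> * N e \<le> T - N p" using g by (simp add: field_simps)
    then show "s \<in> S" using norm_triangle[of p "s *\<^sub>R e"] by (simp add: S_def Ne)
  qed
  have b0: "0 \<le> (T + N p) / N e" using T g norm_nonneg[of p] by simp
  have "measure lborel S \<le> measure lborel {- ((T + N p) / N e) .. (T + N p) / N e}"
    using up meas by (intro measure_mono_fmeasurable) (auto simp: fmeasurable_def emeasure_lborel_Icc_eq)
  also have "\<dots> = 2 * ((T + N p) / N e)" using b0 by simp
  finally have 1: "measure lborel S \<le> 2 * T / N e + 2 * N p / N e" by (simp add: add_divide_distrib)
  have "2 * x \<le> measure lborel {- x .. x}" for x :: real by (cases "0 \<le> x") simp_all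
  then have "2 * ((T - N p) / N e) \<le> measure lborel {- ((T - N p) / N e) .. (T - N p) / N e}" .
  also have "\<dots> \<le> measure lborel S"
    using lo meas fin by (intro measure_mono_fmeasurable) (auto simp: fmeasurable_def)
  finally have 2: "2 * T / N e - 2 * N p / N e \<le> measure lborel S" by (simp add: diff_divide_distrib right_diff_distrib)
  show "\<bar>measure lborel S - 2 * T / N e\<bar> \<le> 2 * N p / N e" using 1 2 by linarith
qed

text \<open>For a fixed slope t the chart is an affine line with direction \<open>evec 1 t\<close>.
  The section has length about 2 T / gau (1, t), and integration over t produces twice the
  area.\<close>

lemma chart_volume:
  fixes n :: real
  assumes n: "n > 0"
  shows "((\<lambda>T. measure lborel {v. N (chart n v) \<le> T} / T) \<longlongrightarrow> 2 * area) at_top"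
proof -
  define p where "p t = (vector [n, 0, 2 * n * t] :: real^3)" for t
  define S where "S T t = {s. N (p t + s *\<^sub>R evec 1 t) \<le> T}" for T t
  have ch: "chart n (join2 (t, s)) = p t + s *\<^sub>R evec 1 t" for t s
    by (simp add: chart_def p_def evec_def vec_eq_iff forall_3 vector_3)
  have g: "N (evec 1 t) = gau (1, t)" for t by (simp add: gau_def)
  have gpos: "gau (1, t) > 0" for t by (rule gau_pos) (simp add: prod_eq_iff)
  have [measurable]: "(\<lambda>t. gau (1, t)) \<in> borel_measurable borel"
    by (intro borel_measurable_continuous_onI continuous_on_compose2[OF gau_continuous] continuous_intros) auto
  have "continuous_on UNIV (chart n)"
    by (intro continuous_at_imp_continuous_on ballI has_derivative_continuous[OF chart_has_derivative])
  then have "continuous_on UNIV (\<lambda>v. N (chart n v))"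
    by (rule continuous_on_compose2[OF continuous_N[of UNIV]]) auto
  then have cm [measurable]: "(\<lambda>v. N (chart n v)) \<in> borel_measurable borel" by (rule borel_measurable_continuous_onI)
  have set: "{v. N (chart n v) \<le> T} \<in> sets borel" for T by measurable
  have em: "emeasure lborel {v. N (chart n v) \<le> T} = (\<integral>\<^sup>+t. emeasure lborel (S T t) \<partial>lborel)" if T: "T \<ge> 0" for T
  proof -
    have "emeasure lborel {v. N (chart n v) \<le> T} = (\<integral>\<^sup>+v. indicator {v. N (chart n v) \<le> T} v \<partial>lborel)"
      using set by simp
    also have "\<dots> = (\<integral>\<^sup>+t. \<integral>\<^sup>+s. indicator {v. N (chart n v) \<le> T} (join2 (t, s)) \<partial>lborel \<partial>lborel)"
      by (rule nn_integral_join2) (use set in measurable)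
    also have "\<dots> = (\<integral>\<^sup>+t. emeasure lborel (S T t) \<partial>lborel)"
    proof (rule nn_integral_cong)
      fix t
      have "(\<integral>\<^sup>+s. indicator {v. N (chart n v) \<le> T} (join2 (t, s)) \<partial>lborel) = (\<integral>\<^sup>+s. indicator (S T t) s \<partial>lborel)"
        by (intro nn_integral_cong) (simp add: indicator_def S_def ch)
      also have "\<dots> = emeasure lborel (S T t)"
        using segment_length(1)[of "evec 1 t" T "p t"] g gpos T by (intro nn_integral_indicator) (simp add: S_def)
      finally show "(\<integral>\<^sup>+s. indicator {v. N (chart n v) \<le> T} (join2 (t, s)) \<partial>lborel) = emeasure lborel (S T t)" .
    qed
    finally show ?thesis .
  qed
  have fin: "emeasure lborel (S T t) = ennreal (measure lborel (S T t))" if T: "T \<ge> 0" for T t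
  proof -
    have "emeasure lborel (S T t) \<le> ennreal (4 * T / gau (1, t))"
      using segment_length(2)[of "evec 1 t" T "p t"] g gpos T by (simp add: S_def)
    then have "emeasure lborel (S T t) \<noteq> \<infinity>" by (metis ennreal_less_top infinity_ennreal_def leD)
    then show ?thesis by (simp add: emeasure_eq_ennreal_measure)
  qed
  \<comment> \<open>The value 0 for T \<le> 0 makes the domination below hold for all T.\<close>
  define f where "f T t = (if T > 0 then measure lborel (S T t) / T else 0)" for T t
  have Smeas: "(\<lambda>t. emeasure lborel (S T t)) \<in> borel_measurable borel" if T: "T \<ge> 0" for T
  proof -
    have "(\<lambda>p. indicator {v. N (chart n v) \<le> T} (join2 p) :: ennreal) \<in> borel_measurable (lborel \<Otimes>\<^sub>M lborel)"
      using measurable_compose[OF join2_measurable, of "indicator {v. N (chart n v) \<le> T} :: _ \<Rightarrow> ennreal" borel] set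
      by (simp add: lborel_prod)
    from lborel.borel_measurable_nn_integral_fst[OF this]
    have "(\<lambda>t. \<integral>\<^sup>+s. indicator {v. N (chart n v) \<le> T} (join2 (t, s)) \<partial>lborel) \<in> borel_measurable lborel" .
    moreover have "(\<integral>\<^sup>+s. indicator {v. N (chart n v) \<le> T} (join2 (t, s)) \<partial>lborel) = emeasure lborel (S T t)" for t
    proof -
      have "(\<integral>\<^sup>+s. indicator {v. N (chart n v) \<le> T} (join2 (t, s)) \<partial>lborel) = (\<integral>\<^sup>+s. indicator (S T t) s \<partial>lborel)"
        by (intro nn_integral_cong) (simp add: indicator_def S_def ch)
      also have "\<dots> = emeasure lborel (S T t)"
        using segment_length(1)[of "evec 1 t" T "p t"] g gpos T by (intro nn_integral_indicator) (simp add: S_def)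
      finally show ?thesis .
    qed
    ultimately show ?thesis by simp
  qed
  have fmeas: "f T \<in> borel_measurable lborel" for T
  proof (cases "T > 0")
    case True
    then have [measurable]: "(\<lambda>t. emeasure lborel (S T t)) \<in> borel_measurable borel" using Smeas[of T] by simp
    have "f T = (\<lambda>t. enn2real (emeasure lborel (S T t)) / T)" using True by (simp add: f_def measure_def fun_eq_iff)
    then show ?thesis by simp
  qed (simp add: f_def[abs_def])
  have nn_inv: "(\<integral>\<^sup>+t. ennreal (1 / gau (1, t)) \<partial>lborel) = ennreal area"
    using area_finite unfolding emeasure_gau_le_1[symmetric] area_def
    by (intro emeasure_eq_ennreal_measure) (simp add: less_top)
  have int_inv: "integrable lborel (\<lambda>t. 1 / gau (1, t))" "integral\<^sup>L lborel (\<lambda>t. 1 / gau (1, t)) = area"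
  proof -
    show i: "integrable lborel (\<lambda>t. 1 / gau (1, t))"
      by (rule integrableI_nonneg) (use nn_inv gau_nonneg in auto)
    have "ennreal (integral\<^sup>L lborel (\<lambda>t. 1 / gau (1, t))) = ennreal area"
      using nn_integral_eq_integral[OF i] nn_inv gau_nonneg by simp
    then show "integral\<^sup>L lborel (\<lambda>t. 1 / gau (1, t)) = area"
      using area_pos gau_nonneg by (simp add: integral_nonneg_AE)
  qed
  have bound: "norm (f T t) \<le> 4 * (1 / gau (1, t))" for T t
  proof (cases "T > 0")
    case True
    have "ennreal (measure lborel (S T t)) \<le> ennreal (4 * T / gau (1, t))"
      using segment_length(2)[of "evec 1 t" T "p t"] fin[of T t] g gpos[of t] True by (simp add: S_def)
    then have "measure lborel (S T t) \<le> 4 * T / gau (1, t)" using True gpos[of t] by (simp add: ennreal_le_iff)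
    then have "measure lborel (S T t) / T \<le> 4 * T / gau (1, t) / T" using True by (intro divide_right_mono) auto
    then show ?thesis using True by (simp add: f_def)
  qed (simp add: f_def gau_nonneg)
  have "((\<lambda>T. integral\<^sup>L lborel (f T)) \<longlongrightarrow> integral\<^sup>L lborel (\<lambda>t. 2 * (1 / gau (1, t)))) at_top"
  proof (rule integral_dominated_convergence_at_top[where w = "\<lambda>t. 4 * (1 / gau (1, t))"])
    show "AE t in lborel. ((\<lambda>T. f T t) \<longlongrightarrow> 2 * (1 / gau (1, t))) at_top"
    proof (rule AE_I2)
      fix t
      have "((\<lambda>T. f T t - 2 * (1 / gau (1, t))) \<longlongrightarrow> 0) at_top"
      proof (rule Lim_null_comparison)
        show "((\<lambda>T. 2 * N (p t) / gau (1, t) / T) \<longlongrightarrow> 0) at_top"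
          by (rule tendsto_divide_0[OF tendsto_const filterlim_at_top_imp_at_infinity[OF filterlim_ident]])
        show "\<forall>\<^sub>F T in at_top. norm (f T t - 2 * (1 / gau (1, t))) \<le> 2 * N (p t) / gau (1, t) / T"
          using eventually_gt_at_top[of 0]
        proof eventually_elim
          case (elim T)
          have "\<bar>measure lborel (S T t) - 2 * T / gau (1, t)\<bar> \<le> 2 * N (p t) / gau (1, t)"
            using segment_length(3)[of "evec 1 t" T "p t"] g gpos[of t] elim by (simp add: S_def)
          then have "\<bar>measure lborel (S T t) - 2 * T / gau (1, t)\<bar> / T \<le> 2 * N (p t) / gau (1, t) / T"
            using elim by (intro divide_right_mono) auto
          moreover have "f T t - 2 * (1 / gau (1, t)) = (measure lborel (S T t) - 2 * T / gau (1, t)) / T"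
            using elim by (simp add: f_def diff_divide_distrib)
          ultimately show ?case using elim by simp
        qed
      qed
      from tendsto_add[OF this tendsto_const[of "2 * (1 / gau (1, t))"]]
      show "((\<lambda>T. f T t) \<longlongrightarrow> 2 * (1 / gau (1, t))) at_top" by simp
    qed
    show "integrable lborel (\<lambda>t. 4 * (1 / gau (1, t)))" using int_inv(1) by (rule integrable_mult_right)
    show "\<forall>\<^sub>F T in at_top. AE t in lborel. norm (f T t) \<le> 4 * (1 / gau (1, t))" using bound by simp
  qed (use fmeas in auto)
  moreover have "integral\<^sup>L lborel (\<lambda>t. 2 * (1 / gau (1, t))) = 2 * area"
    by (simp only: integral_mult_right_zero int_inv(2))
  ultimately have "((\<lambda>T. integral\<^sup>L lborel (f T)) \<longlongrightarrow> 2 * area) at_top" by (simp only:)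
  moreover have "\<forall>\<^sub>F T in at_top. integral\<^sup>L lborel (f T) = measure lborel {v. N (chart n v) \<le> T} / T"
    using eventually_gt_at_top[of 0]
  proof eventually_elim
    case (elim T)
    have fi: "integrable lborel (f T)"
    proof (rule Bochner_Integration.integrable_bound[OF integrable_mult_right[OF int_inv(1), of 4] fmeas])
      show "AE t in lborel. norm (f T t) \<le> norm (4 * (1 / gau (1, t)))"
        using bound[of T] gau_nonneg by simp
    qed
    have i: "integrable lborel (\<lambda>t. measure lborel (S T t))"
      using integrable_mult_right[OF fi, of T] elim by (simp add: f_def)
    have "emeasure lborel {v. N (chart n v) \<le> T} = (\<integral>\<^sup>+t. ennreal (measure lborel (S T t)) \<partial>lborel)"
      using em[of T] fin[of T] elim by simp
    also have "\<dots> = ennreal (integral\<^sup>L lborel (\<lambda>t. measure lborel (S T t)))"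
      by (rule nn_integral_eq_integral[OF i]) simp
    finally have "measure lborel {v. N (chart n v) \<le> T} = integral\<^sup>L lborel (\<lambda>t. measure lborel (S T t))"
      by (simp add: measure_def integral_nonneg_AE)
    then show ?case using elim by (simp add: f_def[abs_def])
  qed
  ultimately show ?thesis by (rule Lim_transform_eventually)
qed

end

text \<open>The chart computation is applied to the norm y \<mapsto> N (\<Psi> y), the one with
  which integral points are counted after the change of variables.\<close>

lemma (in quadric_chart) volume_asymp:
  assumes "is_norm N"
  shows "((\<lambda>T. measure \<mu> (quadric_ball c a N T) / T) \<longlongrightarrow>
    n^2 * \<bar>det \<Psi>\<bar> / \<bar>of_int a\<bar> * (2 * vec_norm.area (\<lambda>y. N (\<Psi> *v y)))) at_top"
proof -
  interpret orig: vec_norm N by unfold_locales fact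
  interpret V: vec_norm "\<lambda>y. N (\<Psi> *v y)" by unfold_locales (rule is_norm_matrix[OF assms inv\<Psi>(1)])
  have "quadric_ball c a N T \<in> sets \<mu>" for T
  proof -
    have "{x. N x \<le> T} \<in> sets borel"
      by (intro borel_closed closed_Collect_le orig.continuous_N continuous_intros)
    then have "quadric c a \<inter> {x. N x \<le> T} \<in> sets (restrict_space borel (quadric c a))"
      by (auto simp: sets_restrict_space)
    moreover have "quadric_ball c a N T = quadric c a \<inter> {x. N x \<le> T}" by (auto simp: quadric_ball_def)
    ultimately show ?thesis using measure by (simp add: is_abs_form_measure_def)
  qed
  from emeasure_quadric[OF this]
  have "emeasure \<mu> (quadric_ball c a N T) = ennreal (n^2 * \<bar>det \<Psi>\<bar> / \<bar>of_int a\<bar>) * emeasure lborel {v. param v \<in> quadric_ball c a N T}" for T .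
  moreover have "{v. param v \<in> quadric_ball c a N T} = {v. N (\<Psi> *v chart n v) \<le> T}" for T
    by (simp add: quadric_ball_def param_def quadric_iff chart_qform)
  ultimately have "measure \<mu> (quadric_ball c a N T) = n^2 * \<bar>det \<Psi>\<bar> / \<bar>of_int a\<bar> * measure lborel {v. N (\<Psi> *v chart n v) \<le> T}" for T
    by (simp add: measure_def enn2real_mult)
  then have eq: "measure \<mu> (quadric_ball c a N T) / T = n^2 * \<bar>det \<Psi>\<bar> / \<bar>of_int a\<bar> * (measure lborel {v. N (\<Psi> *v chart n v) \<le> T} / T)" for T
    by simp
  show ?thesis unfolding eq by (intro tendsto_mult tendsto_const V.chart_volume[OF n])
qed

section \<open>Counting eigenvectors modulo \<open>Q\<close>\<close>

lemma card_totatives_int: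
  fixes m :: int
  assumes m: "m > 0"
  shows "card {k \<in> {0..<m}. coprime k m} = totient (nat m)"
\<comment> \<open>\<open>totatives\<close> takes representatives from 1 to m, the left side from 0
  to m - 1; the two choices disagree only for m = 1.\<close>
proof (cases "m = 1")
  case True
  have "{k \<in> {0..<1::int}. coprime k 1} = {0}" by auto
  then show ?thesis using True by simp
next
  case False
  have "bij_betw nat {k \<in> {0..<m}. coprime k m} (totatives (nat m))"
  proof (rule bij_betw_byWitness[where f' = int])
    have "k \<noteq> 0" if "coprime k m" for k using that m False by auto
    note k0 = this
    have co: "coprime (nat k) (nat m)" if "0 \<le> k" "coprime k m" for k
    proof -
      have "coprime (int (nat k)) (int (nat m))" using that m by simp
      then show ?thesis by (simp only: coprime_int_iff)
    qed
    show "nat ` {k \<in> {0..<m}. coprime k m} \<subseteq> totatives (nat m)"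
    proof (rule image_subsetI)
      fix k assume "k \<in> {k \<in> {0..<m}. coprime k m}"
      then have k: "0 \<le> k" "k < m" "coprime k m" by simp_all
      show "nat k \<in> totatives (nat m)" using k k0[OF k(3)] co[OF k(1,3)] by (simp add: in_totatives_iff)
    qed
    have "int k \<noteq> m" if "coprime k (nat m)" for k
    proof
      assume "int k = m"
      then have "k = nat m" by simp
      then have "nat m = 1" using that by simp
      then show False using False m by simp
    qed
    note km = this
    have co': "coprime (int k) m" if "coprime k (nat m)" for k
    proof -
      have "coprime (int k) (int (nat m))" using that by (simp only: coprime_int_iff)
      then show ?thesis using m by simp
    qed
    show "int ` totatives (nat m) \<subseteq> {k \<in> {0..<m}. coprime k m}"
    proof (rule image_subsetI)
      fix k assume "k \<in> totatives (nat m)"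
      then have k: "k \<le> nat m" "coprime k (nat m)" by (simp_all only: in_totatives_iff)
      have "int k < m" using k(1) km[OF k(2)] m by linarith
      then show "int k \<in> {k \<in> {0..<m}. coprime k m}" using co'[OF k(2)] by simp
    qed
  qed (auto simp: totatives_def)
  then show ?thesis by (simp add: totient_def bij_betw_same_card)
qed

lemma prime_coprime_criterion_int:
  fixes a m :: int
  assumes "m \<noteq> 0" "\<And>p. prime p \<Longrightarrow> p dvd a \<Longrightarrow> \<not> p dvd m"
  shows "coprime a m"
proof (rule ccontr)
  assume "\<not> coprime a m"
  then have "\<not> is_unit (gcd a m)" by (simp add: coprime_iff_gcd_eq_1 del: is_unit_gcd)
  moreover have "gcd a m \<noteq> 0" using assms(1) by simp
  ultimately obtain p where "p dvd gcd a m" "prime p" using prime_divisor_exists by blast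
  then have "prime p" "p dvd a" "p dvd m" by simp_all
  then show False using assms(2) by blast
qed

text \<open>If the determinant vanishes modulo \<open>m\<close>, the vector orthogonal to this combination of the rows spans the kernel.\<close>

lemma primitive_row:
  fixes a b c e m :: int
  assumes m: "m > 0" and prim: "\<And>p. prime p \<Longrightarrow> p dvd a \<Longrightarrow> p dvd b \<Longrightarrow> p dvd c \<Longrightarrow> \<not> p dvd e"
  shows "\<exists>s. \<forall>p. prime p \<longrightarrow> p dvd m \<longrightarrow> \<not> (p dvd s * a + c \<and> p dvd s * b + e)"
proof -
  \<comment> \<open>The product of \<open>P\<close> serves as s: modulo a prime in \<open>P\<close>
    it vanishes and the row (c, e) remains; modulo the other primes of m it is a unit while c and e
    vanish.\<close>
  define P where "P = {p. prime p \<and> p dvd m \<and> \<not> (p dvd c \<and> p dvd e)}"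
  have fin: "finite P"
    by (rule finite_subset[of _ "{0..m}"]) (use m in \<open>auto simp: P_def prime_ge_0_int zdvd_imp_le\<close>)
  have "\<not> (p dvd \<Prod>P * a + c \<and> p dvd \<Prod>P * b + e)" if p: "prime p" "p dvd m" for p
  proof
    assume h: "p dvd \<Prod>P * a + c \<and> p dvd \<Prod>P * b + e"
    show False
    proof (cases "p \<in> P")
      case True
      then have "p dvd \<Prod>P" using fin by (rule dvd_prodI[rotated])
      then have "p dvd c" "p dvd e" using h by (simp_all add: dvd_add_right_iff)
      then show False using True by (simp add: P_def)
    next
      case False
      then have ce: "p dvd c" "p dvd e" using p by (auto simp: P_def)
      have "\<not> p dvd \<Prod>P"
      proof
        assume "p dvd \<Prod>P"
        then obtain q where q: "q \<in> P" "p dvd q" using prime_dvd_prod_iff[OF fin p(1)] by auto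
        then have "p = q" using p(1) by (intro primes_dvd_imp_eq) (auto simp: P_def)
        then show False using q(1) False by simp
      qed
      moreover have "p dvd \<Prod>P * a" "p dvd \<Prod>P * b" using h ce by (simp_all add: dvd_add_left_iff)
      ultimately have "p dvd a" "p dvd b" using p(1) by (simp_all add: prime_dvd_mult_iff)
      then show False using prim[OF p(1)] ce by blast
    qed
  qed
  then show ?thesis by blast
qed

lemma totient_same_primes:
  fixes d m :: nat
  assumes "m > 0" "d > 0" "\<And>p. prime p \<Longrightarrow> p dvd d \<Longrightarrow> p dvd m"
  shows "totient (d * m) = d * totient m"
proof -
  have "prime_factors (d * m) = prime_factors m"
    using assms by (auto simp: prime_factors_dvd prime_dvd_mult_iff)
  then have "real (totient (d * m)) = real d * real (totient m)"
    by (simp add: totient_formula2)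
  then show ?thesis by (metis of_nat_eq_iff of_nat_mult)
qed

text \<open>If the determinant vanishes modulo m, the kernel modulo m is free of rank one and has
  \<phi>(m) generators. Each has d^2 lifts modulo d m, which are again primitive because all primes
  of d divide m, and d^2 \<phi>(m) = d \<phi>(d m). Conversely, multiplication by the adjugate shows
  that the determinant annihilates every vector of the kernel, which for a primitive vector forces
  it to vanish modulo m.\<close>

lemma card_primitive_kernel:
  fixes a b c e d m :: int
  assumes m: "m > 0" and d: "d > 0" and primes: "\<And>p::int. prime p \<Longrightarrow> p dvd d \<Longrightarrow> p dvd m"
    and prim: "\<And>p. prime p \<Longrightarrow> p dvd a \<Longrightarrow> p dvd b \<Longrightarrow> p dvd c \<Longrightarrow> \<not> p dvd e"
  shows "card {u \<in> {0..<d * m} \<times> {0..<d * m}. gcd (gcd (fst u) (snd u)) (d * m) = 1 \<and>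
      m dvd a * fst u + b * snd u \<and> m dvd c * fst u + e * snd u} =
    (if m dvd a * e - b * c then nat d * totient (nat (d * m)) else 0)"
proof -
  let ?S = "{u \<in> {0..<d * m} \<times> {0..<d * m}. gcd (gcd (fst u) (snd u)) (d * m) = 1 \<and>
      m dvd a * fst u + b * snd u \<and> m dvd c * fst u + e * snd u}"
  show ?thesis
  proof (cases "m dvd a * e - b * c")
    case False
    have "?S = {}"
    proof (rule equals0I)
      fix u assume u: "u \<in> ?S"
      define x y where "x = fst u" and "y = snd u"
      have xy: "m dvd a * x + b * y" "m dvd c * x + e * y" "gcd (gcd x y) (d * m) = 1" using u by (auto simp: x_def y_def)
      have "m dvd e * (a * x + b * y) - b * (c * x + e * y)" "m dvd a * (c * x + e * y) - c * (a * x + b * y)"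
        using xy by (auto intro!: dvd_diff dvd_mult)
      then have 1: "m dvd (a * e - b * c) * x" "m dvd (a * e - b * c) * y" by (simp_all add: algebra_simps)
      obtain s t where st: "s * x + t * y = gcd x y" using bezout_int by blast
      have "m dvd s * ((a * e - b * c) * x) + t * ((a * e - b * c) * y)" by (intro dvd_add dvd_mult[OF 1(1)] dvd_mult[OF 1(2)])
      also have "\<dots> = (a * e - b * c) * gcd x y" unfolding st[symmetric] by (simp add: algebra_simps)
      finally have "m dvd (a * e - b * c) * gcd x y" .
      moreover have "coprime (gcd x y) m" using xy(3) by (metis coprime_iff_gcd_eq_1 coprime_mult_right_iff)
      ultimately show False using False by (simp add: coprime_dvd_mult_left_iff coprime_commute)
    qed
    then show ?thesis using False by (simp only: card.empty if_False)
  next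
    case True
    obtain s where s: "\<And>p. prime p \<Longrightarrow> p dvd m \<Longrightarrow> \<not> (p dvd s * a + c \<and> p dvd s * b + e)"
      using primitive_row[OF m, of a b c e] prim by blast
    define r1 r2 where "r1 = s * a + c" and "r2 = s * b + e"
    have "coprime (gcd r1 r2) m"
      by (rule prime_coprime_criterion_int) (use m s in \<open>auto simp: r1_def r2_def\<close>)
    then obtain k where k: "[gcd r1 r2 * k = 1] (mod m)" using cong_solve_coprime_int by blast
    obtain u0 v0 where uv0: "u0 * r1 + v0 * r2 = gcd r1 r2" using bezout_int by blast
    define u v where "u = u0 * k" and "v = v0 * k"
    have "u * r1 + v * r2 = gcd r1 r2 * k" unfolding uv0[symmetric] by (simp add: u_def v_def algebra_simps)
    then have uv: "m dvd u * r1 + v * r2 - 1" using k by (simp add: cong_iff_dvd_diff)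
    let ?T = "{l \<in> {0..<m}. coprime l m}"
    \<comment> \<open>The generators of the kernel are l (r2, -r1) with l a unit, and i, j select
      the lift modulo d m.\<close>
    let ?f = "\<lambda>(l, i, j). ((l * r2) mod m + m * i, (- l * r1) mod m + m * j)"
    have "bij_betw ?f (?T \<times> {0..<d} \<times> {0..<d}) ?S"
    proof (rule bij_betwI')
      fix x y assume x: "x \<in> ?T \<times> {0..<d} \<times> {0..<d}" and y: "y \<in> ?T \<times> {0..<d} \<times> {0..<d}"
      obtain l i j l' i' j' where xy: "x = (l, i, j)" "y = (l', i', j')" by (cases x, cases y) blast
      show "(?f x = ?f y) = (x = y)"
      proof
        assume eq: "?f x = ?f y"
        have e1: "(l * r2) mod m + m * i = (l' * r2) mod m + m * i'" and e2: "(- l * r1) mod m + m * j = (- l' * r1) mod m + m * j'"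
          using eq by (auto simp: xy)
        have q: "(t mod m + m * i) mod m = t mod m" "(t mod m + m * i) div m = i" for t i using m by simp_all
        have "(l * r2) mod m = (l' * r2) mod m" "i = i'" using q e1 by metis+
        moreover have "(- l * r1) mod m = (- l' * r1) mod m" "j = j'" using q e2 by metis+
        ultimately have "m dvd l * r2 - l' * r2" "m dvd - l * r1 - - l' * r1" "i = i'" "j = j'" by (simp_all only: mod_eq_dvd_iff)
        then have "m dvd v * (l * r2 - l' * r2) - u * (- l * r1 - - l' * r1)" by - (rule dvd_diff[OF dvd_mult dvd_mult])
        also have "v * (l * r2 - l' * r2) - u * (- l * r1 - - l' * r1) = (l - l') * (u * r1 + v * r2 - 1) + (l - l')"
          by (simp add: algebra_simps)
        finally have "m dvd l - l'" using uv by (metis dvd_add_right_iff dvd_mult)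
        then have "l mod m = l' mod m" by (simp add: mod_eq_dvd_iff)
        then have "l = l'" using x y by (simp add: xy)
        then show "x = y" using \<open>i = i'\<close> \<open>j = j'\<close> by (simp add: xy)
      qed simp
    next
      fix x assume x: "x \<in> ?T \<times> {0..<d} \<times> {0..<d}"
      obtain l i j where xl: "x = (l, i, j)" by (cases x)
      have l: "coprime l m" "0 \<le> i" "i < d" "0 \<le> j" "j < d" using x by (auto simp: xl)
      define X Y where "X = (l * r2) mod m + m * i" and "Y = (- l * r1) mod m + m * j"
      have bnd: "0 \<le> t mod m + m * i \<and> t mod m + m * i < d * m" if "0 \<le> i" "i < d" for t i
      proof -
        have "m * i \<le> m * (d - 1)" using that m by (intro mult_left_mono) auto
        moreover have "0 \<le> t mod m" "t mod m < m" using m by auto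
        moreover have "0 \<le> m * i" using that m by simp
        ultimately show ?thesis by (simp add: algebra_simps)
      qed
      have red: "m dvd t mod m + m * i - t" for t i
      proof -
        have "t mod m + m * i - t = m * (i - t div m)"
          unfolding right_diff_distrib using mult_div_mod_eq[of m t] by linarith
        then show ?thesis by simp
      qed
      have X: "m dvd X - l * r2" "m dvd Y - - l * r1"
        unfolding X_def Y_def by (rule red)+
      have "m dvd a * (X - l * r2) + b * (Y - - l * r1) + l * (a * e - b * c)"
        using X True by - (rule dvd_add[OF dvd_add[OF dvd_mult dvd_mult] dvd_mult])
      then have c1: "m dvd a * X + b * Y" by (simp add: r1_def r2_def algebra_simps)
      have "m dvd c * (X - l * r2) + e * (Y - - l * r1) - (l * s) * (a * e - b * c)"
        using X True by - (rule dvd_diff[OF dvd_add[OF dvd_mult dvd_mult] dvd_mult])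
      then have c2: "m dvd c * X + e * Y" by (simp add: r1_def r2_def algebra_simps)
      have "coprime (gcd X Y) (d * m)"
      proof (rule prime_coprime_criterion_int)
        fix p :: int assume p: "prime p" "p dvd gcd X Y"
        show "\<not> p dvd d * m"
        proof
          assume "p dvd d * m"
          then have pm: "p dvd m" using p(1) primes by (auto simp: prime_dvd_mult_iff)
          then have "p dvd X - l * r2" "p dvd Y - - l * r1" "p dvd X" "p dvd Y" using X p(2) dvd_trans by auto
          then have "p dvd X - (X - l * r2)" "p dvd (Y - - l * r1) - Y" using dvd_diff by blast+
          then have "p dvd l * r2" "p dvd l * r1" by simp_all
          moreover have "\<not> p dvd l" using l(1) pm p(1) coprime_common_divisor not_prime_unit by blast
          ultimately have "p dvd r1" "p dvd r2" using p(1) by (auto simp: prime_dvd_mult_iff)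
          then show False using s[OF p(1) pm] by (simp add: r1_def r2_def)
        qed
      qed (use m d in simp)
      then have g1: "gcd (gcd X Y) (d * m) = 1" by (simp only: coprime_iff_gcd_eq_1)
      have bX: "0 \<le> X \<and> X < d * m" and bY: "0 \<le> Y \<and> Y < d * m" unfolding X_def Y_def by (rule bnd[OF l(2,3)], rule bnd[OF l(4,5)])
      have fx: "?f x = (X, Y)" by (simp only: xl prod.case X_def Y_def)
      show "?f x \<in> ?S" unfolding fx using bX bY g1 c1 c2
        by (simp only: mem_Collect_eq mem_Times_iff fst_conv snd_conv atLeastLessThan_iff simp_thms)
    next
      fix w assume w: "w \<in> ?S"
      define X Y where "X = fst w" and "Y = snd w"
      have XY: "0 \<le> X" "X < d * m" "0 \<le> Y" "Y < d * m" "gcd (gcd X Y) (d * m) = 1" "m dvd a * X + b * Y" "m dvd c * X + e * Y"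
        using w by (auto simp: X_def Y_def)
      have "m dvd s * (a * X + b * Y) + (c * X + e * Y)" using XY(6,7) by - (rule dvd_add[OF dvd_mult])
      then have r: "m dvd r1 * X + r2 * Y" by (simp add: r1_def r2_def algebra_simps)
      \<comment> \<open>As u r1 + v r2 = 1 modulo m, this functional recovers l from l (r2,
        -r1).\<close>
      define l where "l = (v * X - u * Y) mod m"
      have lm: "m dvd l - (v * X - u * Y)" by (simp add: l_def mod_eq_dvd_iff[symmetric])
      have "m dvd (l - (v * X - u * Y)) * r2 + (u * r1 + v * r2 - 1) * X - u * (r1 * X + r2 * Y)"
        using lm uv r by - (rule dvd_diff[OF dvd_add[OF dvd_mult2 dvd_mult2] dvd_mult])
      also have "(l - (v * X - u * Y)) * r2 + (u * r1 + v * r2 - 1) * X - u * (r1 * X + r2 * Y) = l * r2 - X"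
        by (simp add: algebra_simps)
      finally have lX: "(l * r2) mod m = X mod m" by (simp add: mod_eq_dvd_iff)
      have "m dvd - (l - (v * X - u * Y))" using lm by (simp only: dvd_minus_iff)
      then have "m dvd - (l - (v * X - u * Y)) * r1 + (u * r1 + v * r2 - 1) * Y - v * (r1 * X + r2 * Y)"
        using uv r by - (rule dvd_diff[OF dvd_add[OF dvd_mult2 dvd_mult2] dvd_mult])
      also have "- (l - (v * X - u * Y)) * r1 + (u * r1 + v * r2 - 1) * Y - v * (r1 * X + r2 * Y) = - l * r1 - Y"
        by (simp add: algebra_simps)
      finally have lY: "(- l * r1) mod m = Y mod m" by (simp only: mod_eq_dvd_iff)
      have "coprime l m"
      proof (rule prime_coprime_criterion_int)
        fix p :: int assume p: "prime p" "p dvd l"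
        show "\<not> p dvd m"
        proof
          assume pm: "p dvd m"
          have "m dvd X - l * r2" "m dvd Y - - l * r1" using lX lY by (metis mod_eq_dvd_iff)+
          then have "p dvd X - l * r2" "p dvd Y - - l * r1" using pm dvd_trans by blast+
          then have "p dvd (X - l * r2) + l * r2" "p dvd (Y - - l * r1) + - l * r1" using p(2) by (intro dvd_add; simp)+
          then have "p dvd gcd (gcd X Y) (d * m)" using pm by simp
          then have "is_unit p" unfolding XY(5) .
          then show False using p(1) not_prime_unit by blast
        qed
      qed (use m in simp)
      then have "(l, X div m, Y div m) \<in> ?T \<times> {0..<d} \<times> {0..<d}"
        using XY m by (auto simp: l_def pos_imp_zdiv_nonneg_iff int_div_less mult.commute)
      moreover have "w = ?f (l, X div m, Y div m)"
        by (simp only: prod.case lX lY mod_mult_div_eq X_def Y_def prod.collapse)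
      ultimately show "\<exists>x\<in>?T \<times> {0..<d} \<times> {0..<d}. w = ?f x" by blast
    qed
    from bij_betw_same_card[OF this, symmetric] have "card ?S = totient (nat m) * (nat d * nat d)"
      by (simp only: card_cartesian_product card_totatives_int[OF m] card_atLeastLessThan_int diff_zero)
    moreover have "totient (nat d * nat m) = nat d * totient (nat m)"
    proof (rule totient_same_primes)
      fix p :: nat assume p: "prime p" "p dvd nat d"
      then have "int p dvd int (nat d)" by (simp only: int_dvd_int_iff)
      then have "int p dvd m" using p(1) d by (intro primes) simp_all
      then have "int p dvd int (nat m)" using m by simp
      then show "p dvd nat m" by (simp only: int_dvd_int_iff)
    qed (use m d in simp_all)
    ultimately show ?thesis using True d by (simp add: nat_mult_distrib)
  qed
qed

text \<open>The content of the matrix \<open>\<beta> - n\<close> equals that of the gradient of the form at \<open>\<beta>\<close>.\<close>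

lemma content_eq_gradient:
  fixes A B C n Q :: int
  assumes n: "n > 0" and Q: "Q > 0" "(2 * n)^3 dvd Q" and q: "Q dvd A^2 + B * C - n^2"
  shows "gcd (gcd (A - n) B) (gcd C (2 * n)) = gcd (gcd (gcd (2 * A) C) B) Q"
proof -
  define d where "d = gcd (gcd (A - n) B) (gcd C (2 * n))"
  define g where "g = gcd (gcd (gcd (2 * A) C) B) Q"
  have d: "d dvd A - n" "d dvd B" "d dvd C" "d dvd 2 * n" unfolding d_def by (meson dvd_trans gcd_dvd1 gcd_dvd2)+
  have g: "g dvd 2 * A" "g dvd C" "g dvd B" "g dvd Q" unfolding g_def by (meson dvd_trans gcd_dvd1 gcd_dvd2)+
  have n2Q: "2 * n dvd Q" using Q(2) by (rule dvd_trans[rotated]) (simp add: power3_eq_cube)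
  have "d dvd 2 * (A - n) + 2 * n" using d(4) by (intro dvd_add dvd_mult[OF d(1)])
  then have "d dvd 2 * A" by simp
  then have dg: "d dvd g" unfolding g_def using d n2Q by (auto intro: dvd_trans)
  obtain m where m: "Q = (2 * n)^3 * m" using Q(2) by (rule dvdE)
  have m0: "m \<noteq> 0" using Q(1) m by auto
  \<comment> \<open>By (2 n)^2 = (2 A)^2 + 4 B C - 4 (A^2 + B C - n^2), this gcd divides (2
    n)^2.\<close>
  define h where "h = gcd (g^2) Q"
  have "h dvd (2 * A)^2" using g(1) unfolding h_def by (meson dvd_power_same dvd_trans gcd_dvd1 dvd_power_same)
  moreover have "h dvd 4 * (B * C)"
  proof -
    have "g^2 dvd B * C" unfolding power2_eq_square using g by (intro mult_dvd_mono)
    then show ?thesis unfolding h_def by (meson dvd_mult dvd_trans gcd_dvd1)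
  qed
  moreover have "h dvd 4 * (A^2 + B * C - n^2)" unfolding h_def using q by (meson dvd_mult dvd_trans gcd_dvd2)
  ultimately have "h dvd (2 * A)^2 + 4 * (B * C) - 4 * (A^2 + B * C - n^2)" by (intro dvd_add dvd_diff)
  then have h4: "h dvd (2 * n)^2" by (simp add: power_mult_distrib algebra_simps)
  have "coprime (g^2 div h) (Q div h)" unfolding h_def by (rule div_gcd_coprime) (use Q in simp)
  moreover have "h \<noteq> 0" using Q by (simp add: h_def)
  obtain g' where g': "g^2 = h * g'" unfolding h_def by (metis dvdE gcd_dvd1)
  obtain Q' where Q': "Q = h * Q'" unfolding h_def by (metis dvdE gcd_dvd2)
  have co: "coprime g' Q'" using calculation \<open>h \<noteq> 0\<close> unfolding g' Q' by simp
  \<comment> \<open>Since (2 n)^3 divides \<open>Q\<close>, a factor 2 n remains in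
    \<open>Q'\<close>, which therefore still contains all primes of \<open>Q\<close>. This forces
    g^2 to divide \<open>h\<close>, and so (2 n)^2.\<close>
  have "is_unit g'"
  proof (rule ccontr)
    assume "\<not> is_unit g'"
    moreover have "g' \<noteq> 0"
    proof
      assume "g' = 0"
      then have "g = 0" using g' by simp
      then show False using Q(1) g(4) by simp
    qed
    ultimately obtain p where p: "prime p" "p dvd g'" using prime_divisor_exists by blast
    have "p dvd g^2" unfolding g' using p(2) by simp
    then have "p dvd g" using p(1) prime_dvd_power by blast
    then have "p dvd Q" using g(4) dvd_trans by blast
    then have "p dvd (2 * n)^3 \<or> p dvd m" unfolding m using p(1) prime_dvd_multD by blast
    then have "p dvd 2 * n \<or> p dvd m" using p(1) prime_dvd_power by blast
    then have "p dvd (2 * n) * m" by auto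
    moreover have "2 * n * m dvd Q'"
    proof -
      obtain k where k: "(2 * n)^2 = h * k" using h4 by (rule dvdE)
      have "h * Q' = (2 * n)^2 * (2 * n * m)" using Q' m by (simp add: power2_eq_square power3_eq_cube mult.assoc)
      then have "h * Q' = h * (k * (2 * n * m))" by (simp only: k mult.assoc)
      then have "Q' = k * (2 * n * m)" using \<open>h \<noteq> 0\<close> by (metis mult_cancel_left)
      then show ?thesis by simp
    qed
    ultimately have "p dvd Q'" by (rule dvd_trans)
    then show False using co p coprime_common_divisor not_prime_unit by blast
  qed
  then have "g^2 dvd h" unfolding g' by (metis dvd_refl mult_dvd_mono mult.right_neutral)
  then have "g^2 dvd (2 * n)^2" using h4 by (rule dvd_trans)
  then have g2n: "g dvd 2 * n" by (metis pow_divides_pow_iff zero_less_numeral)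
  have g0: "g \<noteq> 0" using Q(1) g(4) by auto
  obtain \<alpha> where \<alpha>: "2 * A = g * \<alpha>" using g(1) by (rule dvdE)
  obtain \<nu> where \<nu>: "2 * n = g * \<nu>" using g2n by (rule dvdE)
  have "g^2 dvd Q" using \<open>g^2 dvd h\<close> unfolding h_def by (meson dvd_trans gcd_dvd2)
  then have "g^2 dvd A^2 + B * C - n^2" using q by (rule dvd_trans)
  moreover have "g^2 dvd B * C" unfolding power2_eq_square using g by (intro mult_dvd_mono)
  ultimately have "g^2 dvd (A^2 + B * C - n^2) - B * C" by - (rule dvd_diff)
  then obtain l where l: "A^2 - n^2 = g^2 * l" by (auto elim!: dvdE)
  have "g^2 * (\<alpha>^2 - \<nu>^2) = (2 * A)^2 - (2 * n)^2" unfolding \<alpha> \<nu> by (simp add: power_mult_distrib right_diff_distrib)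
  also have "\<dots> = g^2 * (4 * l)" using l by (simp add: power_mult_distrib)
  finally have "\<alpha>^2 - \<nu>^2 = 4 * l" using g0 by simp
  \<comment> \<open>Parity decides whether g divides A - n or only 2 (A - n): since 4 divides
    \<alpha>^2 - \<nu>^2, the difference \<alpha> - \<nu> is even.\<close>
  then have "even (\<alpha>^2 - \<nu>^2)" by simp
  then have "even (\<alpha> - \<nu>)" by simp
  then obtain k where k: "\<alpha> - \<nu> = 2 * k" by (rule evenE)
  have "2 * (A - n) = g * (\<alpha> - \<nu>)" using \<alpha> \<nu> by (simp add: algebra_simps)
  then have "A - n = g * k" by (simp add: k)
  then have "g dvd d" unfolding d_def using g g2n by simp
  moreover have "d \<ge> 0" "g \<ge> 0" by (simp_all add: d_def g_def)
  ultimately have "d = g" using dg zdvd_antisym_nonneg by blast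
  then show ?thesis by (simp add: d_def g_def)
qed

text \<open>Taylor expansion from \<open>Q\<close> to Q^2: the quadratic term vanishes modulo Q^2,
  and one linear congruence is left whose coefficients form the gradient of
  \<open>qform\<close>.\<close>

lemma card_square_lift:
  fixes \<beta> :: "int^3" and Q :: int
  assumes Q: "Q > 0"
  defines "g \<equiv> gcd (gcd (gcd (2 * \<beta> $ 1) (\<beta> $ 3)) (\<beta> $ 2)) Q"
  shows "card {z \<in> box3 Q. Q * Q dvd qform (\<beta> + Q *s z) - n^2} =
    (if Q * g dvd qform \<beta> - n^2 then nat g * nat Q ^ 2 else 0)"
proof (cases "Q dvd qform \<beta> - n^2")
  case True
  then obtain k where k: "qform \<beta> - n^2 = Q * k" by (rule dvdE)
  define l :: "int^3" where "l = vector [2 * \<beta> $ 1, \<beta> $ 3, \<beta> $ 2]"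
  have "qform (\<beta> + Q *s z) - n^2 = Q * (l $ 1 * z $ 1 + l $ 2 * z $ 2 + l $ 3 * z $ 3 + k) + Q * (Q * qform z)" for z
  proof -
    have "qform (\<beta> + Q *s z) - n^2 = (qform \<beta> - n^2) + Q * (l $ 1 * z $ 1 + l $ 2 * z $ 2 + l $ 3 * z $ 3) + Q * (Q * qform z)"
      by (simp add: qform_def l_def vector_3 power2_eq_square algebra_simps)
    then show ?thesis unfolding k by (simp add: algebra_simps)
  qed
  then have "Q * Q dvd qform (\<beta> + Q *s z) - n^2 \<longleftrightarrow> Q dvd l $ 1 * z $ 1 + l $ 2 * z $ 2 + l $ 3 * z $ 3 - (- k)" for z
    using Q by (simp add: distrib_left[symmetric] dvd_add_left_iff)
  then have "card {z \<in> box3 Q. Q * Q dvd qform (\<beta> + Q *s z) - n^2} = (if g dvd - k then nat g * nat Q ^ 2 else 0)"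
    using card_linear_cong_3[OF Q, of l "- k"] by (simp add: g_def l_def vector_3)
  then show ?thesis using Q by (simp add: k)
next
  case False
  have "\<not> Q * Q dvd qform (\<beta> + Q *s z) - n^2" for z
  proof
    assume "Q * Q dvd qform (\<beta> + Q *s z) - n^2"
    then have "Q dvd qform (\<beta> + Q *s z) - n^2" by (rule dvd_mult_left)
    moreover have "qform (\<beta> + Q *s z) - n^2 = (qform \<beta> - n^2) + Q * (2 * \<beta> $ 1 * z $ 1 + \<beta> $ 3 * z $ 2 + \<beta> $ 2 * z $ 3 + Q * qform z)"
      by (simp add: qform_def power2_eq_square algebra_simps)
    ultimately show False using False by (metis dvd_add_left_iff dvd_triv_left)
  qed
  then have "{z \<in> box3 Q. Q * Q dvd qform (\<beta> + Q *s z) - n^2} = {}" by blast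
  moreover have "\<not> Q * g dvd qform \<beta> - n^2" using False dvd_mult_left by blast
  ultimately show ?thesis by (simp only: card.empty if_False)
qed

text \<open>Double counting of pairs of a class \<beta> and an eigenvector, both modulo
  \<open>Q\<close>. A fixed \<beta> has d \<phi>(Q) eigenvectors, with d the content of \<beta> - n,
  and g Q^2 lifts to solutions modulo Q^2, with g the content of the gradient, both under equivalent
  divisibility conditions. As d = g there, the weights turn into a count of points modulo
  Q^2.\<close>

theorem eig_weight_sum:
  fixes n Q :: int and L :: "(int^3) set"
  assumes n: "n > 0" and Q: "Q > 0" "(2 * n)^3 dvd Q" and per: "periodic Q (\<lambda>y. y \<in> L)"
  shows "(\<Sum>r | r \<in> {0..<Q} \<times> {0..<Q} \<and> gcd (gcd (fst r) (snd r)) Q = 1. eig_weight L n Q r) * nat Q ^ 2 =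
    totient (nat Q) * card {y \<in> box3 (Q * Q). y \<in> L \<and> Q * Q dvd qform y - n^2}"
proof -
  let ?R = "{r \<in> {0..<Q} \<times> {0..<Q}. gcd (gcd (fst r) (snd r)) Q = 1}"
  let ?c = "\<lambda>\<beta> u. Q dvd \<beta> $ 1 * fst u + \<beta> $ 2 * snd u - n * fst u \<and> Q dvd \<beta> $ 3 * fst u - \<beta> $ 1 * snd u - n * snd u"
  \<comment> \<open>2 n is included because the second diagonal entry of \<beta> - n is the negative
    of the first one, minus 2 n.\<close>
  define d where "d \<beta> = gcd (gcd (\<beta> $ 1 - n) (\<beta> $ 2)) (gcd (\<beta> $ 3) (2 * n))" for \<beta> :: "int^3"
  define g where "g \<beta> = gcd (gcd (gcd (2 * \<beta> $ 1) (\<beta> $ 3)) (\<beta> $ 2)) Q" for \<beta> :: "int^3"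
  have finR: "finite ?R" by (rule finite_subset[of _ "{0..<Q} \<times> {0..<Q}"]) auto
  have kernel: "card {u \<in> ?R. ?c \<beta> u} = (if Q * d \<beta> dvd qform \<beta> - n^2 then nat (d \<beta>) * totient (nat Q) else 0)" for \<beta> :: "int^3"
  proof -
    have d2n: "d \<beta> dvd 2 * n" unfolding d_def by (rule dvd_trans[OF gcd_dvd2 gcd_dvd2])
    have d0: "d \<beta> > 0" using n by (simp add: d_def)
    obtain m0 where m0: "Q = (2 * n)^3 * m0" using Q(2) by (rule dvdE)
    obtain k where k: "2 * n = d \<beta> * k" using d2n by (rule dvdE)
    define m where "m = k * (2 * n)^2 * m0"
    have Qm: "Q = d \<beta> * m" unfolding m_def m0 by (simp add: power3_eq_cube power2_eq_square k mult.assoc)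
    have m: "m > 0" using Q(1) d0 Qm by (simp add: zero_less_mult_iff)
    have primes: "p dvd m" if "prime p" "p dvd d \<beta>" for p
    proof -
      have "p dvd 2 * n" using that d2n dvd_trans by blast
      then have "p dvd (2 * n)^2" unfolding power2_eq_square by (rule dvd_mult2)
      then show ?thesis by (simp add: m_def)
    qed
    obtain a where a: "\<beta> $ 1 - n = d \<beta> * a" by (metis d_def dvdE dvd_trans gcd_dvd1)
    obtain b where b: "\<beta> $ 2 = d \<beta> * b" by (metis d_def dvdE dvd_trans gcd_dvd1 gcd_dvd2)
    obtain c where c: "\<beta> $ 3 = d \<beta> * c" by (metis d_def dvdE dvd_trans gcd_dvd1 gcd_dvd2)
    define e where "e = - a - k"
    have e: "- \<beta> $ 1 - n = d \<beta> * e" using a k by (simp add: e_def algebra_simps)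
    have prim: "\<not> p dvd e" if p: "prime p" "p dvd a" "p dvd b" "p dvd c" for p
    proof
      assume "p dvd e"
      then have "p dvd - a - e" using p(2) by (intro dvd_diff) auto
      then have "p dvd k" by (simp add: e_def)
      then have "d \<beta> * p dvd \<beta> $ 1 - n" "d \<beta> * p dvd \<beta> $ 2" "d \<beta> * p dvd \<beta> $ 3" "d \<beta> * p dvd 2 * n"
        unfolding a b c k using p by simp_all
      then have "d \<beta> * p dvd d \<beta>" unfolding d_def[of \<beta>, symmetric] by (subst (2) d_def) (intro gcd_greatest)
      then have "p dvd 1" using d0 by (metis dvd_mult_cancel_left less_irrefl mult.right_neutral)
      then show False using p(1) not_prime_unit by blast
    qed
    have c1: "Q dvd \<beta> $ 1 * x + \<beta> $ 2 * y - n * x \<longleftrightarrow> m dvd a * x + b * y" for x y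
    proof -
      have "\<beta> $ 1 * x + \<beta> $ 2 * y - n * x = (\<beta> $ 1 - n) * x + \<beta> $ 2 * y" by (simp add: algebra_simps)
      also have "\<dots> = d \<beta> * (a * x + b * y)" unfolding a b by (simp add: algebra_simps)
      finally show ?thesis unfolding Qm using d0 by simp
    qed
    have c2: "Q dvd \<beta> $ 3 * x - \<beta> $ 1 * y - n * y \<longleftrightarrow> m dvd c * x + e * y" for x y
    proof -
      have "\<beta> $ 3 * x - \<beta> $ 1 * y - n * y = \<beta> $ 3 * x + (- \<beta> $ 1 - n) * y" by (simp add: algebra_simps)
      also have "\<dots> = d \<beta> * (c * x + e * y)" unfolding c e by (simp add: algebra_simps)
      finally show ?thesis unfolding Qm using d0 by simp
    qed
    have "qform \<beta> - n^2 = - ((\<beta> $ 1 - n) * (- \<beta> $ 1 - n) - \<beta> $ 2 * \<beta> $ 3)"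
      by (simp add: qform_def power2_eq_square algebra_simps)
    also have "\<dots> = - (d \<beta> * (d \<beta> * (a * e - b * c)))" unfolding a b c e by (simp add: algebra_simps)
    finally have "Q * d \<beta> dvd qform \<beta> - n^2 \<longleftrightarrow> d \<beta> * (d \<beta> * m) dvd d \<beta> * (d \<beta> * (a * e - b * c))"
      unfolding Qm by (simp add: mult_ac)
    then have det: "Q * d \<beta> dvd qform \<beta> - n^2 \<longleftrightarrow> m dvd a * e - b * c" using d0 by simp
    have "{u \<in> ?R. ?c \<beta> u} = {u \<in> {0..<d \<beta> * m} \<times> {0..<d \<beta> * m}. gcd (gcd (fst u) (snd u)) (d \<beta> * m) = 1 \<and>
      m dvd a * fst u + b * snd u \<and> m dvd c * fst u + e * snd u}"
      unfolding c1 c2 unfolding Qm by auto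
    then show ?thesis using card_primitive_kernel[OF m d0 primes prim] unfolding det unfolding Qm by simp
  qed
  have same: "Q * d \<beta> dvd qform \<beta> - n^2 \<longleftrightarrow> Q * g \<beta> dvd qform \<beta> - n^2" "Q * d \<beta> dvd qform \<beta> - n^2 \<Longrightarrow> d \<beta> = g \<beta>" for \<beta> :: "int^3"
  proof -
    have *: "d \<beta> = g \<beta>" if "Q dvd qform \<beta> - n^2"
      using content_eq_gradient[OF n Q, of "\<beta> $ 1" "\<beta> $ 2" "\<beta> $ 3"] that by (simp add: qform_def d_def g_def)
    show "Q * d \<beta> dvd qform \<beta> - n^2 \<longleftrightarrow> Q * g \<beta> dvd qform \<beta> - n^2" using * dvd_mult_left by metis
    show "d \<beta> = g \<beta>" if "Q * d \<beta> dvd qform \<beta> - n^2" using * that dvd_mult_left by metis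
  qed
  have "(\<Sum>r\<in>?R. eig_weight L n Q r) = (\<Sum>r\<in>?R. \<Sum>\<beta>\<in>{\<beta> \<in> box3 Q. \<beta> \<in> L}. if ?c \<beta> r then 1 else 0)"
  proof (intro sum.cong refl)
    fix r
    have "eig_weight L n Q r = card {\<beta> \<in> {\<beta> \<in> box3 Q. \<beta> \<in> L}. ?c \<beta> r}"
      unfolding eig_weight_def by (rule arg_cong[where f = card]) auto
    then show "eig_weight L n Q r = (\<Sum>\<beta>\<in>{\<beta> \<in> box3 Q. \<beta> \<in> L}. if ?c \<beta> r then 1 else 0)"
      by (simp add: sum.If_cases Int_def)
  qed
  also have "\<dots> = (\<Sum>\<beta>\<in>{\<beta> \<in> box3 Q. \<beta> \<in> L}. \<Sum>r\<in>?R. if ?c \<beta> r then 1 else 0)" by (rule sum.swap)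
  also have "\<dots> = (\<Sum>\<beta>\<in>{\<beta> \<in> box3 Q. \<beta> \<in> L}. if Q * g \<beta> dvd qform \<beta> - n^2 then nat (g \<beta>) * totient (nat Q) else 0)"
  proof (intro sum.cong refl)
    fix \<beta> :: "int^3"
    have "(\<Sum>r\<in>?R. if ?c \<beta> r then 1 else 0) = card {u \<in> ?R. ?c \<beta> u}" using finR by (simp add: sum.If_cases Int_def)
    also have "\<dots> = (if Q * g \<beta> dvd qform \<beta> - n^2 then nat (g \<beta>) * totient (nat Q) else 0)"
      unfolding kernel using same[of \<beta>] by simp
    finally show "(\<Sum>r\<in>?R. if ?c \<beta> r then 1 else 0) = (if Q * g \<beta> dvd qform \<beta> - n^2 then nat (g \<beta>) * totient (nat Q) else 0)" .
  qed
  finally have lhs: "(\<Sum>r\<in>?R. eig_weight L n Q r) = (\<Sum>\<beta>\<in>{\<beta> \<in> box3 Q. \<beta> \<in> L}. if Q * g \<beta> dvd qform \<beta> - n^2 then nat (g \<beta>) * totient (nat Q) else 0)" .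
  have "card {y \<in> box3 (Q * Q). y \<in> L \<and> Q * Q dvd qform y - n^2} =
    (\<Sum>\<beta>\<in>box3 Q. card {z \<in> box3 Q. \<beta> + Q *s z \<in> L \<and> Q * Q dvd qform (\<beta> + Q *s z) - n^2})"
    by (rule card_box3_mult[OF Q(1) Q(1)])
  also have "\<dots> = (\<Sum>\<beta>\<in>box3 Q. if \<beta> \<in> L then (if Q * g \<beta> dvd qform \<beta> - n^2 then nat (g \<beta>) * nat Q ^ 2 else 0) else 0)"
  proof (intro sum.cong refl)
    fix \<beta> :: "int^3"
    have "\<beta> + Q *s z \<in> L \<longleftrightarrow> \<beta> \<in> L" for z using periodicD[OF per vcong_add_scaled] by blast
    then show "card {z \<in> box3 Q. \<beta> + Q *s z \<in> L \<and> Q * Q dvd qform (\<beta> + Q *s z) - n^2} =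
      (if \<beta> \<in> L then (if Q * g \<beta> dvd qform \<beta> - n^2 then nat (g \<beta>) * nat Q ^ 2 else 0) else 0)"
      using card_square_lift[OF Q(1), of \<beta> n] by (simp add: g_def)
  qed
  also have "\<dots> = (\<Sum>\<beta>\<in>{\<beta> \<in> box3 Q. \<beta> \<in> L}. if Q * g \<beta> dvd qform \<beta> - n^2 then nat (g \<beta>) * nat Q ^ 2 else 0)"
    by (rule sum.inter_filter[symmetric]) simp
  finally have rhs: "card {y \<in> box3 (Q * Q). y \<in> L \<and> Q * Q dvd qform y - n^2} =
    (\<Sum>\<beta>\<in>{\<beta> \<in> box3 Q. \<beta> \<in> L}. if Q * g \<beta> dvd qform \<beta> - n^2 then nat (g \<beta>) * nat Q ^ 2 else 0)" .
  show ?thesis unfolding lhs rhs sum_distrib_left sum_distrib_right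
    by (intro sum.cong refl) (simp add: mult_ac)
qed

section \<open>Local densities\<close>

definition qgrad :: "int^3^3 \<Rightarrow> int^3 \<Rightarrow> int^3" where
  "qgrad c x = (\<chi> i. \<Sum>j\<in>UNIV. (c $ i $ j + c $ j $ i) * x $ j)"

definition qcontent :: "int^3^3 \<Rightarrow> int \<Rightarrow> int^3 \<Rightarrow> int" where
  "qcontent c k x = gcd (gcd (gcd (qgrad c x $ 1) (qgrad c x $ 2)) (qgrad c x $ 3)) k"

lemma qf_add_scaled:
  "qf c (x + M *s z) = qf c x + M * (qgrad c x $ 1 * z $ 1 + qgrad c x $ 2 * z $ 2 + qgrad c x $ 3 * z $ 3) + M^2 * qf c z"
  for x z :: "int^3"
  by (simp add: qf_def qgrad_def sum_3 power2_eq_square algebra_simps)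

lemma qgrad_euler: "qgrad c x $ 1 * x $ 1 + qgrad c x $ 2 * x $ 2 + qgrad c x $ 3 * x $ 3 = 2 * qf c x"
  by (simp add: qf_def qgrad_def sum_3 algebra_simps)

lemma qf_vcong:
  assumes "vcong M x y"
  shows "M dvd (qf c x - a) - (qf c y - a)"
proof -
  obtain z where "x = y + M *s z" using assms by (rule vcongE)
  then have "(qf c x - a) - (qf c y - a) =
    M * (qgrad c y $ 1 * z $ 1 + qgrad c y $ 2 * z $ 2 + qgrad c y $ 3 * z $ 3 + M * qf c z)"
    by (simp add: qf_add_scaled power2_eq_square algebra_simps)
  then show ?thesis by simp
qed

lemma periodic_qf: "periodic M (\<lambda>x. M dvd qf c x - a)"
  unfolding periodic_def using qf_vcong by (metis dvd_add_right_iff diff_add_cancel)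

text \<open>Hensel lifting in counted form: as k divides \<open>M\<close>, the quadratic term drops
  out modulo \<open>M * k\<close>, and the lifts of x are the solutions of a linear congruence
  modulo k.\<close>

lemma card_qf_lift:
  assumes M: "M > 0" and k: "k > 0" "k dvd M"
  shows "card {x \<in> box3 (M * k). M * k dvd qf c x - a} =
    (\<Sum>x\<in>box3 M. if M * qcontent c k x dvd qf c x - a then nat (qcontent c k x) * nat k ^ 2 else 0)"
  unfolding card_box3_mult[OF M k(1)]
proof (intro sum.cong refl)
  fix x :: "int^3"
  let ?l = "\<lambda>z. qgrad c x $ 1 * z $ 1 + qgrad c x $ 2 * z $ 2 + qgrad c x $ 3 * z $ 3"
  obtain k' where k': "M = k * k'" using k(2) by (rule dvdE)
  have f: "qf c (x + M *s z) - a = (qf c x - a) + M * (?l z + k * (k' * qf c z))" for z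
    by (simp add: qf_add_scaled power2_eq_square k' algebra_simps)
  show "card {z \<in> box3 k. M * k dvd qf c (x + M *s z) - a} =
    (if M * qcontent c k x dvd qf c x - a then nat (qcontent c k x) * nat k ^ 2 else 0)"
  proof (cases "M dvd qf c x - a")
    case True
    then obtain b where b: "qf c x - a = M * b" by (rule dvdE)
    have "M * k dvd qf c (x + M *s z) - a \<longleftrightarrow> k dvd ?l z - (- b)" for z
    proof -
      have "qf c (x + M *s z) - a = M * ((?l z - (- b)) + k * (k' * qf c z))"
        unfolding f b by (simp add: algebra_simps)
      then show ?thesis using M by (simp add: dvd_add_left_iff)
    qed
    then have "card {z \<in> box3 k. M * k dvd qf c (x + M *s z) - a} =
      (if qcontent c k x dvd - b then nat (qcontent c k x) * nat k ^ 2 else 0)"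
      using card_linear_cong_3[OF k(1), of "qgrad c x" "- b"] by (simp add: qcontent_def)
    then show ?thesis using M by (simp add: b)
  next
    case False
    have "\<not> M * k dvd qf c (x + M *s z) - a" for z
    proof
      assume "M * k dvd qf c (x + M *s z) - a"
      then have "M dvd (qf c x - a) + M * (?l z + k * (k' * qf c z))" unfolding f by (rule dvd_mult_left)
      then show False using False by (simp add: dvd_add_left_iff)
    qed
    moreover have "\<not> M * qcontent c k x dvd qf c x - a" using False dvd_mult_left by blast
    ultimately show ?thesis by simp
  qed
qed

lemma local_ratio_eq:
  "local_ratio c a p m = real (card {x \<in> box3 (int p ^ m). int p ^ m dvd qf c x - a}) / real p ^ (2 * m)"
  unfolding local_ratio_def box3_def by (simp add: cong_iff_dvd_diff conj_commute)

lemma prime_power_gcd_stable: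
  fixes p g :: int
  assumes p: "prime p" and g: "\<not> p ^ Suc e dvd gcd g (p ^ Suc e)"
  shows "gcd g (p ^ Suc e) = gcd g (p ^ e)"
proof -
  have "gcd g (p ^ Suc e) dvd p ^ Suc e" by simp
  then obtain i where i: "i \<le> Suc e" "normalize (gcd g (p ^ Suc e)) = p ^ i"
    using divides_primepow[OF p] by blast
  have gi: "gcd g (p ^ Suc e) = p ^ i" using i(2) by simp
  have "i \<noteq> Suc e"
  proof
    assume "i = Suc e"
    then have "p ^ Suc e dvd gcd g (p ^ Suc e)" unfolding gi by simp
    then show False using g by blast
  qed
  then have "p ^ i dvd p ^ e" using i(1) by (intro le_imp_power_dvd) simp
  then have "gcd g (p ^ Suc e) dvd gcd g (p ^ e)" unfolding gi[symmetric] by (rule gcd_greatest[OF gcd_dvd1])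
  moreover have "gcd g (p ^ e) dvd gcd g (p ^ Suc e)"
    by (rule gcd_greatest[OF gcd_dvd1 dvd_trans[OF gcd_dvd2 le_imp_power_dvd]]) simp
  ultimately show ?thesis by (intro zdvd_antisym_nonneg) simp_all
qed

text \<open>By Euler's identity, a gradient divisible by p^(e+1) at a solution would force p^(e+1)
  to divide 2 a, so the p-part of the gradient is already visible modulo p^e. The levels m and m + 1
  are both lifted from level r = m - e, and m \<ge> 2 e + 1 says r \<ge> e + 1, as the linear
  lifting demands.\<close>

lemma local_ratio_step:
  assumes p: "prime p" and e: "\<not> int p ^ Suc e dvd 2 * a" and m: "m \<ge> 2 * e + 1"
  shows "local_ratio c a p (Suc m) = local_ratio c a p m"
proof -
  define P where "P = int p"
  have P: "prime P" "P > 0" using p by (simp_all add: P_def prime_gt_0_nat)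
  define r where "r = m - e"
  have r: "r \<ge> Suc e" "m = r + e" "Suc m = r + Suc e" using m by (simp_all add: r_def)
  have pos: "P ^ i > 0" for i using P(2) by simp
  have "card {x \<in> box3 (P ^ r * P ^ Suc e). P ^ r * P ^ Suc e dvd qf c x - a} =
    (\<Sum>x\<in>box3 (P ^ r). if P ^ r * qcontent c (P ^ Suc e) x dvd qf c x - a then nat (qcontent c (P ^ Suc e) x) * nat (P ^ Suc e) ^ 2 else 0)"
    using r(1) by (intro card_qf_lift pos le_imp_power_dvd)
  also have "\<dots> = (\<Sum>x\<in>box3 (P ^ r). p^2 * (if P ^ r * qcontent c (P ^ e) x dvd qf c x - a then nat (qcontent c (P ^ e) x) * nat (P ^ e) ^ 2 else 0))"
  proof (intro sum.cong refl)
    fix x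
    show "(if P ^ r * qcontent c (P ^ Suc e) x dvd qf c x - a then nat (qcontent c (P ^ Suc e) x) * nat (P ^ Suc e) ^ 2 else 0) =
      p^2 * (if P ^ r * qcontent c (P ^ e) x dvd qf c x - a then nat (qcontent c (P ^ e) x) * nat (P ^ e) ^ 2 else 0)"
    proof (cases "P ^ r dvd qf c x - a")
      case True
      then have Pe: "P ^ Suc e dvd qf c x - a" using le_imp_power_dvd[OF r(1)] dvd_trans by blast
      have "\<not> P ^ Suc e dvd qcontent c (P ^ Suc e) x"
      proof
        assume "P ^ Suc e dvd qcontent c (P ^ Suc e) x"
        then have l: "P ^ Suc e dvd qgrad c x $ 1" "P ^ Suc e dvd qgrad c x $ 2" "P ^ Suc e dvd qgrad c x $ 3"
          unfolding qcontent_def by (meson dvd_trans gcd_dvd1 gcd_dvd2)+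
        have "P ^ Suc e dvd 2 * qf c x" unfolding qgrad_euler[symmetric] by (intro dvd_add dvd_mult2 l)
        then have "P ^ Suc e dvd 2 * qf c x - 2 * (qf c x - a)" using dvd_mult[OF Pe] by (rule dvd_diff)
        then show False using e by (simp add: P_def)
      qed
      then have "qcontent c (P ^ Suc e) x = qcontent c (P ^ e) x"
        unfolding qcontent_def using prime_power_gcd_stable[OF P(1)] by blast
      moreover have "nat (P ^ Suc e) ^ 2 = p^2 * nat (P ^ e) ^ 2"
        by (simp add: P_def nat_mult_distrib nat_power_eq power_mult_distrib)
      ultimately show ?thesis by (simp add: mult_ac)
    next
      case False
      then have "\<not> P ^ r * k dvd qf c x - a" for k using dvd_mult_left by blast
      then show ?thesis by simp
    qed
  qed
  also have "\<dots> = p^2 * card {x \<in> box3 (P ^ r * P ^ e). P ^ r * P ^ e dvd qf c x - a}"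
    unfolding sum_distrib_left[symmetric] by (subst card_qf_lift[OF pos pos le_imp_power_dvd]) (use r(1) in simp_all)
  finally have "card {x \<in> box3 (P ^ Suc m). P ^ Suc m dvd qf c x - a} = p^2 * card {x \<in> box3 (P ^ m). P ^ m dvd qf c x - a}"
    by (simp only: r(2) power_add[symmetric] add_Suc_right[symmetric])
  then show ?thesis unfolding local_ratio_eq P_def[symmetric] using P(2)
    by (simp add: P_def field_simps power2_eq_square power_add)
qed

text \<open>The ratios are constant from level 2 e + 1 on, so a density is a plain count at a finite
  level.\<close>

lemma local_density_eq:
  assumes p: "prime p" and e: "\<not> int p ^ Suc e dvd 2 * a" and m: "m \<ge> 2 * e + 1"
  shows "local_ratio c a p \<longlonglongrightarrow> local_ratio c a p m" "local_density c a p = local_ratio c a p m"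
proof -
  have "local_ratio c a p k = local_ratio c a p m" if "k \<ge> m" for k
    using that by (induction rule: dec_induct) (use local_ratio_step[OF p e] m in auto)
  then have "\<forall>\<^sub>F k in sequentially. local_ratio c a p k = local_ratio c a p m"
    using eventually_sequentially by blast
  then show "local_ratio c a p \<longlonglongrightarrow> local_ratio c a p m" by (rule tendsto_eventually)
  then show "local_density c a p = local_ratio c a p m" unfolding local_density_def by (rule limI)
qed

lemma not_dvd_Suc_multiplicity:
  assumes "prime p" "a \<noteq> 0"
  shows "\<not> int p ^ Suc (multiplicity (int p) (2 * a)) dvd 2 * a"
proof -
  have "\<not> is_unit (int p)" using assms(1) not_prime_unit prime_nat_int_transfer by blast
  then show ?thesis using assms(2) by (subst power_dvd_iff_le_multiplicity) simp_all
qed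

lemma local_ratio_convergent:
  assumes "prime p" "a \<noteq> 0"
  shows "convergent (local_ratio c a p)"
  using local_density_eq(1)[OF assms(1) not_dvd_Suc_multiplicity[OF assms] order_refl] by (rule convergentI)

lemma card_qf_prod:
  assumes "finite S" "\<And>p. p \<in> S \<Longrightarrow> prime p"
  shows "real (card {x \<in> box3 (\<Prod>p\<in>S. int p ^ k p). (\<Prod>p\<in>S. int p ^ k p) dvd qf c x - a}) =
    (\<Prod>p\<in>S. local_ratio c a p (k p)) * (\<Prod>p\<in>S. real p ^ k p)^2"
  using assms
proof (induction S rule: finite_induct)
  case empty
  show ?case by (simp add: card_box3)
next
  case (insert p S)
  define M where "M = (\<Prod>p\<in>S. int p ^ k p)"
  have pos: "int p ^ k p > 0" "M > 0" using insert(4) by (auto simp: M_def prime_gt_0_nat intro!: prod_pos)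
  have "coprime (int p ^ k p) M" unfolding M_def
  proof (rule prod_coprime_right)
    fix q assume q: "q \<in> S"
    then have "prime p" "prime q" "p \<noteq> q" using insert by auto
    then have "coprime (int p) (int q)" by (simp add: primes_coprime)
    then show "coprime (int p ^ k p) (int q ^ k q)" by simp
  qed
  from card_box3_coprime[OF pos this, of "\<lambda>x. qf c x - a"] qf_vcong
  have "card {x \<in> box3 (int p ^ k p * M). int p ^ k p * M dvd qf c x - a} =
    card {x \<in> box3 (int p ^ k p). int p ^ k p dvd qf c x - a} * card {x \<in> box3 M. M dvd qf c x - a}" by blast
  note c1 = this
  have c2: "real (card {x \<in> box3 (int p ^ k p). int p ^ k p dvd qf c x - a}) = local_ratio c a p (k p) * (real p ^ k p)^2"
    using pos(1) by (simp add: local_ratio_eq power_mult mult.commute)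
  have c3: "real (card {x \<in> box3 M. M dvd qf c x - a}) = (\<Prod>p\<in>S. local_ratio c a p (k p)) * (\<Prod>p\<in>S. real p ^ k p)^2"
    unfolding M_def using insert by blast
  have E: "(\<Prod>q\<in>insert p S. int q ^ k q) = int p ^ k p * M" using insert(1,2) by (simp add: M_def)
  show ?case unfolding E c1 of_nat_mult c2 c3 using insert(1,2) by (simp add: power_mult_distrib mult_ac)
qed

section \<open>Integer matrices acting on vectors\<close>

definition imat :: "int^3^3 \<Rightarrow> 'a::comm_ring_1^3^3" where "imat R = (\<chi> i j. of_int (R $ i $ j))"

lemma imat_int [simp]: "imat R = R" for R :: "int^3^3" by (simp add: imat_def vec_eq_iff)

lemma det_imat: "det (imat R) = of_int (det R)" by (simp add: imat_def det_3)

lemma imat_mult: "imat (R ** S) = imat R ** imat S"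
  by (simp add: imat_def matrix_matrix_mult_def vec_eq_iff)

lemma imat_rvec: "imat R *v rvec x = rvec (R *v x)"
  by (simp add: imat_def rvec_def matrix_vector_mult_def vec_eq_iff)

definition icross :: "int^3 \<Rightarrow> int^3 \<Rightarrow> int^3" where
  "icross u w = vector [u $ 2 * w $ 3 - u $ 3 * w $ 2, u $ 3 * w $ 1 - u $ 1 * w $ 3, u $ 1 * w $ 2 - u $ 2 * w $ 1]"

text \<open>The adjugate, built from cross products of rows; it inverts \<open>R\<close> up to the
  factor \<open>det R\<close> without leaving the integers.\<close>

definition adj3 :: "int^3^3 \<Rightarrow> int^3^3" where
  "adj3 R = transpose (vector [icross (R $ 2) (R $ 3), icross (R $ 3) (R $ 1), icross (R $ 1) (R $ 2)])"

lemma adj3: "R *v (adj3 R *v x) = det R *s x" "adj3 R *v (R *v x) = det R *s x"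
  by (simp_all add: vec_eq_iff forall_3 matrix_vector_mult_def sum_3 adj3_def transpose_def icross_def vector_3 det_3 algebra_simps)

lemma matrix_vector_smult: "R *v (k *s x) = k *s (R *v x)" for R :: "int^3^3"
  by (simp add: vec_eq_iff forall_3 matrix_vector_mult_def sum_3 algebra_simps)

lemma matrix_vector_inj:
  fixes R :: "int^3^3"
  assumes "det R \<noteq> 0" "R *v x = R *v y"
  shows "x = y"
proof -
  have "det R *s x = det R *s y" using assms(2) by (metis adj3(2))
  then show ?thesis using assms(1) by (simp add: vec_eq_iff)
qed

text \<open>By the adjugate, \<open>det R\<close> times any vector lies in the image of
  \<open>R\<close>, so this sublattice is a union of classes modulo every multiple of
  \<open>det R\<close>.\<close>

lemma range_periodic:
  assumes "det R dvd M"
  shows "periodic M (\<lambda>y. y \<in> range ((*v) R))"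
proof -
  have "x \<in> range ((*v) R)" if xy: "vcong M x y" "y \<in> range ((*v) R)" for x y
  proof -
    obtain k where k: "M = det R * k" using assms by (rule dvdE)
    obtain w where w: "y = R *v w" using xy(2) by blast
    obtain z where "x = y + M *s z" using xy(1) by (rule vcongE)
    then have "x = R *v (w + adj3 R *v (k *s z))"
      by (simp add: w k matrix_vector_right_distrib adj3 vector_smult_assoc)
    then show ?thesis by blast
  qed
  then show ?thesis unfolding periodic_def using vcong_sym by blast
qed

text \<open>The nonempty fibres of multiplication by \<open>R\<close> modulo \<open>M\<close> are
  cosets of its kernel, which has |det R| elements by \<open>card_kernel_mod\<close>.\<close>

lemma card_box3_image:
  assumes M: "M > 0" and R: "det R dvd M" and P: "periodic M P"
  shows "card {x \<in> box3 M. P (R *v x)} = nat \<bar>det R\<bar> * card {y \<in> box3 M. y \<in> range ((*v) R) \<and> P y}"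
proof -
  let ?f = "\<lambda>x. vmod M (R *v x)"
  have fib: "card {x \<in> box3 M. ?f x = y} = (if y \<in> range ((*v) R) then nat \<bar>det R\<bar> else 0)" if y: "y \<in> box3 M" for y
  proof (cases "y \<in> range ((*v) R)")
    case True
    then obtain w where w: "y = R *v w" by blast
    have eq: "?f x = y \<longleftrightarrow> vcong M (R *v (x - w)) 0" for x
    proof -
      have "?f x = y \<longleftrightarrow> vmod M (R *v x) = vmod M y" using vmod_box3[OF y] by simp
      also have "\<dots> \<longleftrightarrow> vcong M (R *v x) (R *v w)" by (simp add: vmod_eq_iff w)
      finally show ?thesis by (simp add: vcong_def matrix_vector_mult_diff_distrib)
    qed
    have "periodic M (\<lambda>x. vcong M (R *v x) 0)"
      unfolding periodic_def using vcong_matrix vcong_sym vcong_trans by blast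
    then have "card {x \<in> box3 M. vcong M (R *v (x - w)) 0} = card {x \<in> box3 M. vcong M (R *v x) 0}"
      by (rule card_box3_bij[OF M, where F = "\<lambda>x. x - w" and G = "\<lambda>x. x + w"]) (simp_all add: vcong_def)
    then show ?thesis unfolding eq using True card_kernel_mod[OF M R] by simp
  next
    case False
    have "?f x \<noteq> y" for x
    proof
      assume "?f x = y"
      then have "vcong M y (R *v x)" using vmod_cong by blast
      then show False using False periodicD[OF range_periodic[OF R]] by blast
    qed
    then show ?thesis using False by simp
  qed
  have PP: "P (?f x) = P (R *v x)" for x using periodicD[OF P vmod_cong] .
  have "{x \<in> box3 M. P (R *v x)} = (\<Union>y\<in>{y \<in> box3 M. P y}. {x \<in> box3 M. ?f x = y})"
    using vmod_in_box3[OF M] PP by auto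
  then have "card {x \<in> box3 M. P (R *v x)} = card (\<Union>y\<in>{y \<in> box3 M. P y}. {x \<in> box3 M. ?f x = y})" by (rule arg_cong)
  also have "\<dots> = (\<Sum>y\<in>{y \<in> box3 M. P y}. card {x \<in> box3 M. ?f x = y})"
    by (rule card_UN_disjoint) auto
  also have "\<dots> = (\<Sum>y\<in>{y \<in> box3 M. P y}. if y \<in> range ((*v) R) then nat \<bar>det R\<bar> else 0)"
    by (intro sum.cong refl fib) simp
  also have "\<dots> = (\<Sum>y\<in>{y \<in> {y \<in> box3 M. P y}. y \<in> range ((*v) R)}. nat \<bar>det R\<bar>)"
    by (rule sum.inter_filter[symmetric]) simp
  also have "\<dots> = nat \<bar>det R\<bar> * card {y \<in> {y \<in> box3 M. P y}. y \<in> range ((*v) R)}" by simp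
  also have "{y \<in> {y \<in> box3 M. P y}. y \<in> range ((*v) R)} = {y \<in> box3 M. y \<in> range ((*v) R) \<and> P y}" by auto
  finally show ?thesis .
qed

lemma card_box3_invertible:
  assumes M: "M > 0" and R: "coprime (det R) M" and P: "periodic M P"
  shows "card {x \<in> box3 M. P (R *v x)} = card {x \<in> box3 M. P x}"
proof -
  obtain u where "[det R * u = 1] (mod M)" using cong_solve_coprime_int[OF R] by blast
  then have "M dvd det R * u - 1" by (simp add: cong_iff_dvd_diff)
  then have u: "vcong M ((det R * u) *s x) x" for x
  proof -
    have "((det R * u) *s x) $ i - x $ i = (det R * u - 1) * x $ i" for i by (simp add: algebra_simps)
    then show ?thesis using \<open>M dvd det R * u - 1\<close> by (simp only: vcong_def) simp
  qed
  have sc: "vcong M (u *s x) (u *s y)" if "vcong M x y" for x y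
    using that by (simp add: vcong_def right_diff_distrib[symmetric])
  show ?thesis
  proof (rule card_box3_bij[OF M P vcong_matrix])
    show "vcong M (u *s (adj3 R *v x)) (u *s (adj3 R *v y))" if "vcong M x y" for x y
      using sc vcong_matrix[OF that] by blast
    show "vcong M (R *v (u *s (adj3 R *v x))) x" for x
      using u[of x] by (simp add: matrix_vector_smult adj3 vector_smult_assoc mult.commute)
    show "vcong M (u *s (adj3 R *v (R *v x))) x" for x
      using u[of x] by (simp add: adj3 vector_smult_assoc mult.commute)
  qed
qed

section \<open>Squares modulo a prime\<close>

lemma inj_on_square_mod:
  fixes p :: int
  assumes p: "prime p" and p2: "odd p" and k: "\<not> p dvd k"
  shows "inj_on (\<lambda>x. (k * x^2 + b) mod p) {0..p div 2}"
proof (rule inj_onI)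
  fix x y assume x: "x \<in> {0..p div 2}" and y: "y \<in> {0..p div 2}" and eq: "(k * x^2 + b) mod p = (k * y^2 + b) mod p"
  have "p dvd (k * x^2 + b) - (k * y^2 + b)" using eq by (simp add: mod_eq_dvd_iff)
  also have "(k * x^2 + b) - (k * y^2 + b) = k * ((x - y) * (x + y))" by (simp add: power2_eq_square algebra_simps)
  finally have "p dvd (x - y) * (x + y)" using p k by (simp add: prime_dvd_mult_iff)
  then consider "p dvd x - y" | "p dvd x + y" using p by (auto simp: prime_dvd_mult_iff)
  then show "x = y"
  proof cases
    case 1
    have "\<bar>x - y\<bar> < p" using x y prime_gt_0_int[OF p] by auto
    then show ?thesis using 1 dvd_imp_le_int[of "x - y" p] by fastforce
  next
    case 2
    have "x + y < p" using x y p2 by (auto elim!: oddE)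
    then show ?thesis using 2 x y zdvd_imp_le[of p "x + y"] by fastforce
  qed
qed

text \<open>Pigeonhole: for arguments from 0 to (p - 1) / 2, the values z^2 and A x^2 + B form two
  sets of (p + 1) / 2 residues each, too many to be disjoint.\<close>

lemma norm_form_represents_mod:
  fixes p A B :: int
  assumes p: "prime p" "odd p" and A: "\<not> p dvd A"
  shows "\<exists>x z. p dvd z^2 - A * x^2 - B"
proof (rule ccontr)
  assume no: "\<not> ?thesis"
  let ?I = "{0..p div 2}"
  let ?X = "(\<lambda>x. (A * x^2 + B) mod p) ` ?I" and ?Z = "(\<lambda>x. (1 * x^2 + 0) mod p) ` ?I"
  have disj: "?X \<inter> ?Z = {}"
  proof (rule equals0I)
    fix t assume "t \<in> ?X \<inter> ?Z"
    then obtain x z where "t = (A * x^2 + B) mod p" "t = (1 * z^2 + 0) mod p" by blast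
    then have "(1 * z^2 + 0) mod p = (A * x^2 + B) mod p" by simp
    then have "p dvd (1 * z^2 + 0) - (A * x^2 + B)" by (simp only: mod_eq_dvd_iff)
    then show False using no by (simp add: algebra_simps)
  qed
  have "\<not> p dvd 1" using p(1) not_prime_unit by blast
  then have c: "card ?X = nat (p div 2 + 1)" "card ?Z = nat (p div 2 + 1)"
    using card_image[OF inj_on_square_mod[OF p A, of B]] card_image[OF inj_on_square_mod[OF p, of 1 0]] by simp_all
  have "card (?X \<union> ?Z) = 2 * nat (p div 2 + 1)" using card_Un_disjoint[OF _ _ disj] c by simp
  moreover have "card (?X \<union> ?Z) \<le> card {0..<p}"
    using prime_gt_0_int[OF p(1)] by (intro card_mono) auto
  ultimately show False using p(2) prime_gt_0_int[OF p(1)] by (auto elim!: oddE simp: nat_mult_distrib)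
qed

text \<open>Slicing by the entry b: for b \<noteq> 0 the entry c is determined, and for b = 0 there
  are two choices of a with c free, together p (p - 1) + 2 p.\<close>

lemma card_qform_prime:
  fixes p k :: int
  assumes p: "prime p" "odd p" and k: "\<not> p dvd k"
  shows "int (card {y \<in> box3 p. p dvd qform y - k^2}) = p^2 + p"
proof -
  have p0: "p > 0" using p(1) by (rule prime_gt_0_int)
  let ?c = "\<lambda>a b. card {c \<in> {0..<p}. p dvd qform (vector [a, b, c]) - k^2}"
  have c: "int (?c a b) = (if b = 0 then if p dvd a^2 - k^2 then p else 0 else 1)" if "b \<in> {0..<p}" for a b
  proof -
    have "p dvd qform (vector [a, b, c]) - k^2 \<longleftrightarrow> p dvd b * c - (k^2 - a^2)" for c
      by (simp add: qform_def vector_3 algebra_simps)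
    then have *: "?c a b = (if gcd b p dvd k^2 - a^2 then nat (gcd b p) else 0)" using card_linear_cong_1[OF p0] by simp
    show ?thesis
    proof (cases "b = 0")
      case True
      then show ?thesis using * p0 by (simp add: dvd_diff_commute)
    next
      case False
      then have "\<not> p dvd b" using that zdvd_imp_le[of p b] by auto
      then have "coprime b p" using prime_imp_coprime[OF p(1)] by (simp add: coprime_commute)
      then show ?thesis using * False by simp
    qed
  qed
  have sq: "{a \<in> {0..<p}. p dvd a^2 - k^2} = {k mod p, (- k) mod p}"
  proof -
    have "p dvd a^2 - k^2 \<longleftrightarrow> a = k mod p \<or> a = (- k) mod p" if "a \<in> {0..<p}" for a
    proof -
      have "a^2 - k^2 = (a - k) * (a - - k)" by (simp add: power2_eq_square algebra_simps)
      then have "p dvd a^2 - k^2 \<longleftrightarrow> a mod p = k mod p \<or> a mod p = (- k) mod p"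
        by (simp only: prime_dvd_mult_iff[OF p(1)] mod_eq_dvd_iff)
      then show ?thesis using that by simp
    qed
    then show ?thesis using p0 by auto
  qed
  have ne: "k mod p \<noteq> (- k) mod p"
  proof
    assume "k mod p = (- k) mod p"
    then have "p dvd 2 * k" by (simp add: mod_eq_dvd_iff)
    then have "p dvd 2" using k p(1) by (simp add: prime_dvd_mult_iff)
    then have "p = 2" using p(1) by (intro primes_dvd_imp_eq) auto
    then show False using p(2) by simp
  qed
  have "int (card {y \<in> box3 p. p dvd qform y - k^2}) = (\<Sum>a\<in>{0..<p}. \<Sum>b\<in>{0..<p}. int (?c a b))"
    unfolding card_box3_sum by simp
  also have "\<dots> = (\<Sum>a\<in>{0..<p}. \<Sum>b\<in>{0..<p}. if b = 0 then if p dvd a^2 - k^2 then p else 0 else 1)"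
    using c by (intro sum.cong refl) blast
  also have "\<dots> = (\<Sum>a\<in>{0..<p}. (if p dvd a^2 - k^2 then p else 0) + (p - 1))"
  proof (intro sum.cong refl)
    fix a
    have "{0..<p} = insert 0 {1..<p}" using p0 by auto
    then have "(\<Sum>b\<in>{0..<p}. if b = 0 then if p dvd a^2 - k^2 then p else 0 else 1) =
      (if p dvd a^2 - k^2 then p else 0) + (\<Sum>b\<in>{1..<p}. if b = 0 then if p dvd a^2 - k^2 then p else 0 else 1)"
      by simp
    also have "(\<Sum>b\<in>{1..<p}. if b = 0 then if p dvd a^2 - k^2 then p else 0 else 1) = (\<Sum>b\<in>{1..<p}. 1)"
      by (intro sum.cong refl) auto
    finally show "(\<Sum>b\<in>{0..<p}. if b = 0 then if p dvd a^2 - k^2 then p else 0 else 1) =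
      (if p dvd a^2 - k^2 then p else 0) + (p - 1)" using p0 by simp
  qed
  also have "\<dots> = (\<Sum>a\<in>{a \<in> {0..<p}. p dvd a^2 - k^2}. p) + p * (p - 1)"
    using p0 by (simp only: sum.distrib sum.inter_filter[symmetric] finite_atLeastLessThan_int) simp
  also have "\<dots> = p^2 + p" unfolding sq using ne by (simp add: power2_eq_square algebra_simps)
  finally show ?thesis .
qed

section \<open>Diagonalisation\<close>

definition idot :: "int^3 \<Rightarrow> int^3 \<Rightarrow> int" where "idot u w = u $ 1 * w $ 1 + u $ 2 * w $ 2 + u $ 3 * w $ 3"

lemma idot_simps:
  "idot (u + v) w = idot u w + idot v w" "idot u (v + w) = idot u v + idot u w"
  "idot (k *s u) w = k * idot u w" "idot u (k *s w) = k * idot u w"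
  "idot u (icross u w) = 0" "idot w (icross u w) = 0"
  by (simp_all add: idot_def icross_def vector_3 algebra_simps)

lemma idot_qgrad_commute: "idot (qgrad c u) w = idot (qgrad c w) u"
  by (simp add: idot_def qgrad_def sum_3 algebra_simps)

lemma idot_qgrad_self: "idot (qgrad c u) u = 2 * qf c u"
  using qgrad_euler[of c u] by (simp add: idot_def)

lemma qf_smult: "qf c (k *s x) = k^2 * qf c x"
  by (simp add: qf_def sum_3 power2_eq_square algebra_simps)

lemma qgrad_smult: "qgrad c (k *s x) = k *s qgrad c x"
  by (simp add: qgrad_def vec_eq_iff sum_3 algebra_simps)

lemma binet_cauchy: "idot (icross u v) (icross w z) = idot u w * idot v z - idot u z * idot v w"
  by (simp add: idot_def icross_def vector_3 algebra_simps)

lemma det_rows: "det (vector [u, v, w] :: int^3^3) = idot (icross u v) w"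
  by (simp add: idot_def icross_def vector_3 det_3 algebra_simps)

lemma det_gram: "det (gram c) = of_int (det (\<chi> i j. c $ i $ j + c $ j $ i)) / 8"
  by (simp add: gram_def det_3 field_simps)

lemma qf_combination:
  fixes y :: "'a::comm_ring_1^3"
  shows "qf c (\<chi> i. y $ 1 * of_int (u $ i) + y $ 2 * of_int (v $ i) + y $ 3 * of_int (w $ i)) =
    of_int (qf c u) * (y $ 1)^2 + of_int (qf c v) * (y $ 2)^2 + of_int (qf c w) * (y $ 3)^2 +
    of_int (idot (qgrad c u) v) * (y $ 1 * y $ 2) + of_int (idot (qgrad c u) w) * (y $ 1 * y $ 3) +
    of_int (idot (qgrad c v) w) * (y $ 2 * y $ 3)"
  by (simp add: qf_def idot_def qgrad_def sum_3 power2_eq_square algebra_simps)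

lemma cramer_rows:
  fixes x :: "'a::comm_ring_1^3" and u v w :: "int^3"
  defines "y \<equiv> imat (vector [icross v w, icross w u, icross u v]) *v x"
  shows "of_int (det (vector [u, v, w] :: int^3^3)) *s x =
    (\<chi> i. y $ 1 * of_int (u $ i) + y $ 2 * of_int (v $ i) + y $ 3 * of_int (w $ i))"
  unfolding y_def
  by (simp add: vec_eq_iff forall_3 imat_def matrix_vector_mult_def sum_3 icross_def vector_3 det_3 algebra_simps)

lemma det_cofactors: "det (vector [icross v w, icross w u, icross u v] :: int^3^3) = (det (vector [u, v, w] :: int^3^3))^2"
  by (simp add: icross_def vector_3 det_3 power2_eq_square algebra_simps)

text \<open>Orthogonalisation without denominators: the third vector is the cross product of the
  gradients at the first two and hence orthogonal to both. The last identity is det (V G V^t) =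
  det(V)^2 det(G), where the left matrix is diagonal with twice the values of the form.\<close>

lemma orthogonal_basis:
  assumes "nonsingular c"
  shows "\<exists>u v w. idot (qgrad c u) v = 0 \<and> idot (qgrad c u) w = 0 \<and> idot (qgrad c v) w = 0 \<and>
    det (vector [u, v, w] :: int^3^3) \<noteq> 0 \<and>
    of_int (qf c u * qf c v * qf c w) = det (gram c) * of_int (det (vector [u, v, w] :: int^3^3))^2"
proof -
  define G where "G = (\<chi> i j. c $ i $ j + c $ j $ i)"
  have G0: "det G \<noteq> 0" using assms by (simp add: nonsingular_def det_gram G_def)
  have sym: "G $ 2 $ 1 = G $ 1 $ 2" "G $ 3 $ 1 = G $ 1 $ 3" "G $ 3 $ 2 = G $ 2 $ 3" by (simp_all add: G_def)
  let ?e1 = "vector [1, 0, 0] :: int^3" and ?e2 = "vector [0, 1, 0] :: int^3" and ?e3 = "vector [0, 0, 1] :: int^3"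
  have val: "2 * qf c ?e1 = G $ 1 $ 1" "2 * qf c ?e2 = G $ 2 $ 2" "2 * qf c ?e3 = G $ 3 $ 3"
    "qf c (?e1 + ?e2) = qf c ?e1 + qf c ?e2 + G $ 1 $ 2" "qf c (?e1 + ?e3) = qf c ?e1 + qf c ?e3 + G $ 1 $ 3"
    "qf c (?e2 + ?e3) = qf c ?e2 + qf c ?e3 + G $ 2 $ 3"
    by (simp_all add: qf_def G_def sum_3 vector_3 algebra_simps)
  have "\<exists>u::int^3. qf c u \<noteq> 0"
  proof (rule ccontr)
    assume "\<not> ?thesis"
    then have "qf c x = 0" for x :: "int^3" by blast
    then have "det G = 0" using val by (simp add: det_3 sym)
    then show False using G0 by simp
  qed
  then obtain u :: "int^3" where u: "qf c u \<noteq> 0" by blast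
  define q where "q = qgrad c u"
  have qu: "idot q u = 2 * qf c u" by (simp add: q_def idot_qgrad_self)
  \<comment> \<open>If the form vanished on the orthogonal complement of u, it would be a constant
    times the square of a linear form, hence singular.\<close>
  have "\<exists>v. idot q v = 0 \<and> qf c v \<noteq> 0"
  proof (rule ccontr)
    assume no: "\<not> ?thesis"
    have sq: "4 * qf c u * qf c x = (idot q x)^2" for x
    proof -
      let ?v = "(- idot q x) *s u + (2 * qf c u) *s x"
      have "idot q ?v = 0" by (simp only: idot_simps qu) (simp add: algebra_simps)
      then have "qf c ?v = 0" using no by blast
      moreover have "qf c ?v = (- idot q x)^2 * qf c u + 2 * qf c u * idot (qgrad c ((- idot q x) *s u)) x + (2 * qf c u)^2 * qf c x"
        unfolding qf_add_scaled qf_smult idot_def[of "qgrad c ((- idot q x) *s u)"] ..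
      moreover have "idot (qgrad c ((- idot q x) *s u)) x = - ((idot q x)^2)"
        by (simp only: qgrad_smult idot_simps q_def[symmetric]) (simp add: power2_eq_square)
      ultimately have "qf c u * (4 * qf c u * qf c x - (idot q x)^2) = 0"
        by (auto simp: power2_eq_square algebra_simps)
      then show ?thesis using u by simp
    qed
    define b where "b = 2 * qf c u"
    have iq: "idot q ?e1 = q $ 1" "idot q ?e2 = q $ 2" "idot q ?e3 = q $ 3"
      "idot q (?e1 + ?e2) = q $ 1 + q $ 2" "idot q (?e1 + ?e3) = q $ 1 + q $ 3" "idot q (?e2 + ?e3) = q $ 2 + q $ 3"
      by (simp_all add: idot_def vector_3)
    have bG: "b * G $ 1 $ 1 = q $ 1 * q $ 1" "b * G $ 2 $ 2 = q $ 2 * q $ 2" "b * G $ 3 $ 3 = q $ 3 * q $ 3"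
      using sq[of ?e1] sq[of ?e2] sq[of ?e3] unfolding iq val(1-3)[symmetric] b_def power2_eq_square by (simp_all add: mult_ac)
    have bG': "b * G $ 1 $ 2 = q $ 1 * q $ 2" "b * G $ 1 $ 3 = q $ 1 * q $ 3" "b * G $ 2 $ 3 = q $ 2 * q $ 3"
      using sq[of ?e1] sq[of ?e2] sq[of ?e3] sq[of "?e1 + ?e2"] sq[of "?e1 + ?e3"] sq[of "?e2 + ?e3"]
      unfolding iq val(4-6) b_def power2_eq_square by (simp_all add: algebra_simps)
    have "b^3 * det G = (b * G $ 1 $ 1) * (b * G $ 2 $ 2) * (b * G $ 3 $ 3) + 2 * ((b * G $ 1 $ 2) * (b * G $ 1 $ 3) * (b * G $ 2 $ 3))
      - (b * G $ 1 $ 1) * (b * G $ 2 $ 3) * (b * G $ 2 $ 3) - (b * G $ 1 $ 2) * (b * G $ 1 $ 2) * (b * G $ 3 $ 3)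
      - (b * G $ 1 $ 3) * (b * G $ 2 $ 2) * (b * G $ 1 $ 3)"
      by (simp add: det_3 sym power3_eq_cube algebra_simps)
    also have "\<dots> = 0" unfolding bG bG' by (simp add: algebra_simps)
    finally show False using G0 u by (simp add: b_def)
  qed
  then obtain v where v: "idot q v = 0" "qf c v \<noteq> 0" by blast
  define w where "w = icross q (qgrad c v)"
  have ort: "idot (qgrad c u) v = 0" "idot (qgrad c u) w = 0" "idot (qgrad c v) w = 0"
    using v(1) by (simp_all add: w_def q_def idot_simps)
  define V :: "int^3^3" where "V = vector [u, v, w]"
  have cm: "idot x y = idot y x" for x y by (simp add: idot_def mult.commute)
  have "det V = idot u q * idot v (qgrad c v) - idot u (qgrad c v) * idot v q"
    unfolding V_def det_rows w_def binet_cauchy ..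
  then have "det V = 4 * qf c u * qf c v"
    using v(1) qu idot_qgrad_self[of c v] by (simp add: cm)
  then have V0: "det V \<noteq> 0" using u v(2) by simp
  have ort': "idot (qgrad c v) u = 0" "idot (qgrad c w) u = 0" "idot (qgrad c w) v = 0"
    using ort by (simp_all add: idot_qgrad_commute[of c v u] idot_qgrad_commute[of c w])
  have entry: "(V ** G ** transpose V) $ i $ j = idot (qgrad c (V $ i)) (V $ j)" for i j
    by (simp add: matrix_matrix_mult_def transpose_def idot_def qgrad_def sum_3 G_def algebra_simps)
  have rows: "V $ 1 = u" "V $ 2 = v" "V $ 3 = w" by (simp_all add: V_def vector_3)
  have "det (V ** G ** transpose V) = 8 * (qf c u * qf c v * qf c w)"
    unfolding det_3 entry rows ort ort' idot_qgrad_self by simp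
  then have "det V * det G * det V = 8 * (qf c u * qf c v * qf c w)" by (simp add: det_mul)
  then have "of_int (8 * (qf c u * qf c v * qf c w)) = (of_int (det V * det G * det V) :: rat)" by simp
  then have "of_int (qf c u * qf c v * qf c w) = det (gram c) * of_int (det V)^2"
    unfolding det_gram G_def[symmetric] by (simp add: power2_eq_square field_simps)
  then show ?thesis using ort V0 unfolding V_def by blast
qed

text \<open>Cramer's rule: d x is the combination of the orthogonal vectors with integral
  coordinates M x, where \<open>M\<close> is the cofactor matrix and \<open>d\<close> the
  determinant. The integral identity serves the point count, the real one the volume.\<close>

lemma diagonalisation:
  assumes "nonsingular c"
  shows "\<exists>M d \<alpha> \<beta> \<gamma>. det M \<noteq> 0 \<and> d \<noteq> 0 \<and> of_int (\<alpha> * \<beta> * \<gamma>) = det (gram c) * of_int d^2 \<and>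
    (\<forall>x::int^3. d^2 * qf c x = \<alpha> * ((M *v x) $ 1)^2 + \<beta> * ((M *v x) $ 2)^2 + \<gamma> * ((M *v x) $ 3)^2) \<and>
    (\<forall>x::real^3. of_int d^2 * qf c x = of_int \<alpha> * ((imat M *v x) $ 1)^2 + of_int \<beta> * ((imat M *v x) $ 2)^2 + of_int \<gamma> * ((imat M *v x) $ 3)^2)"
proof -
  obtain u v w where ort: "idot (qgrad c u) v = 0" "idot (qgrad c u) w = 0" "idot (qgrad c v) w = 0"
    and d: "det (vector [u, v, w] :: int^3^3) \<noteq> 0" and
    g: "of_int (qf c u * qf c v * qf c w) = det (gram c) * of_int (det (vector [u, v, w] :: int^3^3))^2"
    using orthogonal_basis[OF assms] by blast
  define M :: "int^3^3" where "M = vector [icross v w, icross w u, icross u v]"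
  define d where "d = det (vector [u, v, w] :: int^3^3)"
  have "det M \<noteq> 0" using d by (simp add: M_def det_cofactors)
  moreover have "qf c (of_int d *s x) = of_int (qf c u) * ((imat M *v x) $ 1)^2 + of_int (qf c v) * ((imat M *v x) $ 2)^2 + of_int (qf c w) * ((imat M *v x) $ 3)^2"
    for x :: "int^3" unfolding d_def cramer_rows qf_combination ort M_def by simp
  moreover have "qf c (of_int d *s x) = of_int (qf c u) * ((imat M *v x) $ 1)^2 + of_int (qf c v) * ((imat M *v x) $ 2)^2 + of_int (qf c w) * ((imat M *v x) $ 3)^2"
    for x :: "real^3" unfolding d_def cramer_rows qf_combination ort M_def by simp
  ultimately show ?thesis using d g unfolding qf_smult d_def[symmetric]
    by (intro exI[of _ M] exI[of _ d] exI[of _ "qf c u"] exI[of _ "qf c v"] exI[of _ "qf c w"]) simp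
qed

lemma periodic_qform: "periodic M (\<lambda>y. M dvd qform y - b)"
proof -
  have "M dvd (qform x - b) - (qform y - b)" if xy: "vcong M x y" for x y :: "int^3"
  proof -
    obtain z where z: "x = y + M *s z" using xy by (rule vcongE)
    have "(qform x - b) - (qform y - b) = M * (2 * y $ 1 * z $ 1 + y $ 2 * z $ 3 + y $ 3 * z $ 2 + M * qform z)"
      by (simp add: z qform_def power2_eq_square algebra_simps)
    then show ?thesis by simp
  qed
  then show ?thesis unfolding periodic_def by (metis dvd_add_right_iff diff_add_cancel)
qed

section \<open>An explicit similitude from the diagonal form to \<open>qform\<close>\<close>

locale diagonal_form =
  fixes c :: "int^3^3" and a :: int and M :: "int^3^3" and d \<alpha> \<beta> \<gamma> s :: int
  assumes det_M: "det M \<noteq> 0" and d: "d \<noteq> 0" and nz: "\<alpha> \<noteq> 0" "\<beta> \<noteq> 0" "\<gamma> \<noteq> 0" and a: "a \<noteq> 0"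
    and s: "- (a * \<alpha> * \<beta> * \<gamma>) = s^2"
    and form_int: "\<And>x::int^3. d^2 * qf c x = \<alpha> * ((M *v x) $ 1)^2 + \<beta> * ((M *v x) $ 2)^2 + \<gamma> * ((M *v x) $ 3)^2"
    and form_real: "\<And>x::real^3. of_int d^2 * qf c x = of_int \<alpha> * ((imat M *v x) $ 1)^2 + of_int \<beta> * ((imat M *v x) $ 2)^2 + of_int \<gamma> * ((imat M *v x) $ 3)^2"
begin

text \<open>With these coefficients z^2 = A x^2 + B y^2 is the equation \<alpha> x^2 + \<beta> y^2 +
  \<gamma> w^2 = 0 multiplied by \<gamma>, with z = \<gamma> w. So Legendre's theorem for (A, B)
  yields a rational zero of the diagonal form.\<close>

abbreviation A where "A \<equiv> - (\<alpha> * \<gamma>)"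
abbreviation B where "B \<equiv> - (\<beta> * \<gamma>)"

text \<open>Multiply \<gamma> v_3 + v_1 sqrt A by z + x sqrt A, whose norm is B y^2 at a zero. The
  first row is A times the coefficient of sqrt A in the product. With E = A x v_1 + \<gamma> z v_3
  its rational part, the other rows are A (B y v_2 - E) and B y v_2 + E, so that
  \<open>qform\<close> becomes a combination of two norms and a square.\<close>

definition K :: "int \<Rightarrow> int \<Rightarrow> int \<Rightarrow> int^3^3" where
  "K x y z = vector [vector [A * z, 0, A * \<gamma> * x], vector [- (A^2 * x), A * B * y, - (A * \<gamma> * z)], vector [A * x, B * y, \<gamma> * z]]"

lemma det_K: "det (K x y z) = 2 * A^2 * B * \<gamma> * y * (z^2 - A * x^2)"
  by (simp add: K_def det_3 vector_3 power2_eq_square algebra_simps)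

lemma qform_K:
  fixes v :: "'a::comm_ring_1^3"
  shows "qform (imat (K x y z) *v v) =
    - of_int (A * B * \<gamma> * y^2) * (of_int \<alpha> * (v $ 1)^2 + of_int \<beta> * (v $ 2)^2 + of_int \<gamma> * (v $ 3)^2)
    - of_int (A * (z^2 - A * x^2 - B * y^2)) * (of_int (\<gamma>^2) * (v $ 3)^2 - of_int A * (v $ 1)^2)"
  by (simp add: qform_def K_def imat_def matrix_vector_mult_def sum_3 vector_3 power2_eq_square algebra_simps)

lemma s0: "s \<noteq> 0" using s a nz by auto

text \<open>The last term vanishes at an exact zero. It is kept because at a good prime p the triple
  (x, y, z) is only a zero modulo p.\<close>

lemma qform_K_int:
  "a * qform (K x y z *v (M *v v)) = (s * \<gamma> * d * y)^2 * qf c v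
    - a * (A * (z^2 - A * x^2 - B * y^2)) * (\<gamma>^2 * ((M *v v) $ 3)^2 - A * ((M *v v) $ 1)^2)"
proof -
  have "(s * \<gamma> * d * y)^2 = s^2 * (\<gamma> * d * y)^2" by (simp add: power_mult_distrib mult_ac)
  also have "\<dots> = - (a * A * B * \<gamma> * y^2) * d^2" unfolding s[symmetric] by (simp add: power2_eq_square algebra_simps)
  finally have "(s * \<gamma> * d * y)^2 * qf c v = - (a * A * B * \<gamma> * y^2) * (d^2 * qf c v)" by simp
  note h = this
  have q: "qform (K x y z *v (M *v v)) = - (A * B * \<gamma> * y^2) * (d^2 * qf c v)
    - A * (z^2 - A * x^2 - B * y^2) * (\<gamma>^2 * ((M *v v) $ 3)^2 - A * ((M *v v) $ 1)^2)"
    using qform_K[of x y z "M *v v"] unfolding form_int by (simp only: imat_int of_int_eq_id id_apply)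
  show ?thesis unfolding h q by (simp add: algebra_simps)
qed

lemma qform_K_real:
  fixes v :: "real^3"
  assumes "z^2 = A * x^2 + B * y^2"
  shows "of_int a * qform (imat (K x y z) *v (imat M *v v)) = of_int (s * \<gamma> * d * y)^2 * qf c v"
proof -
  have "(s * \<gamma> * d * y)^2 = s^2 * (\<gamma> * d * y)^2" by (simp add: power_mult_distrib mult_ac)
  also have "\<dots> = - (a * A * B * \<gamma> * y^2) * d^2" unfolding s[symmetric] by (simp add: power2_eq_square algebra_simps)
  finally have "of_int ((s * \<gamma> * d * y)^2) = (of_int (- (a * A * B * \<gamma> * y^2) * d^2) :: real)" by (rule arg_cong)
  then have "of_int (s * \<gamma> * d * y)^2 * qf c v = - of_int (a * A * B * \<gamma> * y^2) * (of_int d^2 * qf c v)" by simp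
  moreover have "z^2 - A * x^2 - B * y^2 = 0" using assms by simp
  ultimately show ?thesis unfolding qform_K form_real by (simp add: algebra_simps)
qed

text \<open>Multiplying f(x) - a by (\<alpha> \<beta> \<gamma>)^2 \<gamma> d^2 gives a value of the
  quaternion norm form, because the square condition turns the constant (\<alpha> \<beta>
  \<gamma>)^2 \<gamma> d^2 a into - A B (d s)^2. Thus k = d s works for all moduli.\<close>

lemma locally_representedI:
  assumes "\<And>m. m > 0 \<Longrightarrow> \<exists>x. m dvd qf c x - a"
  shows "locally_represented A B"
proof -
  have "\<exists>x y z. m dvd z^2 - A * x^2 - B * (y^2 - A * (d * s)^2)" if m: "m > 0" for m
  proof -
    obtain x where x: "m dvd qf c x - a" using assms[OF m] by blast
    let ?t = "\<alpha> * \<beta> * \<gamma>"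
    define v where "v = M *v x"
    have "A * B * (d * s)^2 = A * B * d^2 * s^2" by (simp add: power_mult_distrib)
    also have "\<dots> = - (?t^2 * \<gamma> * d^2 * a)" unfolding s[symmetric] by (simp add: power2_eq_square algebra_simps)
    finally have AB: "A * B * (d * s)^2 = - (?t^2 * \<gamma> * d^2 * a)" .
    have "(?t * \<gamma> * v $ 3)^2 - A * (?t * v $ 1)^2 - B * ((?t * v $ 2)^2 - A * (d * s)^2) =
      ?t^2 * \<gamma> * (\<alpha> * (v $ 1)^2 + \<beta> * (v $ 2)^2 + \<gamma> * (v $ 3)^2) + A * B * (d * s)^2"
      by (simp add: power2_eq_square algebra_simps)
    also have "\<dots> = ?t^2 * \<gamma> * d^2 * (qf c x - a)"
      unfolding v_def form_int[symmetric] AB by (simp add: algebra_simps)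
    finally show ?thesis using x by (metis dvd_mult)
  qed
  moreover have "d * s \<noteq> 0" using d s0 by simp
  ultimately show ?thesis unfolding locally_represented_def by blast
qed

definition bad :: int where "bad = 2 * a * d * \<alpha> * \<beta> * \<gamma> * det M"

lemma bad0: "bad \<noteq> 0" using a d nz det_M by (simp add: bad_def)

text \<open>By pigeonhole there is a zero modulo p with y = 1, and the resulting matrix is
  invertible modulo p, so f = a has as many solutions modulo p as qform = k^2, namely p^2 + p. As p
  does not divide 2 a, the ratios are constant from the first level on.\<close>

lemma good_prime:
  assumes p: "prime p" "\<not> int p dvd bad"
  shows "local_density c a p = 1 + 1 / real p"
proof -
  define P where "P = int p"
  have P: "prime P" "P > 0" using p by (simp_all add: P_def prime_gt_0_nat)
  have nd: "\<not> P dvd 2" "\<not> P dvd a" "\<not> P dvd d" "\<not> P dvd \<alpha>" "\<not> P dvd \<beta>" "\<not> P dvd \<gamma>" "\<not> P dvd det M"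
    using p(2) P(1) by (simp_all add: P_def bad_def prime_dvd_mult_iff)
  have odd: "odd P"
  proof
    assume "even P"
    then have "2 = P" using P(1) by (intro primes_dvd_imp_eq) auto
    then show False using nd by simp
  qed
  have sP: "\<not> P dvd s"
  proof
    assume "P dvd s"
    then have "P dvd - (a * \<alpha> * \<beta> * \<gamma>)" unfolding s by (simp add: power2_eq_square)
    then show False using nd P(1) by (simp add: prime_dvd_mult_iff)
  qed
  have AP: "\<not> P dvd A" and BP: "\<not> P dvd B" using nd P(1) by (simp_all add: prime_dvd_mult_iff)
  obtain x z where xz: "P dvd z^2 - A * x^2 - B" using norm_form_represents_mod[OF P(1) odd AP] by blast
  define R where "R = K x 1 z ** M"
  define k where "k = s * \<gamma> * d"
  have kP: "\<not> P dvd k" using sP nd P(1) by (simp add: k_def prime_dvd_mult_iff)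
  have "\<not> P dvd z^2 - A * x^2" using xz BP by (metis diff_eq_eq dvd_add_right_iff add_diff_cancel_left' dvd_diff)
  then have "\<not> P dvd 2 * A^2 * B * \<gamma> * 1 * (z^2 - A * x^2) * det M"
    using nd AP BP P(1) not_prime_unit[of P] by (simp only: prime_dvd_mult_iff power2_eq_square) auto
  then have "\<not> P dvd det R" by (simp only: R_def det_mul det_K) simp
  then have R: "coprime (det R) P" using prime_imp_coprime[OF P(1)] coprime_commute by blast
  have eq: "P dvd qform (R *v v) - k^2 \<longleftrightarrow> P dvd qf c v - a" for v
  proof -
    have "P dvd qform (R *v v) - k^2 \<longleftrightarrow> P dvd a * (qform (R *v v) - k^2)"
      using nd(2) P(1) by (simp add: prime_dvd_mult_iff)
    also have "a * (qform (R *v v) - k^2) = k^2 * (qf c v - a)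
      - a * (A * (z^2 - A * x^2 - B)) * (\<gamma>^2 * ((M *v v) $ 3)^2 - A * ((M *v v) $ 1)^2)"
      using qform_K_int[of x 1 z v] by (simp add: R_def k_def matrix_vector_mul_assoc[symmetric] right_diff_distrib algebra_simps)
    also have "P dvd \<dots> \<longleftrightarrow> P dvd k^2 * (qf c v - a)"
      by (rule dvd_diff_left_iff[OF dvd_mult2[OF dvd_mult[OF dvd_mult[OF xz]]]])
    also have "\<dots> \<longleftrightarrow> P dvd qf c v - a" using kP P(1) by (simp add: prime_dvd_mult_iff power2_eq_square)
    finally show ?thesis .
  qed
  have "card {x \<in> box3 P. P dvd qf c x - a} = card {y \<in> box3 P. P dvd qform y - k^2}"
    unfolding eq[symmetric] by (rule card_box3_invertible[OF P(2) R periodic_qform])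
  then have "int (card {x \<in> box3 P. P dvd qf c x - a}) = P^2 + P" using card_qform_prime[OF P(1) odd kP] by simp
  also have "P^2 + P = int (p^2 + p)" by (simp add: P_def)
  finally have "card {x \<in> box3 P. P dvd qf c x - a} = p^2 + p" by (simp only: of_nat_eq_iff)
  then have "local_ratio c a p 1 = 1 + 1 / real p"
    using P(2) by (simp add: local_ratio_eq P_def power2_eq_square field_simps)
  moreover have "\<not> int p ^ Suc 0 dvd 2 * a" using nd P(1) by (simp add: P_def prime_dvd_mult_iff)
  ultimately show ?thesis using local_density_eq(2)[OF p(1), of 0 a 1] by simp
qed

end

context diagonal_form
begin

section \<open>The Euler product\<close>

lemma euler_factor_good:
  assumes "prime p" "\<not> int p dvd bad"
  shows "euler_factor c a p = 1 - 1 / real p ^ 2"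
  using assms good_prime[OF assms] prime_gt_0_nat[OF assms(1)]
  by (simp add: euler_factor_def power2_eq_square field_simps)

lemma convergent_euler_product: "convergent_prod (euler_factor c a)"
proof -
  have "summable (\<lambda>p. norm (euler_factor c a p - 1))"
  proof (rule summable_comparison_test_ev)
    show "\<forall>\<^sub>F p in sequentially. norm (norm (euler_factor c a p - 1)) \<le> inverse (real p ^ 2)"
      using eventually_gt_at_top[of "nat \<bar>bad\<bar>"]
    proof eventually_elim
      case (elim p)
      have "\<not> int p dvd bad" using elim bad0 dvd_imp_le_int[of bad "int p"] by auto
      then show ?case using euler_factor_good[of p] by (cases "prime p") (simp_all add: euler_factor_def divide_inverse)
    qed
    show "summable (\<lambda>p. inverse (real p ^ 2))" by (rule inverse_power_summable) simp
  qed
  then have "abs_convergent_prod (euler_factor c a)" by (simp add: abs_convergent_prod_conv_summable)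
  then show ?thesis by (rule abs_convergent_prod_imp_convergent_prod)
qed

text \<open>The primes outside \<open>Q\<close> enter the point count through the sieve. Their
  product is the Euler product divided by its part at \<open>Q\<close>, provided that no factor in
  that part vanishes.\<close>

lemma euler_product_tail:
  assumes Q: "Q > 0" "bad dvd Q" and E: "(\<Prod>p\<in>prime_factors (nat Q). euler_factor c a p) \<noteq> 0"
  shows "(\<lambda>z. \<Prod>p | prime p \<and> p \<le> z \<and> \<not> int p dvd Q. 1 - 1 / real p ^ 2) \<longlonglongrightarrow>
    prodinf (euler_factor c a) / (\<Prod>p\<in>prime_factors (nat Q). euler_factor c a p)"
proof -
  let ?E = "\<Prod>p\<in>prime_factors (nat Q). euler_factor c a p"
  have dvdQ: "int p dvd Q \<longleftrightarrow> p dvd nat Q" for p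
  proof -
    have "int p dvd int (nat Q) \<longleftrightarrow> p dvd nat Q" by (simp only: int_dvd_int_iff)
    then show ?thesis using Q(1) by simp
  qed
  have "(\<lambda>n. (\<Prod>i\<le>n. euler_factor c a i) / ?E) \<longlonglongrightarrow> prodinf (euler_factor c a) / ?E"
    using convergent_prod_LIMSEQ[OF convergent_euler_product] E by (intro tendsto_divide tendsto_const)
  moreover have "\<forall>\<^sub>F n in sequentially. (\<Prod>i\<le>n. euler_factor c a i) / ?E =
    (\<Prod>p | prime p \<and> p \<le> n \<and> \<not> int p dvd Q. 1 - 1 / real p ^ 2)"
    using eventually_ge_at_top[of "nat Q"]
  proof eventually_elim
    case (elim n)
    let ?G = "{p. prime p \<and> p \<le> n \<and> \<not> int p dvd Q}"
    have sub: "prime_factors (nat Q) \<subseteq> {..n}"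
      using elim Q(1) by (auto simp: prime_factors_dvd dest!: dvd_imp_le)
    have "(\<Prod>i\<in>prime_factors (nat Q) \<union> ?G. euler_factor c a i) = (\<Prod>i\<in>{..n}. euler_factor c a i)"
    proof (rule prod.mono_neutral_left)
      show "prime_factors (nat Q) \<union> ?G \<subseteq> {..n}" using sub by auto
      show "\<forall>i\<in>{..n} - (prime_factors (nat Q) \<union> ?G). euler_factor c a i = 1"
        using Q(1) by (auto simp: euler_factor_def prime_factors_dvd dvdQ)
    qed simp
    moreover have "(\<Prod>i\<in>prime_factors (nat Q) \<union> ?G. euler_factor c a i) = ?E * (\<Prod>i\<in>?G. euler_factor c a i)"
      by (rule prod.union_disjoint) (auto simp: prime_factors_dvd dvdQ)
    moreover have "(\<Prod>i\<in>?G. euler_factor c a i) = (\<Prod>i\<in>?G. 1 - 1 / real i ^ 2)"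
      using Q(2) dvd_trans by (intro prod.cong refl euler_factor_good) auto
    ultimately have "(\<Prod>i\<le>n. euler_factor c a i) = ?E * (\<Prod>i\<in>?G. 1 - 1 / real i ^ 2)" by simp
    then show ?case using E by (simp only: nonzero_mult_div_cancel_left not_False_eq_True)
  qed
  ultimately show ?thesis by (rule Lim_transform_eventually)
qed

lemma solvable_modulo:
  assumes nz: "\<And>p. prime p \<Longrightarrow> local_density c a p \<noteq> 0" and m: "m > 0"
  shows "\<exists>x. m dvd qf c x - a"
proof -
  \<comment> \<open>The first summand makes the modulus a multiple of m; the second brings each
    level into the range where the ratio equals the density.\<close>
  define k where "k p = multiplicity p (nat m) + (2 * multiplicity (int p) (2 * a) + 1)" for p
  let ?S = "prime_factors (nat m)"
  have "local_ratio c a p (k p) \<noteq> 0" if "p \<in> ?S" for p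
    using local_density_eq(2)[OF _ not_dvd_Suc_multiplicity[OF _ a], of p "k p" c] nz[of p] that by (auto simp: k_def)
  then have "(\<Prod>p\<in>?S. local_ratio c a p (k p)) * (\<Prod>p\<in>?S. real p ^ k p)^2 \<noteq> 0"
    by (auto simp: prime_gt_0_nat)
  moreover define X where "X = {x \<in> box3 (\<Prod>p\<in>?S. int p ^ k p). (\<Prod>p\<in>?S. int p ^ k p) dvd qf c x - a}"
  moreover have "real (card X) = (\<Prod>p\<in>?S. local_ratio c a p (k p)) * (\<Prod>p\<in>?S. real p ^ k p)^2"
    unfolding X_def by (rule card_qf_prod) auto
  ultimately have "X \<noteq> {}" by (metis card.empty of_nat_0)
  then obtain x where x: "(\<Prod>p\<in>?S. int p ^ k p) dvd qf c x - a" unfolding X_def by blast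
  have "nat m = (\<Prod>p\<in>?S. p ^ multiplicity p (nat m))" using m by (intro prime_factorization_nat) simp
  also have "\<dots> dvd (\<Prod>p\<in>?S. p ^ k p)" by (intro prod_dvd_prod le_imp_power_dvd) (simp add: k_def)
  finally have "int (nat m) dvd int (\<Prod>p\<in>?S. p ^ k p)" by (simp only: int_dvd_int_iff)
  then have "m dvd (\<Prod>p\<in>?S. int p ^ k p)" using m by simp
  then show ?thesis using x dvd_trans by blast
qed

end

section \<open>The change of variables attached to a zero\<close>

locale diagonal_zero = diagonal_form +
  fixes x0 y0 z0 :: int
  assumes zero: "z0^2 = A * x0^2 + B * y0^2" and y0: "y0 \<noteq> 0"
begin

definition R :: "int^3^3" where "R = K x0 y0 z0 ** M"
definition n :: int where "n = \<bar>s * \<gamma> * d * y0\<bar>"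
text \<open>\<open>W\<close> collects the numbers that have to divide the modulus. The cube in
  \<open>Q\<close> supplies the (2 n)^3 of \<open>eig_weight_sum\<close>, and the surplus brings all
  exponents into the range where the local ratios are constant.\<close>

definition W :: int where "W = 2 * n * \<bar>a\<bar> * \<bar>det R\<bar> * \<bar>bad\<bar>"
definition Q :: int where "Q = W^3"

lemma n: "n > 0" using s0 nz d y0 by (simp add: n_def)

lemma det_R: "det R \<noteq> 0"
proof -
  have "z0^2 - A * x0^2 = B * y0^2" using zero by simp
  then have "det R = 2 * A^2 * B * \<gamma> * y0 * (B * y0^2) * det M" by (simp only: R_def det_mul det_K)
  then show ?thesis using nz y0 det_M by simp
qed

lemma W: "W > 0" using n a det_R bad0 by (simp add: W_def)

lemma Q: "Q > 0" "(2 * n)^3 dvd Q" "det R dvd Q" "bad dvd Q" "n^2 dvd Q" "2 * a dvd W"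
proof -
  show "Q > 0" using W by (simp add: Q_def)
  have W1: "2 * n dvd W" by (simp add: W_def)
  then show "(2 * n)^3 dvd Q" unfolding Q_def by (rule dvd_power_same)
  have "W dvd Q" by (simp add: Q_def)
  moreover have "det R dvd W" "bad dvd W" by (simp_all add: W_def)
  ultimately show "det R dvd Q" "bad dvd Q" using dvd_trans by blast+
  have "n dvd W" by (simp add: W_def)
  then have "n^2 dvd W^2" by (rule dvd_power_same)
  then show "n^2 dvd Q" by (simp add: Q_def power3_eq_cube power2_eq_square dvd_mult2)
  have "2 * \<bar>a\<bar> dvd W" unfolding W_def by (rule dvdI[of _ _ "n * \<bar>det R\<bar> * \<bar>bad\<bar>"]) (simp add: mult_ac)
  then show "2 * a dvd W" by (cases "a \<ge> 0") simp_all
qed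

lemma qform_R: "a * qform (R *v x) = n^2 * qf c x"
  using qform_K_int[of x0 y0 z0 x] zero by (simp add: R_def n_def matrix_vector_mul_assoc[symmetric])

lemma qform_R_iff: "qform (R *v x) = n^2 \<longleftrightarrow> qf c x = a"
proof -
  have "qform (R *v x) = n^2 \<longleftrightarrow> a * qform (R *v x) = n^2 * a" using a by (simp add: mult.commute)
  then show ?thesis unfolding qform_R using n by simp
qed

lemma qform_imat_R: "of_int a * qform (imat R *v x) = of_int n^2 * qf c x" for x :: "real^3"
  using qform_K_real[OF zero, of x] by (simp add: R_def n_def imat_mult matrix_vector_mul_assoc[symmetric])

text \<open>m equals |a| Q^2 / n^2 because, after multiplication by a, the condition that Q^2
  divides q(R x) - n^2 says that m divides f(x) - a.\<close>

lemma local_densities_product: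
  defines "m \<equiv> \<bar>a\<bar> * Q * (Q div n^2)"
  shows "real (card {x \<in> box3 m. m dvd qf c x - a}) = (\<Prod>p\<in>prime_factors (nat Q). local_density c a p) * of_int m^2"
proof -
  have nQ: "n^2 * (Q div n^2) = Q" using Q(5) by (rule dvd_mult_div_cancel)
  have "Q div n^2 > 0" using Q(1) n nQ by (metis zero_less_mult_pos zero_less_power)
  then have m: "m > 0" using Q(1) a by (simp add: m_def)
  have fac: "prime_factors (nat m) = prime_factors (nat Q)"
  proof -
    have "int p dvd m \<longleftrightarrow> int p dvd Q" if "prime p" for p
    proof
      assume "int p dvd Q" then show "int p dvd m" by (simp add: m_def)
    next
      assume "int p dvd m"
      then consider "int p dvd \<bar>a\<bar>" | "int p dvd Q" | "int p dvd Q div n^2"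
        using \<open>prime p\<close> unfolding m_def by (auto simp: prime_dvd_mult_iff)
      then show "int p dvd Q"
      proof cases
        case 1
        then have "int p dvd W" by (simp add: W_def)
        then show ?thesis unfolding Q_def power3_eq_cube by (rule dvd_mult)
      next
        case 3 then show ?thesis using nQ by (metis dvd_mult)
      qed
    qed
    then have "p dvd nat m \<longleftrightarrow> p dvd nat Q" if "prime p" for p
      using that m Q(1) by (metis int_dvd_int_iff int_nat_eq less_imp_le)
    then show ?thesis using m Q(1) by (auto simp: prime_factors_dvd)
  qed
  have W4: "W^4 dvd m"
  proof -
    obtain t where t: "W = n * t" unfolding W_def by (metis dvd_def dvd_mult2 dvd_triv_right)
    have "Q = n^2 * (t^2 * W)" unfolding Q_def by (simp add: power3_eq_cube power2_eq_square mult_ac t[symmetric])  (metis t mult.left_commute mult.commute)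
    then have "Q div n^2 = t^2 * W" using n by simp
    then have "m = W^4 * (\<bar>a\<bar> * t^2)" by (simp add: m_def Q_def power_numeral_reduce mult_ac)
    then show ?thesis by simp
  qed
  \<comment> \<open>If p^e is the power of p in 2 a, then both p^e and p divide \<open>W\<close>, so
    W^4 contains p^(2 e + 2).\<close>
  have exps: "multiplicity p (nat m) \<ge> 2 * multiplicity (int p) (2 * a) + 1" if p: "p \<in> prime_factors (nat Q)" for p
  proof -
    let ?e = "multiplicity (int p) (2 * a)"
    have pp: "prime p" using p by (rule in_prime_factors_imp_prime)
    have "int p dvd int (nat Q)" using p in_prime_factors_imp_dvd by (simp only: int_dvd_int_iff) blast
    then have "int p dvd Q" using Q(1) by simp
    then have pW: "int p dvd W" unfolding Q_def using pp by (metis prime_dvd_power prime_nat_int_transfer)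
    have "int p ^ ?e dvd 2 * a" by (rule multiplicity_dvd)
    then have "int p ^ ?e dvd W" using Q(6) dvd_trans by blast
    then have "int p ^ ?e * int p ^ ?e * int p * int p dvd W * W * W * W" using pW by (intro mult_dvd_mono)
    moreover have "int p ^ (2 * ?e + 2) = int p ^ ?e * int p ^ ?e * int p * int p"
      by (simp add: mult_2 power_add mult_ac)
    ultimately have "int p ^ (2 * ?e + 2) dvd W^4" by (simp only: power4_eq_xxxx)
    then have "int p ^ (2 * ?e + 2) dvd m" using W4 dvd_trans by blast
    then have "int (p ^ (2 * ?e + 2)) dvd int (nat m)" using m by simp
    then have "p ^ (2 * ?e + 2) dvd nat m" by (simp only: int_dvd_int_iff)
    then have "2 * ?e + 2 \<le> multiplicity p (nat m)"
      using m pp by (subst power_dvd_iff_le_multiplicity[symmetric]) auto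
    then show ?thesis by simp
  qed
  have "nat m = (\<Prod>p\<in>prime_factors (nat m). p ^ multiplicity p (nat m))" using m by (intro prime_factorization_nat) simp
  then have "int (nat m) = int (\<Prod>p\<in>prime_factors (nat Q). p ^ multiplicity p (nat m))" unfolding fac by (rule arg_cong)
  then have fm: "m = (\<Prod>p\<in>prime_factors (nat Q). int p ^ multiplicity p (nat m))" using m by simp
  have "real_of_int m = real_of_int (\<Prod>p\<in>prime_factors (nat Q). int p ^ multiplicity p (nat m))" using fm by (rule arg_cong)
  then have fmr: "real_of_int m = (\<Prod>p\<in>prime_factors (nat Q). real p ^ multiplicity p (nat m))" by simp
  have "real (card {x \<in> box3 m. m dvd qf c x - a}) =
    (\<Prod>p\<in>prime_factors (nat Q). local_ratio c a p (multiplicity p (nat m))) * of_int m^2"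
    using card_qf_prod[of "prime_factors (nat Q)" "\<lambda>p. multiplicity p (nat m)" c a]
    unfolding fm[symmetric] fmr[symmetric] by (simp add: in_prime_factors_imp_prime)
  also have "(\<Prod>p\<in>prime_factors (nat Q). local_ratio c a p (multiplicity p (nat m))) = (\<Prod>p\<in>prime_factors (nat Q). local_density c a p)"
  proof (intro prod.cong refl)
    fix p assume p: "p \<in> prime_factors (nat Q)"
    then have "prime p" by (rule in_prime_factors_imp_prime)
    from local_density_eq(2)[OF this not_dvd_Suc_multiplicity[OF this a] exps[OF p]]
    show "local_ratio c a p (multiplicity p (nat m)) = local_density c a p" by simp
  qed
  finally show ?thesis .
qed

text \<open>A chain of counts: \<open>eig_weight_sum\<close> leads to points of the lattice R Z^3
  modulo Q^2, \<open>card_box3_image\<close> leads back to vectors x at the cost of |det R|, and the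
  same condition read modulo m gives local densities. The totient of \<open>Q\<close> supplies the
  factors 1 - 1/p.\<close>

lemma weight_sum:
  "real (\<Sum>r | r \<in> {0..<Q} \<times> {0..<Q} \<and> gcd (gcd (fst r) (snd r)) Q = 1. eig_weight (range ((*v) R)) n Q r) / of_int Q ^ 3 =
    of_int n^2 / (\<bar>of_int a\<bar> * \<bar>of_int (det R)\<bar>) * (\<Prod>p\<in>prime_factors (nat Q). euler_factor c a p)"
proof -
  define m where "m = \<bar>a\<bar> * Q * (Q div n^2)"
  define D where "D = (\<Prod>p\<in>prime_factors (nat Q). local_density c a p)"
  define S where "S = (\<Sum>r | r \<in> {0..<Q} \<times> {0..<Q} \<and> gcd (gcd (fst r) (snd r)) Q = 1. eig_weight (range ((*v) R)) n Q r)"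
  define Y where "Y = card {y \<in> box3 (Q * Q). y \<in> range ((*v) R) \<and> Q * Q dvd qform y - n^2}"
  define X where "X = card {x \<in> box3 (Q * Q). Q * Q dvd qform (R *v x) - n^2}"
  have nQ: "n^2 * (Q div n^2) = Q" using Q(5) by (rule dvd_mult_div_cancel)
  have "Q div n^2 > 0" using Q(1) n nQ by (metis zero_less_mult_pos zero_less_power)
  then have m: "m > 0" using Q(1) a by (simp add: m_def)
  have mn: "m * n^2 = Q * Q * \<bar>a\<bar>" unfolding m_def by (subst (3) nQ[symmetric]) (simp only: mult_ac)
  have SY: "S * nat Q ^ 2 = totient (nat Q) * Y"
    unfolding S_def Y_def by (rule eig_weight_sum[OF n Q(1,2) range_periodic[OF Q(3)]])
  have XY: "X = nat \<bar>det R\<bar> * Y"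
    unfolding X_def Y_def by (rule card_box3_image) (use Q(1,3) periodic_qform in auto)
  have eq: "Q * Q dvd qform (R *v x) - n^2 \<longleftrightarrow> m dvd qf c x - a" for x
  proof -
    have "Q * Q dvd qform (R *v x) - n^2 \<longleftrightarrow> a * (Q * Q) dvd a * (qform (R *v x) - n^2)" using a by simp
    also have "\<dots> \<longleftrightarrow> m * n^2 dvd a * (qform (R *v x) - n^2)" unfolding mn by (cases "a \<ge> 0") (simp_all add: mult_ac)
    also have "a * (qform (R *v x) - n^2) = (qf c x - a) * n^2" using qform_R[of x] by (simp add: algebra_simps)
    finally show ?thesis using n by simp
  qed
  have per: "periodic (Q * Q) (\<lambda>x. Q * Q dvd qform (R *v x) - n^2)"
    unfolding periodic_def using vcong_matrix periodicD[OF periodic_qform] by blast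
  \<comment> \<open>One set modulo Q^2 |a| = m n^2 is counted twice, as periodic modulo Q^2 and as
    periodic modulo m.\<close>
  have "nat \<bar>a\<bar> ^ 3 * X = card {x \<in> box3 (Q * Q * \<bar>a\<bar>). Q * Q dvd qform (R *v x) - n^2}"
    unfolding X_def by (rule card_box3_periodic[OF _ _ per, symmetric]) (use Q(1) a in simp_all)
  also have "\<dots> = card {x \<in> box3 (m * n^2). m dvd qf c x - a}" unfolding eq mn ..
  also have "\<dots> = nat (n^2) ^ 3 * card {x \<in> box3 m. m dvd qf c x - a}"
    by (rule card_box3_periodic[OF m _ periodic_qf]) (use n in simp)
  finally have "real (nat \<bar>a\<bar> ^ 3 * X) = real (nat (n^2) ^ 3 * card {x \<in> box3 m. m dvd qf c x - a})" by (rule arg_cong)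
  then have aX: "\<bar>of_int a\<bar>^3 * real X = (of_int n^2)^3 * (D * of_int m^2)"
    using local_densities_product unfolding m_def[symmetric] D_def[symmetric] by simp
  have pos: "real_of_int n > 0" "\<bar>real_of_int a\<bar> > 0" "\<bar>real_of_int (det R)\<bar> > 0" "real_of_int Q > 0"
    using n a det_R Q(1) by simp_all
  have "real_of_int (m * n^2) = real_of_int (Q * Q * \<bar>a\<bar>)" using mn by (rule arg_cong)
  then have mr: "of_int m * of_int n^2 = (of_int Q^2 * \<bar>of_int a\<bar> :: real)" by (simp add: power2_eq_square)
  have "\<bar>of_int a\<bar>^2 * (\<bar>of_int a\<bar> * real X) = \<bar>of_int a\<bar>^3 * real X" by (simp only: power2_eq_square power3_eq_cube mult_ac)
  also have "\<dots> = of_int n^2 * D * (of_int m * of_int n^2)^2" unfolding aX by (simp only: power2_eq_square power3_eq_cube mult_ac)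
  also have "\<dots> = \<bar>of_int a\<bar>^2 * (of_int n^2 * D * of_int Q^4)"
    unfolding mr by (simp only: power_mult_distrib power_mult[symmetric]) (simp add: mult_ac)
  finally have aX': "\<bar>of_int a\<bar> * real X = of_int n^2 * D * of_int Q^4" using a by simp
  have "real X = real (nat \<bar>det R\<bar> * Y)" using XY by (rule arg_cong)
  then have XY': "real X = \<bar>of_int (det R)\<bar> * real Y" by simp
  have "real (S * nat Q ^ 2) = real (totient (nat Q) * Y)" using SY by (rule arg_cong)
  then have SY': "real S * of_int Q^2 = real (totient (nat Q)) * real Y" using Q(1) by simp
  have "real (totient (nat Q)) = of_int Q * (\<Prod>p\<in>prime_factors (nat Q). 1 - 1 / real p)"
    using totient_formula2[of "nat Q"] Q(1) by simp
  moreover have "(\<Prod>p\<in>prime_factors (nat Q). euler_factor c a p) = (\<Prod>p\<in>prime_factors (nat Q). 1 - 1 / real p) * D"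
    unfolding D_def prod.distrib[symmetric]
    by (intro prod.cong refl) (simp add: euler_factor_def in_prime_factors_imp_prime)
  ultimately have E: "of_int Q * (\<Prod>p\<in>prime_factors (nat Q). euler_factor c a p) = real (totient (nat Q)) * D" by simp
  let ?a = "\<bar>real_of_int a\<bar>" and ?r = "\<bar>real_of_int (det R)\<bar>" and ?q = "real_of_int Q"
  have "?a * ?r * (real S * ?q^2) = real (totient (nat Q)) * (?a * real X)" unfolding SY' XY' by (simp only: mult_ac)
  also have "\<dots> = of_int n^2 * ?q^4 * (real (totient (nat Q)) * D)" unfolding aX' by (simp only: mult_ac)
  also have "\<dots> = of_int n^2 * (\<Prod>p\<in>prime_factors (nat Q). euler_factor c a p) * (?q^3 * ?q^2)"
    unfolding E[symmetric] by (simp add: power_numeral_reduce mult_ac)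
  finally have "?q^2 * (?a * ?r * real S) = ?q^2 * (of_int n^2 * (\<Prod>p\<in>prime_factors (nat Q). euler_factor c a p) * ?q^3)"
    by (simp only: mult_ac)
  then have "?a * ?r * real S = of_int n^2 * (\<Prod>p\<in>prime_factors (nat Q). euler_factor c a p) * ?q^3"
    by (rule mult_left_cancel[THEN iffD1, rotated]) (use pos(4) in simp)
  then show ?thesis unfolding S_def[symmetric] using pos(2-4) by (simp add: field_simps)
qed

definition \<Psi> :: "real^3^3" where "\<Psi> = matrix_inv (imat R)"

lemma inv\<Psi>: "imat R ** \<Psi> = mat 1" "\<Psi> ** imat R = mat 1"
proof -
  have "invertible (imat R :: real^3^3)" using det_R by (simp add: invertible_det_nz det_imat)
  then have "imat R ** \<Psi> = mat 1 \<and> \<Psi> ** imat R = mat 1"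
    unfolding \<Psi>_def matrix_inv_def invertible_def by (rule someI_ex)
  then show "imat R ** \<Psi> = mat 1" "\<Psi> ** imat R = mat 1" by simp_all
qed

lemma det_\<Psi>: "\<bar>det \<Psi>\<bar> = 1 / \<bar>of_int (det R)\<bar>"
proof -
  have "of_int (det R) * det \<Psi> = 1" using arg_cong[OF inv\<Psi>(1), of det] by (simp add: det_mul det_imat)
  then show ?thesis by (metis abs_1 abs_mult eq_divide_imp mult.commute mult_zero_left zero_neq_one abs_eq_0)
qed

lemma int_point_count_eq:
  "int_point_count c a N T = card {y \<in> range ((*v) R). qform y = n^2 \<and> N (\<Psi> *v rvec y) \<le> T}"
proof -
  have N: "\<Psi> *v rvec (R *v x) = rvec x" for x
    by (simp add: imat_rvec[symmetric] matrix_vector_mul_assoc inv\<Psi>)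
  have "bij_betw ((*v) R) {x. qf c x = a \<and> N (rvec x) \<le> T} {y \<in> range ((*v) R). qform y = n^2 \<and> N (\<Psi> *v rvec y) \<le> T}"
    unfolding bij_betw_def
  proof
    show "inj_on ((*v) R) {x. qf c x = a \<and> N (rvec x) \<le> T}"
      using matrix_vector_inj[OF det_R] by (rule inj_onI)
    show "(*v) R ` {x. qf c x = a \<and> N (rvec x) \<le> T} = {y \<in> range ((*v) R). qform y = n^2 \<and> N (\<Psi> *v rvec y) \<le> T}"
      by (auto simp: qform_R_iff N)
  qed
  from bij_betw_same_card[OF this] show ?thesis by (simp add: int_point_count_def rvec_def)
qed

text \<open>The part \<open>E\<close> of the Euler product at \<open>Q\<close> cancels: the sieve
  contributes the full product divided by \<open>E\<close>, the congruence weights contribute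
  \<open>E\<close>.\<close>

lemma count_asymp:
  assumes N: "is_norm N" and nz: "\<And>p. prime p \<Longrightarrow> local_density c a p \<noteq> 0"
  shows "((\<lambda>T. real (int_point_count c a N T) / (T * ln T)) \<longlongrightarrow> prodinf (euler_factor c a) *
    (of_int n^2 * \<bar>det \<Psi>\<bar> / \<bar>of_int a\<bar> * (2 * vec_norm.area (\<lambda>y. N (\<Psi> *v y))))) at_top"
proof -
  interpret V: vec_norm "\<lambda>y. N (\<Psi> *v y)" by unfold_locales (rule is_norm_matrix[OF N, of "imat R"], simp add: matrix_vector_mul_assoc inv\<Psi>)
  define E where "E = (\<Prod>p\<in>prime_factors (nat Q). euler_factor c a p)"
  have "euler_factor c a p \<noteq> 0" if "prime p" for p
    using nz[OF that] prime_gt_1_nat[OF that] that by (simp add: euler_factor_def)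
  then have E: "E \<noteq> 0" unfolding E_def by auto
  have sym: "- y \<in> range ((*v) R) \<longleftrightarrow> y \<in> range ((*v) R)" for y
  proof -
    have neg: "- (R *v x) = R *v (- x)" for x
      by (simp add: vec_eq_iff matrix_vector_mult_def sum_negf)
    have "- y \<in> range ((*v) R)" if "y \<in> range ((*v) R)" for y using that by (auto simp: neg)
    from this[of y] this[of "- y"] show ?thesis by auto
  qed
  have "2 * V.area * (prodinf (euler_factor c a) / E) * (\<Sum>r | r \<in> {0..<Q} \<times> {0..<Q} \<and> gcd (gcd (fst r) (snd r)) Q = 1.
      real (eig_weight (range ((*v) R)) n Q r)) / of_int Q ^ 3 =
    2 * V.area * (prodinf (euler_factor c a) / E) * (of_int n^2 / (\<bar>of_int a\<bar> * \<bar>of_int (det R)\<bar>) * E)"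
    unfolding E_def weight_sum[symmetric] by simp
  also have "\<dots> = prodinf (euler_factor c a) * (of_int n^2 * \<bar>det \<Psi>\<bar> / \<bar>of_int a\<bar> * (2 * V.area))"
    using E by (simp add: det_\<Psi> mult_ac)
  finally show ?thesis
    using V.point_count_asymp[OF n Q(1) range_periodic[OF Q(3)] sym euler_product_tail[OF Q(1,4) E[unfolded E_def]]]
    unfolding int_point_count_eq E_def by simp
qed

text \<open>The same constant \<kappa> is the limit of volume / T and, times the Euler product, that
  of count / (T log T).\<close>

lemma int_points_asymp:
  assumes N: "is_norm N" and nz: "\<And>p. prime p \<Longrightarrow> local_density c a p \<noteq> 0"
    and \<omega>: "normalized_gauge_form c a \<omega>" and \<mu>: "is_abs_form_measure (quadric c a) \<omega> \<mu>"
    and P: "prodinf (euler_factor c a) \<noteq> 0"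
  shows "(\<lambda>T. real (int_point_count c a N T)) \<sim>[at_top]
    (\<lambda>T. prodinf (euler_factor c a) * (ln T * measure \<mu> (quadric_ball c a N T)))"
proof -
  interpret V: vec_norm "\<lambda>y. N (\<Psi> *v y)" by unfold_locales (rule is_norm_matrix[OF N, of "imat R"], simp add: matrix_vector_mul_assoc inv\<Psi>)
  interpret C: quadric_chart c a "of_int n" \<Psi> \<omega> \<mu>
  proof
    show "det \<Psi> \<noteq> 0" using det_\<Psi> det_R by auto
    show "qf c (\<Psi> *v y) * (of_int n)^2 = of_int a * qform y" for y
      using qform_imat_R[of "\<Psi> *v y"] by (simp add: matrix_vector_mul_assoc inv\<Psi> mult.commute)
  qed (use a n \<omega> \<mu> in auto)
  define \<kappa> where "\<kappa> = of_int n^2 * \<bar>det \<Psi>\<bar> / \<bar>of_int a\<bar> * (2 * V.area)"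
  have \<kappa>: "\<kappa> > 0" using n a C.det V.area_pos by (simp add: \<kappa>_def)
  have 1: "((\<lambda>T. real (int_point_count c a N T) / (T * ln T)) \<longlongrightarrow> prodinf (euler_factor c a) * \<kappa>) at_top"
    unfolding \<kappa>_def using N nz by (rule count_asymp)
  have 2: "((\<lambda>T. prodinf (euler_factor c a) * (measure \<mu> (quadric_ball c a N T) / T)) \<longlongrightarrow> prodinf (euler_factor c a) * \<kappa>) at_top"
    unfolding \<kappa>_def by (intro tendsto_mult tendsto_const C.volume_asymp[OF N])
  have "((\<lambda>T. (real (int_point_count c a N T) / (T * ln T)) / (prodinf (euler_factor c a) * (measure \<mu> (quadric_ball c a N T) / T)))
    \<longlongrightarrow> (prodinf (euler_factor c a) * \<kappa>) / (prodinf (euler_factor c a) * \<kappa>)) at_top"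
    using P \<kappa> by (intro tendsto_divide 1 2) simp
  then have lim: "((\<lambda>T. (real (int_point_count c a N T) / (T * ln T)) / (prodinf (euler_factor c a) * (measure \<mu> (quadric_ball c a N T) / T)))
    \<longlongrightarrow> 1) at_top" using P \<kappa> by simp
  show ?thesis
  proof (rule asymp_equivI', rule Lim_transform_eventually[OF lim])
    show "\<forall>\<^sub>F T in at_top. (real (int_point_count c a N T) / (T * ln T)) / (prodinf (euler_factor c a) * (measure \<mu> (quadric_ball c a N T) / T)) =
      real (int_point_count c a N T) / (prodinf (euler_factor c a) * (ln T * measure \<mu> (quadric_ball c a N T)))"
      using eventually_gt_at_top[of 1]
    proof eventually_elim
      case (elim T)
      then have "T \<noteq> 0" "ln T \<noteq> 0" by auto
      then show ?case by (simp add: divide_simps mult_ac)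
    qed
  qed
qed

end

text \<open>As a density is the ratio at a finite level, its vanishing means that there is no
  solution modulo some power of p.\<close>

lemma (in diagonal_form) int_point_count_eq_0:
  assumes p: "prime p" and 0: "local_density c a p = 0"
  shows "int_point_count c a N T = 0"
proof -
  define m where "m = 2 * multiplicity (int p) (2 * a) + 1"
  have "local_ratio c a p m = 0"
    using local_density_eq(2)[OF p not_dvd_Suc_multiplicity[OF p a], of m c] 0 by (simp add: m_def)
  then have "{x \<in> box3 (int p ^ m). int p ^ m dvd qf c x - a} = {}"
    using prime_gt_0_nat[OF p] by (auto simp: local_ratio_eq)
  moreover have "vmod (int p ^ m) x \<in> {x \<in> box3 (int p ^ m). int p ^ m dvd qf c x - a}" if "qf c x = a" for x
  proof -
    have "int p ^ m dvd qf c (vmod (int p ^ m) x) - a \<longleftrightarrow> int p ^ m dvd qf c x - a"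
      by (rule periodicD[OF periodic_qf vmod_cong])
    then show ?thesis using that vmod_in_box3[of "int p ^ m" x] prime_gt_0_nat[OF p] by simp
  qed
  ultimately have "{x. qf c x = a \<and> N (\<chi> i. of_int (x $ i)) \<le> T} = {}" by blast
  then show ?thesis by (simp only: int_point_count_def card.empty)
qed

text \<open>A convergent product has a nonzero limit once finitely many factors are removed, so it
  vanishes only through one of its factors.\<close>

lemma (in diagonal_form) prodinf_eq_0_iff:
  "prodinf (euler_factor c a) = 0 \<longleftrightarrow> (\<exists>p. prime p \<and> local_density c a p = 0)"
proof -
  have "euler_factor c a p = 0 \<longleftrightarrow> prime p \<and> local_density c a p = 0" for p
    using prime_gt_1_nat[of p] by (auto simp: euler_factor_def)
  then show ?thesis
    using convergent_prod_to_zero_iff[OF convergent_euler_product] convergent_prod_LIMSEQ[OF convergent_euler_product]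
      LIMSEQ_unique by metis
qed

lemma rational_square_integer:
  fixes m :: int and r :: rat
  assumes "of_int m = r^2"
  shows "\<exists>s. m = s^2"
proof -
  obtain x y where xy: "r = of_int x / of_int y" "y > 0" by (metis quotient_of_denom_pos quotient_of_div surj_pair)
  then have "of_int m * of_int y^2 = (of_int x^2 :: rat)" using assms by (simp add: power_divide)
  then have "of_int (m * y^2) = (of_int (x^2) :: rat)" by simp
  then have eq: "m * y^2 = x^2" by (simp only: of_int_eq_iff)
  then have "y^2 dvd x^2" by (metis dvd_triv_right)
  then have "y dvd x" by (metis pow_divides_pow_iff zero_less_numeral)
  then obtain s where "x = y * s" by (rule dvdE)
  then have "m * y^2 = s^2 * y^2" using eq by (simp add: power_mult_distrib mult.commute)
  then show ?thesis using xy(2) by auto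
qed

theorem theorem1p1:
  fixes c :: "int^3^3" and a :: int and N :: "real^3 \<Rightarrow> real"
    and \<omega> :: form2 and \<mu> :: "(real^3) measure"
  assumes "nonsingular c" and "indefinite c"
    and "a \<noteq> 0" and "\<exists>q::rat. q \<noteq> 0 \<and> - of_int a * det (gram c) = q ^ 2"
    and "is_norm N"
    and "normalized_gauge_form c a \<omega>"
    and "is_abs_form_measure (quadric c a) \<omega> \<mu>"
  shows "(\<forall>p. prime p \<longrightarrow> convergent (local_ratio c a p)) \<and>
    convergent_prod (euler_factor c a) \<and>
    (\<lambda>T. real (int_point_count c a N T))
      \<sim>[at_top] (\<lambda>T. (\<Prod>p. euler_factor c a p) * (ln T * measure \<mu> (quadric_ball c a N T)))"
proof -
  obtain M d \<alpha> \<beta> \<gamma> where diag: "det M \<noteq> 0" "d \<noteq> 0" "of_int (\<alpha> * \<beta> * \<gamma>) = det (gram c) * of_int d^2"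
    and form: "\<And>x::int^3. d^2 * qf c x = \<alpha> * ((M *v x) $ 1)^2 + \<beta> * ((M *v x) $ 2)^2 + \<gamma> * ((M *v x) $ 3)^2"
      "\<And>x::real^3. of_int d^2 * qf c x = of_int \<alpha> * ((imat M *v x) $ 1)^2 + of_int \<beta> * ((imat M *v x) $ 2)^2 + of_int \<gamma> * ((imat M *v x) $ 3)^2"
    using diagonalisation[OF assms(1)] by blast
  have "of_int (\<alpha> * \<beta> * \<gamma>) \<noteq> (0 :: rat)" unfolding diag(3) using assms(1) diag(2) by (simp add: nonsingular_def)
  then have nz: "\<alpha> \<noteq> 0" "\<beta> \<noteq> 0" "\<gamma> \<noteq> 0" by auto
  obtain q :: rat where q: "- of_int a * det (gram c) = q ^ 2" using assms(4) by blast
  \<comment> \<open>Up to the square d^2 the product \<alpha> \<beta> \<gamma> is det(f), so the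
    hypothesis makes this integer a rational and hence an integral square.\<close>
  have "of_int (- (a * \<alpha> * \<beta> * \<gamma>)) = - of_int a * (of_int (\<alpha> * \<beta> * \<gamma>) :: rat)" by simp
  also have "\<dots> = (q * of_int d)^2" unfolding diag(3) power_mult_distrib q[symmetric] by simp
  finally obtain s where s: "- (a * \<alpha> * \<beta> * \<gamma>) = s^2" using rational_square_integer by blast
  interpret diagonal_form c a M d \<alpha> \<beta> \<gamma> s
    by unfold_locales (use diag nz assms(3) s form in auto)
  have "(\<lambda>T. real (int_point_count c a N T))
      \<sim>[at_top] (\<lambda>T. prodinf (euler_factor c a) * (ln T * measure \<mu> (quadric_ball c a N T)))"
  proof (cases "\<exists>p. prime p \<and> local_density c a p = 0")
    case True
    \<comment> \<open>Both functions are identically 0 here, and asymptotic equivalence counts the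
      quotient 0 / 0 as 1.\<close>
    then show ?thesis using int_point_count_eq_0 prodinf_eq_0_iff by auto
  next
    case False
    then have dens: "local_density c a p \<noteq> 0" if "prime p" for p using that by blast
    \<comment> \<open>Indefiniteness enters here: if \<open>A\<close> and \<open>B\<close> were
      negative, then \<alpha>, \<beta>, \<gamma> would have the same sign and \<gamma> f would take
      no negative value.\<close>
    have "\<not> (A < 0 \<and> B < 0)"
    proof
      assume "A < 0 \<and> B < 0"
      then have sgn: "\<gamma> * \<alpha> \<ge> 0" "\<gamma> * \<beta> \<ge> 0" by (simp_all add: mult.commute)
      have nonneg: "of_int \<gamma> * qf c x \<ge> 0" for x :: "real^3"
      proof -
        define v where "v = imat M *v x"
        have "of_int d^2 * (of_int \<gamma> * qf c x) = of_int \<gamma> * (of_int d^2 * qf c x)" by simp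
        also have "\<dots> = of_int (\<gamma> * \<alpha>) * (v $ 1)^2 + of_int (\<gamma> * \<beta>) * (v $ 2)^2 + of_int (\<gamma> * \<gamma>) * (v $ 3)^2"
          unfolding form(2) v_def by (simp add: algebra_simps)
        also have "\<dots> \<ge> 0" using sgn by (intro add_nonneg_nonneg mult_nonneg_nonneg) (simp_all only: of_int_0_le_iff zero_le_power2 zero_le_square)
        finally show ?thesis using diag(2) by (simp add: zero_le_mult_iff)
      qed
      obtain x y :: "real^3" where xy: "qf c x > 0" "qf c y < 0" using assms(2) by (auto simp: indefinite_def)
      have "real_of_int \<gamma> \<ge> 0" using nonneg[of x] xy(1) by (simp add: zero_le_mult_iff)
      moreover have "real_of_int \<gamma> \<le> 0" using nonneg[of y] xy(2) by (simp add: zero_le_mult_iff)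
      ultimately show False using nz by simp
    qed
    moreover have AB: "A \<noteq> 0" "B \<noteq> 0" using nz by simp_all
    moreover have "locally_represented A B" by (rule locally_representedI) (rule solvable_modulo[OF dens])
    ultimately have iso: "isotropic A B" by (intro legendre)
    have "\<exists>x y z. z^2 = A * x^2 + B * y^2 \<and> y \<noteq> 0" by (rule isotropic_nondegenerate[OF iso AB(1)]) blast
    then obtain x0 y0 z0 where zero: "z0^2 = A * x0^2 + B * y0^2" "y0 \<noteq> 0" by blast
    interpret Z: diagonal_zero c a M d \<alpha> \<beta> \<gamma> s x0 y0 z0
      by unfold_locales (use zero in auto)
    have "prodinf (euler_factor c a) \<noteq> 0" unfolding prodinf_eq_0_iff using False .
    with assms(5) dens assms(6,7) show ?thesis by (intro Z.int_points_asymp)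
  qed
  then show ?thesis using local_ratio_convergent[OF _ assms(3)] convergent_euler_product by blast
qed

end
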